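(* Convex instances of FLaMECaST with one intermediate layer, one sink, unlimited capacity and $\alpha=0$ can be approximated within a factor of $1+\varepsilon$ (i.e., a layout of cost at most $(1+\varepsilon)$ times the minimum can be computed) in $O\!\left(n^7\log^3\!\left(\frac{1}{\varepsilon}\right)\right)$ time, where $n$ is the number of sources.
   Context: FLaMECaST: an instance $I=(S,T,C,\alpha)$ consists of a finite set $S$ of sources and a finite set $T$ of sinks, each with a fixed position in $\mathbb{R}^2$, capacities $C=(c_0,\dots,c_{\lambda+1})$ ($\lambda$ = number of intermediate layers; here $\lambda=1$, $T=\{t\}$, and all capacities are $\infty$, i.e., no capacity constraints), and $\alpha\in[0,1]$ (here $\alpha=0$). A layout consists of a rooted forest (edges directed from child to parent) of height at most $\lambda+1$ whose leaves are exactly $S$ and whose roots lie in $T$ (other vertices are Steiner vertices), together with an embedding mapping sources and sinks to their positions and Steiner vertices to arbitrary points of $\mathbb{R}^2$. The cost of an edge $uv$ ($u$ child of $v$) is $\|\mathrm{pos}(u)-\mathrm{pos}(v)\|\cdot\ell(uv)^\alpha$, where $\ell(uv)$ is the number of sources in the subtree of $u$; for $\alpha=0$ this is the edge length. The cost of a layout is the sum of its edge costs; the goal is a layout of minimum cost. An instance is convex if all sources lie on the boundary of the convex hull of $S\cup T$. *)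

theory Defs
  imports "HOL-Analysis.Analysis"
begin

section \<open>FLaMECaST without capacity constraints\<close>

text \<open>
  Terminals and Steiner vertices are natural numbers, so that a layout never runs out of names for
  Steiner vertices. There is no capacity field: all capacities are infinite.
\<close>

record flamecast =
  sources :: "nat set"
  sinks :: "nat set"
  loc :: "nat \<Rightarrow> real \<times> real"
  layers :: nat
  alpha :: real

record layout =
  verts :: "nat set"
  parent :: "nat \<Rightarrow> nat option"
  emb :: "nat \<Rightarrow> real \<times> real"

definition edges :: "layout \<Rightarrow> (nat \<times> nat) set" where
  "edges L = {(u, v). u \<in> verts L \<and> parent L u = Some v}"

definition roots :: "layout \<Rightarrow> nat set" where
  "roots L = {v \<in> verts L. parent L v = None}"

definition leaves :: "layout \<Rightarrow> nat set" where
  "leaves L = {v \<in> verts L. \<forall>u. (u, v) \<notin> edges L}"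

definition rooted_forest :: "layout \<Rightarrow> bool" where
  "rooted_forest L \<longleftrightarrow>
     finite (verts L) \<and> edges L \<subseteq> verts L \<times> verts L \<and> acyclic (edges L)"

definition height_at_most :: "layout \<Rightarrow> nat \<Rightarrow> bool" where
  "height_at_most L h \<longleftrightarrow> (\<forall>k u v. (u, v) \<in> edges L ^^ k \<longrightarrow> k \<le> h)"

definition is_layout :: "flamecast \<Rightarrow> layout \<Rightarrow> bool" where
  "is_layout I L \<longleftrightarrow>
     rooted_forest L \<and>
     height_at_most L (layers I + 1) \<and>
     leaves L = sources I \<and>
     roots L = verts L \<inter> sinks I \<and>
     (\<forall>v \<in> verts L \<inter> (sources I \<union> sinks I). emb L v = loc I v)"

definition load :: "flamecast \<Rightarrow> layout \<Rightarrow> nat \<Rightarrow> nat" where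
  "load I L u = card {s \<in> sources I. (s, u) \<in> (edges L)\<^sup>*}"

text \<open>
  In a layout every vertex has load at least one, so the convention \<open>0 powr 0 = 0\<close> is harmless.
\<close>

definition cost :: "flamecast \<Rightarrow> layout \<Rightarrow> real" where
  "cost I L =
     (\<Sum>(u, v) \<in> edges L. norm (emb L u - emb L v) * real (load I L u) powr alpha I)"

definition min_cost :: "flamecast \<Rightarrow> real" where
  "min_cost I = (INF L \<in> {L. is_layout I L}. cost I L)"

definition convex_instance :: "flamecast \<Rightarrow> bool" where
  "convex_instance I \<longleftrightarrow>
     loc I ` sources I \<subseteq> frontier (convex hull (loc I ` (sources I \<union> sinks I)))"


section \<open>A real RAM\<close>

text \<open>
  A unit-cost real RAM with two indirectly addressable memories, one for natural numbers and one for
  reals. Reals are exact and support field operations, square roots and comparisons. There is no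
  conversion (floor) from reals to naturals, there are no real constants, and the naturals have
  only addition and truncated subtraction, so that unbounded numbers cannot be exploited for
  packing information. Every operation, memory access, test and command costs one step.
\<close>

type_synonym ram_state = "(nat \<Rightarrow> nat) \<times> (nat \<Rightarrow> real)"

datatype nexp =
    NConst nat
  | NLoad nexp
  | NAdd nexp nexp
  | NSub nexp nexp

datatype rexp =
    ROfNat nexp
  | RLoad nexp
  | RAdd rexp rexp
  | RSub rexp rexp
  | RMul rexp rexp
  | RDiv rexp rexp
  | RSqrt rexp

datatype bexp =
    NLess nexp nexp
  | RLess rexp rexp
  | BNot bexp
  | BAnd bexp bexp

datatype com =
    Skip
  | NStore nexp nexp
  | RStore nexp rexp
  | Seq com com
  | Cond bexp com com
  | While bexp com

fun nval :: "nexp \<Rightarrow> ram_state \<Rightarrow> nat" where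
  "nval (NConst k) s = k"
| "nval (NLoad a) s = fst s (nval a s)"
| "nval (NAdd a b) s = nval a s + nval b s"
| "nval (NSub a b) s = nval a s - nval b s"

fun rval :: "rexp \<Rightarrow> ram_state \<Rightarrow> real" where
  "rval (ROfNat a) s = real (nval a s)"
| "rval (RLoad a) s = snd s (nval a s)"
| "rval (RAdd a b) s = rval a s + rval b s"
| "rval (RSub a b) s = rval a s - rval b s"
| "rval (RMul a b) s = rval a s * rval b s"
| "rval (RDiv a b) s = rval a s / rval b s"
| "rval (RSqrt a) s = sqrt (rval a s)"

fun bval :: "bexp \<Rightarrow> ram_state \<Rightarrow> bool" where
  "bval (NLess a b) s \<longleftrightarrow> nval a s < nval b s"
| "bval (RLess a b) s \<longleftrightarrow> rval a s < rval b s"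
| "bval (BNot b) s \<longleftrightarrow> \<not> bval b s"
| "bval (BAnd b c) s \<longleftrightarrow> bval b s \<and> bval c s"

fun ntime :: "nexp \<Rightarrow> nat" where
  "ntime (NConst k) = 1"
| "ntime (NLoad a) = ntime a + 1"
| "ntime (NAdd a b) = ntime a + ntime b + 1"
| "ntime (NSub a b) = ntime a + ntime b + 1"

fun rtime :: "rexp \<Rightarrow> nat" where
  "rtime (ROfNat a) = ntime a + 1"
| "rtime (RLoad a) = ntime a + 1"
| "rtime (RAdd a b) = rtime a + rtime b + 1"
| "rtime (RSub a b) = rtime a + rtime b + 1"
| "rtime (RMul a b) = rtime a + rtime b + 1"
| "rtime (RDiv a b) = rtime a + rtime b + 1"
| "rtime (RSqrt a) = rtime a + 1"

fun btime :: "bexp \<Rightarrow> nat" where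
  "btime (NLess a b) = ntime a + ntime b + 1"
| "btime (RLess a b) = rtime a + rtime b + 1"
| "btime (BNot b) = btime b + 1"
| "btime (BAnd b c) = btime b + btime c + 1"

text \<open>\<open>exec c s k s'\<close>: started in \<open>s\<close>, the program \<open>c\<close> halts in \<open>s'\<close> after \<open>k\<close> steps.\<close>

inductive exec :: "com \<Rightarrow> ram_state \<Rightarrow> nat \<Rightarrow> ram_state \<Rightarrow> bool" where
  Skip: "exec Skip s 1 s"
| NStore: "exec (NStore a e) s (ntime a + ntime e + 1) ((fst s)(nval a s := nval e s), snd s)"
| RStore: "exec (RStore a e) s (ntime a + rtime e + 1) (fst s, (snd s)(nval a s := rval e s))"
| Seq: "\<lbrakk>exec c1 s k1 s1; exec c2 s1 k2 s2\<rbrakk> \<Longrightarrow> exec (Seq c1 c2) s (k1 + k2 + 1) s2"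
| CondTrue: "\<lbrakk>bval b s; exec c1 s k s1\<rbrakk> \<Longrightarrow> exec (Cond b c1 c2) s (btime b + k + 1) s1"
| CondFalse: "\<lbrakk>\<not> bval b s; exec c2 s k s1\<rbrakk> \<Longrightarrow> exec (Cond b c1 c2) s (btime b + k + 1) s1"
| WhileFalse: "\<not> bval b s \<Longrightarrow> exec (While b c) s (btime b + 1) s"
| WhileTrue: "\<lbrakk>bval b s; exec c s k1 s1; exec (While b c) s1 k2 s2\<rbrakk> \<Longrightarrow>
    exec (While b c) s (btime b + k1 + k2 + 1) s2"

inductive_cases SkipE: "exec Skip s k s'"
inductive_cases NStoreE: "exec (NStore a e) s k s'"
inductive_cases RStoreE: "exec (RStore a e) s k s'"
inductive_cases SeqE: "exec (Seq c1 c2) s k s'"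
inductive_cases CondE: "exec (Cond b c1 c2) s k s'"
inductive_cases WhileE: "exec (While b c) s k s'"

lemma exec_deterministic:
  "exec c s k s1 \<Longrightarrow> exec c s k' s2 \<Longrightarrow> k' = k \<and> s2 = s1"
proof (induction arbitrary: k' s2 rule: exec.induct)
  case Skip then show ?case by (auto elim: SkipE)
next
  case NStore then show ?case by (auto elim: NStoreE)
next
  case RStore then show ?case by (auto elim: RStoreE)
next
  case (Seq c1 s k1 s1 c2 k2 s2 k' s2')
  from Seq.prems obtain i t j where *: "k' = i + j + 1" "exec c1 s i t" "exec c2 t j s2'"
    by (rule SeqE) simp
  then have "i = k1" "t = s1" using Seq.IH(1) by auto
  then show ?case using * Seq.IH(2)[of j s2'] by simp
next
  case (CondTrue b s c1 k s1 c2 k' s2)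
  from CondTrue.prems CondTrue.hyps(1) obtain i where "k' = btime b + i + 1" "exec c1 s i s2"
    by (auto elim!: CondE)
  then show ?case using CondTrue.IH[of i s2] by simp
next
  case (CondFalse b s c2 k s1 c1 k' s2)
  from CondFalse.prems CondFalse.hyps(1) obtain i where "k' = btime b + i + 1" "exec c2 s i s2"
    by (auto elim!: CondE)
  then show ?case using CondFalse.IH[of i s2] by simp
next
  case (WhileFalse b s c k' s2)
  from WhileFalse.prems show ?case by (rule WhileE) (use WhileFalse.hyps in simp_all)
next
  case (WhileTrue b s c k1 s1 k2 s2 k' s2')
  from WhileTrue.prems obtain i t j
    where *: "k' = btime b + i + j + 1" "exec c s i t" "exec (While b c) t j s2'"
    by (rule WhileE) (use WhileTrue.hyps(1) in simp_all)
  then have "i = k1" "t = s1" using WhileTrue.IH(1) by auto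
  then show ?case using * WhileTrue.IH(2)[of j s2'] by simp
qed


section \<open>Input and output\<close>

text \<open>
  For an instance with sources \<open>0, \<dots>, n - 1\<close> and sink \<open>n\<close>, the natural memory initially holds \<open>n\<close>
  in cell \<open>0\<close>; the real memory holds \<open>\<epsilon>\<close> in cell \<open>0\<close> and the coordinates of terminal \<open>v\<close> in cells
  \<open>2 v + 1\<close> and \<open>2 v + 2\<close>. All other cells are \<open>0\<close>.
\<close>

definition input_state :: "nat \<Rightarrow> flamecast \<Rightarrow> real \<Rightarrow> ram_state" where
  "input_state n I \<epsilon> =
     (\<lambda>i. if i = 0 then n else 0,
      \<lambda>i. if i = 0 then \<epsilon>
          else if i > 2 * n + 2 then 0
          else if odd i then fst (loc I ((i - 1) div 2))
          else snd (loc I ((i - 2) div 2)))"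

text \<open>
  The output is a layout on the vertices \<open>0, \<dots>, m - 1\<close>, where \<open>m\<close> is in cell \<open>0\<close> of the natural
  memory, the parent of \<open>v \<noteq> n\<close> is in cell \<open>v + 1\<close>, and coordinates are stored as in the input.
\<close>

definition output_layout :: "nat \<Rightarrow> ram_state \<Rightarrow> layout" where
  "output_layout n s =
     \<lparr>verts = {..<fst s 0},
      parent = (\<lambda>v. if v = n then None else Some (fst s (v + 1))),
      emb = (\<lambda>v. (snd s (2 * v + 1), snd s (2 * v + 2)))\<rparr>"

end

theory Submission imports Defs begin

text \<open>
  In an optimal layout every source may be attached to the nearest hub (child of the sink), ties
  being broken lexicographically, and hubs may be projected into the convex hull. Segments from
  sources to their nearest hubs do not cross, so the clusters form a noncrossing partition of the
  sources in their angular order. If the cluster of one hub fell into four or more cyclic runs, the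
  hubs nested in the gaps would be seen from it pairwise under angles of at least 90 degrees, which
  the tie-breaking rules out for four hubs. So each cluster consists of at most three cyclic runs.

  Let \<open>A i j\<close> be the cost of the arc from \<open>i\<close> to \<open>j\<close> and
  \<open>B i f\<close> that of the shortest arc containing the cluster of \<open>i\<close>. A
  cluster with at most three runs is given by six indices, and the two gaps between its runs are
  smaller arcs, so the recurrence inspects \<open>O(n^6)\<close> clusters. For each of them a
  \<open>(1 + \<epsilon>)\<close>-approximate median is found by the ellipsoid method, started from
  a disc about the centroid whose radius is comparable to the optimum divided by the cluster size.
  Every step shrinks the area by a constant factor, so that \<open>O(log (1/\<epsilon>))\<close>
  steps of cost \<open>O(n)\<close> suffice.
\<close>

text \<open>Angles cannot be computed on the machine, so the sources are sorted about the centroid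
  of all terminals by an algebraic key that is monotone in the angle. If the centroid is not
  interior to the hull, the hull is flat and the same key sorts along a line. The crossing arguments
  do not speak of angles either: the geometry is condensed into one predicate saying that a chord of
  the hull separates two points, in a form that stays valid for coinciding points and flat hulls.
  The cyclic order is cut open by storing the sequence twice and trying every start; some start
  falls between two clusters (or there is only one cluster), so that at most three cyclic runs
  become at most three linear ones. A source attached directly to the sink is charged to a hub at
  the sink, whose own edge has length zero. The ellipsoid argument is free of measure theory: areas
  are determinants, and the target is a disc of good points with radius about
  \<open>\<epsilon>\<close> times a mean distance. The time obtained is linear in the logarithm of
  \<open>1 / \<epsilon>\<close>; for \<open>\<epsilon>\<close> at most 1/2 this is below a constant
  times its cube.\<close>

type_synonym point = "real \<times> real"

subsection \<open>Obtuse hubs\<close>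

text \<open>In the difference of the two squared distances the quadratic terms in \<open>w\<close>
  cancel. The condition becomes affine in \<open>w\<close>, so that the regions of points nearer to
  one hub than to another are half spaces.\<close>

lemma dist_le_iff_inner:
  fixes w p q :: "'a::real_inner"
  shows "dist w p \<le> dist w q \<longleftrightarrow> 2 * ((w - p) \<bullet> (q - p)) \<le> (q - p) \<bullet> (q - p)"
proof -
  have "dist w p \<le> dist w q \<longleftrightarrow> (dist w p)\<^sup>2 \<le> (dist w q)\<^sup>2" by simp
  moreover have "(dist w q)\<^sup>2 = (dist w p)\<^sup>2 - 2 * ((w - p) \<bullet> (q - p)) + (q - p) \<bullet> (q - p)"
    by (simp add: dist_norm power2_norm_eq_inner inner_diff inner_commute algebra_simps)
  ultimately show ?thesis by linarith
qed

lemma dist_less_iff_inner: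
  fixes w p q :: "'a::real_inner"
  shows "dist w p < dist w q \<longleftrightarrow> 2 * ((w - p) \<bullet> (q - p)) < (q - p) \<bullet> (q - p)"
proof -
  have "dist w p < dist w q \<longleftrightarrow> (dist w p)\<^sup>2 < (dist w q)\<^sup>2"
    by (metis abs_of_nonneg abs_le_square_iff linorder_not_le zero_le_dist)
  moreover have "(dist w q)\<^sup>2 = (dist w p)\<^sup>2 - 2 * ((w - p) \<bullet> (q - p)) + (q - p) \<bullet> (q - p)"
    by (simp add: dist_norm power2_norm_eq_inner inner_diff inner_commute algebra_simps)
  ultimately show ?thesis by linarith
qed

lemma convex_dist_le: "convex {w :: 'a::real_inner. dist w p \<le> dist w q}"
proof -
  have "{w. dist w p \<le> dist w q} = {w. (2 *\<^sub>R (q - p)) \<bullet> w \<le> (q - p) \<bullet> (q - p) + 2 * (p \<bullet> (q - p))}"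
    unfolding dist_le_iff_inner by (auto simp: inner_diff inner_commute algebra_simps)
  then show ?thesis using convex_halfspace_le by metis
qed

lemma convex_dist_less: "convex {w :: 'a::real_inner. dist w p < dist w q}"
proof -
  have "{w. dist w p < dist w q} = {w. (2 *\<^sub>R (q - p)) \<bullet> w < (q - p) \<bullet> (q - p) + 2 * (p \<bullet> (q - p))}"
    unfolding dist_less_iff_inner by (auto simp: inner_diff inner_commute algebra_simps)
  then show ?thesis using convex_halfspace_lt by metis
qed

text \<open>The disc about \<open>w\<close> whose radius is the smaller of \<open>dist w q\<close>
  and \<open>dist w q'\<close> lies inside the disc with diameter \<open>q q'\<close>. As
  \<open>p\<close> is in it, Thales gives a right or obtuse angle at \<open>p\<close>. A right angle
  forces \<open>w\<close> to be the midpoint and all three distances to be equal, hence the strict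
  version.\<close>

lemma segment_near_hub_obtuse:
  fixes p q q' w :: "'a::real_inner"
  assumes w: "w \<in> closed_segment q q'" and pq: "dist w p \<le> dist w q" "dist w p \<le> dist w q'"
    and ne: "p \<noteq> q" "p \<noteq> q'"
  shows "(q - p) \<bullet> (q' - p) \<le> 0"
    and "dist w p < dist w q \<or> dist w p < dist w q' \<Longrightarrow> (q - p) \<bullet> (q' - p) < 0"
proof -
  define u v where "u = q - p" and "v = q' - p"
  obtain \<sigma> where \<sigma>: "0 \<le> \<sigma>" "\<sigma> \<le> 1" "w = (1 - \<sigma>) *\<^sub>R q + \<sigma> *\<^sub>R q'"
    using w by (auto simp: in_segment)
  have x: "w - p = (1 - \<sigma>) *\<^sub>R u + \<sigma> *\<^sub>R v" by (simp add: \<sigma>(3) u_def v_def algebra_simps)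
  have uu: "u \<bullet> u > 0" "v \<bullet> v > 0" using ne by (auto simp: u_def v_def)
  define c where "c = u \<bullet> v"
  \<comment> \<open>The two bisector inequalities with \<open>w - p\<close> expanded in
    \<open>u\<close> and \<open>v\<close>. Whichever of the factors \<open>1 - 2 * \<sigma>\<close>
    and \<open>2 * \<sigma> - 1\<close> is nonnegative forces \<open>c\<close> to be at most
    zero.\<close>
  have 1: "(1 - 2 * \<sigma>) * (u \<bullet> u) \<le> - 2 * \<sigma> * c"
    using pq(1) unfolding dist_le_iff_inner x u_def[symmetric] c_def
    by (simp add: inner_add_left inner_commute algebra_simps)
  have 2: "(2 * \<sigma> - 1) * (v \<bullet> v) \<le> - 2 * (1 - \<sigma>) * c"
    using pq(2) unfolding dist_le_iff_inner x v_def[symmetric] c_def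
    by (simp add: inner_add_left inner_commute algebra_simps)
  show le: "(q - p) \<bullet> (q' - p) \<le> 0"
  proof (rule ccontr)
    assume "\<not> ?thesis"
    then have c: "c > 0" by (simp add: c_def u_def v_def)
    show False
    proof (cases "\<sigma> \<le> 1/2")
      case True
      then have "0 \<le> (1 - 2 * \<sigma>) * (u \<bullet> u)" using uu by simp
      then have "\<sigma> * c \<le> 0" using 1 by linarith
      then have "\<sigma> = 0" using c \<sigma> by (simp add: mult_le_0_iff)
      then show False using 1 uu by simp
    next
      case False
      then have "0 \<le> (2 * \<sigma> - 1) * (v \<bullet> v)" using uu by simp
      then have "(1 - \<sigma>) * c \<le> 0" using 2 by linarith
      then have "\<sigma> = 1" using c \<sigma> by (simp add: mult_le_0_iff)
      then show False using 2 uu by simp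
    qed
  qed
  assume st: "dist w p < dist w q \<or> dist w p < dist w q'"
  show "(q - p) \<bullet> (q' - p) < 0"
  proof (rule ccontr)
    assume "\<not> ?thesis"
    then have c0: "c = 0" using le by (simp add: c_def u_def v_def)
    from 1 c0 uu have a: "\<sigma> \<ge> 1/2" by (simp add: mult_le_0_iff)
    from 2 c0 uu have b: "\<sigma> \<le> 1/2" by (simp add: mult_le_0_iff)
    from a b have s: "\<sigma> = 1/2" by simp
    from st show False
    proof
      assume "dist w p < dist w q"
      then show False unfolding dist_less_iff_inner x u_def[symmetric] using c0 s
        by (simp add: inner_add_right inner_commute c_def)
    next
      assume "dist w p < dist w q'"
      then show False unfolding dist_less_iff_inner x v_def[symmetric] using c0 s
        by (simp add: inner_add_right inner_commute c_def)
    qed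
  qed
qed

definition lex_less :: "point \<Rightarrow> point \<Rightarrow> bool" where
  "lex_less p q \<longleftrightarrow> fst p < fst q \<or> fst p = fst q \<and> snd p < snd q"

text \<open>The identity for \<open>(u \<bullet> u) * (x \<bullet> y)\<close> splits an inner
  product into components along and across \<open>u\<close>. Two vectors strictly obtuse to
  \<open>u\<close> and not acute to each other therefore lie strictly on opposite sides of the line
  through \<open>u\<close>, which three vectors cannot do pairwise.\<close>

lemma no_four_strictly_obtuse:
  fixes u v w z :: point
  assumes u: "u \<bullet> v < 0" "u \<bullet> w < 0" "u \<bullet> z < 0"
    and o: "v \<bullet> w \<le> 0" "v \<bullet> z \<le> 0" "w \<bullet> z \<le> 0"
  shows False
proof -
  define c where "c x = fst u * snd x - snd u * fst x" for x :: point
  have id: "(u \<bullet> u) * (x \<bullet> y) = (u \<bullet> x) * (u \<bullet> y) + c x * c y" for x y :: point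
    by (simp add: c_def inner_prod_def algebra_simps)
  have pos: "u \<bullet> u \<ge> 0" by simp
  have neg: "c x * c y < 0" if "u \<bullet> x < 0" "u \<bullet> y < 0" "x \<bullet> y \<le> 0" for x y :: point
  proof -
    have "(u \<bullet> u) * (x \<bullet> y) \<le> 0" using pos that(3) by (rule mult_nonneg_nonpos)
    moreover have "(u \<bullet> x) * (u \<bullet> y) > 0" using that by (simp add: mult_neg_neg)
    ultimately show ?thesis using id[of x y] by linarith
  qed
  from neg[OF u(1,2) o(1)] neg[OF u(1,3) o(2)] neg[OF u(2,3) o(3)] show False
    by (auto simp: mult_less_0_iff)
qed

text \<open>Four nonzero plane vectors can be pairwise nonacute only as two perpendicular pairs of
  opposite vectors. One vector of each pair is lexicographically negative, and strictness there
  rules this cross out.\<close>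

lemma no_four_obtuse_hubs:
  fixes v :: "nat \<Rightarrow> point"
  assumes nz: "\<And>i. i < 4 \<Longrightarrow> v i \<noteq> 0"
    and le: "\<And>i j. i < 4 \<Longrightarrow> j < 4 \<Longrightarrow> i \<noteq> j \<Longrightarrow> v i \<bullet> v j \<le> 0"
    and less: "\<And>i j. i < 4 \<Longrightarrow> j < 4 \<Longrightarrow> i \<noteq> j \<Longrightarrow> lex_less (v i) 0 \<Longrightarrow> v i \<bullet> v j < 0"
  shows False
proof (cases "\<exists>i<4. lex_less (v i) 0")
  case True
  then obtain i where i: "i < 4" "lex_less (v i) 0" by blast
  have "i = 0 \<or> i = 1 \<or> i = 2 \<or> i = 3" using i(1) by linarith
  then obtain j k l where jkl: "j < 4" "k < 4" "l < 4" "i \<noteq> j" "i \<noteq> k" "i \<noteq> l" "j \<noteq> k" "j \<noteq> l" "k \<noteq> l"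
  proof (elim disjE)
    assume "i = 0" then show thesis using that[of 1 2 3] by simp
  next
    assume "i = 1" then show thesis using that[of 0 2 3] by simp
  next
    assume "i = 2" then show thesis using that[of 0 1 3] by simp
  next
    assume "i = 3" then show thesis using that[of 0 1 2] by simp
  qed
  show False
    by (rule no_four_strictly_obtuse[of "v i" "v j" "v k" "v l"]) (use i jkl le less in auto)
next
  case False
  \<comment> \<open>Without a lexicographically negative vector all first coordinates are
    nonnegative, so nonacuteness passes to the second coordinates: their pairwise products are
    nonpositive.\<close>
  have x: "fst (v i) \<ge> 0" "fst (v i) = 0 \<Longrightarrow> snd (v i) > 0" if "i < 4" for i
  proof -
    have "\<not> lex_less (v i) 0" using False that by blast
    then show "fst (v i) \<ge> 0" "fst (v i) = 0 \<Longrightarrow> snd (v i) > 0"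
      using nz[OF that] by (auto simp: lex_less_def prod_eq_iff)
  qed
  have y: "snd (v i) * snd (v j) \<le> - (fst (v i) * fst (v j))" if "i < 4" "j < 4" "i \<noteq> j" for i j
    using le[OF that] by (simp add: inner_prod_def)
  have y0: "snd (v i) * snd (v j) \<le> 0" if "i < 4" "j < 4" "i \<noteq> j" for i j
    using y[OF that] x[OF that(1)] x[OF that(2)] mult_nonneg_nonneg[of "fst (v i)" "fst (v j)"] by linarith
  have zz: "\<not> (snd (v i) = 0 \<and> snd (v j) = 0)" if "i < 4" "j < 4" "i \<noteq> j" for i j
  proof
    assume s: "snd (v i) = 0 \<and> snd (v j) = 0"
    then have "fst (v i) > 0" "fst (v j) > 0" using x[OF that(1)] x[OF that(2)]
      by (metis less_irrefl order.order_iff_strict)+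
    then have "fst (v i) * fst (v j) > 0" by simp
    then show False using y[OF that] s by simp
  qed
  \<comment> \<open>Second coordinates with nonpositive pairwise products, at most one of them zero,
    have distinct signs, and there are only three signs.\<close>
  have "inj_on (\<lambda>i. sgn (snd (v i))) {..<4}"
  proof (rule inj_onI, rule ccontr)
    fix i j :: nat assume ij: "i \<in> {..<4}" "j \<in> {..<4}" "i \<noteq> j" and eq: "sgn (snd (v i)) = sgn (snd (v j))"
    have "snd (v i) * snd (v j) > 0"
      using zz[of i j] ij eq by (auto simp: sgn_if zero_less_mult_iff split: if_splits)
    then show False using y0[of i j] ij by simp
  qed
  then have "card {..<4::nat} \<le> card {-1, 0, 1 :: real}"
    by (rule card_inj_on_le) (auto simp: sgn_if)
  moreover have "card {-1, 0, 1 :: real} \<le> 3" by (simp add: card_insert_if)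
  ultimately show False by simp
qed

subsection \<open>Convex position\<close>

text \<open>The chord from \<open>A\<close> to \<open>C\<close> has \<open>B\<close> and
  \<open>D\<close> on different sides within \<open>H\<close>, expressed by its consequence for
  hubs: points of \<open>H\<close> that are reached from \<open>B\<close> and from \<open>D\<close>
  along segments avoiding the chord can only be joined through the chord. Unlike a condition on
  signs of areas, this remains meaningful if points coincide, if \<open>B\<close> lies on the chord,
  or if \<open>H\<close> is flat.\<close>

definition separates :: "point set \<Rightarrow> point \<Rightarrow> point \<Rightarrow> point \<Rightarrow> point \<Rightarrow> bool" where
  "separates H A C B D \<longleftrightarrow> (\<forall>q\<in>H. \<forall>q'\<in>H.
     closed_segment B q \<inter> closed_segment A C = {} \<longrightarrow>
     closed_segment D q' \<inter> closed_segment A C = {} \<longrightarrow>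
     closed_segment q q' \<inter> closed_segment A C \<noteq> {})"

lemma separates_sym: "separates H A C B D \<longleftrightarrow> separates H C A D B"
  unfolding separates_def by (metis closed_segment_commute)

lemma separates_trivial:
  "B \<in> closed_segment A C \<or> D \<in> closed_segment A C \<Longrightarrow> separates H A C B D"
  unfolding separates_def by auto

definition cross :: "point \<Rightarrow> point \<Rightarrow> real" where
  "cross u v = fst u * snd v - snd u * fst v"

lemma cross_crossing_point:
  assumes "cross (C - A) (x - A) < 0" "cross (C - A) (y - A) \<ge> 0"
  obtains z where "z \<in> closed_segment x y" "cross (C - A) (z - A) = 0"
proof -
  define fx fy where "fx = cross (C - A) (x - A)" and "fy = cross (C - A) (y - A)"
  define s where "s = fx / (fx - fy)"
  have d: "fx - fy < 0" using assms by (simp add: fx_def fy_def)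
  have s: "0 \<le> s" "s \<le> 1" using assms d unfolding s_def fx_def[symmetric] fy_def[symmetric]
    by (auto simp: divide_simps)
  let ?z = "(1 - s) *\<^sub>R x + s *\<^sub>R y"
  have "cross (C - A) (?z - A) = (1 - s) * fx + s * fy"
    unfolding fx_def fy_def cross_def by (simp add: algebra_simps)
  also have "\<dots> = 0" using d by (simp add: s_def field_simps)
  finally show thesis using that[of ?z] s by (auto simp: in_segment)
qed

lemma cross_crossing_point':
  assumes "cross (C - A) (x - A) > 0" "cross (C - A) (y - A) \<le> 0"
  obtains z where "z \<in> closed_segment x y" "cross (C - A) (z - A) = 0"
proof -
  have eq: "cross (A - C) (z - C) = - cross (C - A) (z - A)" for z
    by (simp add: cross_def algebra_simps)
  show thesis using cross_crossing_point[of A C x y] assms that unfolding eq by auto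
qed

text \<open>By \<open>line\<close>, the set \<open>H\<close> meets the line through \<open>A\<close>
  and \<open>C\<close> only in the chord. A segment inside \<open>H\<close> can change sides only
  through the chord, so avoiding it keeps \<open>q\<close> on the side of \<open>B\<close> and
  \<open>q'\<close> on the side of \<open>D\<close>.\<close>

lemma separates_strict:
  assumes H: "convex H" "B \<in> H" "D \<in> H"
    and BD: "cross (C - A) (B - A) < 0" "cross (C - A) (D - A) > 0"
    and line: "\<And>x. x \<in> H \<Longrightarrow> cross (C - A) (x - A) = 0 \<Longrightarrow> x \<in> closed_segment A C"
  shows "separates H A C B D"
  unfolding separates_def
proof (intro ballI impI)
  fix q q' assume q: "q \<in> H" "q' \<in> H"
    and d: "closed_segment B q \<inter> closed_segment A C = {}" "closed_segment D q' \<inter> closed_segment A C = {}"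
  have sub: "closed_segment x y \<subseteq> H" if "x \<in> H" "y \<in> H" for x y
    using H(1) that by (simp add: closed_segment_subset)
  have 1: "cross (C - A) (q - A) < 0"
  proof (rule ccontr)
    assume "\<not> ?thesis"
    then obtain z where "z \<in> closed_segment B q" "cross (C - A) (z - A) = 0"
      using cross_crossing_point[OF BD(1)] by (metis not_less)
    then show False using line sub[OF H(2) q(1)] d(1) by blast
  qed
  have 2: "cross (C - A) (q' - A) > 0"
  proof (rule ccontr)
    assume "\<not> ?thesis"
    then obtain z where "z \<in> closed_segment D q'" "cross (C - A) (z - A) = 0"
      using cross_crossing_point'[OF BD(2)] by (metis not_less)
    then show False using line sub[OF H(3) q(2)] d(2) by blast
  qed
  obtain z where "z \<in> closed_segment q q'" "cross (C - A) (z - A) = 0"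
    using cross_crossing_point[OF 1, of q'] 2 by auto
  then show "closed_segment q q' \<inter> closed_segment A C \<noteq> {}" using line sub[OF q] by blast
qed

section \<open>Supporting lines and chords of convex sets\<close>

lemma boundary_supporting:
  fixes H :: "'a::euclidean_space set"
  assumes H: "convex H" "A \<in> H" "A \<notin> interior H"
  obtains a where "a \<noteq> 0" "\<And>y. y \<in> H \<Longrightarrow> a \<bullet> A \<le> a \<bullet> y"
proof (cases "interior H = {}")
  case True
  then obtain a b where "a \<noteq> 0" "H \<subseteq> {x. a \<bullet> x = b}"
    using empty_interior_subset_hyperplane[OF H(1)] by metis
  then show thesis using that[of a] H(2) by (metis (mono_tags, lifting) mem_Collect_eq order_refl subsetD)
next
  case False
  have "\<exists>a b. a \<noteq> 0 \<and> (\<forall>x\<in>{A}. a \<bullet> x \<le> b) \<and> (\<forall>x\<in>interior H. b \<le> a \<bullet> x)"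
    by (rule separating_hyperplane_sets) (use H False in \<open>auto intro: convex_interior\<close>)
  then obtain a b where ab: "a \<noteq> 0" "a \<bullet> A \<le> b" "\<forall>x\<in>interior H. b \<le> a \<bullet> x" by auto
  have "closure (interior H) \<subseteq> {x. a \<bullet> x \<ge> b}"
    by (rule closure_minimal) (use ab in \<open>auto intro: closed_halfspace_ge\<close>)
  then have "H \<subseteq> {x. a \<bullet> x \<ge> b}"
    using convex_closure_interior[OF H(1) False] closure_subset by blast
  then show thesis using that[of a] ab by force
qed

text \<open>If \<open>A\<close> lay strictly between \<open>x\<close> and \<open>C\<close>, a
  supporting functional at \<open>A\<close> would be constant along the line. In the plane it would
  then be a multiple of the normal of that line, which takes opposite signs on \<open>l\<close> and
  \<open>r\<close>.\<close>

lemma boundary_not_between: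
  assumes H: "convex H" "x \<in> H" "C \<in> H" "A \<notin> interior H" "A \<in> H"
    and sides: "l \<in> H" "cross (C - A) (l - A) > 0" "r \<in> H" "cross (C - A) (r - A) < 0"
    and x: "x = A + \<tau> *\<^sub>R (C - A)"
  shows "\<tau> \<ge> 0"
proof (rule ccontr)
  assume neg: "\<not> ?thesis"
  obtain a where a: "a \<noteq> 0" "\<And>y. y \<in> H \<Longrightarrow> a \<bullet> A \<le> a \<bullet> y"
    using boundary_supporting[OF H(1,5,4)] by blast
  define u where "u = C - A"
  have "a \<bullet> u \<ge> 0" using a(2)[OF H(3)] by (simp add: u_def inner_diff)
  moreover have "\<tau> * (a \<bullet> u) \<ge> 0" using a(2)[OF H(2)] x by (simp add: u_def inner_add inner_diff)
  ultimately have au: "a \<bullet> u = 0" using neg by (simp add: zero_le_mult_iff)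
  have un: "u \<bullet> u > 0" using sides(2) by (auto simp: u_def cross_def)
  \<comment> \<open>Since \<open>a\<close> is orthogonal to \<open>u\<close>, only the component
    across \<open>u\<close> remains in the planar expansion of the inner product.\<close>
  have key: "(u \<bullet> u) * (a \<bullet> (y - A)) = cross u a * cross u (y - A)" for y
  proof -
    have "(u \<bullet> u) * (a \<bullet> z) = (a \<bullet> u) * (u \<bullet> z) + cross u a * cross u z" for z
      by (simp add: cross_def inner_prod_def algebra_simps)
    then show ?thesis using au by simp
  qed
  have ge: "cross u a * cross u (y - A) \<ge> 0" if "y \<in> H" for y
    using a(2)[OF that] un key[of y] by (simp add: inner_diff flip: key)
  have k0: "cross u a = 0" using ge[OF sides(1)] ge[OF sides(3)] sides(2,4)
    by (simp add: u_def zero_le_mult_iff)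
  have "(u \<bullet> u) * (a \<bullet> a) = (a \<bullet> u) * (a \<bullet> u) + cross u a * cross u a"
    by (simp add: cross_def inner_prod_def algebra_simps)
  then show False using au k0 un a(1) by simp
qed

lemma parallel_scaleR:
  assumes "cross u y = 0" "u \<noteq> 0"
  shows "y = ((y \<bullet> u) / (u \<bullet> u)) *\<^sub>R u"
proof -
  have c: "fst u * snd y = snd u * fst y" using assms(1) by (simp add: cross_def)
  have uu: "u \<bullet> u \<noteq> 0" using assms(2) by simp
  have "(u \<bullet> u) * fst y = fst u * (fst u * fst y) + snd u * (snd u * fst y)"
    by (simp add: inner_prod_def algebra_simps)
  also have "\<dots> = (y \<bullet> u) * fst u" unfolding c[symmetric] by (simp add: inner_prod_def algebra_simps)
  finally have 1: "fst y = (y \<bullet> u) / (u \<bullet> u) * fst u" using uu by (simp add: field_simps)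
  have "(u \<bullet> u) * snd y = fst u * (fst u * snd y) + snd u * (snd u * snd y)"
    by (simp add: inner_prod_def algebra_simps)
  also have "\<dots> = (y \<bullet> u) * snd u" unfolding c by (simp add: inner_prod_def algebra_simps)
  finally have 2: "snd y = (y \<bullet> u) / (u \<bullet> u) * snd u" using uu by (simp add: field_simps)
  from 1 2 show ?thesis by (simp add: prod_eq_iff)
qed

text \<open>The parameter of \<open>x\<close> on the line is bounded from both ends by
  \<open>boundary_not_between\<close>, applied at \<open>A\<close> and, with the roles of
  \<open>l\<close> and \<open>r\<close> exchanged, at \<open>C\<close>.\<close>

lemma boundary_chord:
  assumes H: "convex H" "A \<in> H" "A \<notin> interior H" "C \<in> H" "C \<notin> interior H"
    and sides: "l \<in> H" "cross (C - A) (l - A) > 0" "r \<in> H" "cross (C - A) (r - A) < 0"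
    and x: "x \<in> H" "cross (C - A) (x - A) = 0"
  shows "x \<in> closed_segment A C"
proof -
  define u where "u = C - A"
  have un: "u \<bullet> u > 0" using sides(2) by (auto simp: u_def cross_def)
  define \<tau> where "\<tau> = ((x - A) \<bullet> u) / (u \<bullet> u)"
  have xe: "x = A + \<tau> *\<^sub>R (C - A)"
  proof -
    have "x - A = \<tau> *\<^sub>R u" unfolding \<tau>_def using parallel_scaleR[of u "x - A"] x(2) un
      by (auto simp: u_def)
    then show ?thesis by (simp add: u_def algebra_simps)
  qed
  have "\<tau> \<ge> 0" using boundary_not_between[OF H(1) x(1) H(4,3,2) sides xe] .
  moreover have "1 - \<tau> \<ge> 0"
  proof (rule boundary_not_between[OF H(1) x(1) H(2,5,4) sides(3) _ sides(1)])
    show "cross (A - C) (r - C) > 0" using sides(4) by (simp add: cross_def algebra_simps)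
    show "cross (A - C) (l - C) < 0" using sides(2) by (simp add: cross_def algebra_simps)
    show "x = C + (1 - \<tau>) *\<^sub>R (A - C)" by (simp add: xe algebra_simps)
  qed
  ultimately show ?thesis unfolding in_segment using xe
    by (intro exI[of _ \<tau>]) (simp add: algebra_simps)
qed

text \<open>With \<open>\<kappa> + \<mu> < 1\<close> the point \<open>Z\<close> would be
  \<open>o'\<close> itself or lie strictly between \<open>o'\<close> and a point \<open>W\<close> of
  the segment from \<open>X\<close> to \<open>Y\<close>, hence in the interior. So a boundary point
  in the cone over a chord lies on or beyond that chord.\<close>

lemma boundary_cone_ge_1:
  fixes H :: "'a::euclidean_space set"
  assumes H: "convex H" "o' \<in> interior H" "X \<in> H" "Y \<in> H" "Z \<notin> interior H"
    and Z: "Z = o' + \<kappa> *\<^sub>R (X - o') + \<mu> *\<^sub>R (Y - o')" "\<kappa> \<ge> 0" "\<mu> \<ge> 0"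
  shows "\<kappa> + \<mu> \<ge> 1"
proof (rule ccontr)
  assume k: "\<not> ?thesis"
  show False
  proof (cases "\<kappa> + \<mu> = 0")
    case True
    then have "\<kappa> = 0" "\<mu> = 0" using Z by auto
    then show False using Z H(2,5) by simp
  next
    case False
    define k where "k = \<kappa> + \<mu>"
    have kk: "0 < k" "k < 1" using False k Z by (auto simp: k_def)
    define W where "W = (\<kappa> / k) *\<^sub>R X + (\<mu> / k) *\<^sub>R Y"
    have "W \<in> H" unfolding W_def using H kk Z
      by (intro convexD) (auto simp: k_def add_divide_distrib[symmetric])
    have "Z = W - (1 - k) *\<^sub>R (W - o')"
    proof -
      have "k *\<^sub>R W = \<kappa> *\<^sub>R X + \<mu> *\<^sub>R Y" unfolding W_def using kk by (simp add: scaleR_add_right)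
      moreover have "W - (1 - k) *\<^sub>R (W - o') = k *\<^sub>R W + (1 - k) *\<^sub>R o'" by (simp add: algebra_simps)
      ultimately show ?thesis unfolding Z(1) by (simp add: k_def algebra_simps)
    qed
    moreover have "W - (1 - k) *\<^sub>R (W - o') \<in> interior H"
      by (rule mem_interior_convex_shrink[OF H(1,2) \<open>W \<in> H\<close>]) (use kk in auto)
    ultimately show False using H(5) by simp
  qed
qed


text \<open>The cone estimate with a single generator, used in both directions: each of the two
  points is at least as far out on the ray as the other.\<close>

lemma boundary_ray_unique:
  fixes H :: "'a::euclidean_space set"
  assumes H: "convex H" "o' \<in> interior H" "X \<in> H" "X \<notin> interior H" "Y \<in> H" "Y \<notin> interior H"
    and e: "X = o' + x *\<^sub>R e" "Y = o' + y *\<^sub>R e" "x > 0" "y > 0"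
  shows "X = Y"
proof -
  have "x / y \<ge> 1" using boundary_cone_ge_1[OF H(1,2,5,5,4), of "x / y" 0] e by simp
  moreover have "y / x \<ge> 1" using boundary_cone_ge_1[OF H(1,2,3,3,6), of "y / x" 0] e by simp
  ultimately have "x = y" using e by (simp add: divide_simps)
  then show ?thesis using e by simp
qed

section \<open>Boundary points in polar coordinates\<close>

definition polar :: "real \<Rightarrow> point" where "polar \<theta> = (cos \<theta>, sin \<theta>)"

lemma cross_polar: "cross (a *\<^sub>R polar \<alpha>) (b *\<^sub>R polar \<beta>) = a * b * sin (\<beta> - \<alpha>)"
  by (simp add: cross_def polar_def sin_diff algebra_simps)

text \<open>Up to the factor \<open>sin (\<gamma> - \<alpha>)\<close> these are the coordinates of
  the direction \<open>\<beta>\<close> in the basis formed by the directions \<open>\<alpha>\<close>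
  and \<open>\<gamma>\<close>.\<close>

lemma polar_combination:
  "sin (\<gamma> - \<alpha>) *\<^sub>R polar \<beta> = sin (\<gamma> - \<beta>) *\<^sub>R polar \<alpha> + sin (\<beta> - \<alpha>) *\<^sub>R polar \<gamma>"
proof -
  have 1: "sin (\<gamma> - \<alpha>) * cos \<beta> = sin (\<gamma> - \<beta>) * cos \<alpha> + sin (\<beta> - \<alpha>) * cos \<gamma>"
    by (simp add: sin_diff algebra_simps)
  have 2: "sin (\<gamma> - \<alpha>) * sin \<beta> = sin (\<gamma> - \<beta>) * sin \<alpha> + sin (\<beta> - \<alpha>) * sin \<gamma>"
    by (simp add: sin_diff algebra_simps)
  show ?thesis using 1 2 by (simp add: polar_def)
qed

lemma polar_periodic: "polar (\<theta> + 2 * pi) = polar \<theta>"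
  by (simp add: polar_def)

lemma sin_nonneg_cases:
  assumes "0 \<le> x" "x \<le> 2 * pi" "sin x \<ge> 0"
  shows "x \<le> pi \<or> x = 2 * pi"
proof (rule ccontr)
  assume "\<not> ?thesis"
  then have "pi < x" "x < 2 * pi" using assms by auto
  then show False using sin_lt_zero[of x] assms by simp
qed

lemma sin_nonpos_cases:
  assumes "0 \<le> x" "x \<le> 2 * pi" "sin x \<le> 0"
  shows "x = 0 \<or> x \<ge> pi"
proof (rule ccontr)
  assume "\<not> ?thesis"
  then have "0 < x" "x < pi" using assms by auto
  then show False using sin_gt_zero[of x] assms by simp
qed

text \<open>The arc from \<open>A\<close> to \<open>C\<close> is less than a half turn, so
  \<open>B\<close> lies in the cone over the chord and by convexity on or beyond it, while the
  centre \<open>o'\<close> is on the near side. If \<open>D\<close> were not on the side of the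
  centre, it would be in that cone as well, and the angular order leaves it only the directions of
  \<open>A\<close> and \<open>C\<close>.\<close>

lemma separates_polar_aux:
  assumes H: "convex H" "o' \<in> interior H"
    and mem: "A \<in> H" "B \<in> H" "C \<in> H" "D \<in> H"
    and bd: "A \<notin> interior H" "B \<notin> interior H" "C \<notin> interior H" "D \<notin> interior H"
    and pol: "A = o' + a *\<^sub>R polar \<alpha>" "B = o' + b *\<^sub>R polar \<beta>"
      "C = o' + c *\<^sub>R polar \<gamma>" "D = o' + d *\<^sub>R polar \<delta>"
    and pos: "a > 0" "b > 0" "c > 0" "d > 0"
    and ord: "\<alpha> \<le> \<beta>" "\<beta> \<le> \<gamma>" "\<gamma> \<le> \<delta>" "\<delta> \<le> \<alpha> + 2 * pi" and less: "\<gamma> - \<alpha> < pi"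
  shows "separates H A C B D"
proof (cases "\<alpha> = \<gamma>")
  case True
  then have "B = A" using boundary_ray_unique[OF H mem(2) bd(2) mem(1) bd(1)] pol pos ord by auto
  then show ?thesis by (auto intro: separates_trivial)
next
  case False
  define s where "s = sin (\<gamma> - \<alpha>)"
  have s: "s > 0" unfolding s_def using False ord less by (intro sin_gt_zero) auto
  \<comment> \<open>The coordinates of \<open>B - o'\<close> with respect to \<open>A - o'\<close>
    and \<open>C - o'\<close>, rescaled from \<open>polar_combination\<close>.\<close>
  define \<kappa> \<mu> where "\<kappa> = b * sin (\<gamma> - \<beta>) / (a * s)" and "\<mu> = b * sin (\<beta> - \<alpha>) / (c * s)"
  have nn: "\<kappa> \<ge> 0" "\<mu> \<ge> 0" unfolding \<kappa>_def \<mu>_def using pos s ord less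
    by (auto intro!: divide_nonneg_nonneg mult_nonneg_nonneg sin_ge_zero)
  have Bc: "B = o' + \<kappa> *\<^sub>R (A - o') + \<mu> *\<^sub>R (C - o')"
  proof -
    have "polar \<beta> = (1 / s) *\<^sub>R (s *\<^sub>R polar \<beta>)" using s by simp
    also have "\<dots> = (sin (\<gamma> - \<beta>) / s) *\<^sub>R polar \<alpha> + (sin (\<beta> - \<alpha>) / s) *\<^sub>R polar \<gamma>"
      unfolding s_def polar_combination[of \<gamma> \<alpha> \<beta>] by (simp add: scaleR_add_right)
    finally have e: "polar \<beta> = (sin (\<gamma> - \<beta>) / s) *\<^sub>R polar \<alpha> + (sin (\<beta> - \<alpha>) / s) *\<^sub>R polar \<gamma>" .
    show ?thesis unfolding pol(2) e unfolding pol \<kappa>_def \<mu>_def using pos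
      by (simp add: scaleR_add_right)
  qed
  have km: "\<kappa> + \<mu> \<ge> 1" using boundary_cone_ge_1[OF H mem(1,3) bd(2) Bc nn] .
  have crAC: "cross (A - o') (C - o') = a * c * s" by (simp add: pol cross_polar s_def)
  then have crAC0: "cross (A - o') (C - o') > 0" using pos s by simp
  have fo: "cross (C - A) (o' - A) > 0" using crAC0 by (simp add: cross_def algebra_simps)
  have fB: "cross (C - A) (B - A) = cross (A - o') (C - o') * (1 - \<kappa> - \<mu>)"
    unfolding Bc by (simp add: cross_def algebra_simps)
  have oH: "o' \<in> H" using H(2) interior_subset by blast
  show ?thesis
  proof (cases "\<kappa> + \<mu> = 1")
    case True
    then have \<mu>1: "\<kappa> = 1 - \<mu>" by simp
    have "B = (1 - \<mu>) *\<^sub>R A + \<mu> *\<^sub>R C" unfolding Bc \<mu>1 by (simp add: algebra_simps)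
    then have "B \<in> closed_segment A C" using nn True by (auto simp: in_segment intro!: exI[of _ \<mu>])
    then show ?thesis by (auto intro: separates_trivial)
  next
    case False
    have fB0: "cross (C - A) (B - A) < 0" unfolding fB using crAC0 km False
      by (intro mult_pos_neg) auto
    have line: "x \<in> closed_segment A C" if "x \<in> H" "cross (C - A) (x - A) = 0" for x
      using boundary_chord[OF H(1) mem(1) bd(1) mem(3) bd(3) oH fo mem(2) fB0 that] .
    show ?thesis
    proof (cases "cross (C - A) (D - A) > 0")
      case True
      then show ?thesis using separates_strict[OF H(1) mem(2,4) fB0 True line] by simp
    next
      case nD: False
      \<comment> \<open>Since \<open>D\<close> is not on the side of \<open>o'\<close>, the segment
        from \<open>o'\<close> to \<open>D\<close> meets the chord. Equating the two
        parametrisations of \<open>z\<close> exhibits \<open>D - o'\<close> as a nonnegative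
        combination of \<open>A - o'\<close> and \<open>C - o'\<close>.\<close>
      obtain z where z: "z \<in> closed_segment o' D" "cross (C - A) (z - A) = 0"
        using cross_crossing_point'[OF fo] nD by (metis not_less)
      have "z \<in> H" using z(1) H(1) oH mem(4) closed_segment_subset by blast
      then have "z \<in> closed_segment A C" using line z by blast
      then obtain \<theta> where \<theta>: "0 \<le> \<theta>" "\<theta> \<le> 1" "z = (1 - \<theta>) *\<^sub>R A + \<theta> *\<^sub>R C" by (auto simp: in_segment)
      obtain \<tau> where \<tau>: "0 \<le> \<tau>" "\<tau> \<le> 1" "z = (1 - \<tau>) *\<^sub>R o' + \<tau> *\<^sub>R D" using z by (auto simp: in_segment)
      have "\<tau> \<noteq> 0" using \<tau> z fo by auto
      then have \<tau>0: "\<tau> > 0" using \<tau> by simp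
      have eq: "\<tau> *\<^sub>R (D - o') = (1 - \<theta>) *\<^sub>R (A - o') + \<theta> *\<^sub>R (C - o')"
        using \<theta>(3) \<tau>(3) by (simp add: algebra_simps)
      have "\<tau> * cross (A - o') (D - o') = cross (A - o') (\<tau> *\<^sub>R (D - o'))"
        by (simp add: cross_def algebra_simps)
      also have "\<dots> = \<theta> * cross (A - o') (C - o')" unfolding eq by (simp add: cross_def algebra_simps)
      finally have "\<tau> * cross (A - o') (D - o') \<ge> 0" using \<theta> crAC0 by simp
      then have "cross (A - o') (D - o') \<ge> 0" using \<tau>0 by (simp add: zero_le_mult_iff)
      then have s1: "sin (\<delta> - \<alpha>) \<ge> 0" using pos
        by (simp add: pol cross_polar zero_le_mult_iff mult_le_0_iff)
      have "\<tau> * cross (D - o') (C - o') = cross (\<tau> *\<^sub>R (D - o')) (C - o')"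
        by (simp add: cross_def algebra_simps)
      also have "\<dots> = (1 - \<theta>) * cross (A - o') (C - o')" unfolding eq by (simp add: cross_def algebra_simps)
      finally have "\<tau> * cross (D - o') (C - o') \<ge> 0" using \<theta> crAC0 by simp
      then have "cross (D - o') (C - o') \<ge> 0" using \<tau>0 by (simp add: zero_le_mult_iff)
      then have "sin (\<gamma> - \<delta>) \<ge> 0" using pos
        by (simp add: pol cross_polar zero_le_mult_iff mult_le_0_iff)
      then have s2: "sin (\<delta> - \<gamma>) \<le> 0" using sin_minus[of "\<gamma> - \<delta>"] by simp
      \<comment> \<open>Both sine signs together with the cyclic order leave only
        \<open>\<delta> = \<gamma>\<close> and the full turn
        \<open>\<delta> = \<alpha> + 2 * pi\<close>.\<close>
      have "\<delta> - \<gamma> = 0 \<or> \<delta> - \<gamma> \<ge> pi" using sin_nonpos_cases[OF _ _ s2] ord by simp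
      moreover have "\<delta> - \<alpha> \<le> pi \<or> \<delta> - \<alpha> = 2 * pi" using sin_nonneg_cases[OF _ _ s1] ord by simp
      ultimately consider "\<delta> = \<gamma>" | "\<delta> = \<alpha> + 2 * pi" using \<open>\<alpha> \<noteq> \<gamma>\<close> ord by linarith
      then have "D = C \<or> D = A"
      proof cases
        case 1
        then show ?thesis using boundary_ray_unique[OF H mem(4) bd(4) mem(3) bd(3)] pol pos by blast
      next
        case 2
        then have "D = o' + d *\<^sub>R polar \<alpha>" using pol polar_periodic by simp
        then show ?thesis using boundary_ray_unique[OF H mem(4) bd(4) mem(1) bd(1) _ pol(1)] pos by blast
      qed
      then show ?thesis by (auto intro: separates_trivial)
    qed
  qed
qed

text \<open>One of the two arcs between \<open>A\<close> and \<open>C\<close> is shorter than a half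
  turn unless the chord passes through \<open>o'\<close>. If it is the arc from \<open>C\<close> on
  to \<open>A\<close>, the roles are exchanged after adding a full turn to \<open>A\<close> and
  \<open>B\<close>. For a chord through the centre, the sides of \<open>B\<close> and
  \<open>D\<close> are read off from the signs of two sines.\<close>

lemma separates_polar:
  assumes H: "convex H" "o' \<in> interior H"
    and mem: "A \<in> H" "B \<in> H" "C \<in> H" "D \<in> H"
    and bd: "A \<notin> interior H" "B \<notin> interior H" "C \<notin> interior H" "D \<notin> interior H"
    and pol: "A = o' + a *\<^sub>R polar \<alpha>" "B = o' + b *\<^sub>R polar \<beta>"
      "C = o' + c *\<^sub>R polar \<gamma>" "D = o' + d *\<^sub>R polar \<delta>"
    and pos: "a > 0" "b > 0" "c > 0" "d > 0"
    and ord: "\<alpha> \<le> \<beta>" "\<beta> \<le> \<gamma>" "\<gamma> \<le> \<delta>" "\<delta> \<le> \<alpha> + 2 * pi"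
  shows "separates H A C B D"
proof -
  consider "\<gamma> - \<alpha> < pi" | "\<gamma> - \<alpha> > pi" | "\<gamma> - \<alpha> = pi" by linarith
  then show ?thesis
  proof cases
    case 1
    then show ?thesis using separates_polar_aux[OF assms] by blast
  next
    case 2
    have A': "A = o' + a *\<^sub>R polar (\<alpha> + 2 * pi)" and B': "B = o' + b *\<^sub>R polar (\<beta> + 2 * pi)"
      using pol polar_periodic by auto
    have "separates H C A D B"
      using separates_polar_aux[OF H mem(3,4,1,2) bd(3,4,1,2) pol(3,4) A' B' pos(3,4,1,2)] ord 2 by simp
    then show ?thesis using separates_sym by blast
  next
    case 3
    have \<gamma>: "\<gamma> = \<alpha> + pi" using 3 by simp
    have pg: "polar \<gamma> = - polar \<alpha>" unfolding \<gamma> polar_def by simp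
    have f: "cross (C - A) (X - A) = - (a + c) * (x * sin (\<xi> - \<alpha>))"
      if "X = o' + x *\<^sub>R polar \<xi>" for X x \<xi>
    proof -
      have "cross (C - A) (X - A) = - (a + c) * (x * cross (1 *\<^sub>R polar \<alpha>) (1 *\<^sub>R polar \<xi>))"
        unfolding that pol pg by (simp add: cross_def algebra_simps)
      then show ?thesis unfolding cross_polar by simp
    qed
    show ?thesis
    proof (cases "B = A \<or> B = C \<or> D = A \<or> D = C")
      case True
      then show ?thesis by (auto intro: separates_trivial)
    next
      case False
      have "\<beta> \<noteq> \<alpha>" "\<beta> \<noteq> \<gamma>" "\<delta> \<noteq> \<gamma>"
        using boundary_ray_unique[OF H mem(2) bd(2) mem(1) bd(1) _ pol(1)]
          boundary_ray_unique[OF H mem(2) bd(2) mem(3) bd(3) _ pol(3)]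
          boundary_ray_unique[OF H mem(4) bd(4) mem(3) bd(3) _ pol(3)] pol pos False by blast+
      moreover have "\<delta> \<noteq> \<alpha> + 2 * pi"
        using boundary_ray_unique[OF H mem(4) bd(4) mem(1) bd(1) _ pol(1)] pol pos False polar_periodic
        by metis
      ultimately have "0 < \<beta> - \<alpha>" "\<beta> - \<alpha> < pi" "pi < \<delta> - \<alpha>" "\<delta> - \<alpha> < 2 * pi"
        using ord \<gamma> by auto
      then have "sin (\<beta> - \<alpha>) > 0" "sin (\<delta> - \<alpha>) < 0" using sin_gt_zero sin_lt_zero by auto
      then have fb: "cross (C - A) (B - A) < 0" and fd: "cross (C - A) (D - A) > 0"
        unfolding f[OF pol(2)] f[OF pol(4)] using pos
        by (auto simp: mult_pos_neg mult_neg_pos zero_less_mult_iff mult_less_0_iff)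
      show ?thesis
        using separates_strict[OF H(1) mem(2,4) fb fd]
          boundary_chord[OF H(1) mem(1) bd(1) mem(3) bd(3) mem(4) fd mem(2) fb] by blast
    qed
  qed
qed

section \<open>Sorting by angle\<close>

text \<open>A substitute for the angle of \<open>d\<close> that costs one square root and one
  division: \<open>1 - cos\<close> rises from 0 to 2 on the upper half turn and
  \<open>3 + cos\<close> from 2 to 4 on the lower one. The centre itself gets a smaller key than all
  directions.\<close>

definition ang_key :: "point \<Rightarrow> real" where
  "ang_key d = (if d = 0 then - 1
     else if snd d > 0 \<or> snd d = 0 \<and> fst d > 0 then 1 - fst d / norm d
     else 3 + fst d / norm d)"

text \<open>Coordinates break ties for the sake of flat hulls, where the key takes few values; the
  final \<open>\<le>\<close> admits sources in the same position.\<close>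

definition before :: "point \<Rightarrow> point \<Rightarrow> point \<Rightarrow> bool" where
  "before o' s s' \<longleftrightarrow> ang_key (s - o') < ang_key (s' - o') \<or>
     ang_key (s - o') = ang_key (s' - o') \<and> (snd s < snd s' \<or> snd s = snd s' \<and> fst s \<le> fst s')"

lemma ang_key_polar:
  assumes "d \<noteq> 0"
  obtains \<theta> where "0 \<le> \<theta>" "\<theta> < 2 * pi" "d = norm d *\<^sub>R polar \<theta>"
    "ang_key d = (if \<theta> < pi then 1 - cos \<theta> else 3 + cos \<theta>)"
proof -
  have nd: "norm d > 0" using assms by simp
  have "(fst d / norm d)\<^sup>2 + (snd d / norm d)\<^sup>2 = 1"
    using nd by (auto simp: norm_prod_def power_divide add_divide_distrib[symmetric])
  then obtain \<theta> where \<theta>: "0 \<le> \<theta>" "\<theta> < 2 * pi" "fst d / norm d = cos \<theta>" "snd d / norm d = sin \<theta>"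
    using sincos_total_2pi by metis
  have d: "d = norm d *\<^sub>R polar \<theta>" using nd unfolding polar_def \<theta>(3,4)[symmetric]
    by (simp add: prod_eq_iff)
  have s: "snd d = norm d * sin \<theta>" "fst d = norm d * cos \<theta>" using \<theta>(3,4) nd by (auto simp: field_simps)
  have "(snd d > 0 \<or> snd d = 0 \<and> fst d > 0) \<longleftrightarrow> \<theta> < pi"
  proof
    assume *: "snd d > 0 \<or> snd d = 0 \<and> fst d > 0"
    show "\<theta> < pi"
    proof (rule ccontr)
      assume "\<not> \<theta> < pi"
      then have ge: "pi \<le> \<theta>" by simp
      show False
      proof (cases "\<theta> = pi")
        case True
        then show False using * s nd by (simp add: zero_less_mult_iff)
      next
        case False
        then have "sin \<theta> < 0" using ge \<theta> by (intro sin_lt_zero) auto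
        then show False using * s nd by (simp add: zero_less_mult_iff)
      qed
    qed
  next
    assume *: "\<theta> < pi"
    show "snd d > 0 \<or> snd d = 0 \<and> fst d > 0"
    proof (cases "\<theta> = 0")
      case True then show ?thesis using s nd by simp
    next
      case False
      then have "sin \<theta> > 0" using * \<theta> by (intro sin_gt_zero) auto
      then show ?thesis using s nd by simp
    qed
  qed
  then have "ang_key d = (if \<theta> < pi then 1 - cos \<theta> else 3 + cos \<theta>)"
    using assms \<theta>(3) by (simp add: ang_key_def)
  then show thesis using that \<theta> d by blast
qed

text \<open>The key is increasing on each half turn, and the value 2 separates the two
  halves.\<close>

lemma ang_key_mono:
  fixes \<theta> \<theta>' :: real
  assumes \<theta>: "0 \<le> \<theta>" "\<theta> < 2 * pi" "0 \<le> \<theta>'" "\<theta>' < 2 * pi"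
    and le: "(if \<theta> < pi then 1 - cos \<theta> else 3 + cos \<theta>) \<le> (if \<theta>' < pi then 1 - cos \<theta>' else 3 + cos \<theta>')"
  shows "\<theta> \<le> \<theta>'"
proof (rule ccontr)
  assume "\<not> ?thesis"
  then have lt: "\<theta>' < \<theta>" by simp
  consider "\<theta> < pi" | "\<theta>' < pi" "pi \<le> \<theta>" | "pi \<le> \<theta>'" by linarith
  then show False
  proof cases
    case 1
    then have "cos \<theta> < cos \<theta>'" using lt \<theta> by (intro cos_monotone_0_pi) auto
    then show False using 1 lt le by simp
  next
    case 2
    then have "cos pi < cos \<theta>'" using \<theta> by (intro cos_monotone_0_pi) auto
    then show False using 2 le cos_ge_minus_one[of \<theta>] by simp
  next
    case 3
    have "cos (2 * pi - \<theta>') < cos (2 * pi - \<theta>)" using 3 lt \<theta> by (intro cos_monotone_0_pi) auto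
    then show False using 3 lt le by (simp add: cos_diff)
  qed
qed

text \<open>Sorted keys give nondecreasing angles within one turn. The second conclusion is the
  first one after a cyclic shift, with the angle of \<open>s i\<close> advanced by a full
  turn.\<close>

lemma separates_sorted:
  fixes s :: "nat \<Rightarrow> point"
  assumes H: "convex H" "o' \<in> interior H"
    and s: "\<And>i. i < n \<Longrightarrow> s i \<in> H" "\<And>i. i < n \<Longrightarrow> s i \<notin> interior H"
    and srt: "\<And>i j. i < j \<Longrightarrow> j < n \<Longrightarrow> before o' (s i) (s j)"
    and ijkl: "i < j" "j < k" "k < l" "l < n"
  shows "separates H (s i) (s k) (s j) (s l)" "separates H (s j) (s l) (s k) (s i)"
proof -
  have "\<exists>\<theta>. 0 \<le> \<theta> \<and> \<theta> < 2 * pi \<and> s m - o' = norm (s m - o') *\<^sub>R polar \<theta> \<and>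
    ang_key (s m - o') = (if \<theta> < pi then 1 - cos \<theta> else 3 + cos \<theta>)" if "m < n" for m
  proof -
    have "s m - o' \<noteq> 0" using s(2)[OF that] H(2) by auto
    then show ?thesis using ang_key_polar by metis
  qed
  then obtain \<theta> where \<theta>: "\<And>m. m < n \<Longrightarrow> 0 \<le> \<theta> m \<and> \<theta> m < 2 * pi \<and>
      s m - o' = norm (s m - o') *\<^sub>R polar (\<theta> m) \<and>
      ang_key (s m - o') = (if \<theta> m < pi then 1 - cos (\<theta> m) else 3 + cos (\<theta> m))"
    by metis
  have mono: "\<theta> p \<le> \<theta> q" if "p < q" "q < n" for p q
  proof -
    have "ang_key (s p - o') \<le> ang_key (s q - o')" using srt[OF that] by (auto simp: before_def)
    then show ?thesis using ang_key_mono[of "\<theta> p" "\<theta> q"] \<theta>[of p] \<theta>[of q] that by auto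
  qed
  define r where "r m = norm (s m - o')" for m
  have pol: "s m = o' + r m *\<^sub>R polar (\<theta> m)" if "m < n" for m
    using \<theta>[OF that] by (simp add: r_def algebra_simps)
  have rp: "r m > 0" if "m < n" for m
    using s(2)[OF that] H(2) by (auto simp: r_def)
  have b: "i < n" "j < n" "k < n" "l < n" using ijkl by auto
  have m: "\<theta> i \<le> \<theta> j" "\<theta> j \<le> \<theta> k" "\<theta> k \<le> \<theta> l" "\<theta> l \<le> \<theta> i + 2 * pi"
    using mono ijkl b \<theta>[OF b(4)] \<theta>[OF b(1)] by (auto intro!: mono)
  show "separates H (s i) (s k) (s j) (s l)"
    using separates_polar[OF H s(1)[OF b(1)] s(1)[OF b(2)] s(1)[OF b(3)] s(1)[OF b(4)]
        s(2)[OF b(1)] s(2)[OF b(2)] s(2)[OF b(3)] s(2)[OF b(4)]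
        pol[OF b(1)] pol[OF b(2)] pol[OF b(3)] pol[OF b(4)] rp[OF b(1)] rp[OF b(2)] rp[OF b(3)] rp[OF b(4)] m] .
  have pi': "s i = o' + r i *\<^sub>R polar (\<theta> i + 2 * pi)" using pol[OF b(1)] polar_periodic by simp
  have m': "\<theta> l \<le> \<theta> i + 2 * pi" "\<theta> i + 2 * pi \<le> \<theta> j + 2 * pi" using m by auto
  show "separates H (s j) (s l) (s k) (s i)"
    using separates_polar[OF H s(1)[OF b(2)] s(1)[OF b(3)] s(1)[OF b(4)] s(1)[OF b(1)]
        s(2)[OF b(2)] s(2)[OF b(3)] s(2)[OF b(4)] s(2)[OF b(1)]
        pol[OF b(2)] pol[OF b(3)] pol[OF b(4)] pi' rp[OF b(2)] rp[OF b(3)] rp[OF b(4)] rp[OF b(1)] m(2,3) m'] .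
qed

text \<open>
  In a degenerate hull the key only distinguishes the two sides of the centre, so that the
  lexicographic tie-breaking sorts the points along the line, up to a cyclic rotation.
\<close>

lemma separates_sorted_flat:
  fixes s :: "nat \<Rightarrow> point"
  assumes H: "a \<noteq> 0" "H \<subseteq> {x. a \<bullet> x = b}" "o' \<in> H"
    and s: "\<And>i. i < n \<Longrightarrow> s i \<in> H"
    and srt: "\<And>i j. i < j \<Longrightarrow> j < n \<Longrightarrow> before o' (s i) (s j)"
    and ijkl: "i < j" "j < k" "k < l" "l < n"
  shows "separates H (s i) (s k) (s j) (s l)" "separates H (s j) (s l) (s k) (s i)"
proof -
  \<comment> \<open>A direction vector of the line, oriented such that its positive multiples fall
    under the first case of the key.\<close>
  define e :: point where
    "e = (if fst a > 0 \<or> fst a = 0 \<and> snd a < 0 then (- snd a, fst a) else (snd a, - fst a))"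
  have e: "snd e > 0 \<or> snd e = 0 \<and> fst e > 0"
    using H(1) by (auto simp: e_def prod_eq_iff)
  then have e0: "e \<noteq> 0" by auto
  have ae: "a \<bullet> e = 0" by (simp add: e_def inner_prod_def)
  have ee: "e \<bullet> e > 0" using e0 by simp
  have line: "\<exists>z. x = o' + z *\<^sub>R e" if "x \<in> H" for x
  proof
    have "a \<bullet> (x - o') = 0" using H that by (auto simp: inner_diff)
    then have c: "fst a * fst (x - o') + snd a * snd (x - o') = 0" by (simp add: inner_prod_def)
    have "cross e (x - o') = 0" using c unfolding e_def cross_def by auto
    from parallel_scaleR[OF this e0] have "x - o' = (((x - o') \<bullet> e) / (e \<bullet> e)) *\<^sub>R e" .
    then show "x = o' + (((x - o') \<bullet> e) / (e \<bullet> e)) *\<^sub>R e" by (simp add: algebra_simps)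
  qed
  then have "\<forall>m. \<exists>z. m < n \<longrightarrow> s m = o' + z *\<^sub>R e" using s by blast
  from choice[OF this] obtain z where z: "\<And>m. m < n \<Longrightarrow> s m = o' + z m *\<^sub>R e" by blast
  define c where "c = fst e / norm e"
  have "\<bar>fst e\<bar> \<le> norm e" using norm_fst_le[of "fst e" "snd e"] by simp
  then have c: "c \<le> 1" unfolding c_def using e0 by (simp add: divide_le_eq)
  have key: "ang_key (t *\<^sub>R e) = (if t = 0 then - 1 else if t > 0 then 1 - c else 3 - c)" for t
  proof -
    consider "t = 0" | "t > 0" | "t < 0" by linarith
    then show ?thesis
    proof cases
      case 2
      then show ?thesis using e e0 by (auto simp: ang_key_def c_def zero_less_mult_iff)
    next
      case 3
      then have "\<not> (snd (t *\<^sub>R e) > 0 \<or> snd (t *\<^sub>R e) = 0 \<and> fst (t *\<^sub>R e) > 0)"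
        using e by (auto simp: zero_less_mult_iff)
      then show ?thesis using 3 e0 by (auto simp: ang_key_def c_def)
    qed (simp add: ang_key_def)
  qed
  \<comment> \<open>The sorted order lists the points at the centre, those on the positive side by
    increasing parameter, and those on the negative side by increasing parameter.\<close>
  have R: "z p = 0 \<or> z p > 0 \<and> (z q < 0 \<or> z p \<le> z q) \<or> z p < 0 \<and> z q < 0 \<and> z p \<le> z q"
    if "p < q" "q < n" for p q
  proof -
    have bf: "before o' (s p) (s q)" using srt[OF that] .
    have sp: "s p - o' = z p *\<^sub>R e" "s q - o' = z q *\<^sub>R e" using z that by auto
    have tie: "snd (s p) < snd (s q) \<or> snd (s p) = snd (s q) \<and> fst (s p) \<le> fst (s q) \<Longrightarrow> z p \<le> z q"
      using z[of p] z[of q] that e by (auto simp: mult_less_cancel_right)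
    show ?thesis
      using bf tie c unfolding before_def sp key by (auto split: if_splits)
  qed
  have seg: "s p \<in> closed_segment (s q) (s r)"
    if "p < n" "q < n" "r < n" "z q \<le> z p \<and> z p \<le> z r \<or> z r \<le> z p \<and> z p \<le> z q" for p q r
  proof (cases "z q = z r")
    case True
    then show ?thesis using that z by auto
  next
    case False
    define u where "u = (z p - z q) / (z r - z q)"
    have u: "0 \<le> u" "u \<le> 1" "z p = (1 - u) * z q + u * z r"
      using that False by (auto simp: u_def divide_simps) (auto simp: algebra_simps)
    have "s p = (1 - u) *\<^sub>R s q + u *\<^sub>R s r"
      unfolding z[OF that(1)] z[OF that(2)] z[OF that(3)] u(3) by (simp add: algebra_simps)
    then show ?thesis using u by (auto simp: in_segment)
  qed
  have b: "i < n" "j < n" "k < n" "l < n" using ijkl by auto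
  have R1: "0 \<le> z p \<and> z p \<le> z q" if "p < q" "q < n" "0 \<le> z q" for p q using R[OF that(1,2)] that(3) by auto
  have R2: "z q < 0 \<and> z p \<le> z q" if "p < q" "q < n" "z p < 0" for p q using R[OF that(1,2)] that(3) by auto
  consider "0 \<le> z l" | "z l < 0" "0 \<le> z k" | "z k < 0" "0 \<le> z j" | "z j < 0" "0 \<le> z i" | "z i < 0"
    by linarith
  \<comment> \<open>In each case one of the two points to be separated lies on the chord of the
    other two, where the separation is trivial.\<close>
  then have "(z i \<le> z j \<and> z j \<le> z k \<or> z k \<le> z l \<and> z l \<le> z i) \<and>
    (z j \<le> z k \<and> z k \<le> z l \<or> z l \<le> z i \<and> z i \<le> z j)"
  proof cases
    case 1 then show ?thesis using R1[of k l] R1[of j k] R1[of i j] ijkl b by auto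
  next
    case 2 then show ?thesis using R1[of j k] R1[of i j] ijkl b by auto
  next
    case 3 then show ?thesis using R2[of k l] R1[of i j] ijkl b by auto
  next
    case 4 then show ?thesis using R2[of j k] R2[of k l] ijkl b by auto
  next
    case 5 then show ?thesis using R2[of i j] R2[of j k] R2[of k l] ijkl b by auto
  qed
  then show "separates H (s i) (s k) (s j) (s l)" "separates H (s j) (s l) (s k) (s i)"
    using seg b by (blast intro: separates_trivial)+
qed

text \<open>Reduction modulo \<open>n\<close> turns four increasing positions within one turn into a
  cyclic shift of an increasing quadruple. There are four shifts: \<open>base\<close> covers two of
  them, and \<open>separates_sym\<close> yields the other two.\<close>

lemma separates_cyclic:
  fixes s :: "nat \<Rightarrow> point"
  assumes base: "\<And>i j k l. i < j \<Longrightarrow> j < k \<Longrightarrow> k < l \<Longrightarrow> l < n \<Longrightarrow>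
      separates H (s i) (s k) (s j) (s l) \<and> separates H (s j) (s l) (s k) (s i)"
    and x: "x1 < x2" "x2 < x3" "x3 < x4" "x4 < x1 + n"
  shows "separates H (s (x1 mod n)) (s (x3 mod n)) (s (x2 mod n)) (s (x4 mod n))"
proof -
  define q r1 where "q = x1 div n" and "r1 = x1 mod n"
  have n: "n > 0" using x by auto
  have r1: "r1 < n" "x1 = q * n + r1" using n by (auto simp: q_def r1_def)
  have wrap: "\<exists>y. x mod n = y \<and> (y = x - q * n \<and> y < n \<and> r1 \<le> y \<or> y + n = x - q * n \<and> y < r1)"
    if "x1 \<le> x" "x < x1 + n" for x
  proof (cases "x - q * n < n")
    case True
    have "x = q * n + (x - q * n)" using r1 that by simp
    then have "x mod n = x - q * n" using True by (metis mod_less mod_mult_self3)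
    then show ?thesis using True r1 that by simp
  next
    case False
    define y where "y = x - q * n - n"
    have "q * n + n \<le> x" using False n by linarith
    then have xy: "x = Suc q * n + y" by (simp add: y_def)
    have yr: "y < r1" using that r1 xy by simp
    then have "x mod n = y" using xy r1 by (metis mod_less mod_mult_self3 less_trans)
    then show ?thesis using xy yr by simp
  qed
  obtain y2 y3 y4 where y: "x2 mod n = y2" "x3 mod n = y3" "x4 mod n = y4"
    and c2: "y2 = x2 - q * n \<and> y2 < n \<and> r1 \<le> y2 \<or> y2 + n = x2 - q * n \<and> y2 < r1"
    and c3: "y3 = x3 - q * n \<and> y3 < n \<and> r1 \<le> y3 \<or> y3 + n = x3 - q * n \<and> y3 < r1"
    and c4: "y4 = x4 - q * n \<and> y4 < n \<and> r1 \<le> y4 \<or> y4 + n = x4 - q * n \<and> y4 < r1"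
    using wrap[of x2] wrap[of x3] wrap[of x4] x by force
  have "r1 < y2 \<and> y2 < y3 \<and> y3 < y4 \<and> y4 < n \<or> y4 < r1 \<and> r1 < y2 \<and> y2 < y3 \<and> y3 < n
    \<or> y3 < y4 \<and> y4 < r1 \<and> r1 < y2 \<and> y2 < n \<or> y2 < y3 \<and> y3 < y4 \<and> y4 < r1"
  proof -
    define Q where "Q = q * n"
    note d = c2[folded Q_def] c3[folded Q_def] c4[folded Q_def] r1(1) r1(2)[folded Q_def] x
    have u: "x2 < Q + n \<Longrightarrow> y2 + Q = x2" "x3 < Q + n \<Longrightarrow> y3 + Q = x3" "x4 < Q + n \<Longrightarrow> y4 + Q = x4"
      using d by linarith+
    have w: "x2 \<ge> Q + n \<Longrightarrow> y2 + n + Q = x2" "x3 \<ge> Q + n \<Longrightarrow> y3 + n + Q = x3"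
      "x4 \<ge> Q + n \<Longrightarrow> y4 + n + Q = x4"
      using d by linarith+
    \<comment> \<open>\<open>Q + n\<close> is the first multiple of \<open>n\<close> beyond
      \<open>x1\<close>; the cases tell how many of the three later positions have passed
      it.\<close>
    consider "x4 < Q + n" | "x4 \<ge> Q + n" "x3 < Q + n"
      | "x3 \<ge> Q + n" "x2 < Q + n" | "x2 \<ge> Q + n" by linarith
    then show ?thesis
    proof cases
      case 1
      then have "y2 + Q = x2" "y3 + Q = x3" "y4 + Q = x4" using u d(6-9) by auto
      then show ?thesis using 1 d(4-9) by auto
    next
      case 2
      then have "y2 + Q = x2" "y3 + Q = x3" "y4 + n + Q = x4" using u w d(6-9) by auto
      then show ?thesis using 2 d(4-9) by auto
    next
      case 3
      then have "y2 + Q = x2" "y3 + n + Q = x3" "y4 + n + Q = x4" using u w d(6-9) by auto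
      then show ?thesis using 3 d(4-9) by auto
    next
      case 4
      then have "y2 + n + Q = x2" "y3 + n + Q = x3" "y4 + n + Q = x4" using w d(6-9) by auto
      then show ?thesis using 4 d(4-9) by auto
    qed
  qed
  then show ?thesis unfolding y r1_def[symmetric]
    using base[of r1 y2 y3 y4] base[of y4 r1 y2 y3] base[of y3 y4 r1 y2] base[of y2 y3 y4 r1] r1
      separates_sym[of H "s r1" "s y3" "s y2" "s y4"] by blast
qed

subsection \<open>Nearest hubs\<close>

text \<open>Giving ties to the lexicographically smallest hub makes the nearest hub unique and keeps
  one side of every bisector strict.\<close>

definition nearest :: "point set \<Rightarrow> point \<Rightarrow> point \<Rightarrow> bool" where
  "nearest F x f \<longleftrightarrow> f \<in> F \<and>
     (\<forall>g\<in>F. g \<noteq> f \<longrightarrow> dist x f < dist x g \<or> dist x f = dist x g \<and> lex_less f g)"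

lemma nearest_le: "nearest F x f \<Longrightarrow> g \<in> F \<Longrightarrow> dist x f \<le> dist x g"
  unfolding nearest_def by force

lemma nearest_exists:
  assumes "finite F" "F \<noteq> {}"
  obtains f where "nearest F x f"
proof -
  have "\<exists>f\<in>F. \<forall>g\<in>F. g \<noteq> f \<longrightarrow> dist x f < dist x g \<or> dist x f = dist x g \<and> lex_less f g"
    using assms
  proof (induction rule: finite_ne_induct)
    case (singleton f)
    then show ?case by simp
  next
    case (insert h F)
    then obtain f where f: "f \<in> F" "\<forall>g\<in>F. g \<noteq> f \<longrightarrow> dist x f < dist x g \<or> dist x f = dist x g \<and> lex_less f g"
      by blast
    have hf: "h \<noteq> f" using f insert by blast
    show ?case
    proof (cases "dist x f < dist x h \<or> dist x f = dist x h \<and> lex_less f h")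
      case True
      then show ?thesis using f by auto
    next
      case False
      then have *: "dist x h < dist x f \<or> dist x h = dist x f \<and> lex_less h f"
        using hf by (auto simp: lex_less_def prod_eq_iff)
      have "dist x h < dist x g \<or> dist x h = dist x g \<and> lex_less h g" if "g \<in> F" for g
      proof (cases "g = f")
        case False
        then show ?thesis using f(2) * that by (auto simp: lex_less_def)
      qed (use * in simp)
      then show ?thesis by auto
    qed
  qed
  then show thesis using that unfolding nearest_def by blast
qed

text \<open>Points on the bisector of two hubs belong to the lexicographically smaller one. Compared
  with each other, the hubs thus have a closed and an open half plane as their regions, which are
  disjoint and, being convex, contain the two segments.\<close>

lemma nearest_segments_disjoint:
  assumes "nearest F A f" "nearest F C f" "nearest F B g" "f \<noteq> g"
  shows "closed_segment B g \<inter> closed_segment A C = {}"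
proof (cases "lex_less f g")
  case True
  then have nl: "\<not> lex_less g f" by (auto simp: lex_less_def)
  have "dist B g < dist B f" using assms nl by (auto simp: nearest_def)
  then have "closed_segment B g \<subseteq> {w. dist w g < dist w f}"
    using assms(4) by (intro closed_segment_subset convex_dist_less) auto
  moreover have "closed_segment A C \<subseteq> {w. dist w f \<le> dist w g}"
    using assms by (intro closed_segment_subset convex_dist_le) (auto intro: nearest_le simp: nearest_def[of F B])
  ultimately show ?thesis by force
next
  case False
  have "dist A f < dist A g" "dist C f < dist C g" using assms False by (auto simp: nearest_def)
  then have "closed_segment A C \<subseteq> {w. dist w f < dist w g}"
    by (intro closed_segment_subset convex_dist_less) auto
  moreover have "closed_segment B g \<subseteq> {w. dist w g \<le> dist w f}"
    using assms by (intro closed_segment_subset convex_dist_le) (auto intro: nearest_le simp: nearest_def[of F A])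
  ultimately show ?thesis by force
qed

text \<open>Separation is applied with both \<open>q\<close> and \<open>q'\<close> equal to
  \<open>g\<close>: the degenerate segment from \<open>g\<close> to \<open>g\<close> would have to
  meet the chord, yet \<open>g\<close> is the end of a segment that avoids it.\<close>

lemma nearest_noncrossing:
  assumes sep: "separates H A C B D" and F: "F \<subseteq> H"
    and near: "nearest F A f" "nearest F C f" "nearest F B g" "nearest F D g"
  shows "f = g"
proof (rule ccontr)
  assume ne: "f \<noteq> g"
  have "g \<in> H" using near F by (auto simp: nearest_def)
  moreover have d: "closed_segment B g \<inter> closed_segment A C = {}" "closed_segment D g \<inter> closed_segment A C = {}"
    using nearest_segments_disjoint near ne by blast+
  ultimately have "closed_segment g g \<inter> closed_segment A C \<noteq> {}"
    using sep unfolding separates_def by blast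
  then show False using d(1) by auto
qed

text \<open>The segment from \<open>g\<close> to \<open>h\<close> crosses the chord
  \<open>A C\<close> in a point \<open>w\<close>, and the region of \<open>f\<close> contains the
  whole chord by convexity. So \<open>f\<close> is nearest to a point between \<open>g\<close> and
  \<open>h\<close>, which bounds the angle at \<open>f\<close>. A lexicographically smaller hub
  loses strictly at \<open>A\<close> and \<open>C\<close>, hence also at \<open>w\<close>.\<close>

lemma nearest_hubs_obtuse:
  assumes sep: "separates H A C B D" and F: "F \<subseteq> H"
    and near: "nearest F A f" "nearest F C f" "nearest F B g" "nearest F D h" and ne: "g \<noteq> f" "h \<noteq> f"
  shows "(g - f) \<bullet> (h - f) \<le> 0" "lex_less g f \<or> lex_less h f \<Longrightarrow> (g - f) \<bullet> (h - f) < 0"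
proof -
  have gh: "g \<in> F" "h \<in> F" "f \<in> F" using near by (auto simp: nearest_def)
  have d: "closed_segment B g \<inter> closed_segment A C = {}" "closed_segment D h \<inter> closed_segment A C = {}"
    using nearest_segments_disjoint near ne by blast+
  then obtain w where w: "w \<in> closed_segment g h" "w \<in> closed_segment A C"
    using sep gh F unfolding separates_def by blast
  have le: "dist w f \<le> dist w x" if "x \<in> F" for x
  proof -
    have "closed_segment A C \<subseteq> {w. dist w f \<le> dist w x}"
      using near that by (intro closed_segment_subset convex_dist_le) (auto intro: nearest_le)
    then show ?thesis using w by blast
  qed
  have less: "dist w f < dist w x" if "x \<in> F" "lex_less x f" for x
  proof -
    have "\<not> lex_less f x" "x \<noteq> f" using that by (auto simp: lex_less_def)
    then have "dist A f < dist A x" "dist C f < dist C x" using near that by (auto simp: nearest_def)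
    then have "closed_segment A C \<subseteq> {w. dist w f < dist w x}"
      by (intro closed_segment_subset convex_dist_less) auto
    then show ?thesis using w by blast
  qed
  note * = segment_near_hub_obtuse[OF w(1) le[OF gh(1)] le[OF gh(2)] ne[symmetric]]
  show "(g - f) \<bullet> (h - f) \<le> 0" using *(1) .
  show "lex_less g f \<or> lex_less h f \<Longrightarrow> (g - f) \<bullet> (h - f) < 0" using *(2) less gh by blast
qed

text \<open>The positions \<open>a\<close> in the cluster of \<open>f\<close> and the positions
  \<open>b\<close> outside it alternate around the cycle, which \<open>a 4 = a 0 + n\<close> closes.
  For any two of the four gaps a chord of the cluster separates their representatives, so the four
  hubs of the \<open>b i\<close> seen from \<open>f\<close> would form the impossible configuration
  of \<open>no_four_obtuse_hubs\<close>.\<close>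

lemma nearest_at_most_three_runs:
  fixes P :: "nat \<Rightarrow> point" and a b :: "nat \<Rightarrow> nat"
  assumes sep: "\<And>x1 x2 x3 x4. x1 < x2 \<Longrightarrow> x2 < x3 \<Longrightarrow> x3 < x4 \<Longrightarrow> x4 < x1 + n \<Longrightarrow>
      separates H (P x1) (P x3) (P x2) (P x4)"
    and per: "\<And>k. P (k + n) = P k" and F: "F \<subseteq> H"
    and near: "\<And>k. nearest F (P k) (\<psi> k)"
    and a: "\<And>i. i \<le> 4 \<Longrightarrow> \<psi> (a i) = f" and b: "\<And>i. i < 4 \<Longrightarrow> \<psi> (b i) \<noteq> f"
    and ab: "\<And>i. i < 4 \<Longrightarrow> a i < b i" "\<And>i. i < 4 \<Longrightarrow> b i < a (Suc i)" and a4: "a 4 = a 0 + n"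
  shows False
proof -
  have a_mono: "a i \<le> a j" if "i \<le> j" "j \<le> 4" for i j
    using that
  proof (induction j rule: dec_induct)
    case (step m)
    then show ?case using ab[of m] by simp
  qed simp
  have main: "(\<psi> (b k) - f) \<bullet> (\<psi> (b i) - f) \<le> 0 \<and>
      (lex_less (\<psi> (b k)) f \<or> lex_less (\<psi> (b i)) f \<longrightarrow> (\<psi> (b k) - f) \<bullet> (\<psi> (b i) - f) < 0)"
    if "i < k" "k < 4" for i k
  proof -
    have 1: "a (Suc i) < b k" using a_mono[of "Suc i" k] ab(1)[of k] that by simp
    have 2: "b k < a (Suc k)" using ab(2) that by simp
    have 3: "a (Suc k) < b i + n" using a_mono[of "Suc k" 4] a_mono[of 0 i] a4 ab(1)[of i] that by simp
    have 4: "b i + n < a (Suc i) + n" using ab(2)[of i] that by simp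
    \<comment> \<open>Gap \<open>i\<close> is moved one turn ahead, so that the chord from
      \<open>a (Suc i)\<close> to \<open>a (Suc k)\<close> has \<open>b k\<close> before its second
      end and \<open>b i + n\<close> after it.\<close>
    have s: "separates H (P (a (Suc i))) (P (a (Suc k))) (P (b k)) (P (b i))"
      using sep[OF 1 2 3 4] by (simp add: per)
    have nn: "nearest F (P (a (Suc i))) f" "nearest F (P (a (Suc k))) f"
      using near[of "a (Suc i)"] near[of "a (Suc k)"] a that by auto
    show ?thesis using nearest_hubs_obtuse[OF s F nn near near] b that by simp
  qed
  show False
  proof (rule no_four_obtuse_hubs[of "\<lambda>i. \<psi> (b i) - f"])
    fix i j :: nat assume "i < 4" "j < 4" "i \<noteq> j"
    then show "(\<psi> (b i) - f) \<bullet> (\<psi> (b j) - f) \<le> 0"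
      using main[of i j] main[of j i] by (cases "i < j") (auto simp: inner_commute)
    assume "lex_less (\<psi> (b i) - f) 0"
    then have "lex_less (\<psi> (b i)) f" by (simp add: lex_less_def)
    then show "(\<psi> (b i) - f) \<bullet> (\<psi> (b j) - f) < 0"
      using main[of i j] main[of j i] \<open>i < 4\<close> \<open>j < 4\<close> \<open>i \<noteq> j\<close> by (cases "i < j") (auto simp: inner_commute)
  qed (use b in auto)
qed

subsection \<open>The ellipsoid method for planar medians\<close>

text \<open>The cost of a hub at \<open>p\<close> with cluster \<open>X\<close>; its edge to the
  sink at \<open>T\<close> counts like one more source.\<close>

definition star :: "(nat \<Rightarrow> point) \<Rightarrow> point \<Rightarrow> nat set \<Rightarrow> point \<Rightarrow> real" where
  "star P T X p = dist p T + (\<Sum>k\<in>X. dist p (P k))"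

text \<open>Division by zero yields zero, so a point coinciding with \<open>p\<close> contributes
  the subgradient 0 of the distance at its minimum.\<close>

definition star_grad :: "(nat \<Rightarrow> point) \<Rightarrow> point \<Rightarrow> nat set \<Rightarrow> point \<Rightarrow> point" where
  "star_grad P T X p = (1 / dist p T) *\<^sub>R (p - T) + (\<Sum>k\<in>X. (1 / dist p (P k)) *\<^sub>R (p - P k))"

definition star_mean :: "(nat \<Rightarrow> point) \<Rightarrow> point \<Rightarrow> nat set \<Rightarrow> point" where
  "star_mean P T X = (1 / (1 + real (card X))) *\<^sub>R (T + (\<Sum>k\<in>X. P k))"

lemma star_nonneg: "star P T X p \<ge> 0"
  by (simp add: star_def sum_nonneg)

text \<open>Cauchy-Schwarz for \<open>c - s\<close> and \<open>x - s\<close>; at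
  \<open>c = s\<close> the slope is zero and the distance is nonnegative.\<close>

lemma dist_subgradient:
  fixes c s x :: "'a::real_inner"
  shows "dist x s \<ge> dist c s + ((1 / dist c s) *\<^sub>R (c - s)) \<bullet> (x - c)"
proof (cases "c = s")
  case False
  then have d: "dist c s > 0" by simp
  have "(c - s) \<bullet> (x - s) \<le> dist c s * dist x s"
    using norm_cauchy_schwarz[of "c - s" "x - s"] by (simp add: dist_norm)
  moreover have "(c - s) \<bullet> (x - s) = (c - s) \<bullet> (x - c) + (dist c s)\<^sup>2"
    by (simp add: dist_norm power2_norm_eq_inner inner_diff inner_commute algebra_simps)
  ultimately have "(c - s) \<bullet> (x - c) \<le> (dist x s - dist c s) * dist c s"
    by (simp add: power2_eq_square left_diff_distrib mult.commute[of "dist x s"])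
  then have "(c - s) \<bullet> (x - c) / dist c s \<le> dist x s - dist c s"
    using d by (simp add: pos_divide_le_eq)
  then show ?thesis by simp
qed simp

lemma star_subgradient: "star P T X x \<ge> star P T X c + star_grad P T X c \<bullet> (x - c)"
proof -
  have "(\<Sum>k\<in>X. dist c (P k) + ((1 / dist c (P k)) *\<^sub>R (c - P k)) \<bullet> (x - c)) \<le> (\<Sum>k\<in>X. dist x (P k))"
    by (rule sum_mono) (rule dist_subgradient)
  then show ?thesis using dist_subgradient[of c T x]
    by (simp add: star_def star_grad_def inner_add_left inner_sum_left sum.distrib)
qed

lemma star_lipschitz: "star P T X x \<le> star P T X p + (1 + real (card X)) * dist x p"
proof -
  have "(\<Sum>k\<in>X. dist x (P k)) \<le> (\<Sum>k\<in>X. dist x p + dist p (P k))"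
    by (rule sum_mono) (rule dist_triangle)
  then show ?thesis using dist_triangle[of x T p]
    by (simp add: star_def sum.distrib algebra_simps)
qed

text \<open>The vector from \<open>p\<close> to the centroid is the mean of the vectors from
  \<open>p\<close> to the points, so its length is at most the mean distance at \<open>p\<close>.
  This localises all good hubs around the centroid.\<close>

lemma star_mean_dist:
  assumes "finite X"
  shows "dist (star_mean P T X) p \<le> star P T X p / (1 + real (card X))"
proof -
  let ?m = "1 + real (card X)"
  have "?m *\<^sub>R (star_mean P T X - p) = (T - p) + (\<Sum>k\<in>X. P k - p)"
    by (simp add: star_mean_def scaleR_diff_right sum_subtractf scaleR_add_left algebra_simps sum_constant_scaleR)
  then have "?m * dist (star_mean P T X) p = norm ((T - p) + (\<Sum>k\<in>X. P k - p))"
    unfolding dist_norm by (metis abs_of_nonneg norm_scaleR of_nat_0_le_iff add_nonneg_nonneg zero_le_one)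
  also have "\<dots> \<le> star P T X p"
    unfolding star_def using norm_triangle_ineq[of "T - p"] norm_sum[of "\<lambda>k. P k - p" X]
    by (smt (verit) dist_commute dist_norm sum.cong)
  finally show ?thesis by (simp add: field_simps)
qed

text \<open>The affine image of the unit disc, of area \<open>pi * \<bar>cross u v\<bar>\<close>.
  Since \<open>u\<close> and \<open>v\<close> need not be orthogonal, a cut only changes these two
  vectors.\<close>

definition ellipse :: "point \<Rightarrow> point \<Rightarrow> point \<Rightarrow> point set" where
  "ellipse c u v = {c + a *\<^sub>R u + b *\<^sub>R v |a b. a\<^sup>2 + b\<^sup>2 \<le> 1}"

text \<open>A comparison of areas by determinants. Half the difference of two antipodal points of
  the disc cancels both centres, so \<open>\<rho>\<close> times a unit vector is a combination of
  \<open>u\<close> and \<open>v\<close> with coefficients in the unit disc. For the two coordinate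
  directions, \<open>\<rho>\<^sup>2\<close> is the determinant of the coefficients times
  \<open>cross u v\<close>.\<close>

lemma disc_in_ellipse_area:
  assumes sub: "cball z \<rho> \<subseteq> ellipse c u v" and "\<rho> \<ge> 0"
  shows "\<rho>\<^sup>2 \<le> \<bar>cross u v\<bar>"
proof -
  have half: "\<exists>a b. a\<^sup>2 + b\<^sup>2 \<le> 1 \<and> \<rho> *\<^sub>R w = a *\<^sub>R u + b *\<^sub>R v" if "norm w = 1" for w
  proof -
    have "z + \<rho> *\<^sub>R w \<in> ellipse c u v" "z - \<rho> *\<^sub>R w \<in> ellipse c u v"
      by (rule subsetD[OF sub]; use assms(2) that in \<open>simp add: dist_norm\<close>)+
    then obtain a b a' b' where ab: "a\<^sup>2 + b\<^sup>2 \<le> 1" "z + \<rho> *\<^sub>R w = c + a *\<^sub>R u + b *\<^sub>R v"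
      and ab': "a'\<^sup>2 + b'\<^sup>2 \<le> 1" "z - \<rho> *\<^sub>R w = c + a' *\<^sub>R u + b' *\<^sub>R v"
      unfolding ellipse_def by blast
    have "2 *\<^sub>R (\<rho> *\<^sub>R w) = (z + \<rho> *\<^sub>R w) - (z - \<rho> *\<^sub>R w)" by (simp add: algebra_simps flip: scaleR_2)
    also have "\<dots> = (a - a') *\<^sub>R u + (b - b') *\<^sub>R v" unfolding ab ab' by (simp add: algebra_simps)
    finally have "(1/2) *\<^sub>R (2 *\<^sub>R (\<rho> *\<^sub>R w)) = (1/2) *\<^sub>R ((a - a') *\<^sub>R u + (b - b') *\<^sub>R v)" by simp
    then have "\<rho> *\<^sub>R w = ((a - a') / 2) *\<^sub>R u + ((b - b') / 2) *\<^sub>R v" by (simp add: scaleR_add_right)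
    \<comment> \<open>The parallelogram law: half the difference of two vectors of the unit disc is
      in the unit disc.\<close>
    moreover have "((a - a') / 2)\<^sup>2 + ((b - b') / 2)\<^sup>2 \<le> 1"
    proof -
      define l r where "l = (a - a')\<^sup>2 + (b - b')\<^sup>2" and "r = (a + a')\<^sup>2 + (b + b')\<^sup>2"
      define m m' where "m = a\<^sup>2 + b\<^sup>2" and "m' = a'\<^sup>2 + b'\<^sup>2"
      have "l + r = 2 * m + 2 * m'"
        unfolding m_def m'_def l_def r_def by (simp add: power2_eq_square algebra_simps)
      moreover have "r \<ge> 0" unfolding r_def by simp
      ultimately have "l \<le> 4" using ab(1) ab'(1) unfolding m_def[symmetric] m'_def[symmetric] by linarith
      then have "(a - a')\<^sup>2 + (b - b')\<^sup>2 \<le> 4" unfolding l_def .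
      then show ?thesis by (simp add: power_divide)
    qed
    ultimately show ?thesis by blast
  qed
  obtain a b where ab: "a\<^sup>2 + b\<^sup>2 \<le> 1" "\<rho> *\<^sub>R (1, 0) = a *\<^sub>R u + b *\<^sub>R v"
    using half[of "(1, 0)"] by (auto simp: norm_prod_def)
  obtain a' b' where ab': "a'\<^sup>2 + b'\<^sup>2 \<le> 1" "\<rho> *\<^sub>R (0, 1) = a' *\<^sub>R u + b' *\<^sub>R v"
    using half[of "(0, 1)"] by (auto simp: norm_prod_def)
  have "\<rho>\<^sup>2 = cross (\<rho> *\<^sub>R (1, 0)) (\<rho> *\<^sub>R (0, 1))" by (simp add: cross_def power2_eq_square)
  also have "\<dots> = (a * b' - b * a') * cross u v" unfolding ab ab' by (simp add: cross_def algebra_simps)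
  finally have eq: "\<rho>\<^sup>2 = (a * b' - b * a') * cross u v" .
  \<comment> \<open>Lagrange's identity bounds the determinant of two coefficient vectors of norm at
    most one.\<close>
  have "(a * b' - b * a')\<^sup>2 + (a * a' + b * b')\<^sup>2 = (a\<^sup>2 + b\<^sup>2) * (a'\<^sup>2 + b'\<^sup>2)"
    by (simp add: power2_eq_square algebra_simps)
  moreover have "(a\<^sup>2 + b\<^sup>2) * (a'\<^sup>2 + b'\<^sup>2) \<le> 1 * 1" by (rule mult_mono) (use ab ab' in auto)
  moreover have "(a * a' + b * b')\<^sup>2 \<ge> 0" by simp
  ultimately have "(a * b' - b * a')\<^sup>2 \<le> 1\<^sup>2" unfolding one_power2 by linarith
  then have le: "\<bar>a * b' - b * a'\<bar> \<le> 1" by (simp add: abs_square_le_1)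
  have "\<rho>\<^sup>2 = \<bar>\<rho>\<^sup>2\<bar>" by simp
  also have "\<dots> = \<bar>a * b' - b * a'\<bar> * \<bar>cross u v\<bar>" unfolding eq by (rule abs_mult)
  also have "\<dots> \<le> 1 * \<bar>cross u v\<bar>" by (rule mult_right_mono[OF le]) simp
  finally show ?thesis by simp
qed

text \<open>The cut of the ellipsoid method in the plane. After an affine map the ellipse is the
  unit disc, and the smallest ellipse around a half disc has its centre at distance 1/3, half axis
  2/3 along the cut direction and \<open>2 / sqrt 3\<close> across it. The latter is rounded up to
  the rational 7/6, so that the area shrinks by \<open>2/3 * 7/6 = 7/9\<close>.\<close>

lemma half_ellipse:
  assumes x: "x \<in> ellipse c u v" "g \<bullet> (x - c) < 0"
  defines "h1 \<equiv> u \<bullet> g" and "h2 \<equiv> v \<bullet> g"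
  defines "w \<equiv> sqrt (h1\<^sup>2 + h2\<^sup>2)"
  defines "e1 \<equiv> h1 / w" and "e2 \<equiv> h2 / w"
  defines "c' \<equiv> c - (1/3) *\<^sub>R (e1 *\<^sub>R u + e2 *\<^sub>R v)"
    and "u' \<equiv> (2/3) *\<^sub>R (e1 *\<^sub>R u + e2 *\<^sub>R v)" and "v' \<equiv> (7/6) *\<^sub>R (e1 *\<^sub>R v - e2 *\<^sub>R u)"
  shows "x \<in> ellipse c' u' v'" "cross u' v' = (7/9) * cross u v"
proof -
  obtain a b where ab: "a\<^sup>2 + b\<^sup>2 \<le> 1" "x = c + a *\<^sub>R u + b *\<^sub>R v" using x(1) unfolding ellipse_def by blast
  have neg: "a * h1 + b * h2 < 0"
    using x(2) unfolding ab(2) h1_def h2_def by (simp add: inner_add_right inner_commute)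
  have w0: "w > 0"
  proof -
    have "\<not> (h1 = 0 \<and> h2 = 0)" using neg by auto
    then have "h1\<^sup>2 + h2\<^sup>2 > 0" by (metis sum_power2_gt_zero_iff)
    then show ?thesis unfolding w_def by simp
  qed
  have "w\<^sup>2 = h1\<^sup>2 + h2\<^sup>2" unfolding w_def by simp
  then have e: "e1\<^sup>2 + e2\<^sup>2 = 1" unfolding e1_def e2_def using w0
    by (auto simp: power_divide add_divide_distrib[symmetric])
  \<comment> \<open>The coordinates along the normalised gradient and across it; the cut leaves
    \<open>s < 0\<close>.\<close>
  define s t where "s = a * e1 + b * e2" and "t = b * e1 - a * e2"
  have st: "s\<^sup>2 + t\<^sup>2 = a\<^sup>2 + b\<^sup>2"
  proof -
    have "s\<^sup>2 + t\<^sup>2 = (a\<^sup>2 + b\<^sup>2) * (e1\<^sup>2 + e2\<^sup>2)"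
      unfolding s_def t_def by (simp add: power2_eq_square algebra_simps)
    then show ?thesis using e by simp
  qed
  have "s = (a * h1 + b * h2) / w" unfolding s_def e1_def e2_def by (simp add: add_divide_distrib)
  then have s0: "s < 0" using neg w0 by (simp add: divide_neg_pos)
  have s1: "s \<ge> -1"
  proof -
    have "s\<^sup>2 \<le> 1\<^sup>2" using st ab(1) zero_le_power2[of t] unfolding one_power2 by linarith
    then show ?thesis using abs_le_square_iff[of s 1] by linarith
  qed
  have A: "a = s * e1 - t * e2" "b = s * e2 + t * e1"
  proof -
    have "s * e1 - t * e2 = a * (e1\<^sup>2 + e2\<^sup>2)" unfolding s_def t_def by (simp add: power2_eq_square algebra_simps)
    then show "a = s * e1 - t * e2" using e by simp
    have "s * e2 + t * e1 = b * (e1\<^sup>2 + e2\<^sup>2)" unfolding s_def t_def by (simp add: power2_eq_square algebra_simps)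
    then show "b = s * e2 + t * e1" using e by simp
  qed
  have "x = c' + ((s + 1/3) * (3/2)) *\<^sub>R u' + (t * (6/7)) *\<^sub>R v'"
    unfolding ab(2) c'_def u'_def v'_def A by (simp add: prod_eq_iff field_simps)
  moreover have "((s + 1/3) * (3/2))\<^sup>2 + (t * (6/7))\<^sup>2 \<le> 1"
  proof -
    \<comment> \<open>On the half disc \<open>s\<close> is between -1 and 0, whence
      \<open>s\<^sup>2 \<le> - s\<close>. The resulting bound is tight at \<open>s = -1\<close>,
      where the new ellipse touches the disc.\<close>
    have "s * (s + 1) \<le> 0" using s0 s1 by (simp add: mult_nonpos_nonneg)
    then have "s\<^sup>2 \<le> - s" by (simp add: power2_eq_square algebra_simps)
    moreover have "((s + 1/3) * (3/2))\<^sup>2 + (t * (6/7))\<^sup>2 = (9/4) * s\<^sup>2 + (3/2) * s + 1/4 + (36/49) * t\<^sup>2"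
      by (simp add: power2_eq_square algebra_simps)
    moreover have "t\<^sup>2 \<le> 1 - s\<^sup>2" using st ab(1) by linarith
    moreover have "t\<^sup>2 \<ge> 0" "s\<^sup>2 \<ge> 0" by auto
    ultimately show ?thesis by linarith
  qed
  ultimately show "x \<in> ellipse c' u' v'" unfolding ellipse_def by blast
  have "cross u' v' = (7/9) * (e1\<^sup>2 + e2\<^sup>2) * cross u v"
    unfolding u'_def v'_def cross_def by (simp add: power2_eq_square algebra_simps)
  then show "cross u' v' = (7/9) * cross u v" using e by simp
qed

text \<open>The claim is conditional on a point \<open>p\<close> that still beats
  \<open>best\<close> by more than the factor \<open>1 + \<epsilon>\<close>. For such a
  \<open>p\<close> a whole disc of points within that factor of \<open>p\<close> has survived all
  cuts. Its centre is shifted from \<open>p\<close> towards the centroid, so that the disc fits into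
  the initial one of radius \<open>r\<close>, the mean distance at the centroid. After a cut with
  vanishing gradient no such \<open>p\<close> is left, and the claim is vacuous.\<close>

definition med_inv where
  "med_inv P T X \<epsilon> k best c u v \<longleftrightarrow>
    (let c0 = star_mean P T X; r = star P T X c0 / (1 + real (card X)) in
     best \<le> star P T X c0 \<and>
     (\<forall>p. best > (1 + \<epsilon>) * star P T X p \<longrightarrow>
        cross u v = r\<^sup>2 * (7/9) ^ k \<and>
        cball (p + (\<epsilon>/4) *\<^sub>R (c0 - p)) (\<epsilon>/4 * r) \<subseteq> ellipse c u v))"

text \<open>Points of the target disc are within \<open>\<epsilon>/2 * r\<close> of
  \<open>p\<close>. Moving that far costs at most \<open>\<epsilon>/2\<close> times the cost of the
  centroid, which is at most twice the cost of \<open>p\<close>; together this is the factor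
  \<open>1 + \<epsilon>\<close>.\<close>

lemma med_bad_facts:
  fixes P :: "nat \<Rightarrow> point" and T :: point
  assumes X: "finite X" and \<epsilon>: "0 < \<epsilon>" "\<epsilon> \<le> 1"
  defines "c0 \<equiv> star_mean P T X"
  defines "r \<equiv> star P T X c0 / (1 + real (card X))"
  assumes bad: "star P T X c0 > (1 + \<epsilon>) * star P T X p"
  shows "r > 0" "dist p c0 \<le> r"
    "x \<in> cball (p + (\<epsilon>/4) *\<^sub>R (c0 - p)) (\<epsilon>/4 * r) \<Longrightarrow> star P T X x \<le> (1 + \<epsilon>) * star P T X p"
    "x \<in> cball (p + (\<epsilon>/4) *\<^sub>R (c0 - p)) (\<epsilon>/4 * r) \<Longrightarrow> dist x c0 \<le> r"
proof -
  let ?m = "1 + real (card X)" and ?f = "star P T X"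
  have m: "?m > 0" by (simp add: add_pos_nonneg)
  have fp: "0 \<le> ?f p" "?f p \<le> (1 + \<epsilon>) * ?f p" using star_nonneg \<epsilon> by (auto simp: algebra_simps)
  then have "?f c0 > 0" using bad by linarith
  then show r: "r > 0" unfolding r_def using m by simp
  have d: "dist c0 p \<le> ?f p / ?m" unfolding c0_def by (rule star_mean_dist[OF X])
  also have "\<dots> \<le> r" unfolding r_def using bad fp m by (intro divide_right_mono) auto
  finally show dp: "dist p c0 \<le> r" by (simp add: dist_commute)
  \<comment> \<open>The centroid is within the mean distance at \<open>p\<close> of
    \<open>p\<close>, so moving there at most doubles the cost.\<close>
  have f2: "?f c0 \<le> 2 * ?f p"
  proof -
    have "?m * dist c0 p \<le> ?f p" using d m by (simp add: field_simps)
    then show ?thesis using star_lipschitz[of P T X c0 p] by linarith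
  qed
  assume x: "x \<in> cball (p + (\<epsilon>/4) *\<^sub>R (c0 - p)) (\<epsilon>/4 * r)"
  let ?z = "p + (\<epsilon>/4) *\<^sub>R (c0 - p)"
  have xz: "dist x ?z \<le> \<epsilon>/4 * r" using x by (simp add: dist_commute)
  have "dist ?z p = \<epsilon>/4 * dist p c0" using \<epsilon> by (simp add: dist_norm norm_minus_commute)
  then have zp: "dist ?z p \<le> \<epsilon>/4 * r" using dp \<epsilon> by simp
  have "dist x p \<le> \<epsilon>/2 * r" using dist_triangle[of x p ?z] xz zp by linarith
  then have "?m * dist x p \<le> ?m * (\<epsilon>/2 * r)" using m by (intro mult_left_mono) auto
  also have "\<dots> = \<epsilon>/2 * ?f c0" unfolding r_def using m by (simp add: field_simps)
  also have "\<dots> \<le> \<epsilon>/2 * (2 * ?f p)" using f2 \<epsilon> by (intro mult_left_mono) auto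
  finally show "?f x \<le> (1 + \<epsilon>) * ?f p" using star_lipschitz[of P T X x p] by (simp add: algebra_simps)
  have "?z - c0 = (1 - \<epsilon>/4) *\<^sub>R (p - c0)" by (simp add: algebra_simps)
  then have "dist ?z c0 = (1 - \<epsilon>/4) * dist p c0" using \<epsilon> by (simp add: dist_norm)
  also have "\<dots> \<le> (1 - \<epsilon>/4) * r" using dp \<epsilon> by (intro mult_left_mono) auto
  finally show "dist x c0 \<le> r" using dist_triangle[of x c0 ?z] xz by (simp add: algebra_simps)
qed

lemma med_inv_init:
  fixes P :: "nat \<Rightarrow> point" and T :: point
  assumes X: "finite X" and \<epsilon>: "0 < \<epsilon>" "\<epsilon> \<le> 1"
  defines "c0 \<equiv> star_mean P T X"
  defines "r \<equiv> star P T X c0 / (1 + real (card X))"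
  shows "med_inv P T X \<epsilon> 0 (star P T X c0) c0 (r, 0) (0, r)"
  unfolding med_inv_def Let_def c0_def[symmetric] r_def[symmetric]
proof (intro conjI allI impI)
  fix p assume "(1 + \<epsilon>) * star P T X p < star P T X c0"
  note bad = med_bad_facts[OF X \<epsilon> this[unfolded c0_def], folded c0_def, folded r_def]
  show "cross (r, 0) (0, r) = r\<^sup>2 * (7/9) ^ 0" by (simp add: cross_def power2_eq_square)
  show "cball (p + (\<epsilon>/4) *\<^sub>R (c0 - p)) (\<epsilon>/4 * r) \<subseteq> ellipse c0 (r, 0) (0, r)"
  proof
    fix x assume "x \<in> cball (p + (\<epsilon>/4) *\<^sub>R (c0 - p)) (\<epsilon>/4 * r)"
    then have d: "dist x c0 \<le> r" using bad(4) by blast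
    define a b where "a = fst (x - c0) / r" and "b = snd (x - c0) / r"
    have "x = c0 + a *\<^sub>R (r, 0) + b *\<^sub>R (0, r)" using bad(1) by (simp add: a_def b_def prod_eq_iff)
    moreover have "a\<^sup>2 + b\<^sup>2 \<le> 1"
    proof -
      have "(fst (x - c0))\<^sup>2 + (snd (x - c0))\<^sup>2 = (dist x c0)\<^sup>2"
        by (simp add: dist_norm norm_prod_def)
      also have "\<dots> \<le> r\<^sup>2" using d by (simp add: power_mono)
      finally show ?thesis unfolding a_def b_def using bad(1)
        by (simp add: power_divide add_divide_distrib[symmetric])
    qed
    ultimately show "x \<in> ellipse c0 (r, 0) (0, r)" unfolding ellipse_def by blast
  qed
qed simp

text \<open>All points of the target disc are cheaper than the centre \<open>c\<close> of the
  ellipse, because \<open>c\<close> costs at least \<open>best'\<close>. By the subgradient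
  inequality they lie strictly in the half that is kept.\<close>

lemma med_inv_step:
  fixes P :: "nat \<Rightarrow> point" and T :: point
  assumes X: "finite X" and \<epsilon>: "0 < \<epsilon>" "\<epsilon> \<le> 1" and inv: "med_inv P T X \<epsilon> k best c u v"
    and best': "best' \<le> best" "best' \<le> star P T X c"
  defines "g \<equiv> star_grad P T X c"
  defines "h1 \<equiv> u \<bullet> g" and "h2 \<equiv> v \<bullet> g"
  defines "w \<equiv> sqrt (h1\<^sup>2 + h2\<^sup>2)"
  defines "e1 \<equiv> h1 / w" and "e2 \<equiv> h2 / w"
  shows "med_inv P T X \<epsilon> (Suc k) best' (c - (1/3) *\<^sub>R (e1 *\<^sub>R u + e2 *\<^sub>R v))
    ((2/3) *\<^sub>R (e1 *\<^sub>R u + e2 *\<^sub>R v)) ((7/6) *\<^sub>R (e1 *\<^sub>R v - e2 *\<^sub>R u))"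
proof -
  define c0 where "c0 = star_mean P T X"
  define r where "r = star P T X c0 / (1 + real (card X))"
  note inv' = inv[unfolded med_inv_def Let_def, folded c0_def, folded r_def]
  show ?thesis unfolding med_inv_def Let_def c0_def[symmetric] r_def[symmetric]
  proof (rule conjI, use inv' best' in linarith, intro allI impI)
    fix p assume p: "(1 + \<epsilon>) * star P T X p < best'"
    then have "(1 + \<epsilon>) * star P T X p < star P T X c0" using inv' best' by linarith
    note bad = med_bad_facts[OF X \<epsilon> this[unfolded c0_def], folded c0_def, folded r_def]
    let ?B = "cball (p + (\<epsilon>/4) *\<^sub>R (c0 - p)) (\<epsilon>/4 * r)"
    have old: "cross u v = r\<^sup>2 * (7/9) ^ k" "?B \<subseteq> ellipse c u v"
      using conjunct2[OF inv', rule_format, of p] p best' by linarith+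
    have neg: "g \<bullet> (x - c) < 0" if "x \<in> ?B" for x
      using bad(3)[OF that] p best' star_subgradient[of P T X c x] unfolding g_def by linarith
    note half = half_ellipse[of _ c u v g, folded h1_def h2_def, folded w_def, folded e1_def e2_def]
    \<comment> \<open>The centre of the disc is the witness that the kept half is nonempty, from
      which the factor of the area follows.\<close>
    have "p + (\<epsilon>/4) *\<^sub>R (c0 - p) \<in> ?B" using bad(1) \<epsilon> by simp
    then have "cross ((2/3) *\<^sub>R (e1 *\<^sub>R u + e2 *\<^sub>R v)) ((7/6) *\<^sub>R (e1 *\<^sub>R v - e2 *\<^sub>R u)) = (7/9) * cross u v"
      using half(2) neg old(2) by blast
    moreover have "?B \<subseteq> ellipse (c - (1/3) *\<^sub>R (e1 *\<^sub>R u + e2 *\<^sub>R v))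
        ((2/3) *\<^sub>R (e1 *\<^sub>R u + e2 *\<^sub>R v)) ((7/6) *\<^sub>R (e1 *\<^sub>R v - e2 *\<^sub>R u))"
      using half(1) neg old(2) by blast
    ultimately show "cross ((2/3) *\<^sub>R (e1 *\<^sub>R u + e2 *\<^sub>R v)) ((7/6) *\<^sub>R (e1 *\<^sub>R v - e2 *\<^sub>R u)) = r\<^sup>2 * (7/9) ^ Suc k \<and>
      ?B \<subseteq> ellipse (c - (1/3) *\<^sub>R (e1 *\<^sub>R u + e2 *\<^sub>R v))
        ((2/3) *\<^sub>R (e1 *\<^sub>R u + e2 *\<^sub>R v)) ((7/6) *\<^sub>R (e1 *\<^sub>R v - e2 *\<^sub>R u))"
      using old(1) by simp
  qed
qed

text \<open>The surviving disc has radius \<open>\<epsilon>/4 * r\<close>, but the determinant has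
  dropped to \<open>r\<^sup>2 * (7/9) ^ k\<close>, which is too small to contain it.\<close>

lemma med_inv_final:
  assumes X: "finite X" and \<epsilon>: "0 < \<epsilon>" "\<epsilon> \<le> 1" and inv: "med_inv P T X \<epsilon> k best c u v"
    and k: "(7/9) ^ k < (\<epsilon>/4)\<^sup>2"
  shows "best \<le> (1 + \<epsilon>) * star P T X p"
proof (rule ccontr)
  assume n: "\<not> ?thesis"
  define c0 where "c0 = star_mean P T X"
  define r where "r = star P T X c0 / (1 + real (card X))"
  note inv' = inv[unfolded med_inv_def Let_def, folded c0_def, folded r_def]
  have "(1 + \<epsilon>) * star P T X p < star P T X c0" using inv' n by linarith
  note bad = med_bad_facts[OF X \<epsilon> this[unfolded c0_def], folded c0_def, folded r_def]
  have old: "cross u v = r\<^sup>2 * (7/9) ^ k" "cball (p + (\<epsilon>/4) *\<^sub>R (c0 - p)) (\<epsilon>/4 * r) \<subseteq> ellipse c u v"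
    using conjunct2[OF inv', rule_format, of p] n by linarith+
  have "(\<epsilon>/4 * r)\<^sup>2 \<le> \<bar>cross u v\<bar>"
    by (rule disc_in_ellipse_area[OF old(2)]) (use bad(1) \<epsilon> in auto)
  also have "\<dots> = r\<^sup>2 * (7/9) ^ k" unfolding old(1) by simp
  also have "\<dots> < r\<^sup>2 * (\<epsilon>/4)\<^sup>2" using k bad(1) by (intro mult_strict_left_mono) auto
  finally have "(\<epsilon>/4 * r)\<^sup>2 < r\<^sup>2 * (\<epsilon>/4)\<^sup>2" .
  then show False unfolding power_mult_distrib[of "\<epsilon>/4" r] by simp
qed

subsection \<open>Optimality of the recurrence\<close>

text \<open>For nondecreasing indices these are the runs \<open>{i..<b}\<close>,
  \<open>{c..<d}\<close> and \<open>{e..<f}\<close>. Empty runs and gaps let the same six indices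
  describe clusters with fewer runs.\<close>

definition grp :: "nat \<Rightarrow> nat \<Rightarrow> nat \<Rightarrow> nat \<Rightarrow> nat \<Rightarrow> nat \<Rightarrow> nat set" where
  "grp i b c d e f = {k \<in> {i..<f}. k < b \<or> c \<le> k \<and> k < d \<or> e \<le> k}"

lemma finite_grp [simp]: "finite (grp i b c d e f)"
  by (simp add: grp_def)

lemma maximal_prefix:
  fixes i j :: nat
  assumes "i \<le> j"
  obtains b where "i \<le> b" "b \<le> j" "\<And>k. i \<le> k \<Longrightarrow> k < b \<Longrightarrow> Q k" "b < j \<Longrightarrow> \<not> Q b"
proof -
  have "\<exists>b. i \<le> b \<and> b \<le> j \<and> (\<forall>k. i \<le> k \<and> k < b \<longrightarrow> Q k) \<and> (b < j \<longrightarrow> \<not> Q b)"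
    using assms
  proof (induction j rule: dec_induct)
    case base
    then show ?case by auto
  next
    case (step j)
    then obtain b where b: "i \<le> b" "b \<le> j" "\<forall>k. i \<le> k \<and> k < b \<longrightarrow> Q k" "b < j \<longrightarrow> \<not> Q b" by blast
    show ?case
    proof (cases "b = j \<and> Q j")
      case True
      then show ?thesis using b by (intro exI[of _ "Suc j"]) (auto simp: less_Suc_eq)
    next
      case False
      then show ?thesis using b by (intro exI[of _ b]) auto
    qed
  qed
  then show thesis using that by blast
qed

text \<open>A hub pays for its edge to the sink once, hence the sum over the image of
  \<open>\<psi>\<close>.\<close>

definition label_cost :: "(nat \<Rightarrow> point) \<Rightarrow> point \<Rightarrow> (nat \<Rightarrow> point) \<Rightarrow> nat \<Rightarrow> nat \<Rightarrow> real" where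
  "label_cost P T \<psi> i j = (\<Sum>f\<in>\<psi> ` {i..<j}. dist f T) + (\<Sum>k\<in>{i..<j}. dist (\<psi> k) (P k))"

text \<open>Pure combinatorics: tables obeying the inequalities of the recurrence stay below
  \<open>\<rho>\<close> times the cost of any noncrossing labelling with at most three runs per
  label. The cluster of position \<open>i\<close> is split off. Its two gaps and the tail behind it
  have pairwise disjoint sets of labels, so the cost is additive and induction on the length
  applies.\<close>

lemma dp_le_label_cost:
  fixes A B :: "nat \<Rightarrow> nat \<Rightarrow> real" and P \<psi> :: "nat \<Rightarrow> point"
  assumes A0: "\<And>i. lo \<le> i \<Longrightarrow> i \<le> hi \<Longrightarrow> A i i = 0"
    and AB: "\<And>i f j. lo \<le> i \<Longrightarrow> i < f \<Longrightarrow> f \<le> j \<Longrightarrow> j \<le> hi \<Longrightarrow> A i j \<le> B i f + A f j"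
    and Bopt: "\<And>i b c d e f p. lo \<le> i \<Longrightarrow> i < b \<Longrightarrow> b \<le> c \<Longrightarrow> c \<le> d \<Longrightarrow> d \<le> e \<Longrightarrow> e \<le> f \<Longrightarrow> f \<le> hi \<Longrightarrow>
      B i f \<le> \<rho> * star P T (grp i b c d e f) p + A b c + A d e"
    and \<rho>: "\<rho> \<ge> 0"
    and nc: "\<And>x1 x2 x3 x4. lo \<le> x1 \<Longrightarrow> x1 < x2 \<Longrightarrow> x2 < x3 \<Longrightarrow> x3 < x4 \<Longrightarrow> x4 < hi \<Longrightarrow>
      \<psi> x1 = \<psi> x3 \<Longrightarrow> \<psi> x2 = \<psi> x4 \<Longrightarrow> \<psi> x1 = \<psi> x2"
    and runs: "\<And>x1 x2 x3 x4 x5 x6 x7. lo \<le> x1 \<Longrightarrow> x1 < x2 \<Longrightarrow> x2 < x3 \<Longrightarrow> x3 < x4 \<Longrightarrow> x4 < x5 \<Longrightarrow>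
      x5 < x6 \<Longrightarrow> x6 < x7 \<Longrightarrow> x7 < hi \<Longrightarrow> \<psi> x3 = \<psi> x1 \<Longrightarrow> \<psi> x5 = \<psi> x1 \<Longrightarrow> \<psi> x7 = \<psi> x1 \<Longrightarrow>
      \<psi> x2 \<noteq> \<psi> x1 \<Longrightarrow> \<psi> x4 \<noteq> \<psi> x1 \<Longrightarrow> \<psi> x6 \<noteq> \<psi> x1 \<Longrightarrow> False"
    and ij: "lo \<le> i" "i \<le> j" "j \<le> hi"
  shows "A i j \<le> \<rho> * label_cost P T \<psi> i j"
  using ij
proof (induction "j - i" arbitrary: i j rule: less_induct)
  case less
  show ?case
  proof (cases "i = j")
    case True
    then show ?thesis using A0[of i] less.prems by (simp add: label_cost_def)
  next
    case False
    then have ij: "i < j" using less.prems by simp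
    define h where "h = \<psi> i"
    \<comment> \<open>Starting at \<open>Suc i\<close> keeps the first run nonempty. As soon as one
      of the following ends reaches \<open>j\<close>, all later runs and gaps are empty.\<close>
    obtain b where b: "Suc i \<le> b" "b \<le> j" "\<And>k. Suc i \<le> k \<Longrightarrow> k < b \<Longrightarrow> \<psi> k = h" "b < j \<Longrightarrow> \<psi> b \<noteq> h"
      using maximal_prefix[of "Suc i" j "\<lambda>k. \<psi> k = h"] ij by (metis Suc_leI)
    obtain c where c: "b \<le> c" "c \<le> j" "\<And>k. b \<le> k \<Longrightarrow> k < c \<Longrightarrow> \<psi> k \<noteq> h" "c < j \<Longrightarrow> \<psi> c = h"
      using maximal_prefix[of b j "\<lambda>k. \<psi> k \<noteq> h"] b(2) by metis
    obtain d where d: "c \<le> d" "d \<le> j" "\<And>k. c \<le> k \<Longrightarrow> k < d \<Longrightarrow> \<psi> k = h" "d < j \<Longrightarrow> \<psi> d \<noteq> h"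
      using maximal_prefix[of c j "\<lambda>k. \<psi> k = h"] c(2) by metis
    obtain e where e: "d \<le> e" "e \<le> j" "\<And>k. d \<le> k \<Longrightarrow> k < e \<Longrightarrow> \<psi> k \<noteq> h" "e < j \<Longrightarrow> \<psi> e = h"
      using maximal_prefix[of d j "\<lambda>k. \<psi> k \<noteq> h"] d(2) by metis
    obtain f where f: "e \<le> f" "f \<le> j" "\<And>k. e \<le> k \<Longrightarrow> k < f \<Longrightarrow> \<psi> k = h" "f < j \<Longrightarrow> \<psi> f \<noteq> h"
      using maximal_prefix[of e j "\<lambda>k. \<psi> k = h"] e(2) by metis
    have cd: "c < d" if "c < j" using d c(4) that by (metis le_neq_implies_less)
    have ef: "e < f" if "e < j" using f e(4) that by (metis le_neq_implies_less)
    have bc: "b < c" if "b < j" using c b(4) that by (metis le_neq_implies_less)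
    have de: "d < e" if "d < j" using e d(4) that by (metis le_neq_implies_less)
    \<comment> \<open>A further occurrence of \<open>h\<close> behind \<open>f\<close> would belong
      to a fourth run.\<close>
    have tail: "\<psi> k \<noteq> h" if k: "f \<le> k" "k < j" for k
    proof
      assume h: "\<psi> k = h"
      have lt: "f < j" "e < j" "d < j" "c < j" "b < j" using k f e d c b by linarith+
      have fk: "f < k" using k h f(4)[OF lt(1)] by (cases "f = k") auto
      have o: "i < b" "b < c" "c < d" "d < e" "e < f" using b(1) bc cd de ef lt by simp_all
      have l: "\<psi> c = \<psi> i" "\<psi> e = \<psi> i" "\<psi> k = \<psi> i" "\<psi> b \<noteq> \<psi> i" "\<psi> d \<noteq> \<psi> i" "\<psi> f \<noteq> \<psi> i"
        using c(4) e(4) h b(4) d(4) f(4) lt unfolding h_def by simp_all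
      have "k < hi" using k less.prems by simp
      from runs[OF less.prems(1) o fk this l] show False .
    qed
    let ?G = "grp i b c d e f"
    have G: "\<psi> k = h" if "k \<in> ?G" for k
      using that b(3) d(3) f(3) unfolding grp_def by (cases "k = i") (auto simp: h_def)
    have Ge: "?G = {i..<b} \<union> {c..<d} \<union> {e..<f}"
      using b(1) c(1) d(1) e(1) f(1) unfolding grp_def by (intro set_eqI iffI; simp; linarith)
    have split: "{i..<j} = ?G \<union> {b..<c} \<union> {d..<e} \<union> {f..<j}"
    proof -
      have "{i..<j} = {i..<b} \<union> {b..<c} \<union> {c..<d} \<union> {d..<e} \<union> {e..<f} \<union> {f..<j}"
        using b(1) c(1) d(1) e(1) f(1,2) by (simp add: ivl_disj_un_two(3))
      then show ?thesis unfolding Ge by blast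
    qed
    have disj: "?G \<inter> {b..<c} = {}" "(?G \<union> {b..<c}) \<inter> {d..<e} = {}" "(?G \<union> {b..<c} \<union> {d..<e}) \<inter> {f..<j} = {}"
      unfolding Ge using b(1) c(1) d(1) e(1) f(1) by (simp_all add: Int_Un_distrib2)
    have sum_split: "(\<Sum>k\<in>{i..<j}. w k) = (\<Sum>k\<in>?G. w k) + (\<Sum>k\<in>{b..<c}. w k) + (\<Sum>k\<in>{d..<e}. w k) + (\<Sum>k\<in>{f..<j}. w k)"
      for w :: "nat \<Rightarrow> real"
      unfolding split using disj by (simp add: sum.union_disjoint)
    \<comment> \<open>Different parts are separated by a position \<open>m\<close> labelled
      \<open>h\<close>. With \<open>i\<close> in front, a label shared by two parts would create the
      forbidden alternation of two labels.\<close>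
    have crossing: "\<psi> x \<noteq> \<psi> y" if xy: "b \<le> x" "x < c \<and> c \<le> y \<or> x < e \<and> e \<le> y" "y < j"
      "\<psi> x \<noteq> h" "\<psi> y \<noteq> h" for x y
    proof
      assume eq: "\<psi> x = \<psi> y"
      obtain m where m: "\<psi> m = h" "x < m" "m < y"
      proof (cases "x < c \<and> c \<le> y")
        case True
        then have "\<psi> c = h" using c(4) xy by simp
        then show thesis using that[of c] True xy by (metis le_neq_implies_less)
      next
        case False
        then have "x < e \<and> e \<le> y" using xy by blast
        then have "\<psi> e = h" using e(4) xy by simp
        then show thesis using that[of e] \<open>x < e \<and> e \<le> y\<close> xy by (metis le_neq_implies_less)
      qed
      have "i < x" "y < hi" using b(1) xy(1,3) less.prems by simp_all
      then have "\<psi> i = \<psi> x" using nc[OF less.prems(1) _ m(2,3) _ _ eq] m(1) by (simp add: h_def)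
      then show False using xy(4) by (simp add: h_def)
    qed
    have img: "\<psi> ` {i..<j} = insert h (\<psi> ` {b..<c} \<union> \<psi> ` {d..<e} \<union> \<psi> ` {f..<j})"
    proof -
      have "i \<in> ?G" using b(1) c(1) d(1) e(1) f(1) unfolding grp_def by simp
      then have "\<psi> ` ?G = {h}" using G by blast
      then show ?thesis unfolding split image_Un by auto
    qed
    have ne: "\<psi> k \<noteq> h" if "k \<in> {b..<c} \<union> {d..<e} \<union> {f..<j}" for k using that c(3) e(3) tail by auto
    have i1: "\<psi> ` {b..<c} \<inter> \<psi> ` {d..<e} = {}"
      
    proof -
      have "\<psi> x \<noteq> \<psi> y" if "x \<in> {b..<c}" "y \<in> {d..<e}" for x y
        by (rule crossing) (use that ne d(1) e(2) in auto)
      then show ?thesis by blast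
    qed
    have i2: "(\<psi> ` {b..<c} \<union> \<psi> ` {d..<e}) \<inter> \<psi> ` {f..<j} = {}"
    proof -
      have "\<psi> x \<noteq> \<psi> y" if "x \<in> {b..<c} \<union> {d..<e}" "y \<in> {f..<j}" for x y
        by (rule crossing) (use that ne d(1) e(1) c(1) f(1) in auto)
      then show ?thesis by blast
    qed
    have hsum: "(\<Sum>f\<in>\<psi> ` {i..<j}. dist f T) = dist h T + (\<Sum>f\<in>\<psi> ` {b..<c}. dist f T)
        + (\<Sum>f\<in>\<psi> ` {d..<e}. dist f T) + (\<Sum>f\<in>\<psi> ` {f..<j}. dist f T)"
    proof -
      have "h \<notin> \<psi> ` {b..<c} \<union> \<psi> ` {d..<e} \<union> \<psi> ` {f..<j}" using ne by blast
      then show ?thesis unfolding img using i1 i2 by (simp add: sum.union_disjoint)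
    qed
    have "label_cost P T \<psi> i j = star P T ?G h + label_cost P T \<psi> b c + label_cost P T \<psi> d e + label_cost P T \<psi> f j"
      unfolding label_cost_def hsum sum_split star_def using G by simp
    then have eq: "\<rho> * label_cost P T \<psi> i j = \<rho> * star P T ?G h + \<rho> * label_cost P T \<psi> b c
        + \<rho> * label_cost P T \<psi> d e + \<rho> * label_cost P T \<psi> f j"
      by (simp add: algebra_simps)
    have "A i j \<le> B i f + A f j" using less.prems f(1,2) e(1,2) d(1,2) c(1,2) b(1,2) by (intro AB) auto
    also have "B i f \<le> \<rho> * star P T ?G h + A b c + A d e"
      using less.prems f(1,2) e(1,2) d(1,2) c(1,2) b(1,2) by (intro Bopt) auto
    finally have "A i j \<le> \<rho> * star P T ?G h + A b c + A d e + A f j" by simp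
    moreover have "A b c \<le> \<rho> * label_cost P T \<psi> b c" using less.prems f(1,2) e(1,2) d(1,2) c(1,2) b(1,2) by (intro less.hyps) auto
    moreover have "A d e \<le> \<rho> * label_cost P T \<psi> d e" using less.prems f(1,2) e(1,2) d(1,2) c(1,2) b(1,2) by (intro less.hyps) auto
    moreover have "A f j \<le> \<rho> * label_cost P T \<psi> f j" using less.prems f(1,2) e(1,2) d(1,2) c(1,2) b(1,2) by (intro less.hyps) auto
    ultimately show ?thesis unfolding eq by linarith
  qed
qed

text \<open>The window is cut where the label changes, unless the labelling is constant. Then four
  linear runs of a label are also four cyclic runs, which the planar bound excludes.\<close>

lemma cyclic_dp_le:
  fixes A B :: "nat \<Rightarrow> nat \<Rightarrow> real" and P \<psi> :: "nat \<Rightarrow> point"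
  assumes n: "n \<ge> 1"
    and A0: "\<And>i. i \<le> 2 * n \<Longrightarrow> A i i = 0"
    and AB: "\<And>i f j. i < f \<Longrightarrow> f \<le> j \<Longrightarrow> j \<le> i + n \<Longrightarrow> j \<le> 2 * n \<Longrightarrow> A i j \<le> B i f + A f j"
    and Bopt: "\<And>i b c d e f p. i < b \<Longrightarrow> b \<le> c \<Longrightarrow> c \<le> d \<Longrightarrow> d \<le> e \<Longrightarrow> e \<le> f \<Longrightarrow> f \<le> i + n \<Longrightarrow> f \<le> 2 * n \<Longrightarrow>
      B i f \<le> \<rho> * star P T (grp i b c d e f) p + A b c + A d e"
    and \<rho>: "\<rho> \<ge> 0"
    and sep: "\<And>x1 x2 x3 x4. x1 < x2 \<Longrightarrow> x2 < x3 \<Longrightarrow> x3 < x4 \<Longrightarrow> x4 < x1 + n \<Longrightarrow>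
      separates H (P x1) (P x3) (P x2) (P x4)"
    and per: "\<And>k. P (k + n) = P k" "\<And>k. \<psi> (k + n) = \<psi> k" and F: "F \<subseteq> H"
    and near: "\<And>k. nearest F (P k) (\<psi> k)"
  obtains c where "c < n" "A c (c + n) \<le> \<rho> * label_cost P T \<psi> c (c + n)"
proof -
  \<comment> \<open>\<open>c + n - 1\<close> is the cyclic predecessor of \<open>c\<close>; if no
    position differs from its predecessor, there is only one label.\<close>
  obtain c where c: "c < n" "\<psi> c \<noteq> \<psi> (c + n - 1) \<or> (\<forall>k<n. \<psi> k = \<psi> 0)"
  proof (cases "\<exists>c<n. \<psi> c \<noteq> \<psi> (c + n - 1)")
    case False
    have "\<psi> k = \<psi> 0" if "k < n" for k
      using that
    proof (induction k)
      case (Suc k)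
      have "\<psi> (Suc k) = \<psi> (Suc k + n - 1)" using False Suc.prems by blast
      also have "Suc k + n - 1 = k + n" by simp
      finally show ?case using Suc per by simp
    qed simp
    then have "\<forall>k<n. \<psi> k = \<psi> 0" by blast
    then show thesis by (intro that[of 0]) (use n in linarith, blast)
  qed (use that in blast)
  have "A c (c + n) \<le> \<rho> * label_cost P T \<psi> c (c + n)"
  proof (rule dp_le_label_cost[where lo = c and hi = "c + n" and B = B])
    fix x1 x2 x3 x4 assume x: "c \<le> x1" "x1 < x2" "x2 < x3" "x3 < x4" "x4 < c + n"
      and eq: "\<psi> x1 = \<psi> x3" "\<psi> x2 = \<psi> x4"
    have "separates H (P x1) (P x3) (P x2) (P x4)" using x by (intro sep) auto
    then show "\<psi> x1 = \<psi> x2"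
      using nearest_noncrossing[OF _ F near _ near, of x1 "P x3" x2 "P x4"] near[of x3] near[of x4] eq by simp
  next
    fix x1 x2 x3 x4 x5 x6 x7
    assume x: "c \<le> x1" "x1 < x2" "x2 < x3" "x3 < x4" "x4 < x5" "x5 < x6" "x6 < x7" "x7 < c + n"
      and eq: "\<psi> x3 = \<psi> x1" "\<psi> x5 = \<psi> x1" "\<psi> x7 = \<psi> x1"
      and ne: "\<psi> x2 \<noteq> \<psi> x1" "\<psi> x4 \<noteq> \<psi> x1" "\<psi> x6 \<noteq> \<psi> x1"
    have ncons: "\<not> (\<forall>k<n. \<psi> k = \<psi> 0)"
    proof
      assume *: "\<forall>k<n. \<psi> k = \<psi> 0"
      have "\<psi> k = \<psi> 0" if "k < n + n" for k
      proof (cases "k < n")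
        case False
        then have "\<psi> k = \<psi> (k - n)" using per(2)[of "k - n"] by simp
        moreover have "k - n < n" using that False by linarith
        ultimately show ?thesis using * by metis
      qed (use * in blast)
      moreover have "x1 < n + n" "x2 < n + n" using x c(1) by linarith+
      ultimately have "\<psi> x1 = \<psi> 0" "\<psi> x2 = \<psi> 0" by blast+
      then show False using ne(1) by simp
    qed
    \<comment> \<open>A position of another label between the fourth run and the return to
      \<open>x1\<close>: the last one of the window or, if that carries the label, the first one a
      turn later, whose label is different by the choice of \<open>c\<close>.\<close>
    obtain x8 where x8: "x7 < x8" "x8 < x1 + n" "\<psi> x8 \<noteq> \<psi> x1"
    proof (cases "\<psi> (c + n - 1) = \<psi> x1")
      case True
      then have "\<psi> c \<noteq> \<psi> x1" using c ncons by auto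
      then have "c \<noteq> x1" "\<psi> (c + n) \<noteq> \<psi> x1" using per by auto
      then show thesis using that[of "c + n"] x by simp
    next
      case False
      have "x7 \<noteq> c + n - 1" using False eq(3) by auto
      then show thesis using that[of "c + n - 1"] x False by linarith
    qed
    define a where "a = (\<lambda>i::nat. if i = 0 then x1 else if i = 1 then x3 else if i = 2 then x5 else if i = 3 then x7 else x1 + n)"
    define b where "b = (\<lambda>i::nat. if i = 0 then x2 else if i = 1 then x4 else if i = 2 then x6 else x8)"
    show False
    proof (rule nearest_at_most_three_runs[where P = P and \<psi> = \<psi> and n = n and H = H and F = F and f = "\<psi> x1" and a = a and b = b])
      fix i :: nat assume i: "i < 4"
      then have "i = 0 \<or> i = 1 \<or> i = 2 \<or> i = 3" by linarith
      then show "a i < b i" "b i < a (Suc i)" "\<psi> (b i) \<noteq> \<psi> x1"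
        using x x8 ne by (elim disjE; simp add: a_def b_def)+
    next
      fix i :: nat assume "i \<le> 4" then show "\<psi> (a i) = \<psi> x1" using eq per by (auto simp: a_def)
    qed (use sep per F near in \<open>auto simp: a_def\<close>)
  qed (use A0 AB Bopt \<rho> c in auto)
  then show thesis using that c by blast
qed

section \<open>From layouts to sets of hubs and back\<close>

text \<open>In a forest of height two the parent of a source is the sink or a vertex directly below
  the sink. Keeping only the edges on paths from sources to the sink cannot increase the
  cost.\<close>

lemma layout_hubs:
  assumes L: "is_layout I L" and I: "sources I = {..<n}" "sinks I = {n}" "layers I = 1" "alpha I = 0"
  obtains h where "\<And>s. s < n \<Longrightarrow> h s \<noteq> n \<Longrightarrow> h s > n"
    "(\<Sum>s<n. dist (loc I s) (if h s = n then loc I n else emb L (h s))) +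
     (\<Sum>u\<in>h ` {..<n} - {n}. dist (emb L u) (loc I n)) \<le> cost I L"
proof -
  note L' = L[unfolded is_layout_def rooted_forest_def I]
  have fin: "finite (verts L)" and E: "edges L \<subseteq> verts L \<times> verts L"
    and lv: "leaves L = {..<n}" and rt: "roots L = verts L \<inter> {n}" using L' by blast+
  have "height_at_most L 2" using L' by (simp add: numeral_2_eq_2)
  then have ht: "\<And>k u v. (u, v) \<in> edges L ^^ k \<Longrightarrow> k \<le> 2" unfolding height_at_most_def by blast
  have em: "emb L v = loc I v" if "v \<in> verts L" "v \<le> n" for v
  proof -
    have "v \<in> verts L \<inter> ({..<n} \<union> {n})" using that by auto
    then show ?thesis using L' by blast
  qed
  have finE: "finite (edges L)" using finite_subset[OF E] fin by simp
  have sv: "s \<in> verts L" if "s < n" for s using lv that by (auto simp: leaves_def)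
  have par: "\<exists>v. (u, v) \<in> edges L" if "u \<in> verts L" "u \<noteq> n" for u
  proof -
    have "u \<notin> roots L" using rt that by auto
    then show ?thesis using that by (auto simp: roots_def edges_def)
  qed
  have "\<forall>s. \<exists>v. s < n \<longrightarrow> (s, v) \<in> edges L" using par sv by blast
  from choice[OF this] obtain h where h: "\<And>s. s < n \<Longrightarrow> (s, h s) \<in> edges L" by blast
  have hv: "h s \<in> verts L" if "s < n" for s using h[OF that] E by auto
  have nl: "\<not> v < n" if "(u, v) \<in> edges L" for u v
  proof
    assume "v < n"
    then have "v \<in> leaves L" using lv by auto
    then show False using that by (auto simp: leaves_def)
  qed
  have hgt: "h s > n" if "s < n" "h s \<noteq> n" for s using nl[OF h[OF that(1)]] that by simp
  have hn: "(h s, n) \<in> edges L" if s: "s < n" "h s \<noteq> n" for s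
  proof -
    obtain w where w: "(h s, w) \<in> edges L" using par[OF hv] s by blast
    show ?thesis
    proof (cases "w = n")
      case False
      have "w \<in> verts L" using w E by auto
      then obtain x where x: "(w, x) \<in> edges L" using par False by blast
      have "(s, x) \<in> edges L ^^ 3" using h[OF s(1)] w x by (auto simp: numeral_3_eq_3)
      then show ?thesis using ht by fastforce
    qed (use w in simp)
  qed
  \<comment> \<open>A positive load makes its power with exponent zero equal to one, so that edges
    cost their length.\<close>
  have ld: "load I L u \<ge> 1" if "s < n" "(s, u) \<in> (edges L)\<^sup>*" for s u
  proof -
    have "{s \<in> sources I. (s, u) \<in> (edges L)\<^sup>*} \<noteq> {}" using that I by auto
    moreover have "finite {s \<in> sources I. (s, u) \<in> (edges L)\<^sup>*}" using I by simp
    ultimately have "card {s \<in> sources I. (s, u) \<in> (edges L)\<^sup>*} \<noteq> 0" by simp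
    then show ?thesis unfolding load_def by linarith
  qed
  define w where "w = (\<lambda>(u, v). norm (emb L u - emb L v) * real (load I L u) powr alpha I)"
  let ?E1 = "(\<lambda>s. (s, h s)) ` {..<n}" and ?E2 = "(\<lambda>u. (u, n)) ` (h ` {..<n} - {n})"
  have sub: "?E1 \<union> ?E2 \<subseteq> edges L" using h hn by auto
  have dj: "?E1 \<inter> ?E2 = {}" using nl h by fastforce
  have "(\<Sum>x\<in>?E1 \<union> ?E2. w x) \<le> (\<Sum>x\<in>edges L. w x)"
    by (rule sum_mono2[OF finE sub]) (auto simp: w_def)
  also have "\<dots> = cost I L" unfolding cost_def w_def by (simp add: case_prod_unfold)
  also have "(\<Sum>x\<in>?E1 \<union> ?E2. w x) = (\<Sum>x\<in>?E1. w x) + (\<Sum>x\<in>?E2. w x)"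
    by (rule sum.union_disjoint) (use dj in auto)
  also have "(\<Sum>x\<in>?E1. w x) = (\<Sum>s<n. w (s, h s))" by (subst sum.reindex) (auto simp: inj_on_def)
  also have "\<dots> = (\<Sum>s<n. dist (loc I s) (if h s = n then loc I n else emb L (h s)))"
  proof (rule sum.cong[OF refl])
    fix s assume "s \<in> {..<n}"
    then have s: "s < n" by simp
    have "load I L s \<ge> 1" using ld[of s s] s by simp
    then have "w (s, h s) = norm (emb L s - emb L (h s))" by (simp add: w_def I)
    also have "emb L s = loc I s" using em sv[OF s] s by simp
    also have "emb L (h s) = (if h s = n then loc I n else emb L (h s))"
      using em[OF hv[OF s]] by auto
    finally show "w (s, h s) = dist (loc I s) (if h s = n then loc I n else emb L (h s))"
      by (simp add: dist_norm)
  qed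
  also have "(\<Sum>x\<in>?E2. w x) = (\<Sum>u\<in>h ` {..<n} - {n}. w (u, n))" by (subst sum.reindex) (auto simp: inj_on_def)
  also have "\<dots> = (\<Sum>u\<in>h ` {..<n} - {n}. dist (emb L u) (loc I n))"
  proof (rule sum.cong[OF refl])
    fix u assume "u \<in> h ` {..<n} - {n}"
    then obtain s where s: "s < n" "u = h s" "u \<noteq> n" by auto
    have "load I L u \<ge> 1" using ld[of s u] h[OF s(1)] s by auto
    moreover have "n \<in> verts L" using hn[of s] s E by auto
    ultimately show "w (u, n) = dist (emb L u) (loc I n)" using em[of n] by (simp add: w_def I dist_norm)
  qed
  finally show thesis using that[of h] hgt by blast
qed

text \<open>The closest point map of the hull is nonexpansive and fixes the hull, so projecting hubs
  lengthens no edge to a terminal. The sink position is in \<open>F\<close> for the sources attached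
  directly to the sink; as a hub its own edge has length zero.\<close>

lemma layout_nearest_hubs:
  assumes L: "is_layout I L" and I: "sources I = {..<n}" "sinks I = {n}" "layers I = 1" "alpha I = 0"
  defines "H \<equiv> convex hull (loc I ` {..n})"
  obtains F where "finite F" "F \<noteq> {}" "F \<subseteq> H"
    "\<And>\<phi>. (\<And>s. s < n \<Longrightarrow> nearest F (loc I s) (\<phi> s)) \<Longrightarrow>
      (\<Sum>f\<in>\<phi> ` {..<n}. dist f (loc I n)) + (\<Sum>s<n. dist (\<phi> s) (loc I s)) \<le> cost I L"
proof -
  obtain h where h: "\<And>s. s < n \<Longrightarrow> h s \<noteq> n \<Longrightarrow> h s > n"
    and hc: "(\<Sum>s<n. dist (loc I s) (if h s = n then loc I n else emb L (h s))) +
     (\<Sum>u\<in>h ` {..<n} - {n}. dist (emb L u) (loc I n)) \<le> cost I L"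
    using layout_hubs[OF assms(1-5)] by blast
  let ?T = "loc I n"
  have H: "closed H" "convex H" "H \<noteq> {}"
    unfolding H_def by (auto intro!: compact_imp_closed finite_imp_compact_convex_hull)
  have inH: "loc I s \<in> H" if "s \<le> n" for s unfolding H_def using that by (intro hull_inc) auto
  define \<pi> where "\<pi> = closest_point H"
  have lip: "dist (\<pi> x) y \<le> dist x y" if "y \<in> H" for x y
    using closest_point_lipschitz[OF H(2,1,3), of x y] closest_point_self[OF that] by (simp add: \<pi>_def)
  define U where "U = h ` {..<n} - {n}"
  define F where "F = insert ?T ((\<lambda>u. \<pi> (emb L u)) ` U)"
  have U: "finite U" by (simp add: U_def)
  show thesis
  proof
    show "finite F" "F \<noteq> {}" using U by (auto simp: F_def)
    have "\<pi> x \<in> H" for x unfolding \<pi>_def by (rule closest_point_in_set[OF H(1,3)])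
    then show "F \<subseteq> H" unfolding F_def using inH[of n] by blast
    fix \<phi> assume near: "\<And>s. s < n \<Longrightarrow> nearest F (loc I s) (\<phi> s)"
    have sub: "\<phi> ` {..<n} \<subseteq> F" using near by (auto simp: nearest_def)
    have "(\<Sum>f\<in>\<phi> ` {..<n}. dist f ?T) \<le> (\<Sum>f\<in>F. dist f ?T)"
      by (rule sum_mono2[OF _ sub]) (use U in \<open>auto simp: F_def\<close>)
    also have "\<dots> \<le> (\<Sum>f\<in>(\<lambda>u. \<pi> (emb L u)) ` U. dist f ?T)"
      unfolding F_def using U by (cases "?T \<in> (\<lambda>u. \<pi> (emb L u)) ` U") (auto simp: insert_absorb)
    \<comment> \<open>Several hubs may be projected to the same point, which then pays only
      once.\<close>
    also have "\<dots> \<le> (\<Sum>u\<in>U. dist (\<pi> (emb L u)) ?T)"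
      using sum_image_le[OF U, of "\<lambda>f. dist f ?T" "\<lambda>u. \<pi> (emb L u)"] by simp
    also have "\<dots> \<le> (\<Sum>u\<in>U. dist (emb L u) ?T)" by (intro sum_mono lip inH) simp
    finally have 1: "(\<Sum>f\<in>\<phi> ` {..<n}. dist f ?T) \<le> (\<Sum>u\<in>U. dist (emb L u) ?T)" .
    have 2: "(\<Sum>s<n. dist (\<phi> s) (loc I s)) \<le> (\<Sum>s<n. dist (loc I s) (if h s = n then ?T else emb L (h s)))"
    proof (rule sum_mono)
      fix s assume "s \<in> {..<n}"
      then have s: "s < n" by simp
      show "dist (\<phi> s) (loc I s) \<le> dist (loc I s) (if h s = n then ?T else emb L (h s))"
      proof (cases "h s = n")
        case True
        have "dist (loc I s) (\<phi> s) \<le> dist (loc I s) ?T" by (rule nearest_le[OF near[OF s]]) (simp add: F_def)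
        then show ?thesis using True by (simp add: dist_commute)
      next
        case False
        have "dist (loc I s) (\<phi> s) \<le> dist (loc I s) (\<pi> (emb L (h s)))"
          by (rule nearest_le[OF near[OF s]]) (use s False in \<open>auto simp: F_def U_def\<close>)
        also have "\<dots> \<le> dist (loc I s) (emb L (h s))"
          using lip[OF inH, of s "emb L (h s)"] s by (simp add: dist_commute)
        finally show ?thesis using False by (simp add: dist_commute)
      qed
    qed
    show "(\<Sum>f\<in>\<phi> ` {..<n}. dist f ?T) + (\<Sum>s<n. dist (\<phi> s) (loc I s)) \<le> cost I L"
      using 1 2 hc unfolding U_def by linarith
  qed
qed


text \<open>Relative to a supporting functional at the centroid, the points have nonnegative
  excesses with mean zero, so all of them lie on the supporting line. Hence the centroid is a
  computable centre for the angular order unless the hull is flat.\<close>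

lemma centroid_interior_or_flat:
  fixes p :: "nat \<Rightarrow> 'a::euclidean_space" and n :: nat
  defines "H \<equiv> convex hull (p ` {..n})" and "o' \<equiv> (1 / real (n + 1)) *\<^sub>R (\<Sum>v\<le>n. p v)"
  shows "o' \<in> H" "o' \<in> interior H \<or> (\<exists>a b. a \<noteq> 0 \<and> H \<subseteq> {x. a \<bullet> x = b})"
proof -
  have inH: "p v \<in> H" if "v \<le> n" for v unfolding H_def using that by (intro hull_inc) auto
  have "(\<Sum>v\<in>{..n}. (1 / real (n + 1)) *\<^sub>R p v) \<in> H"
    by (rule convex_sum) (auto simp: H_def intro!: hull_inc)
  then show oH: "o' \<in> H" unfolding o'_def by (simp add: scaleR_sum_right)
  show "o' \<in> interior H \<or> (\<exists>a b. a \<noteq> 0 \<and> H \<subseteq> {x. a \<bullet> x = b})"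
  proof (rule disjCI)
    assume nf: "\<nexists>a b. a \<noteq> 0 \<and> H \<subseteq> {x. a \<bullet> x = b}"
    show "o' \<in> interior H"
    proof (rule ccontr)
      assume "o' \<notin> interior H"
      then obtain a where a: "a \<noteq> 0" "\<And>y. y \<in> H \<Longrightarrow> a \<bullet> o' \<le> a \<bullet> y"
        using boundary_supporting[OF _ oH] unfolding H_def by (metis convex_convex_hull)
      have "(\<Sum>v\<le>n. a \<bullet> p v - a \<bullet> o') = a \<bullet> (\<Sum>v\<le>n. p v) - real (n + 1) * (a \<bullet> o')"
        by (simp add: sum_subtractf inner_sum_right algebra_simps)
      also have "\<dots> = 0" unfolding o'_def by simp
      finally have "\<forall>v\<in>{..n}. a \<bullet> p v - a \<bullet> o' = 0"
        by (subst (asm) sum_nonneg_eq_0_iff) (use a(2) inH in auto)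
      then have "p ` {..n} \<subseteq> {x. a \<bullet> x = a \<bullet> o'}" by auto
      then have "H \<subseteq> {x. a \<bullet> x = a \<bullet> o'}" unfolding H_def
        by (intro hull_minimal convex_hyperplane)
      then show False using nf a(1) by blast
    qed
  qed
qed

lemma bij_betw_mod_window: "bij_betw (\<lambda>k. k mod n) {c..<c + n} {..<n :: nat}"
proof (cases "n = 0")
  case False
  have inj: "inj_on (\<lambda>k. k mod n) {c..<c + n}"
  proof (rule inj_onI)
    fix x y assume xy: "x \<in> {c..<c + n}" "y \<in> {c..<c + n}" "x mod n = y mod n"
    show "x = y"
    proof (rule ccontr)
      assume "x \<noteq> y"
      then consider "x < y" | "y < x" by linarith
      then show False
      proof cases
        case 1
        then have "n dvd y - x" using xy(3) by (metis less_imp_le_nat mod_eq_dvd_iff_nat)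
        then show False using 1 xy(1,2) by (auto dest!: dvd_imp_le)
      next
        case 2
        then have "n dvd x - y" using xy(3) by (metis less_imp_le_nat mod_eq_dvd_iff_nat)
        then show False using 2 xy(1,2) by (auto dest!: dvd_imp_le)
      qed
    qed
  qed
  have "(\<lambda>k. k mod n) ` {c..<c + n} \<subseteq> {..<n}" using False by auto
  moreover have "card ((\<lambda>k. k mod n) ` {c..<c + n}) = card {..<n}" using card_image[OF inj] by simp
  ultimately have "(\<lambda>k. k mod n) ` {c..<c + n} = {..<n}" by (intro card_subset_eq) auto
  then show ?thesis using inj by (simp add: bij_betw_def)
qed (simp add: bij_betw_def)

text \<open>The geometric and the combinatorial part meet: nearest hubs of a layout label the
  doubled sorted sequence. The starting position \<open>c\<close> depends on the layout, the tables
  do not.\<close>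

lemma dp_le_cost:
  fixes A B :: "nat \<Rightarrow> nat \<Rightarrow> real" and \<pi> :: "nat \<Rightarrow> nat"
  assumes n: "n \<ge> 1" and I: "sources I = {..<n}" "sinks I = {n}" "layers I = 1" "alpha I = 0"
    and conv: "convex_instance I" and L: "is_layout I L"
    and \<pi>: "bij_betw \<pi> {..<n} {..<n}"
    and srt: "\<And>i j. i < j \<Longrightarrow> j < n \<Longrightarrow>
      before ((1 / real (n + 1)) *\<^sub>R (\<Sum>v\<le>n. loc I v)) (loc I (\<pi> i)) (loc I (\<pi> j))"
    and P: "P = (\<lambda>k. loc I (\<pi> (k mod n)))" and T: "T = loc I n"
    and A0: "\<And>i. i \<le> 2 * n \<Longrightarrow> A i i = 0"
    and AB: "\<And>i f j. i < f \<Longrightarrow> f \<le> j \<Longrightarrow> j \<le> i + n \<Longrightarrow> j \<le> 2 * n \<Longrightarrow> A i j \<le> B i f + A f j"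
    and Bopt: "\<And>i b c d e f p. i < b \<Longrightarrow> b \<le> c \<Longrightarrow> c \<le> d \<Longrightarrow> d \<le> e \<Longrightarrow> e \<le> f \<Longrightarrow> f \<le> i + n \<Longrightarrow> f \<le> 2 * n \<Longrightarrow>
      B i f \<le> \<rho> * star P T (grp i b c d e f) p + A b c + A d e"
    and \<rho>: "\<rho> \<ge> 0"
  obtains c where "c < n" "A c (c + n) \<le> \<rho> * cost I L"
proof -
  define H where "H = convex hull (loc I ` {..n})"
  have un: "{..<n} \<union> {n} = {..n}" by auto
  have bd: "loc I v \<in> H" "loc I v \<notin> interior H" if "v < n" for v
  proof -
    show "loc I v \<in> H" unfolding H_def using that by (intro hull_inc) auto
    have "loc I v \<in> frontier H" using conv that unfolding convex_instance_def I un H_def by auto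
    then show "loc I v \<notin> interior H" by (simp add: frontier_def)
  qed
  define o' where "o' = (1 / real (n + 1)) *\<^sub>R (\<Sum>v\<le>n. loc I v)"
  note o = centroid_interior_or_flat[where p = "loc I" and n = n, folded H_def o'_def]
  have \<pi>n: "\<pi> i < n" if "i < n" for i using \<pi> that by (auto simp: bij_betw_def)
  define s where "s i = loc I (\<pi> i)" for i
  have base: "separates H (s i) (s k) (s j) (s l) \<and> separates H (s j) (s l) (s k) (s i)"
    if ijkl: "i < j" "j < k" "k < l" "l < n" for i j k l
    using o(2)
  proof
    assume oi: "o' \<in> interior H"
    have cv: "convex H" by (simp add: H_def)
    show ?thesis
      using separates_sorted[OF cv oi _ _ _ ijkl, of s] bd \<pi>n srt unfolding s_def o'_def by blast
  next
    assume "\<exists>a b. a \<noteq> 0 \<and> H \<subseteq> {x. a \<bullet> x = b}"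
    then obtain a b where ab: "a \<noteq> 0" "H \<subseteq> {x. a \<bullet> x = b}" by blast
    show ?thesis
      using separates_sorted_flat[OF ab o(1) _ _ ijkl, of s] bd \<pi>n srt unfolding s_def o'_def by blast
  qed
  have sep: "separates H (P x1) (P x3) (P x2) (P x4)"
    if "x1 < x2" "x2 < x3" "x3 < x4" "x4 < x1 + n" for x1 x2 x3 x4
    using separates_cyclic[of n H s, OF base that] unfolding P s_def by blast
  obtain F where F: "finite F" "F \<noteq> {}" "F \<subseteq> H"
    and Fc: "\<And>\<phi>. (\<And>s. s < n \<Longrightarrow> nearest F (loc I s) (\<phi> s)) \<Longrightarrow>
      (\<Sum>f\<in>\<phi> ` {..<n}. dist f (loc I n)) + (\<Sum>s<n. dist (\<phi> s) (loc I s)) \<le> cost I L"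
    using layout_nearest_hubs[OF L I] unfolding H_def by blast
  have "\<forall>x. \<exists>f. nearest F x f" using nearest_exists[OF F(1,2)] by blast
  \<comment> \<open>The nearest hub is chosen as a function of the point in the plane, so the
    labelling is periodic.\<close>
  from choice[OF this] obtain N where N: "\<And>x. nearest F x (N x)" by blast
  define \<psi> where "\<psi> k = N (P k)" for k
  obtain c where c: "c < n" "A c (c + n) \<le> \<rho> * label_cost P T \<psi> c (c + n)"
  proof -
    have per: "P (k + n) = P k" "\<psi> (k + n) = \<psi> k" for k by (simp_all add: P \<psi>_def)
    have near: "nearest F (P k) (\<psi> k)" for k using N by (simp add: \<psi>_def)
    show thesis using cyclic_dp_le[OF n A0 AB Bopt \<rho> sep per F(3) near] that by blast
  qed
  have bij: "bij_betw (\<lambda>k. \<pi> (k mod n)) {c..<c + n} {..<n}"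
    using bij_betw_trans[OF bij_betw_mod_window \<pi>] by (simp add: comp_def)
  have "label_cost P T \<psi> c (c + n) = (\<Sum>f\<in>(\<lambda>s. N (loc I s)) ` {..<n}. dist f (loc I n)) + (\<Sum>s<n. dist (N (loc I s)) (loc I s))"
  proof -
    have "\<psi> ` {c..<c + n} = (\<lambda>s. N (loc I s)) ` ((\<lambda>k. \<pi> (k mod n)) ` {c..<c + n})"
      by (simp add: image_image \<psi>_def P)
    also have "\<dots> = (\<lambda>s. N (loc I s)) ` {..<n}" using bij by (simp add: bij_betw_def)
    finally have 1: "\<psi> ` {c..<c + n} = (\<lambda>s. N (loc I s)) ` {..<n}" .
    have 2: "(\<Sum>k\<in>{c..<c + n}. dist (\<psi> k) (P k)) = (\<Sum>s<n. dist (N (loc I s)) (loc I s))"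
      using sum.reindex_bij_betw[OF bij, of "\<lambda>s. dist (N (loc I s)) (loc I s)"] by (simp add: \<psi>_def P)
    show ?thesis unfolding label_cost_def 1 2 T ..
  qed
  also have "\<dots> \<le> cost I L" using N by (intro Fc) auto
  finally have "\<rho> * label_cost P T \<psi> c (c + n) \<le> \<rho> * cost I L" using \<rho> by (rule mult_left_mono)
  then show thesis using that c by fastforce
qed

text \<open>What the parent array has to satisfy for the output to be a layout: a Steiner vertex
  without a source below it would be an additional leaf, hence the second part of
  \<open>hub\<close>.\<close>

lemma two_level_layout:
  fixes m n :: nat and par :: "nat \<Rightarrow> nat" and E :: "nat \<Rightarrow> point"
  assumes n: "n \<ge> 1" and I: "sources I = {..<n}" "sinks I = {n}" "layers I = 1" "alpha I = 0"
    and src: "\<And>u. u < n \<Longrightarrow> n < par u \<and> par u < m"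
    and hub: "\<And>v. n < v \<Longrightarrow> v < m \<Longrightarrow> par v = n \<and> (\<exists>u<n. par u = v)"
    and E: "\<And>v. v \<le> n \<Longrightarrow> E v = loc I v"
  defines "L \<equiv> \<lparr>verts = {..<m}, parent = (\<lambda>v. if v = n then None else Some (par v)), emb = E\<rparr>"
  shows "is_layout I L"
    "cost I L = (\<Sum>s<n. dist (E (par s)) (loc I s)) + (\<Sum>v\<in>{n<..<m}. dist (E v) (loc I n))"
proof -
  have m: "n < m" using src[of 0] n by simp
  have ed: "edges L = (\<lambda>u. (u, par u)) ` {..<n} \<union> (\<lambda>v. (v, n)) ` {n<..<m}"
  proof (intro set_eqI iffI)
    fix x assume "x \<in> edges L"
    then obtain u where u: "x = (u, par u)" "u < m" "u \<noteq> n" by (auto simp: edges_def L_def split: if_splits)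
    show "x \<in> (\<lambda>u. (u, par u)) ` {..<n} \<union> (\<lambda>v. (v, n)) ` {n<..<m}"
    proof (cases "u < n")
      case False
      then show ?thesis using u hub[of u] by auto
    qed (use u in auto)
  next
    fix x assume "x \<in> (\<lambda>u. (u, par u)) ` {..<n} \<union> (\<lambda>v. (v, n)) ` {n<..<m}"
    then show "x \<in> edges L" using hub m by (auto simp: edges_def L_def)
  qed
  \<comment> \<open>A rank that increases along edges gives acyclicity and the height bound at
    once.\<close>
  define r where "r u = (if u < n then 0 else if u = n then 2 else 1 :: nat)" for u
  have rk: "r u < r v" if "(u, v) \<in> edges L" for u v
    using that src unfolding ed r_def by force
  have rkk: "r u + k \<le> r v" if "(u, v) \<in> edges L ^^ k" for k u v
    using that
  proof (induction k arbitrary: v)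
    case (Suc k)
    then obtain w where w: "(u, w) \<in> edges L ^^ k" "(w, v) \<in> edges L" by auto
    show ?case using Suc.IH[OF w(1)] rk[OF w(2)] by simp
  qed simp
  have ac: "acyclic (edges L)"
    by (rule acyclic_subset[OF wf_acyclic[OF wf_measure[of r]]]) (auto dest: rk)
  have lv: "leaves L = {..<n}"
  proof (intro set_eqI iffI)
    fix v assume v: "v \<in> leaves L"
    show "v \<in> {..<n}"
    proof (rule ccontr)
      assume "v \<notin> {..<n}"
      moreover have "v < m" using v by (simp add: leaves_def L_def)
      ultimately consider "v = n" | "n < v" "v < m" by fastforce
      then show False
      proof cases
        case 1
        have "(par 0, n) \<in> edges L" using src[of 0] n by (auto simp: ed)
        then show False using v 1 by (auto simp: leaves_def)
      next
        case 2
        then obtain u where "u < n" "par u = v" using hub by blast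
        then have "(u, v) \<in> edges L" by (auto simp: ed)
        then show False using v by (auto simp: leaves_def)
      qed
    qed
  next
    fix v assume v: "v \<in> {..<n}"
    then have "(u, v) \<notin> edges L" for u using src by (force simp: ed)
    then show "v \<in> leaves L" using v m by (auto simp: leaves_def L_def)
  qed
  have ht: "height_at_most L (layers I + 1)"
    unfolding height_at_most_def I
  proof (intro allI impI)
    fix k u v assume "(u, v) \<in> edges L ^^ k"
    then have "k \<le> r v" using rkk by fastforce
    also have "r v \<le> 2" by (simp add: r_def)
    finally show "k \<le> 1 + 1" by simp
  qed
  show "is_layout I L"
    unfolding is_layout_def rooted_forest_def
  proof (intro conjI)
    show "edges L \<subseteq> verts L \<times> verts L" using src m unfolding ed by (force simp: L_def)
    show "roots L = verts L \<inter> sinks I" by (auto simp: roots_def L_def I)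
    show "\<forall>v\<in>verts L \<inter> (sources I \<union> sinks I). emb L v = loc I v" using E by (auto simp: L_def I)
  qed (use ac ht lv I in \<open>auto simp: L_def\<close>)
  have ld: "load I L u \<ge> 1" if "s < n" "(s, u) \<in> (edges L)\<^sup>*" for s u
  proof -
    have "{s \<in> sources I. (s, u) \<in> (edges L)\<^sup>*} \<noteq> {}" using that I by auto
    moreover have "finite {s \<in> sources I. (s, u) \<in> (edges L)\<^sup>*}" using I by simp
    ultimately have "card {s \<in> sources I. (s, u) \<in> (edges L)\<^sup>*} \<noteq> 0" by simp
    then show ?thesis unfolding load_def by linarith
  qed
  define w where "w = (\<lambda>(u, v). norm (emb L u - emb L v) * real (load I L u) powr alpha I)"
  have "cost I L = (\<Sum>x\<in>edges L. w x)" unfolding cost_def w_def by (simp add: case_prod_unfold)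
  also have "\<dots> = (\<Sum>x\<in>(\<lambda>u. (u, par u)) ` {..<n}. w x) + (\<Sum>x\<in>(\<lambda>v. (v, n)) ` {n<..<m}. w x)"
    unfolding ed by (rule sum.union_disjoint) auto
  also have "(\<Sum>x\<in>(\<lambda>u. (u, par u)) ` {..<n}. w x) = (\<Sum>s<n. w (s, par s))"
    by (subst sum.reindex) (auto simp: inj_on_def)
  also have "(\<Sum>s<n. w (s, par s)) = (\<Sum>s<n. dist (E (par s)) (loc I s))"
  proof (rule sum.cong[OF refl])
    fix s assume "s \<in> {..<n}"
    then have s: "s < n" by simp
    have "load I L s \<ge> 1" using ld[of s s] s by simp
    then show "w (s, par s) = dist (E (par s)) (loc I s)"
      using E[of s] s by (simp add: w_def I L_def dist_norm norm_minus_commute)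
  qed
  also have "(\<Sum>x\<in>(\<lambda>v. (v, n)) ` {n<..<m}. w x) = (\<Sum>v\<in>{n<..<m}. w (v, n))"
    by (subst sum.reindex) (auto simp: inj_on_def)
  also have "\<dots> = (\<Sum>v\<in>{n<..<m}. dist (E v) (loc I n))"
  proof (rule sum.cong[OF refl])
    fix v assume v: "v \<in> {n<..<m}"
    then obtain u where "u < n" "par u = v" using hub by auto
    then have "(u, v) \<in> edges L" by (auto simp: ed)
    then have "load I L v \<ge> 1" using ld[of u v] \<open>u < n\<close> by blast
    then show "w (v, n) = dist (E v) (loc I n)" using E[of n] by (simp add: w_def I L_def dist_norm)
  qed
  finally show "cost I L = (\<Sum>s<n. dist (E (par s)) (loc I s)) + (\<Sum>v\<in>{n<..<m}. dist (E v) (loc I n))" .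
qed

subsection \<open>Running times of programs\<close>

text \<open>Total correctness within time \<open>t\<close>. Only an upper bound is recorded, so that
  times of different branches and iterations can be rounded to a common value.\<close>

definition tot :: "com \<Rightarrow> ram_state \<Rightarrow> nat \<Rightarrow> (ram_state \<Rightarrow> bool) \<Rightarrow> bool" where
  "tot c s t Q \<longleftrightarrow> (\<exists>k s'. exec c s k s' \<and> k \<le> t \<and> Q s')"

lemma tot_mono: "tot c s t Q \<Longrightarrow> t \<le> t' \<Longrightarrow> (\<And>s'. Q s' \<Longrightarrow> Q' s') \<Longrightarrow> tot c s t' Q'"
  unfolding tot_def by (meson le_trans)

lemma tot_Seq:
  assumes "tot c1 s t1 R" "\<And>s1. R s1 \<Longrightarrow> tot c2 s1 t2 Q" "t1 + t2 + 1 \<le> t"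
  shows "tot (Seq c1 c2) s t Q"
proof -
  from assms(1) obtain k1 s1 where 1: "exec c1 s k1 s1" "k1 \<le> t1" "R s1" unfolding tot_def by blast
  from assms(2)[OF 1(3)] obtain k2 s2 where 2: "exec c2 s1 k2 s2" "k2 \<le> t2" "Q s2" unfolding tot_def by blast
  have "exec (Seq c1 c2) s (k1 + k2 + 1) s2" using 1 2 by (blast intro: exec.Seq)
  moreover have "k1 + k2 + 1 \<le> t" using 1 2 assms(3) by linarith
  ultimately show ?thesis using 2 unfolding tot_def by blast
qed

lemma tot_Cond:
  assumes "bval b s \<Longrightarrow> tot c1 s t1 Q" "\<not> bval b s \<Longrightarrow> tot c2 s t1 Q" "btime b + t1 + 1 \<le> t"
  shows "tot (Cond b c1 c2) s t Q"
proof (cases "bval b s")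
  case True
  from assms(1)[OF this] obtain k s' where 1: "exec c1 s k s'" "k \<le> t1" "Q s'" unfolding tot_def by blast
  have "exec (Cond b c1 c2) s (btime b + k + 1) s'" using 1 True by (blast intro: CondTrue)
  moreover have "btime b + k + 1 \<le> t" using 1 assms(3) by linarith
  ultimately show ?thesis using 1 unfolding tot_def by blast
next
  case False
  from assms(2)[OF this] obtain k s' where 1: "exec c2 s k s'" "k \<le> t1" "Q s'" unfolding tot_def by blast
  have "exec (Cond b c1 c2) s (btime b + k + 1) s'" using 1 False by (blast intro: CondFalse)
  moreover have "btime b + k + 1 \<le> t" using 1 assms(3) by linarith
  ultimately show ?thesis using 1 unfolding tot_def by blast
qed

text \<open>The invariant is indexed by the number of finished iterations, of which there are
  exactly \<open>m\<close>. The factor \<open>m + 1\<close> includes the last, failing test.\<close>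

lemma tot_While:
  assumes inv: "I 0 s"
    and step: "\<And>x s. x < m \<Longrightarrow> I x s \<Longrightarrow> bval b s \<and> tot c s t (I (Suc x))"
    and fin: "\<And>s. I m s \<Longrightarrow> \<not> bval b s \<and> Q s"
    and time: "(m + 1) * (t + btime b + 1) \<le> t'"
  shows "tot (While b c) s t' Q"
proof -
  have "\<exists>k s'. exec (While b c) s k s' \<and> k \<le> (m - x + 1) * (t + btime b + 1) \<and> Q s'"
    if "x \<le> m" "I x s" for x s
    using that
  proof (induction "m - x" arbitrary: x s)
    case 0
    then have "x = m" by simp
    then have f: "\<not> bval b s" "Q s" using fin 0 by auto
    then have "exec (While b c) s (btime b + 1) s" by (blast intro: WhileFalse)
    moreover have "btime b + 1 \<le> (m - x + 1) * (t + btime b + 1)" by simp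
    ultimately show ?case using f by blast
  next
    case (Suc d)
    then have xm: "x < m" by simp
    from step[OF xm Suc.prems(2)] obtain k1 s1
      where b: "bval b s" and 1: "exec c s k1 s1" "k1 \<le> t" "I (Suc x) s1" unfolding tot_def by blast
    have "d = m - Suc x" using Suc.hyps by simp
    from Suc.hyps(1)[OF this _ 1(3)] xm obtain k2 s2
      where 2: "exec (While b c) s1 k2 s2" "k2 \<le> (m - Suc x + 1) * (t + btime b + 1)" "Q s2" by auto
    have "exec (While b c) s (btime b + k1 + k2 + 1) s2" using b 1 2 by (blast intro: WhileTrue)
    moreover have "btime b + k1 + k2 + 1 \<le> (m - x + 1) * (t + btime b + 1)"
    proof -
      have "m - x + 1 = Suc (m - Suc x + 1)" using xm by simp
      then show ?thesis using 1(2) 2(2) by simp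
    qed
    ultimately show ?case using 2 by blast
  qed
  from this[of 0 s] inv obtain k s' where "exec (While b c) s k s'" "k \<le> (m + 1) * (t + btime b + 1)" "Q s'" by auto
  then show ?thesis using time unfolding tot_def by (meson le_trans)
qed

section \<open>Symbolic execution of loop-free code\<close>

text \<open>The clause for \<open>While\<close>, like the one in \<open>ctime\<close>, is a dummy
  that \<open>loopfree\<close> excludes.\<close>

fun run :: "com \<Rightarrow> ram_state \<Rightarrow> ram_state" where
  "run Skip s = s"
| "run (NStore a e) s = ((fst s)(nval a s := nval e s), snd s)"
| "run (RStore a e) s = (fst s, (snd s)(nval a s := rval e s))"
| "run (Seq c1 c2) s = run c2 (run c1 s)"
| "run (Cond b c1 c2) s = (if bval b s then run c1 s else run c2 s)"
| "run (While b c) s = s"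

fun loopfree :: "com \<Rightarrow> bool" where
  "loopfree (Seq c1 c2) \<longleftrightarrow> loopfree c1 \<and> loopfree c2"
| "loopfree (Cond b c1 c2) \<longleftrightarrow> loopfree c1 \<and> loopfree c2"
| "loopfree (While b c) \<longleftrightarrow> False"
| "loopfree _ \<longleftrightarrow> True"

fun ctime :: "com \<Rightarrow> nat" where
  "ctime Skip = 1"
| "ctime (NStore a e) = ntime a + ntime e + 1"
| "ctime (RStore a e) = ntime a + rtime e + 1"
| "ctime (Seq c1 c2) = ctime c1 + ctime c2 + 1"
| "ctime (Cond b c1 c2) = btime b + max (ctime c1) (ctime c2) + 1"
| "ctime (While b c) = 0"

lemma run_exec: "loopfree c \<Longrightarrow> \<exists>k \<le> ctime c. exec c s k (run c s)"
proof (induction c arbitrary: s)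
  case Skip
  then show ?case using exec.Skip by (intro exI[of _ 1]) simp
next
  case (NStore a e)
  then show ?case using exec.NStore by (intro exI[of _ "ntime a + ntime e + 1"]) simp
next
  case (RStore a e)
  then show ?case using exec.RStore by (intro exI[of _ "ntime a + rtime e + 1"]) simp
next
  case (Seq c1 c2)
  have lf: "loopfree c1" "loopfree c2" using Seq.prems by simp_all
  obtain k1 where k1: "k1 \<le> ctime c1" "exec c1 s k1 (run c1 s)" using Seq.IH(1)[OF lf(1)] by blast
  obtain k2 where k2: "k2 \<le> ctime c2" "exec c2 (run c1 s) k2 (run c2 (run c1 s))"
    using Seq.IH(2)[OF lf(2)] by blast
  show ?case using exec.Seq[OF k1(2) k2(2)] k1(1) k2(1) by (intro exI[of _ "k1 + k2 + 1"]) simp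
next
  case (Cond b c1 c2)
  have lf: "loopfree c1" "loopfree c2" using Cond.prems by simp_all
  obtain k1 where k1: "k1 \<le> ctime c1" "exec c1 s k1 (run c1 s)" using Cond.IH(1)[OF lf(1)] by blast
  obtain k2 where k2: "k2 \<le> ctime c2" "exec c2 s k2 (run c2 s)" using Cond.IH(2)[OF lf(2)] by blast
  note k = k1 k2
  show ?case
  proof (cases "bval b s")
    case True
    then show ?thesis using k CondTrue[OF True k(2)] by (intro exI[of _ "btime b + k1 + 1"]) auto
  next
    case False
    then show ?thesis using k CondFalse[OF False k(4)] by (intro exI[of _ "btime b + k2 + 1"]) auto
  qed
qed simp

lemma tot_run: "loopfree c \<Longrightarrow> ctime c \<le> t \<Longrightarrow> Q (run c s) \<Longrightarrow> tot c s t Q"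
  unfolding tot_def using run_exec[of c s] by (meson le_trans)

lemma tot_run_Seq:
  "loopfree c1 \<Longrightarrow> tot c2 (run c1 s) t2 Q \<Longrightarrow> ctime c1 + t2 + 1 \<le> t \<Longrightarrow> tot (Seq c1 c2) s t Q"
  by (rule tot_Seq[where R = "\<lambda>s1. s1 = run c1 s"]) (auto intro: tot_run)

fun seqs :: "com list \<Rightarrow> com" where
  "seqs [] = Skip"
| "seqs (c # cs) = Seq c (seqs cs)"

text \<open>
  Memory layout: natural variables live in cells below \<open>100\<close>, element \<open>x\<close> of the natural array \<open>q < 16\<close>
  in cell \<open>100 + q + 16 x\<close>. Variable \<open>5\<close> holds the offset behind which the real memory is organised in
  the same way; the real cells before that offset are reserved for input and output.
\<close>

definition nad :: "nat \<Rightarrow> nat \<Rightarrow> nat" where "nad q x = 100 + q + 16 * x"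

definition nv :: "ram_state \<Rightarrow> nat \<Rightarrow> nat" where "nv s k = fst s k"
definition na :: "ram_state \<Rightarrow> nat \<Rightarrow> nat \<Rightarrow> nat" where "na s q x = fst s (nad q x)"
definition rv :: "ram_state \<Rightarrow> nat \<Rightarrow> real" where "rv s k = snd s (fst s 5 + k)"
definition ra :: "ram_state \<Rightarrow> nat \<Rightarrow> nat \<Rightarrow> real" where "ra s q x = snd s (fst s 5 + nad q x)"
definition inp :: "ram_state \<Rightarrow> nat \<Rightarrow> real" where "inp s a = snd s a"

definition snv :: "nat \<Rightarrow> nat \<Rightarrow> ram_state \<Rightarrow> ram_state" where "snv k x s = ((fst s)(k := x), snd s)"
definition sna :: "nat \<Rightarrow> nat \<Rightarrow> nat \<Rightarrow> ram_state \<Rightarrow> ram_state" where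
  "sna q i x s = ((fst s)(nad q i := x), snd s)"
definition srv :: "nat \<Rightarrow> real \<Rightarrow> ram_state \<Rightarrow> ram_state" where
  "srv k x s = (fst s, (snd s)(fst s 5 + k := x))"
definition sra :: "nat \<Rightarrow> nat \<Rightarrow> real \<Rightarrow> ram_state \<Rightarrow> ram_state" where
  "sra q i x s = (fst s, (snd s)(fst s 5 + nad q i := x))"
definition sinp :: "nat \<Rightarrow> real \<Rightarrow> ram_state \<Rightarrow> ram_state" where
  "sinp a x s = (fst s, (snd s)(a := x))"

lemma nad_eq: "q < 16 \<Longrightarrow> q' < 16 \<Longrightarrow> nad q x = nad q' x' \<longleftrightarrow> q = q' \<and> x = x'"
proof
  assume q: "q < 16" "q' < 16" and "nad q x = nad q' x'"
  then have e: "q + 16 * x = q' + 16 * x'" by (simp add: nad_def)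
  have "q = (q + 16 * x) mod 16" using q by simp
  also have "\<dots> = q'" unfolding e using q by simp
  finally show "q = q' \<and> x = x'" using e by simp
qed simp

lemma nad_ge: "nad q x \<ge> 100" by (simp add: nad_def)

lemma get_nv [simp]:
  "nv (snv k x s) j = (if j = k then x else nv s j)"
  "j < 100 \<Longrightarrow> nv (sna q i y s) j = nv s j"
  "nv (srv k z s) j = nv s j"
  "nv (sra q i z s) j = nv s j"
  "nv (sinp a z s) j = nv s j"
  using nad_ge[of q i] by (auto simp: nv_def snv_def sna_def srv_def sra_def sinp_def)

lemma get_na [simp]:
  "k < 100 \<Longrightarrow> na (snv k x s) q' i' = na s q' i'"
  "q < 16 \<Longrightarrow> q' < 16 \<Longrightarrow> na (sna q i y s) q' i' = (if q' = q \<and> i' = i then y else na s q' i')"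
  "na (srv k z s) q' i' = na s q' i'"
  "na (sra q i z s) q' i' = na s q' i'"
  "na (sinp a z s) q' i' = na s q' i'"
  using nad_ge[of q' i'] by (auto simp: na_def snv_def sna_def srv_def sra_def sinp_def nad_eq)

lemma get_rv [simp]:
  "k \<noteq> 5 \<Longrightarrow> rv (snv k x s) j = rv s j"
  "rv (sna q i y s) j = rv s j"
  "rv (srv k z s) j = (if j = k then z else rv s j)"
  "j < 100 \<Longrightarrow> rv (sra q i z s) j = rv s j"
  "a < nv s 5 \<Longrightarrow> rv (sinp a z s) j = rv s j"
  using nad_ge[of q i] by (auto simp: rv_def nv_def snv_def sna_def srv_def sra_def sinp_def)

lemma get_ra [simp]:
  "k \<noteq> 5 \<Longrightarrow> ra (snv k x s) q' i' = ra s q' i'"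
  "ra (sna q i y s) q' i' = ra s q' i'"
  "k < 100 \<Longrightarrow> ra (srv k z s) q' i' = ra s q' i'"
  "q < 16 \<Longrightarrow> q' < 16 \<Longrightarrow> ra (sra q i z s) q' i' = (if q' = q \<and> i' = i then z else ra s q' i')"
  "a < nv s 5 \<Longrightarrow> ra (sinp a z s) q' i' = ra s q' i'"
  using nad_ge[of q i] nad_ge[of q' i'] nad_eq[of q q' i i']
  by (auto simp: ra_def nv_def snv_def sna_def srv_def sra_def sinp_def)

lemma get_inp [simp]:
  "inp (snv k x s) a = inp s a"
  "inp (sna q i y s) a = inp s a"
  "a < nv s 5 \<Longrightarrow> inp (srv k z s) a = inp s a"
  "a < nv s 5 \<Longrightarrow> inp (sra q i z s) a = inp s a"
  "inp (sinp b z s) a = (if a = b then z else inp s a)"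
  by (auto simp: inp_def nv_def snv_def sna_def srv_def sra_def sinp_def)

text \<open>Naturals can only be added, so the stride 16 of the arrays is reached by four
  doublings.\<close>

definition mul16 :: "nexp \<Rightarrow> nexp" where
  "mul16 e = (let t = NAdd (NAdd e e) (NAdd e e) in NAdd (NAdd t t) (NAdd t t))"
definition aN :: "nat \<Rightarrow> nexp \<Rightarrow> nexp" where "aN q e = NAdd (NConst (100 + q)) (mul16 e)"
definition NV :: "nat \<Rightarrow> nexp" where "NV k = NLoad (NConst k)"
definition NA :: "nat \<Rightarrow> nexp \<Rightarrow> nexp" where "NA q e = NLoad (aN q e)"
definition RV :: "nat \<Rightarrow> rexp" where "RV k = RLoad (NAdd (NV 5) (NConst k))"
definition RA :: "nat \<Rightarrow> nexp \<Rightarrow> rexp" where "RA q e = RLoad (NAdd (NV 5) (aN q e))"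
definition RI :: "nexp \<Rightarrow> rexp" where "RI e = RLoad e"
definition RN :: "nat \<Rightarrow> rexp" where "RN k = ROfNat (NConst k)"

definition SNV :: "nat \<Rightarrow> nexp \<Rightarrow> com" where "SNV k e = NStore (NConst k) e"
definition SNA :: "nat \<Rightarrow> nexp \<Rightarrow> nexp \<Rightarrow> com" where "SNA q i e = NStore (aN q i) e"
definition SRV :: "nat \<Rightarrow> rexp \<Rightarrow> com" where "SRV k e = RStore (NAdd (NV 5) (NConst k)) e"
definition SRA :: "nat \<Rightarrow> nexp \<Rightarrow> rexp \<Rightarrow> com" where "SRA q i e = RStore (NAdd (NV 5) (aN q i)) e"
definition SRI :: "nexp \<Rightarrow> rexp \<Rightarrow> com" where "SRI a e = RStore a e"

lemma nval_simps [simp]: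
  "nval (NV k) s = nv s k"
  "nval (NA q e) s = na s q (nval e s)"
  "nval (aN q e) s = nad q (nval e s)"
  by (simp_all add: NV_def NA_def aN_def mul16_def Let_def nv_def na_def nad_def add.commute)

lemma rval_simps [simp]:
  "rval (RV k) s = rv s k"
  "rval (RA q e) s = ra s q (nval e s)"
  "rval (RI e) s = inp s (nval e s)"
  "rval (RN k) s = real k"
  unfolding RV_def RA_def RI_def RN_def rval.simps nval.simps nval_simps
  by (simp_all add: rv_def ra_def inp_def nv_def)

lemma run_simps [simp]:
  "run (SNV k e) s = snv k (nval e s) s"
  "run (SNA q i e) s = sna q (nval i s) (nval e s) s"
  "run (SRV k r) s = srv k (rval r s) s"
  "run (SRA q i r) s = sra q (nval i s) (rval r s) s"
  "run (SRI i r) s = sinp (nval i s) (rval r s) s"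
  unfolding SNV_def SNA_def SRV_def SRA_def SRI_def run.simps nval.simps nval_simps
  by (simp_all add: snv_def sna_def srv_def sra_def sinp_def nv_def)

lemma loopfree_simps [simp]:
  "loopfree (SNV k e)" "loopfree (SNA q i e)" "loopfree (SRV k r)" "loopfree (SRA q i r)" "loopfree (SRI i r)"
  by (simp_all add: SNV_def SNA_def SRV_def SRA_def SRI_def)

text \<open>The upper bound is evaluated anew in every test, so the invariant of a loop has to fix
  its value.\<close>

definition For :: "nat \<Rightarrow> nexp \<Rightarrow> nexp \<Rightarrow> com \<Rightarrow> com" where
  "For v lo hi body = Seq (SNV v lo)
     (While (NLess (NV v) hi) (Seq body (SNV v (NAdd (NV v) (NConst 1)))))"

lemma tot_For:
  assumes lh: "nval lo s = l" "l \<le> h"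
    and init: "I l (snv v l s)"
    and inv: "\<And>x s. I x s \<Longrightarrow> nv s v = x \<and> nval hi s = h"
    and step: "\<And>x s. l \<le> x \<Longrightarrow> x < h \<Longrightarrow> I x s \<Longrightarrow>
      tot body s t (\<lambda>s'. nv s' v = x \<and> I (Suc x) (snv v (Suc x) s'))"
    and post: "\<And>s. I h s \<Longrightarrow> Q s"
    and time: "(h - l + 1) * (t + ntime lo + ntime hi + 14) \<le> t'"
  shows "tot (For v lo hi body) s t' Q"
  unfolding For_def
proof (rule tot_run_Seq)
  show "loopfree (SNV v lo)" by simp
  let ?b = "NLess (NV v) hi" and ?c = "Seq body (SNV v (NAdd (NV v) (NConst 1)))"
  have bt: "btime ?b = ntime hi + 3" by (simp add: NV_def)
  show "tot (While ?b ?c) (run (SNV v lo) s) ((h - l + 1) * ((t + 7) + btime ?b + 1)) Q"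
  proof (rule tot_While[where I = "\<lambda>x s. I (l + x) s" and m = "h - l" and t = "t + 7"])
    show "I (l + 0) (run (SNV v lo) s)" using init lh by simp
    fix x s assume x: "x < h - l" and i: "I (l + x) s"
    have lx: "l \<le> l + x" "l + x < h" using x by auto
    have "tot ?c s (t + 7) (I (l + Suc x))"
    proof (rule tot_Seq[OF step[OF lx i]])
      fix s1 assume s1: "nv s1 v = l + x \<and> I (Suc (l + x)) (snv v (Suc (l + x)) s1)"
      show "tot (SNV v (NAdd (NV v) (NConst 1))) s1 6 (I (l + Suc x))"
        by (rule tot_run) (use s1 in \<open>auto simp: SNV_def NV_def\<close>, simp add: snv_def nv_def)
    qed simp
    then show "bval ?b s \<and> tot ?c s (t + 7) (I (l + Suc x))" using inv[OF i] lx by simp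
  next
    fix s assume "I (l + (h - l)) s"
    then have i: "I h s" using lh by simp
    then show "\<not> bval ?b s \<and> Q s" using inv[OF i] post by simp
  qed simp
  have "ctime (SNV v lo) = ntime lo + 2" by (simp add: SNV_def)
  moreover have "ntime lo + 3 + (h - l + 1) * (t + ntime hi + 11) \<le> (h - l + 1) * (t + ntime lo + ntime hi + 14)"
  proof -
    have "(h - l + 1) * (t + ntime lo + ntime hi + 14) = (h - l + 1) * (t + ntime hi + 11) + (h - l + 1) * (ntime lo + 3)"
      by (simp add: algebra_simps)
    moreover have "(h - l + 1) * (ntime lo + 3) \<ge> ntime lo + 3" by simp
    ultimately show ?thesis by linarith
  qed
  ultimately show "ctime (SNV v lo) + (h - l + 1) * ((t + 7) + btime ?b + 1) + 1 \<le> t'"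
    using time unfolding bt by (simp add: algebra_simps)
qed


text \<open>What a subroutine leaves alone: the arrays, the input cells, the offset in variable 5,
  and the natural and real variables below \<open>kn\<close> and \<open>kr\<close>. The remaining
  variables are scratch space.\<close>

definition frame :: "nat \<Rightarrow> nat \<Rightarrow> ram_state \<Rightarrow> ram_state \<Rightarrow> bool" where
  "frame kn kr s s' \<longleftrightarrow> nv s' 5 = nv s 5 \<and> (\<forall>j<kn. nv s' j = nv s j) \<and> (\<forall>q<16. \<forall>i. na s' q i = na s q i) \<and>
     (\<forall>j<kr. rv s' j = rv s j) \<and> (\<forall>q<16. \<forall>i. ra s' q i = ra s q i) \<and> (\<forall>a<nv s 5. inp s' a = inp s a)"

lemma frame_refl [simp]: "frame kn kr s s" by (simp add: frame_def)

lemma frame_trans: "frame kn kr s s1 \<Longrightarrow> frame kn kr s1 s2 \<Longrightarrow> frame kn kr s s2"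
  by (auto simp: frame_def)

lemma frame_mono: "frame kn' kr' s s' \<Longrightarrow> kn \<le> kn' \<Longrightarrow> kr \<le> kr' \<Longrightarrow> frame kn kr s s'"
  by (auto simp: frame_def)

lemma frame_snv [simp]: "frame kn kr s s' \<Longrightarrow> kn \<le> k \<Longrightarrow> k < 100 \<Longrightarrow> k \<noteq> 5 \<Longrightarrow> frame kn kr s (snv k x s')"
  by (auto simp: frame_def)

lemma frame_srv [simp]: "frame kn kr s s' \<Longrightarrow> kr \<le> k \<Longrightarrow> k < 100 \<Longrightarrow> frame kn kr s (srv k x s')"
  by (auto simp: frame_def)

lemma frame_get:
  assumes "frame kn kr s s'"
  shows "j < kn \<Longrightarrow> nv s' j = nv s j" "q < 16 \<Longrightarrow> na s' q i = na s q i" "j < kr \<Longrightarrow> rv s' j = rv s j"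
    "q < 16 \<Longrightarrow> ra s' q i = ra s q i" "a < nv s 5 \<Longrightarrow> inp s' a = inp s a" "nv s' 5 = nv s 5"
  using assms by (auto simp: frame_def)

definition BOr :: "bexp \<Rightarrow> bexp \<Rightarrow> bexp" where "BOr a b = BNot (BAnd (BNot a) (BNot b))"

lemma bval_BOr [simp]: "bval (BOr a b) s \<longleftrightarrow> bval a s \<or> bval b s"
  by (simp add: BOr_def)

definition RDist :: "rexp \<Rightarrow> rexp \<Rightarrow> rexp \<Rightarrow> rexp \<Rightarrow> rexp" where
  "RDist a b c d = RSqrt (RAdd (RMul (RSub a c) (RSub a c)) (RMul (RSub b d) (RSub b d)))"

lemma dist_pair: "dist (a, b) (c, d :: real) = sqrt ((a - c) * (a - c) + (b - d) * (b - d))" for a c :: real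
  by (simp add: dist_Pair_Pair dist_real_def power2_eq_square)

lemma rval_RDist [simp]: "rval (RDist a b c d) s = dist (rval a s, rval b s) (rval c s, rval d s)"
  by (simp add: RDist_def dist_pair)

subsection \<open>Approximate medians\<close>

text \<open>Variables 17 to 20 hold \<open>b\<close>, \<open>c\<close>, \<open>d\<close>,
  \<open>e\<close>. The outer bounds \<open>i\<close> and \<open>f\<close>, in variables 11 and 12,
  are supplied by the loop around the test.\<close>

definition in_grp :: "nexp \<Rightarrow> bexp" where
  "in_grp k = BOr (NLess k (NV 17)) (BOr (BAnd (BNot (NLess k (NV 18))) (NLess k (NV 19))) (BNot (NLess k (NV 20))))"

definition cur_grp :: "ram_state \<Rightarrow> nat set" where
  "cur_grp s = grp (nv s 11) (nv s 17) (nv s 18) (nv s 19) (nv s 20) (nv s 12)"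

lemma bval_in_grp: "nv s 11 \<le> nval k s \<Longrightarrow> nval k s < nv s 12 \<Longrightarrow> bval (in_grp k) s \<longleftrightarrow> nval k s \<in> cur_grp s"
  by (auto simp: in_grp_def cur_grp_def grp_def)

definition pts :: "(nat \<Rightarrow> point) \<Rightarrow> point \<Rightarrow> nat \<Rightarrow> ram_state \<Rightarrow> bool" where
  "pts P T m s \<longleftrightarrow> (\<forall>k<m. P k = (ra s 0 k, ra s 8 k)) \<and> T = (rv s 2, rv s 3)"

lemma pts_frame: "pts P T m s \<Longrightarrow> frame kn kr s s' \<Longrightarrow> 4 \<le> kr \<Longrightarrow> pts P T m s'"
  by (auto simp: pts_def frame_def)

text \<open>Registers 24 and 25 hold a point; registers 40 to 42 collect its cost and its
  subgradient, so that a single pass over the cluster serves one step of the ellipsoid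
  method.\<close>

definition pass_init :: com where
  "pass_init = seqs [SRV 40 (RDist (RV 24) (RV 25) (RV 2) (RV 3)),
     SRV 41 (RDiv (RSub (RV 24) (RV 2)) (RV 40)), SRV 42 (RDiv (RSub (RV 25) (RV 3)) (RV 40))]"

definition pass_body :: com where
  "pass_body = Cond (in_grp (NV 30)) (seqs [
       SRV 43 (RDist (RV 24) (RV 25) (RA 0 (NV 30)) (RA 8 (NV 30))),
       SRV 40 (RAdd (RV 40) (RV 43)),
       SRV 41 (RAdd (RV 41) (RDiv (RSub (RV 24) (RA 0 (NV 30))) (RV 43))),
       SRV 42 (RAdd (RV 42) (RDiv (RSub (RV 25) (RA 8 (NV 30))) (RV 43)))]) Skip"

definition pass :: com where
  "pass = Seq pass_init (For 30 (NV 11) (NV 12) pass_body)"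

definition "pass_time = ctime pass_init + ctime pass_body + ntime (NV 11) + ntime (NV 12) + 15"

lemma sum_Int_Suc:
  "finite X \<Longrightarrow> (\<Sum>j\<in>X \<inter> {..<Suc k}. g j) = (\<Sum>j\<in>X \<inter> {..<k}. g j) + (if k \<in> X then g k else 0 :: 'a::comm_monoid_add)"
proof -
  assume "finite X"
  have "X \<inter> {..<Suc k} = (if k \<in> X then insert k (X \<inter> {..<k}) else X \<inter> {..<k})"
    by (auto simp: less_Suc_eq)
  then show ?thesis using \<open>finite X\<close> by (simp add: add.commute)
qed

lemma cur_grp_Int:
  "cur_grp s \<inter> {..<nv s 11} = {}" "cur_grp s \<inter> {..<nv s 12} = cur_grp s" "finite (cur_grp s)"
  by (auto simp: cur_grp_def grp_def)

lemma cur_grp_frame: "frame kn kr s s' \<Longrightarrow> 21 \<le> kn \<Longrightarrow> cur_grp s' = cur_grp s"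
  by (simp add: cur_grp_def frame_get)

lemma pass_correct:
  assumes pts: "pts P T m s" and le: "nv s 11 \<le> nv s 12" "nv s 12 \<le> m"
  defines "c \<equiv> (rv s 24, rv s 25)" and "X \<equiv> cur_grp s"
  shows "tot pass s (pass_time * (m + 1)) (\<lambda>s'. frame 30 40 s s' \<and> rv s' 40 = star P T X c \<and>
    (rv s' 41, rv s' 42) = star_grad P T X c)"
  unfolding pass_def
proof (rule tot_run_Seq)
  show "loopfree pass_init" by (simp add: pass_init_def)
  let ?s1 = "run pass_init s"
  define G where "G Y = (1 / dist c T) *\<^sub>R (c - T) + (\<Sum>k\<in>Y. (1 / dist c (P k)) *\<^sub>R (c - P k))" for Y
  define I where "I k s' \<longleftrightarrow> frame 30 40 s s' \<and> nv s' 30 = k \<and>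
    rv s' 40 = dist c T + (\<Sum>j\<in>X \<inter> {..<k}. dist c (P j)) \<and> (rv s' 41, rv s' 42) = G (X \<inter> {..<k})" for k s'
  have T: "T = (rv s 2, rv s 3)" using pts by (simp add: pts_def)
  show "tot (For 30 (NV 11) (NV 12) pass_body) ?s1 ((nv s 12 - nv s 11 + 1) * (ctime pass_body + ntime (NV 11) + ntime (NV 12) + 14))
    (\<lambda>s'. frame 30 40 s s' \<and> rv s' 40 = star P T X c \<and> (rv s' 41, rv s' 42) = star_grad P T X c)"
  proof (rule tot_For[where I = I and l = "nv s 11" and h = "nv s 12"])
    show "nval (NV 11) ?s1 = nv s 11" by (simp add: pass_init_def)
    show "I (nv s 11) (snv 30 (nv s 11) ?s1)"
      unfolding I_def X_def cur_grp_Int(1) G_def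
      by (simp add: pass_init_def T c_def)
    show "nv s' 30 = x \<and> nval (NV 12) s' = nv s 12" if "I x s'" for x s'
      using that by (auto simp: I_def frame_get)
    show "frame 30 40 s s' \<and> rv s' 40 = star P T X c \<and> (rv s' 41, rv s' 42) = star_grad P T X c"
      if "I (nv s 12) s'" for s'
      using that unfolding I_def X_def cur_grp_Int(2) star_def star_grad_def G_def by simp
    fix k s' assume k: "nv s 11 \<le> k" "k < nv s 12" and i: "I k s'"
    have fr: "frame 30 40 s s'" and k30: "nv s' 30 = k" using i by (auto simp: I_def)
    have inX: "bval (in_grp (NV 30)) s' \<longleftrightarrow> k \<in> X"
      using bval_in_grp[of s' "NV 30"] k k30 frame_get[OF fr] cur_grp_frame[OF fr] by (simp add: X_def)
    have Pk: "P k = (ra s' 0 k, ra s' 8 k)" using pts k le frame_get(4)[OF fr] by (simp add: pts_def)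
    have c': "c = (rv s' 24, rv s' 25)" using frame_get(3)[OF fr] by (simp add: c_def)
    show "tot pass_body s' (ctime pass_body) (\<lambda>s''. nv s'' 30 = k \<and> I (Suc k) (snv 30 (Suc k) s''))"
    proof (rule tot_run)
      show "loopfree pass_body" by (simp add: pass_body_def)
      have fX: "finite X" by (simp add: X_def cur_grp_Int)
      have GS: "G (X \<inter> {..<Suc k}) = G (X \<inter> {..<k}) + (if k \<in> X then (1 / dist c (P k)) *\<^sub>R (c - P k) else 0)"
        unfolding G_def sum_Int_Suc[OF fX] by (simp add: add.assoc)
      show "nv (run pass_body s') 30 = k \<and> I (Suc k) (snv 30 (Suc k) (run pass_body s'))"
      proof (cases "k \<in> X")
        case True
        have e: "dist (rv s' 24, rv s' 25) (ra s' 0 k, ra s' 8 k) = dist c (P k)" using Pk c' by simp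
        have r40: "rv s' 40 = dist c T + (\<Sum>j\<in>X \<inter> {..<k}. dist c (P j))"
          and g: "fst (G (X \<inter> {..<k})) = rv s' 41" "snd (G (X \<inter> {..<k})) = rv s' 42"
          using i unfolding I_def by (metis fst_conv snd_conv)+
        have cp: "fst c = rv s' 24" "snd c = rv s' 25" "fst (P k) = ra s' 0 k" "snd (P k) = ra s' 8 k"
          using c' Pk by (metis fst_conv snd_conv)+
        show ?thesis
          using True fr k30 inX unfolding I_def sum_Int_Suc[OF fX] GS
          by (simp add: pass_body_def e r40 prod_eq_iff g cp)
      next
        case False
        then show ?thesis
          using fr k30 inX i unfolding I_def sum_Int_Suc[OF fX] GS by (simp add: pass_body_def)
      qed
    qed simp
  qed (use le in auto)
  have "(nv s 12 - nv s 11 + 1) * (ctime pass_body + ntime (NV 11) + ntime (NV 12) + 14)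
    \<le> (m + 1) * (ctime pass_body + ntime (NV 11) + ntime (NV 12) + 14)"
    by (rule mult_le_mono1) (use le in linarith)
  moreover have "ctime pass_init + 1 \<le> (m + 1) * (ctime pass_init + 1)" by simp
  ultimately have "ctime pass_init + 1 + (nv s 12 - nv s 11 + 1) * (ctime pass_body + ntime (NV 11) + ntime (NV 12) + 14)
    \<le> (m + 1) * (ctime pass_init + 1) + (m + 1) * (ctime pass_body + ntime (NV 11) + ntime (NV 12) + 14)" by linarith
  also have "\<dots> = pass_time * (m + 1)" by (simp add: pass_time_def algebra_simps)
  finally show "ctime pass_init + (nv s 12 - nv s 11 + 1) * (ctime pass_body + ntime (NV 11) + ntime (NV 12) + 14) + 1
    \<le> pass_time * (m + 1)" by simp
qed

definition mean_body :: com where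
  "mean_body = Cond (in_grp (NV 30)) (seqs [SRV 24 (RAdd (RV 24) (RA 0 (NV 30))),
     SRV 25 (RAdd (RV 25) (RA 8 (NV 30))), SRV 26 (RAdd (RV 26) (RN 1))]) Skip"

definition mean_init :: com where
  "mean_init = seqs [SRV 24 (RV 2), SRV 25 (RV 3), SRV 26 (RN 1)]"

definition mean :: com where
  "mean = Seq (Seq mean_init (For 30 (NV 11) (NV 12) mean_body))
     (seqs [SRV 24 (RDiv (RV 24) (RV 26)), SRV 25 (RDiv (RV 25) (RV 26))])"

definition "mean_time = ctime mean_init + ctime mean_body + ntime (NV 11) + ntime (NV 12) + 17
  + ctime (seqs [SRV 24 (RDiv (RV 24) (RV 26)), SRV 25 (RDiv (RV 25) (RV 26))])"

lemma mean_correct: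
  assumes pts: "pts P T m s" and le: "nv s 11 \<le> nv s 12" "nv s 12 \<le> m"
  defines "X \<equiv> cur_grp s"
  shows "tot mean s (mean_time * (m + 1)) (\<lambda>s'. frame 30 24 s s' \<and>
    (rv s' 24, rv s' 25) = star_mean P T X \<and> rv s' 26 = 1 + real (card X))"
  unfolding mean_def
proof (rule tot_Seq)
  let ?s1 = "run mean_init s"
  let ?R = "\<lambda>s'. frame 30 24 s s' \<and> (rv s' 24, rv s' 25) = T + (\<Sum>j\<in>X. P j) \<and> rv s' 26 = 1 + real (card X)"
  define I where "I k s' \<longleftrightarrow> frame 30 24 s s' \<and> nv s' 30 = k \<and>
    (rv s' 24, rv s' 25) = T + (\<Sum>j\<in>X \<inter> {..<k}. P j) \<and> rv s' 26 = 1 + (\<Sum>j\<in>X \<inter> {..<k}. 1)" for k s'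
  have T: "T = (rv s 2, rv s 3)" using pts by (simp add: pts_def)
  show "tot (Seq mean_init (For 30 (NV 11) (NV 12) mean_body)) s
    (ctime mean_init + (m + 1) * (ctime mean_body + ntime (NV 11) + ntime (NV 12) + 14) + 1) ?R"
  proof (rule tot_run_Seq)
    show "loopfree mean_init" by (simp add: mean_init_def)
    show "tot (For 30 (NV 11) (NV 12) mean_body) ?s1 ((m + 1) * (ctime mean_body + ntime (NV 11) + ntime (NV 12) + 14)) ?R"
    proof (rule tot_For[where I = I and l = "nv s 11" and h = "nv s 12"])
      show "nval (NV 11) ?s1 = nv s 11" by (simp add: mean_init_def)
      show "I (nv s 11) (snv 30 (nv s 11) ?s1)"
        unfolding I_def X_def cur_grp_Int(1) by (simp add: mean_init_def T)
      show "nv s' 30 = x \<and> nval (NV 12) s' = nv s 12" if "I x s'" for x s'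
        using that by (auto simp: I_def frame_get)
      show "?R s'" if "I (nv s 12) s'" for s'
        using that unfolding I_def X_def cur_grp_Int(2) by simp
      fix k s' assume k: "nv s 11 \<le> k" "k < nv s 12" and i: "I k s'"
      have fr: "frame 30 24 s s'" and k30: "nv s' 30 = k" using i by (auto simp: I_def)
      have inX: "bval (in_grp (NV 30)) s' \<longleftrightarrow> k \<in> X"
        using bval_in_grp[of s' "NV 30"] k k30 frame_get[OF fr] cur_grp_frame[OF fr] by (simp add: X_def)
      have Pk: "P k = (ra s' 0 k, ra s' 8 k)" using pts k le frame_get(4)[OF fr] by (simp add: pts_def)
      have fX: "finite X" by (simp add: X_def cur_grp_Int)
      define S where "S = T + (\<Sum>j\<in>X \<inter> {..<k}. P j)"
      have S': "T + (\<Sum>j\<in>X \<inter> {..<Suc k}. P j) = S + (if k \<in> X then P k else 0)"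
        unfolding sum_Int_Suc[OF fX] S_def by (simp add: add.assoc)
      have g: "fst S = rv s' 24" "snd S = rv s' 25" using i unfolding I_def S_def by (metis fst_conv snd_conv)+
      have r26: "rv s' 26 = 1 + (\<Sum>j\<in>X \<inter> {..<k}. 1)" using i by (simp add: I_def)
      show "tot mean_body s' (ctime mean_body) (\<lambda>s''. nv s'' 30 = k \<and> I (Suc k) (snv 30 (Suc k) s''))"
      proof (rule tot_run)
        show "loopfree mean_body" by (simp add: mean_body_def)
        show "nv (run mean_body s') 30 = k \<and> I (Suc k) (snv 30 (Suc k) (run mean_body s'))"
          using fr k30 inX unfolding I_def S' unfolding sum_Int_Suc[OF fX]
          by (cases "k \<in> X") (simp_all add: mean_body_def prod_eq_iff g r26 Pk)
      qed simp
    next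
      show "(nv s 12 - nv s 11 + 1) * (ctime mean_body + ntime (NV 11) + ntime (NV 12) + 14)
        \<le> (m + 1) * (ctime mean_body + ntime (NV 11) + ntime (NV 12) + 14)"
        by (rule mult_le_mono1) (use le in linarith)
    qed (use le in auto)
  qed simp
  fix s1 assume s1: "?R s1"
  have mp: "1 + real (card X) \<noteq> 0" by (metis add_nonneg_pos less_irrefl of_nat_0_le_iff zero_less_one add.commute)
  have g: "fst (T + (\<Sum>j\<in>X. P j)) = rv s1 24" "snd (T + (\<Sum>j\<in>X. P j)) = rv s1 25" using s1 by (metis fst_conv snd_conv)+
  show "tot (seqs [SRV 24 (RDiv (RV 24) (RV 26)), SRV 25 (RDiv (RV 25) (RV 26))]) s1
    (ctime (seqs [SRV 24 (RDiv (RV 24) (RV 26)), SRV 25 (RDiv (RV 25) (RV 26))]))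
    (\<lambda>s'. frame 30 24 s s' \<and> (rv s' 24, rv s' 25) = star_mean P T X \<and> rv s' 26 = 1 + real (card X))"
    by (rule tot_run) (use s1 g in \<open>simp_all add: star_mean_def prod_eq_iff\<close>)
next
  let ?a = "ctime mean_init" and ?b = "ctime mean_body + ntime (NV 11) + ntime (NV 12) + 14"
    and ?c = "ctime (seqs [SRV 24 (RDiv (RV 24) (RV 26)), SRV 25 (RDiv (RV 25) (RV 26))])"
  have "?a + ?c + 2 \<le> (m + 1) * (?a + ?c + 3)" by simp
  then have "?a + ?c + 2 + (m + 1) * ?b \<le> (m + 1) * (?a + ?c + 3) + (m + 1) * ?b" by linarith
  also have "\<dots> = (m + 1) * (?a + ?c + 3 + ?b)" by (simp add: algebra_simps)
  also have "?a + ?c + 3 + ?b = mean_time" unfolding mean_time_def by linarith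
  finally show "?a + (m + 1) * ?b + 1 + ?c + 1 \<le> mean_time * (m + 1)" by (simp add: mult.commute)
qed

lemma frame_trans': "frame a b s s1 \<Longrightarrow> frame c d s1 s2 \<Longrightarrow> a \<le> c \<Longrightarrow> b \<le> d \<Longrightarrow> frame a b s s2"
  using frame_trans frame_mono by blast

definition med_init :: com where
  "med_init = seqs [SRV 21 (RV 40), SRV 22 (RV 24), SRV 23 (RV 25), SRV 31 (RDiv (RV 40) (RV 26)),
     SRV 32 (RN 0), SRV 33 (RN 0), SRV 34 (RDiv (RV 40) (RV 26))]"

definition med_best :: com where
  "med_best = Cond (RLess (RV 40) (RV 21)) (seqs [SRV 21 (RV 40), SRV 22 (RV 24), SRV 23 (RV 25)]) Skip"

text \<open>The formulas of \<open>half_ellipse\<close>: registers 31 to 34 hold the axes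
  \<open>u\<close> and \<open>v\<close>, 44 and 45 become the direction \<open>e1\<close>,
  \<open>e2\<close> of the cut, and 47 to 50 the rotated axes before scaling.\<close>

definition med_cut :: com where
  "med_cut = seqs [
     SRV 44 (RAdd (RMul (RV 31) (RV 41)) (RMul (RV 32) (RV 42))),
     SRV 45 (RAdd (RMul (RV 33) (RV 41)) (RMul (RV 34) (RV 42))),
     SRV 46 (RSqrt (RAdd (RMul (RV 44) (RV 44)) (RMul (RV 45) (RV 45)))),
     SRV 44 (RDiv (RV 44) (RV 46)),
     SRV 45 (RDiv (RV 45) (RV 46)),
     SRV 47 (RAdd (RMul (RV 44) (RV 31)) (RMul (RV 45) (RV 33))),
     SRV 48 (RAdd (RMul (RV 44) (RV 32)) (RMul (RV 45) (RV 34))),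
     SRV 49 (RSub (RMul (RV 44) (RV 33)) (RMul (RV 45) (RV 31))),
     SRV 50 (RSub (RMul (RV 44) (RV 34)) (RMul (RV 45) (RV 32))),
     SRV 24 (RSub (RV 24) (RDiv (RV 47) (RN 3))),
     SRV 25 (RSub (RV 25) (RDiv (RV 48) (RN 3))),
     SRV 31 (RMul (RDiv (RN 2) (RN 3)) (RV 47)),
     SRV 32 (RMul (RDiv (RN 2) (RN 3)) (RV 48)),
     SRV 33 (RMul (RDiv (RN 7) (RN 6)) (RV 49)),
     SRV 34 (RMul (RDiv (RN 7) (RN 6)) (RV 50))]"

text \<open>The pass before the loop evaluates the centroid, which determines the initial disc and
  the initial best point. Each iteration evaluates the current centre before the cut replaces
  it.\<close>

definition med :: com where
  "med = Seq mean (Seq pass (Seq med_init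
     (For 21 (NConst 0) (NV 2) (Seq pass (Seq med_best med_cut)))))"

definition "med_time = mean_time + 2 * pass_time + ctime med_init + ctime med_best + ctime med_cut + 30"

lemma med_cut_inv:
  assumes X: "finite X" and \<epsilon>: "0 < \<epsilon>" "\<epsilon> \<le> 1"
    and inv: "med_inv P T X \<epsilon> k b (rv s 24, rv s 25) (rv s 31, rv s 32) (rv s 33, rv s 34)"
    and g: "(rv s 41, rv s 42) = star_grad P T X (rv s 24, rv s 25)"
    and best: "rv s 21 \<le> b" "rv s 21 \<le> star P T X (rv s 24, rv s 25)"
  defines "s' \<equiv> run med_cut s"
  shows "frame 21 24 s s'" "rv s' 21 = rv s 21" "rv s' 22 = rv s 22" "rv s' 23 = rv s 23"
    "nv s' 21 = nv s 21"
    "med_inv P T X \<epsilon> (Suc k) (rv s' 21) (rv s' 24, rv s' 25) (rv s' 31, rv s' 32) (rv s' 33, rv s' 34)"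
proof -
  show "frame 21 24 s s'" "rv s' 21 = rv s 21" "rv s' 22 = rv s 22" "rv s' 23 = rv s 23" "nv s' 21 = nv s 21"
    by (simp_all add: s'_def med_cut_def)
  define h1 h2 where "h1 = (rv s 31, rv s 32) \<bullet> (rv s 41, rv s 42)" and "h2 = (rv s 33, rv s 34) \<bullet> (rv s 41, rv s 42)"
  define w where "w = sqrt (h1\<^sup>2 + h2\<^sup>2)"
  define e1 e2 where "e1 = h1 / w" and "e2 = h2 / w"
  have h: "rv s 31 * rv s 41 + rv s 32 * rv s 42 = h1" "rv s 33 * rv s 41 + rv s 34 * rv s 42 = h2"
    by (simp_all add: h1_def h2_def inner_prod_def)
  have w': "sqrt (h1 * h1 + h2 * h2) = w" by (simp add: w_def power2_eq_square)
  have "med_inv P T X \<epsilon> (Suc k) (rv s 21)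
     ((rv s 24, rv s 25) - (1/3) *\<^sub>R (e1 *\<^sub>R (rv s 31, rv s 32) + e2 *\<^sub>R (rv s 33, rv s 34)))
     ((2/3) *\<^sub>R (e1 *\<^sub>R (rv s 31, rv s 32) + e2 *\<^sub>R (rv s 33, rv s 34)))
     ((7/6) *\<^sub>R (e1 *\<^sub>R (rv s 33, rv s 34) - e2 *\<^sub>R (rv s 31, rv s 32)))"
    using med_inv_step[OF X \<epsilon> inv best] unfolding g[symmetric] h1_def[symmetric] h2_def[symmetric]
      w_def[symmetric] e1_def[symmetric] e2_def[symmetric] .
  moreover have "(rv s' 24, rv s' 25) = (rv s 24, rv s 25) - (1/3) *\<^sub>R (e1 *\<^sub>R (rv s 31, rv s 32) + e2 *\<^sub>R (rv s 33, rv s 34))"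
    "(rv s' 31, rv s' 32) = (2/3) *\<^sub>R (e1 *\<^sub>R (rv s 31, rv s 32) + e2 *\<^sub>R (rv s 33, rv s 34))"
    "(rv s' 33, rv s' 34) = (7/6) *\<^sub>R (e1 *\<^sub>R (rv s 33, rv s 34) - e2 *\<^sub>R (rv s 31, rv s 32))"
    "rv s' 21 = rv s 21"
    by (simp_all add: s'_def med_cut_def h w' flip: e1_def e2_def)
  ultimately show "med_inv P T X \<epsilon> (Suc k) (rv s' 21) (rv s' 24, rv s' 25) (rv s' 31, rv s' 32) (rv s' 33, rv s' 34)"
    by (simp only:)
qed

lemma med_correct:
  assumes pts: "pts P T m s" and le: "nv s 11 \<le> nv s 12" "nv s 12 \<le> m"
    and \<epsilon>: "0 < \<epsilon>" "\<epsilon> \<le> 1" and N: "nv s 2 = N" "(7/9) ^ N < (\<epsilon>/4)\<^sup>2"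
  defines "X \<equiv> cur_grp s"
  shows "tot med s (med_time * ((m + 1) * (N + 1))) (\<lambda>s'. frame 21 21 s s' \<and>
    rv s' 21 = star P T X (rv s' 22, rv s' 23) \<and> (\<forall>p. rv s' 21 \<le> (1 + \<epsilon>) * star P T X p))"
proof -
  have fX: "finite X" by (simp add: X_def cur_grp_Int)
  let ?Q = "\<lambda>s'. frame 21 21 s s' \<and> rv s' 21 = star P T X (rv s' 22, rv s' 23) \<and> (\<forall>p. rv s' 21 \<le> (1 + \<epsilon>) * star P T X p)"
  define I where "I k s' \<longleftrightarrow> frame 21 21 s s' \<and> nv s' 21 = k \<and> rv s' 21 = star P T X (rv s' 22, rv s' 23) \<and>
    med_inv P T X \<epsilon> k (rv s' 21) (rv s' 24, rv s' 25) (rv s' 31, rv s' 32) (rv s' 33, rv s' 34)" for k s'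
  let ?t = "pass_time * (m + 1) + (ctime med_best + ctime med_cut + 1) + 1"
  have loop: "tot (For 21 (NConst 0) (NV 2) (Seq pass (Seq med_best med_cut))) s3 ((N + 1) * (?t + 17)) ?Q"
    if i0: "I 0 (snv 21 0 s3)" for s3
  proof (rule tot_For[where I = I and l = 0 and h = N])
    show "nv s' 21 = x \<and> nval (NV 2) s' = N" if "I x s'" for x s'
      using that N by (auto simp: I_def frame_get)
    show "?Q s'" if "I N s'" for s'
      using that med_inv_final[OF fX \<epsilon> _ N(2)] unfolding I_def by blast
    show "(N - 0 + 1) * (?t + ntime (NConst 0) + ntime (NV 2) + 14) \<le> (N + 1) * (?t + 17)" by (simp add: NV_def)
    fix k s' assume "0 \<le> k" "k < N" and i: "I k s'"
    have fr: "frame 21 21 s s'" using i by (simp add: I_def)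
    have pts': "pts P T m s'" using pts_frame[OF pts fr] by simp
    have le': "nv s' 11 \<le> nv s' 12" "nv s' 12 \<le> m" using le frame_get[OF fr] by auto
    have X': "cur_grp s' = X" using cur_grp_frame[OF fr] by (simp add: X_def)
    show "tot (Seq pass (Seq med_best med_cut)) s' ?t (\<lambda>s''. nv s'' 21 = k \<and> I (Suc k) (snv 21 (Suc k) s''))"
    proof (rule tot_Seq[OF pass_correct[OF pts' le', unfolded X']])
      fix s1 assume s1: "frame 30 40 s' s1 \<and> rv s1 40 = star P T X (rv s' 24, rv s' 25) \<and>
        (rv s1 41, rv s1 42) = star_grad P T X (rv s' 24, rv s' 25)"
      have f1: "frame 30 40 s' s1" using s1 by blast
      note [simp] = frame_get(1,3)[OF f1]
      let ?s2 = "run med_best s1"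
      have s2: "rv ?s2 21 = min (rv s1 40) (rv s1 21)" "frame 21 21 s1 ?s2"
        "rv ?s2 24 = rv s' 24" "rv ?s2 25 = rv s' 25" "rv ?s2 31 = rv s' 31" "rv ?s2 32 = rv s' 32"
        "rv ?s2 33 = rv s' 33" "rv ?s2 34 = rv s' 34" "rv ?s2 41 = rv s1 41" "rv ?s2 42 = rv s1 42"
        "nv ?s2 21 = nv s' 21"
        by (auto simp: med_best_def min_def)
      have b2: "rv ?s2 21 = star P T X (rv ?s2 22, rv ?s2 23)"
        using s1 i by (auto simp: med_best_def I_def)
      note cut = med_cut_inv[OF fX \<epsilon>, of P T k "rv s' 21" ?s2]
      have i': "med_inv P T X \<epsilon> k (rv s' 21) (rv ?s2 24, rv ?s2 25) (rv ?s2 31, rv ?s2 32) (rv ?s2 33, rv ?s2 34)"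
        using i unfolding I_def s2 by blast
      have g': "(rv ?s2 41, rv ?s2 42) = star_grad P T X (rv ?s2 24, rv ?s2 25)" using s1 by (simp add: s2)
      have b': "rv ?s2 21 \<le> rv s' 21" "rv ?s2 21 \<le> star P T X (rv ?s2 24, rv ?s2 25)"
        using s1 by (simp_all add: s2)
      note cut = cut[OF i' g' b']
      have F: "frame 21 21 s (run med_cut ?s2)"
        using frame_trans'[OF frame_trans[OF frame_trans'[OF fr f1] s2(2)] cut(1)] by simp
      show "tot (Seq med_best med_cut) s1 (ctime med_best + ctime med_cut + 1)
        (\<lambda>s''. nv s'' 21 = k \<and> I (Suc k) (snv 21 (Suc k) s''))"
      proof (rule tot_run)
        show "loopfree (Seq med_best med_cut)" by (simp add: med_best_def med_cut_def)
        show "ctime (Seq med_best med_cut) \<le> ctime med_best + ctime med_cut + 1" by simp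
        have k: "nv (run med_cut ?s2) 21 = k" using i unfolding cut(5) s2(11) I_def by blast
        have "I (Suc k) (snv 21 (Suc k) (run med_cut ?s2))"
          unfolding I_def
        proof (intro conjI)
          show "frame 21 21 s (snv 21 (Suc k) (run med_cut ?s2))" using F by simp
          show "rv (snv 21 (Suc k) (run med_cut ?s2)) 21 =
            star P T X (rv (snv 21 (Suc k) (run med_cut ?s2)) 22, rv (snv 21 (Suc k) (run med_cut ?s2)) 23)"
            using b2 by (simp add: cut(2-4))
        qed (use cut(6) in simp_all)
        then show "nv (run (Seq med_best med_cut) s1) 21 = k \<and> I (Suc k) (snv 21 (Suc k) (run (Seq med_best med_cut) s1))"
          using k by simp
      qed
    qed simp
  qed (use i0 in simp_all)
  let ?tl = "(N + 1) * (?t + 17)"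
  show ?thesis unfolding med_def
  proof (rule tot_Seq[OF mean_correct[OF pts le], folded X_def])
    fix s1 assume s1: "frame 30 24 s s1 \<and> (rv s1 24, rv s1 25) = star_mean P T X \<and> rv s1 26 = 1 + real (card X)"
    then have f1: "frame 30 24 s s1" by blast
    have X1: "cur_grp s1 = X" using cur_grp_frame[OF f1] by (simp add: X_def)
    have le1: "nv s1 11 \<le> nv s1 12" "nv s1 12 \<le> m" using le frame_get[OF f1] by auto
    have pts1: "pts P T m s1" using pts_frame[OF pts f1] by simp
    have c1: "(rv s1 24, rv s1 25) = star_mean P T X" using s1 by blast
    show "tot (Seq pass (Seq med_init (For 21 (NConst 0) (NV 2) (Seq pass (Seq med_best med_cut))))) s1
      (pass_time * (m + 1) + (ctime med_init + ?tl + 1) + 1) ?Q"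
    proof (rule tot_Seq[OF pass_correct[OF pts1 le1, unfolded X1 c1]])
      fix s2 assume s2: "frame 30 40 s1 s2 \<and> rv s2 40 = star P T X (star_mean P T X) \<and>
        (rv s2 41, rv s2 42) = star_grad P T X (star_mean P T X)"
      then have f2: "frame 30 40 s1 s2" by blast
      let ?s3 = "run med_init s2"
      have r: "rv s2 24 = rv s1 24" "rv s2 25 = rv s1 25" "rv s2 26 = 1 + real (card X)"
        using frame_get(3)[OF f2] s1 by auto
      have F: "frame 21 21 s s2" 
        using frame_trans'[OF frame_mono[OF f1, where kn = 21 and kr = 21] f2] by simp
      have "med_inv P T X \<epsilon> 0 (rv ?s3 21) (rv ?s3 24, rv ?s3 25) (rv ?s3 31, rv ?s3 32) (rv ?s3 33, rv ?s3 34)"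
        using med_inv_init[OF fX \<epsilon>, of P T] s2 c1 by (simp add: med_init_def r)
      then have "I 0 (snv 21 0 ?s3)"
        using F s2 c1 by (simp add: I_def med_init_def r)
      then show "tot (Seq med_init (For 21 (NConst 0) (NV 2) (Seq pass (Seq med_best med_cut)))) s2
        (ctime med_init + ?tl + 1) ?Q"
        by (intro tot_run_Seq[OF _ loop]) (simp_all add: med_init_def)
    qed simp
  next
    define u where "u = (m + 1) * (N + 1)"
    have u: "m + 1 \<le> u" "N + 1 \<le> u" "1 \<le> u" by (simp_all add: u_def)
    have 1: "mean_time * (m + 1) \<le> mean_time * u" "pass_time * (m + 1) \<le> pass_time * u"
      using u(1) by (rule mult_le_mono2)+
    have 2: "(N + 1) * (pass_time * (m + 1)) = pass_time * u" by (simp add: u_def algebra_simps)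
    have 3: "(N + 1) * (ctime med_best + ctime med_cut + 19) \<le> u * (ctime med_best + ctime med_cut + 19)"
      using u by (intro mult_le_mono1)
    have 4: "?tl = (N + 1) * (pass_time * (m + 1)) + (N + 1) * (ctime med_best + ctime med_cut + 19)"
      by (simp add: algebra_simps)
    have 5: "ctime med_init + 3 \<le> (ctime med_init + 3) * u" using u by simp
    have "med_time * u = mean_time * u + pass_time * u + pass_time * u + u * (ctime med_best + ctime med_cut + 19)
       + (ctime med_init + 3) * u + 8 * u" by (simp add: med_time_def algebra_simps)
    then show "mean_time * (m + 1) + (pass_time * (m + 1) + (ctime med_init + ?tl + 1) + 1) + 1 \<le> med_time * ((m + 1) * (N + 1))"
      unfolding u_def[symmetric] 4 2 using 1 3 5 by linarith
  qed
qed


subsection \<open>The dynamic programme\<close>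

text \<open>A template for loops that lower the minimum in register 13. \<open>D x\<close> says that
  candidate \<open>x\<close> has been taken into account; since it is preserved when the minimum
  decreases, it survives all later iterations, and the conclusion for an inner loop can serve as
  \<open>D\<close> for the outer one.\<close>

lemma tot_For_search:
  fixes D :: "nat \<Rightarrow> real \<Rightarrow> bool"
  assumes lh: "nval lo s = l" "l \<le> h" and J: "J s" and v: "v \<noteq> 5"
    and hi: "\<And>s. J s \<Longrightarrow> nval hi s = h"
    and upd: "\<And>x s. J s \<Longrightarrow> J (snv v x s)"
    and body: "\<And>x s. l \<le> x \<Longrightarrow> x < h \<Longrightarrow> J s \<Longrightarrow> nv s v = x \<Longrightarrow>
      tot body s t (\<lambda>s'. J s' \<and> nv s' v = x \<and> rv s' 13 \<le> rv s 13 \<and> D x (rv s' 13))"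
    and mono: "\<And>x a b. D x a \<Longrightarrow> b \<le> a \<Longrightarrow> D x b"
    and time: "(h - l + 1) * (t + ntime lo + ntime hi + 14) \<le> t'"
  shows "tot (For v lo hi body) s t' (\<lambda>s'. J s' \<and> rv s' 13 \<le> rv s 13 \<and> (\<forall>x. l \<le> x \<longrightarrow> x < h \<longrightarrow> D x (rv s' 13)))"
proof (rule tot_For[where I = "\<lambda>k s'. J s' \<and> nv s' v = k \<and> rv s' 13 \<le> rv s 13 \<and> (\<forall>x. l \<le> x \<longrightarrow> x < k \<longrightarrow> D x (rv s' 13))"])
  fix k s'
  assume k: "l \<le> k" "k < h" and i: "J s' \<and> nv s' v = k \<and> rv s' 13 \<le> rv s 13 \<and> (\<forall>x. l \<le> x \<longrightarrow> x < k \<longrightarrow> D x (rv s' 13))"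
  have "tot body s' t (\<lambda>s''. J s'' \<and> nv s'' v = k \<and> rv s'' 13 \<le> rv s' 13 \<and> D k (rv s'' 13))"
    using body[OF k] i by blast
  then show "tot body s' t (\<lambda>s''. nv s'' v = k \<and> J (snv v (Suc k) s'') \<and> nv (snv v (Suc k) s'') v = Suc k \<and>
    rv (snv v (Suc k) s'') 13 \<le> rv s 13 \<and> (\<forall>x. l \<le> x \<longrightarrow> x < Suc k \<longrightarrow> D x (rv (snv v (Suc k) s'') 13)))"
  proof (rule tot_mono)
    fix s'' assume s'': "J s'' \<and> nv s'' v = k \<and> rv s'' 13 \<le> rv s' 13 \<and> D k (rv s'' 13)"
    have "D x (rv s'' 13)" if "l \<le> x" "x < Suc k" for x
    proof (cases "x = k")
      case False
      then have "D x (rv s' 13)" using i that by simp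
      then show ?thesis using mono s'' by blast
    qed (use s'' in simp)
    then show "nv s'' v = k \<and> J (snv v (Suc k) s'') \<and> nv (snv v (Suc k) s'') v = Suc k \<and>
      rv (snv v (Suc k) s'') 13 \<le> rv s 13 \<and> (\<forall>x. l \<le> x \<longrightarrow> x < Suc k \<longrightarrow> D x (rv (snv v (Suc k) s'') 13))"
      using s'' i upd v by auto
  qed simp
qed (use lh J hi upd v time in auto)

text \<open>A matrix entry is addressed by row offset plus column. Array 2 tabulates the offsets,
  because naturals cannot be multiplied.\<close>

definition AT :: "nexp \<Rightarrow> nexp \<Rightarrow> nexp" where "AT i j = NAdd (NA 2 i) j"

definition tab :: "ram_state \<Rightarrow> nat \<Rightarrow> nat \<Rightarrow> nat \<Rightarrow> real" where
  "tab s q i j = ra s q (na s 2 i + j)"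
definition ntab :: "ram_state \<Rightarrow> nat \<Rightarrow> nat \<Rightarrow> nat \<Rightarrow> nat" where
  "ntab s q i j = na s q (na s 2 i + j)"

lemma nval_AT [simp]: "nval (AT i j) s = na s 2 (nval i s) + nval j s"
  by (simp add: AT_def)

lemma ra_tab [simp]: "ra s q (na s 2 i + j) = tab s q i j"
  by (simp add: tab_def)

lemma na_ntab [simp]: "na s q (na s 2 i + j) = ntab s q i j"
  by (simp add: ntab_def)

lemma get_tab [simp]:
  "k < 100 \<Longrightarrow> k \<noteq> 5 \<Longrightarrow> tab (snv k x s) q i j = tab s q i j"
  "k < 100 \<Longrightarrow> tab (srv k z s) q i j = tab s q i j"
  "k < 100 \<Longrightarrow> k \<noteq> 5 \<Longrightarrow> ntab (snv k x s) q i j = ntab s q i j"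
  "ntab (srv k z s) q i j = ntab s q i j"
  by (simp_all add: tab_def ntab_def del: ra_tab na_ntab)

lemma frame_tab: "frame kn kr s s' \<Longrightarrow> q < 16 \<Longrightarrow> tab s' q i j = tab s q i j"
  "frame kn kr s s' \<Longrightarrow> q < 16 \<Longrightarrow> ntab s' q i j = ntab s q i j"
  by (simp_all add: tab_def ntab_def frame_get del: ra_tab na_ntab)

definition cand_val :: rexp where
  "cand_val = RAdd (RV 21) (RAdd (RA 3 (AT (NV 17) (NV 18))) (RA 3 (AT (NV 19) (NV 20))))"

definition take_best :: com where
  "take_best = seqs [SRV 13 cand_val, SRV 14 (RV 22), SRV 15 (RV 23),
     SNV 13 (NV 17), SNV 14 (NV 18), SNV 15 (NV 19), SNV 16 (NV 20)]"

definition cand_upd :: com where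
  "cand_upd = Cond (RLess cand_val (RV 13)) take_best Skip"

text \<open>The exclusive loop bound \<open>f + 1\<close>: cuts may be equal to \<open>f\<close>,
  which produces empty runs and gaps.\<close>

definition f1 :: nexp where "f1 = NAdd (NV 12) (NConst 1)"

definition search_e :: com where "search_e = For 20 (NV 19) f1 (Seq med cand_upd)"
definition search_d :: com where "search_d = For 19 (NV 18) f1 search_e"
definition search_c :: com where "search_c = For 18 (NV 17) f1 search_d"
definition search_b :: com where "search_b = For 17 (NAdd (NV 11) (NConst 1)) f1 search_c"
text \<open>All cuts at \<open>f\<close> describe a cluster with a single run. It provides a genuine
  first candidate for the minimum in place of an infinite value.\<close>

definition set_f :: com where "set_f = seqs [SNV 17 (NV 12), SNV 18 (NV 12), SNV 19 (NV 12), SNV 20 (NV 12)]"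
definition search :: com where "search = Seq set_f (Seq med (Seq take_best search_b))"

definition valid_cut :: "nat \<Rightarrow> nat \<Rightarrow> nat \<Rightarrow> nat \<Rightarrow> nat \<Rightarrow> nat \<Rightarrow> bool" where
  "valid_cut i b c d e f \<longleftrightarrow> i < b \<and> b \<le> c \<and> c \<le> d \<and> d \<le> e \<and> e \<le> f"

text \<open>The specification has two halves: \<open>sound_cut\<close> says that the stored value is
  the exact cost of a stored solution, \<open>good_cut\<close> that it competes with every
  alternative. Only the cluster's own cost carries the factor \<open>1 + \<epsilon>\<close>; errors
  inside the gaps are already contained in \<open>A\<close>.\<close>

definition sound_cut where
  "sound_cut P T A i f b c d e p val \<longleftrightarrow> valid_cut i b c d e f \<and>
     val = star P T (grp i b c d e f) p + A b c + A d e"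

definition good_cut where
  "good_cut P T A \<epsilon> i f b c d e val \<longleftrightarrow> (\<forall>p. val \<le> (1 + \<epsilon>) * star P T (grp i b c d e f) p + A b c + A d e)"

text \<open>Four nested loops over the cuts and a linear median make the fifth power;
  \<open>N + 1\<close> counts the ellipsoid steps.\<close>

definition search_time :: "nat \<Rightarrow> nat \<Rightarrow> nat" where
  "search_time n N = (2 * med_time + ctime set_f + ctime take_best + ctime cand_upd + 92) * ((2 * n + 2) ^ 5 * (N + 1))"

lemma search_correct:
  assumes pts: "pts P T (2 * n) s" and i: "i < f" "f \<le> 2 * n" "nv s 11 = i" "nv s 12 = f"
    and \<epsilon>: "0 < \<epsilon>" "\<epsilon> \<le> 1" and N: "nv s 2 = N" "(7/9) ^ N < (\<epsilon>/4)\<^sup>2"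
    and A: "A = tab s 3"
  shows "tot search s (search_time n N) (\<lambda>s'. frame 13 13 s s' \<and>
    sound_cut P T A i f (nv s' 13) (nv s' 14) (nv s' 15) (nv s' 16) (rv s' 14, rv s' 15) (rv s' 13) \<and>
    (\<forall>b c d e. valid_cut i b c d e f \<longrightarrow> good_cut P T A \<epsilon> i f b c d e (rv s' 13)))"
proof -
  define snd_ok where "snd_ok s' \<longleftrightarrow> sound_cut P T A i f (nv s' 13) (nv s' 14) (nv s' 15) (nv s' 16) (rv s' 14, rv s' 15) (rv s' 13)" for s'
  define J where "J s' \<longleftrightarrow> frame 13 13 s s' \<and> snd_ok s'" for s'
  have Jf: "frame 13 13 s s'" if "J s'" for s' using that by (simp add: J_def)
  have J_snv: "J (snv v x s')" if "J s'" "17 \<le> v" "v < 100" for v x s'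
    using that by (simp add: J_def snd_ok_def)
  have hi: "nval f1 s' = f + 1" if "J s'" for s'
    using frame_get(1)[OF Jf[OF that], of 12] i by (simp add: f1_def)
  have gm: "good_cut P T A \<epsilon> i f b c d e y" if "good_cut P T A \<epsilon> i f b c d e x" "y \<le> x" for b c d e x y
    using that by (auto simp: good_cut_def intro: order_trans)
  define mt where "mt = med_time * ((2 * n + 1) * (N + 1))"
  have med': "tot med s' mt (\<lambda>s''. frame 21 21 s' s'' \<and> frame 13 13 s s'' \<and>
      rv s'' 21 = star P T (grp i (nv s' 17) (nv s' 18) (nv s' 19) (nv s' 20) f) (rv s'' 22, rv s'' 23) \<and>
      (\<forall>p. rv s'' 21 \<le> (1 + \<epsilon>) * star P T (grp i (nv s' 17) (nv s' 18) (nv s' 19) (nv s' 20) f) p))"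
    if fr: "frame 13 13 s s'" for s'
  proof -
    have g: "nv s' 11 = i" "nv s' 12 = f" "nv s' 2 = N" using frame_get[OF fr] i N by auto
    have p: "pts P T (2 * n) s'" using pts_frame[OF pts fr] by simp
    have X: "cur_grp s' = grp i (nv s' 17) (nv s' 18) (nv s' 19) (nv s' 20) f" by (simp add: cur_grp_def g)
    show ?thesis unfolding mt_def
      by (rule tot_mono[OF med_correct[OF p _ _ \<epsilon> g(3) N(2), unfolded X]])
         (use g i frame_trans[OF fr frame_mono[of 21 21]] in auto)
  qed
  have tabA: "tab s' 3 = A" if "frame 13 13 s s'" for s'
    using frame_tab(1)[OF that] A by (intro ext) simp
  have cval: "rval cand_val s' = rv s' 21 + A (nv s' 17) (nv s' 18) + A (nv s' 19) (nv s' 20)"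
    if "frame 13 13 s s'" for s' using tabA[OF that] by (simp add: cand_val_def)
  have take: "run take_best s' = snv 16 (nv s' 20) (snv 15 (nv s' 19) (snv 14 (nv s' 18) (snv 13 (nv s' 17)
     (srv 15 (rv s' 23) (srv 14 (rv s' 22) (srv 13 (rval cand_val s') s'))))))" for s'
    by (simp add: take_best_def)
  let ?t1 = "mt + ctime cand_upd + 1"
  have cand: "tot (Seq med cand_upd) s' ?t1 (\<lambda>s''. (J s'' \<and> nv s'' 17 = b \<and> nv s'' 18 = c \<and> nv s'' 19 = d) \<and>
      nv s'' 20 = e \<and> rv s'' 13 \<le> rv s' 13 \<and> good_cut P T A \<epsilon> i f b c d e (rv s'' 13))"
    if j: "J s' \<and> nv s' 17 = b \<and> nv s' 18 = c \<and> nv s' 19 = d" "nv s' 20 = e" and v: "valid_cut i b c d e f"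
    for s' b c d e
  proof (rule tot_Seq[OF med'])
    show fr: "frame 13 13 s s'" using j Jf by blast
    fix s1 assume s1: "frame 21 21 s' s1 \<and> frame 13 13 s s1 \<and>
      rv s1 21 = star P T (grp i (nv s' 17) (nv s' 18) (nv s' 19) (nv s' 20) f) (rv s1 22, rv s1 23) \<and>
      (\<forall>p. rv s1 21 \<le> (1 + \<epsilon>) * star P T (grp i (nv s' 17) (nv s' 18) (nv s' 19) (nv s' 20) f) p)"
    then have f21: "frame 21 21 s' s1" and f13: "frame 13 13 s s1" by blast+
    have g: "nv s1 17 = b" "nv s1 18 = c" "nv s1 19 = d" "nv s1 20 = e"
      using frame_get(1)[OF f21] j by auto
    have same: "nv s1 13 = nv s' 13" "nv s1 14 = nv s' 14" "nv s1 15 = nv s' 15" "nv s1 16 = nv s' 16"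
      "rv s1 13 = rv s' 13" "rv s1 14 = rv s' 14" "rv s1 15 = rv s' 15"
      using frame_get(1,3)[OF f21] by auto
    define val where "val = rv s1 21 + A b c + A d e"
    have vv: "rval cand_val s1 = val" using cval[OF f13] by (simp add: val_def g)
    have r21: "rv s1 21 = star P T (grp i b c d e f) (rv s1 22, rv s1 23)"
      and opt: "\<And>p. rv s1 21 \<le> (1 + \<epsilon>) * star P T (grp i b c d e f) p" using s1 j by auto
    have gd: "good_cut P T A \<epsilon> i f b c d e val" unfolding good_cut_def val_def using opt by auto
    show "tot cand_upd s1 (ctime cand_upd) (\<lambda>s''. (J s'' \<and> nv s'' 17 = b \<and> nv s'' 18 = c \<and> nv s'' 19 = d) \<and>
      nv s'' 20 = e \<and> rv s'' 13 \<le> rv s' 13 \<and> good_cut P T A \<epsilon> i f b c d e (rv s'' 13))"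
    proof (rule tot_run)
      show "loopfree cand_upd" by (simp add: cand_upd_def take_best_def)
      show "(J (run cand_upd s1) \<and> nv (run cand_upd s1) 17 = b \<and> nv (run cand_upd s1) 18 = c \<and> nv (run cand_upd s1) 19 = d) \<and>
        nv (run cand_upd s1) 20 = e \<and> rv (run cand_upd s1) 13 \<le> rv s' 13 \<and> good_cut P T A \<epsilon> i f b c d e (rv (run cand_upd s1) 13)"
      proof (cases "val < rv s1 13")
        case True
        have "sound_cut P T A i f b c d e (rv s1 22, rv s1 23) val"
          unfolding sound_cut_def using v r21 by (simp add: val_def)
        then show ?thesis using True f13 g gd same
          by (simp add: cand_upd_def vv take J_def snd_ok_def)
      next
        case False
        then have "good_cut P T A \<epsilon> i f b c d e (rv s1 13)" using gm[OF gd] by simp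
        then show ?thesis using False f13 g same j
          by (simp add: cand_upd_def vv J_def snd_ok_def)
      qed
    qed simp
  qed simp
  define X where "X = 2 * n + 2"
  have X1: "X \<ge> 1" by (simp add: X_def)
  have nt: "ntime (NV k) = 2" "ntime f1 = 4" "ntime (NAdd (NV 11) (NConst 1)) = 4" for k by (simp_all add: NV_def f1_def)
  have tm: "(f + 1 - l + 1) * (t + 2 + 4 + 14) \<le> X * (t + 22)" "(f + 1 - l + 1) * (t + 4 + 4 + 14) \<le> X * (t + 22)"
    if "1 \<le> l" for l t
    by (rule mult_le_mono; use i that in \<open>simp add: X_def\<close>)+
  \<comment> \<open>\<open>D4\<close> concerns a single candidate; \<open>D3\<close>,
    \<open>D2\<close> and \<open>D1\<close> are what the loops over \<open>e\<close>,
    \<open>d\<close> and \<open>c\<close> have established when they end.\<close>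
  define D4 where "D4 b c d e x \<longleftrightarrow> good_cut P T A \<epsilon> i f b c d e x" for b c d e x
  define D3 where "D3 b c d x \<longleftrightarrow> (\<forall>e. d \<le> e \<longrightarrow> e < f + 1 \<longrightarrow> D4 b c d e x)" for b c d x
  define D2 where "D2 b c x \<longleftrightarrow> (\<forall>d. c \<le> d \<longrightarrow> d < f + 1 \<longrightarrow> D3 b c d x)" for b c x
  define D1 where "D1 b x \<longleftrightarrow> (\<forall>c. b \<le> c \<longrightarrow> c < f + 1 \<longrightarrow> D2 b c x)" for b x
  have m4: "D4 b c d e x \<Longrightarrow> y \<le> x \<Longrightarrow> D4 b c d e y" for b c d e x y using gm by (simp add: D4_def)
  have m3: "D3 b c d x \<Longrightarrow> y \<le> x \<Longrightarrow> D3 b c d y" for b c d x y using m4 unfolding D3_def by blast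
  have m2: "D2 b c x \<Longrightarrow> y \<le> x \<Longrightarrow> D2 b c y" for b c x y using m3 unfolding D2_def by blast
  have m1: "D1 b x \<Longrightarrow> y \<le> x \<Longrightarrow> D1 b y" for b x y using m2 unfolding D1_def by blast
  have e: "tot search_e s' (X * (?t1 + 22)) (\<lambda>s''. (J s'' \<and> nv s'' 17 = b \<and> nv s'' 18 = c) \<and> nv s'' 19 = d \<and>
      rv s'' 13 \<le> rv s' 13 \<and> D3 b c d (rv s'' 13))"
    if j: "J s' \<and> nv s' 17 = b \<and> nv s' 18 = c" "nv s' 19 = d" and v: "i < b" "b \<le> c" "c \<le> d" "d < f + 1" for s' b c d
  proof -
    have "tot search_e s' (X * (?t1 + 22)) (\<lambda>s''. (J s'' \<and> nv s'' 17 = b \<and> nv s'' 18 = c \<and> nv s'' 19 = d) \<and>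
      rv s'' 13 \<le> rv s' 13 \<and> (\<forall>e. d \<le> e \<longrightarrow> e < f + 1 \<longrightarrow> D4 b c d e (rv s'' 13)))"
      unfolding search_e_def
    proof (rule tot_For_search[where l = d and h = "f + 1" and t = ?t1])
      fix e s2 assume e: "d \<le> e" "e < f + 1" and j2: "J s2 \<and> nv s2 17 = b \<and> nv s2 18 = c \<and> nv s2 19 = d" "nv s2 20 = e"
      have "valid_cut i b c d e f" using v e by (simp add: valid_cut_def)
      from cand[OF j2 this] show "tot (Seq med cand_upd) s2 ?t1 (\<lambda>s'. (J s' \<and> nv s' 17 = b \<and> nv s' 18 = c \<and> nv s' 19 = d) \<and>
        nv s' 20 = e \<and> rv s' 13 \<le> rv s2 13 \<and> D4 b c d e (rv s' 13))" unfolding D4_def .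
    next
      show "(f + 1 - d + 1) * (?t1 + ntime (NV 19) + ntime f1 + 14) \<le> X * (?t1 + 22)"
        unfolding nt by (rule tm(1)) (use v in simp)
    qed (use j v hi J_snv m4 in auto)
    then show ?thesis by (rule tot_mono) (auto simp: D3_def)
  qed
  let ?t2 = "X * (?t1 + 22)"
  have d: "tot search_d s' (X * (?t2 + 22)) (\<lambda>s''. (J s'' \<and> nv s'' 17 = b) \<and> nv s'' 18 = c \<and>
      rv s'' 13 \<le> rv s' 13 \<and> D2 b c (rv s'' 13))"
    if j: "J s' \<and> nv s' 17 = b" "nv s' 18 = c" and v: "i < b" "b \<le> c" "c < f + 1" for s' b c
  proof -
    have "tot search_d s' (X * (?t2 + 22)) (\<lambda>s''. (J s'' \<and> nv s'' 17 = b \<and> nv s'' 18 = c) \<and>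
      rv s'' 13 \<le> rv s' 13 \<and> (\<forall>d. c \<le> d \<longrightarrow> d < f + 1 \<longrightarrow> D3 b c d (rv s'' 13)))"
      unfolding search_d_def
    proof (rule tot_For_search[where l = c and h = "f + 1" and t = ?t2])
      fix d s2 assume d: "c \<le> d" "d < f + 1" and j2: "J s2 \<and> nv s2 17 = b \<and> nv s2 18 = c" "nv s2 19 = d"
      from e[OF j2 v(1,2) d] show "tot search_e s2 ?t2 (\<lambda>s'. (J s' \<and> nv s' 17 = b \<and> nv s' 18 = c) \<and>
        nv s' 19 = d \<and> rv s' 13 \<le> rv s2 13 \<and> D3 b c d (rv s' 13))" .
    next
      show "(f + 1 - c + 1) * (?t2 + ntime (NV 18) + ntime f1 + 14) \<le> X * (?t2 + 22)"
        unfolding nt by (rule tm(1)) (use v in simp)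
    qed (use j v hi J_snv m3 in auto)
    then show ?thesis by (rule tot_mono) (auto simp: D2_def)
  qed
  let ?t3 = "X * (?t2 + 22)"
  have c: "tot search_c s' (X * (?t3 + 22)) (\<lambda>s''. J s'' \<and> nv s'' 17 = b \<and>
      rv s'' 13 \<le> rv s' 13 \<and> D1 b (rv s'' 13))"
    if j: "J s'" "nv s' 17 = b" and v: "i < b" "b < f + 1" for s' b
  proof -
    have "tot search_c s' (X * (?t3 + 22)) (\<lambda>s''. (J s'' \<and> nv s'' 17 = b) \<and>
      rv s'' 13 \<le> rv s' 13 \<and> (\<forall>c. b \<le> c \<longrightarrow> c < f + 1 \<longrightarrow> D2 b c (rv s'' 13)))"
      unfolding search_c_def
    proof (rule tot_For_search[where l = b and h = "f + 1" and t = ?t3])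
      fix c s2 assume c: "b \<le> c" "c < f + 1" and j2: "J s2 \<and> nv s2 17 = b" "nv s2 18 = c"
      from d[OF j2 v(1) c] show "tot search_d s2 ?t3 (\<lambda>s'. (J s' \<and> nv s' 17 = b) \<and>
        nv s' 18 = c \<and> rv s' 13 \<le> rv s2 13 \<and> D2 b c (rv s' 13))" .
    next
      show "(f + 1 - b + 1) * (?t3 + ntime (NV 17) + ntime f1 + 14) \<le> X * (?t3 + 22)"
        unfolding nt by (rule tm(1)) (use v in simp)
    qed (use j v hi J_snv m2 in auto)
    then show ?thesis by (rule tot_mono) (auto simp: D1_def)
  qed
  let ?t4 = "X * (?t3 + 22)"
  have b: "tot search_b s' (X * (?t4 + 22)) (\<lambda>s''. J s'' \<and> (\<forall>b. i + 1 \<le> b \<longrightarrow> b < f + 1 \<longrightarrow> D1 b (rv s'' 13)))"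
    if j: "J s'" for s'
  proof -
    have "tot search_b s' (X * (?t4 + 22)) (\<lambda>s''. J s'' \<and>
      rv s'' 13 \<le> rv s' 13 \<and> (\<forall>b. i + 1 \<le> b \<longrightarrow> b < f + 1 \<longrightarrow> D1 b (rv s'' 13)))"
      unfolding search_b_def
    proof (rule tot_For_search[where l = "i + 1" and h = "f + 1" and t = ?t4])
      show "nval (NAdd (NV 11) (NConst 1)) s' = i + 1" using frame_get(1)[OF Jf[OF j], of 11] i by simp
      fix b s2 assume b: "i + 1 \<le> b" "b < f + 1" and j2: "J s2" "nv s2 17 = b"
      have ib: "i < b" using b by simp
      from c[OF j2 ib b(2)] show "tot search_c s2 ?t4 (\<lambda>s'. J s' \<and> nv s' 17 = b \<and> rv s' 13 \<le> rv s2 13 \<and> D1 b (rv s' 13))" .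
    next
      show "(f + 1 - (i + 1) + 1) * (?t4 + ntime (NAdd (NV 11) (NConst 1)) + ntime f1 + 14) \<le> X * (?t4 + 22)"
        unfolding nt by (rule tm(2)) simp
    qed (use j hi J_snv m1 i in auto)
    then show ?thesis by (rule tot_mono) auto
  qed
  let ?t5 = "X * (?t4 + 22)"
  have fin: "tot search s (ctime set_f + (mt + (ctime take_best + ?t5 + 1) + 1) + 1)
    (\<lambda>s'. J s' \<and> (\<forall>b. i + 1 \<le> b \<longrightarrow> b < f + 1 \<longrightarrow> D1 b (rv s' 13)))"
    unfolding search_def
  proof (rule tot_run_Seq)
    show "loopfree set_f" by (simp add: set_f_def)
    let ?s1 = "run set_f s"
    have fr1: "frame 13 13 s ?s1" and v1: "nv ?s1 17 = f" "nv ?s1 18 = f" "nv ?s1 19 = f" "nv ?s1 20 = f"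
      by (simp_all add: set_f_def i)
    show "tot (Seq med (Seq take_best search_b)) ?s1 (mt + (ctime take_best + ?t5 + 1) + 1)
      (\<lambda>s'. J s' \<and> (\<forall>b. i + 1 \<le> b \<longrightarrow> b < f + 1 \<longrightarrow> D1 b (rv s' 13)))"
    proof (rule tot_Seq[OF med'[OF fr1]])
      fix s2 assume s2: "frame 21 21 ?s1 s2 \<and> frame 13 13 s s2 \<and>
        rv s2 21 = star P T (grp i (nv ?s1 17) (nv ?s1 18) (nv ?s1 19) (nv ?s1 20) f) (rv s2 22, rv s2 23) \<and>
        (\<forall>p. rv s2 21 \<le> (1 + \<epsilon>) * star P T (grp i (nv ?s1 17) (nv ?s1 18) (nv ?s1 19) (nv ?s1 20) f) p)"
      then have f21: "frame 21 21 ?s1 s2" and f13: "frame 13 13 s s2" by blast+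
      have g: "nv s2 17 = f" "nv s2 18 = f" "nv s2 19 = f" "nv s2 20 = f"
        using frame_get(1)[OF f21] v1 by auto
      have vv: "rval cand_val s2 = rv s2 21 + A f f + A f f" using cval[OF f13] by (simp add: g)
      have "sound_cut P T A i f f f f f (rv s2 22, rv s2 23) (rv s2 21 + A f f + A f f)"
        using s2 i by (simp add: sound_cut_def valid_cut_def v1)
      then have "J (run take_best s2)" using f13 by (simp add: take vv J_def snd_ok_def g)
      then show "tot (Seq take_best search_b) s2 (ctime take_best + ?t5 + 1)
        (\<lambda>s'. J s' \<and> (\<forall>b. i + 1 \<le> b \<longrightarrow> b < f + 1 \<longrightarrow> D1 b (rv s' 13)))"
        by (intro tot_run_Seq[OF _ b]) (simp_all add: take_best_def)
    qed simp
  qed simp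
  have "ctime set_f + (mt + (ctime take_best + ?t5 + 1) + 1) + 1 \<le> search_time n N"
  proof -
    have q: "X * (X ^ k * (t + r) + 22) \<le> X ^ Suc k * (t + (r + 22))" for k t r
    proof -
      have "22 * X \<le> 22 * (X * X ^ k)" using X1 by simp
      then show ?thesis by (simp add: algebra_simps)
    qed
    have t2: "?t2 \<le> X ^ 1 * (?t1 + 22)" by simp
    have t3: "?t3 \<le> X ^ 2 * (?t1 + 44)"
      using q[of 1 ?t1 22] by (simp add: numeral_2_eq_2)
    have t4: "?t4 \<le> X ^ 3 * (?t1 + 66)"
    proof -
      have "?t4 \<le> X * (X ^ 2 * (?t1 + 44) + 22)" using t3 by (intro mult_le_mono2 add_le_mono1)
      also have "\<dots> \<le> X ^ Suc 2 * (?t1 + (44 + 22))" by (rule q)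
      finally show ?thesis by (simp only: numeral_3_eq_3 numeral_2_eq_2) simp
    qed
    have t5: "?t5 \<le> X ^ 4 * (?t1 + 88)"
    proof -
      have "?t5 \<le> X * (X ^ 3 * (?t1 + 66) + 22)" using t4 by (intro mult_le_mono2 add_le_mono1)
      also have "\<dots> \<le> X ^ Suc 3 * (?t1 + (66 + 22))" by (rule q)
      also have "Suc 3 = 4" by simp
      finally show ?thesis by simp
    qed
    define u where "u = X ^ 5 * (N + 1)"
    have X4: "X ^ 4 \<le> u" "X ^ 4 * (X * (N + 1)) = u" "X * (N + 1) \<le> u" "1 \<le> u"
    proof -
      have e: "X ^ 5 = X ^ 4 * X" by (simp add: power_Suc2[symmetric] del: power_Suc2) 
      show 1: "X ^ 4 * (X * (N + 1)) = u" unfolding u_def e by (simp only: mult.assoc)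
      have "1 \<le> X * (N + 1)" using X1 by simp
      then have "X ^ 4 * 1 \<le> X ^ 4 * (X * (N + 1))" by (rule mult_le_mono2)
      then show 2: "X ^ 4 \<le> u" unfolding 1 by simp
      have x4: "1 \<le> X ^ 4" using X1 by simp
      then have "1 * (X * (N + 1)) \<le> X ^ 4 * (X * (N + 1))" by (rule mult_le_mono1)
      then show "X * (N + 1) \<le> u" unfolding 1 by simp
      show "1 \<le> u" using 2 x4 by linarith
    qed
    have mt: "mt \<le> med_time * (X * (N + 1))" unfolding mt_def X_def by (intro mult_le_mono2 mult_le_mono1) simp
    also have "\<dots> \<le> med_time * u" using X4(3) by (rule mult_le_mono2)
    finally have mtu: "mt \<le> med_time * u" .
    have "X ^ 4 * mt \<le> X ^ 4 * (med_time * (X * (N + 1)))" using mt by (rule mult_le_mono2)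
    also have "\<dots> = med_time * (X ^ 4 * (X * (N + 1)))" by (simp only: mult.left_commute)
    also have "\<dots> = med_time * u" unfolding X4(2) ..
    finally have m5: "X ^ 4 * mt \<le> med_time * u" .
    have "?t5 \<le> X ^ 4 * mt + X ^ 4 * (ctime cand_upd + 89)" using t5 by (simp add: algebra_simps)
    also have "\<dots> \<le> med_time * u + u * (ctime cand_upd + 89)" using m5 X4(1) by (intro add_mono mult_le_mono1)
    finally have t5': "?t5 \<le> med_time * u + u * (ctime cand_upd + 89)" .
    have r: "ctime set_f + ctime take_best \<le> (ctime set_f + ctime take_best) * u" using X4(4) by simp
    have "search_time n N = med_time * u + med_time * u + (ctime set_f + ctime take_best) * u + u * (ctime cand_upd + 89) + 3 * u"
      unfolding search_time_def X_def[symmetric] u_def[symmetric] by (simp add: algebra_simps)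
    then show ?thesis using t5' mtu r X4(4) by linarith
  qed
  then show ?thesis
    by (rule tot_mono[OF fin]) (auto simp: J_def snd_ok_def D1_def D2_def D3_def D4_def valid_cut_def)
qed

section \<open>The invariants of the tables\<close>

text \<open>The coarser frame condition while the tables are filled: arrays 3 to 7 may change,
  whereas the points, the permutation, the row offsets and the buffers for the readout are
  kept.\<close>

definition keep :: "ram_state \<Rightarrow> ram_state \<Rightarrow> bool" where
  "keep s s' \<longleftrightarrow> (\<forall>k<9. nv s' k = nv s k) \<and> (\<forall>k<13. rv s' k = rv s k) \<and>
     (\<forall>q\<in>{0, 2, 8, 9}. \<forall>i. na s' q i = na s q i) \<and> (\<forall>q\<in>{0, 8}. \<forall>i. ra s' q i = ra s q i) \<and>
     (\<forall>a<nv s 5. inp s' a = inp s a)"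

lemma keep_refl [simp]: "keep s s" by (simp add: keep_def)

lemma keep_trans: "keep s s1 \<Longrightarrow> keep s1 s2 \<Longrightarrow> keep s s2"
  by (auto simp: keep_def)

lemma keep_frame: "frame kn kr s s' \<Longrightarrow> 9 \<le> kn \<Longrightarrow> 13 \<le> kr \<Longrightarrow> keep s s'"
  by (auto simp: keep_def frame_def)

lemma keep_set [simp]:
  "keep s s' \<Longrightarrow> 9 \<le> k \<Longrightarrow> k < 100 \<Longrightarrow> keep s (snv k x s')"
  "keep s s' \<Longrightarrow> 13 \<le> k \<Longrightarrow> k < 100 \<Longrightarrow> keep s (srv k z s')"
  "keep s s' \<Longrightarrow> q \<in> {3, 4, 5, 6, 7} \<Longrightarrow> keep s (sna q i x s')"
  "keep s s' \<Longrightarrow> q \<in> {3, 4, 5, 6, 7} \<Longrightarrow> keep s (sra q i z s')"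
  by (auto simp: keep_def)

definition dctx :: "nat \<Rightarrow> nat \<Rightarrow> (nat \<Rightarrow> point) \<Rightarrow> point \<Rightarrow> ram_state \<Rightarrow> bool" where
  "dctx n N P T s \<longleftrightarrow> nv s 0 = n \<and> nv s 2 = N \<and> pts P T (2 * n) s \<and> (\<forall>i\<le>2 * n. na s 2 i = i * (2 * n + 1))"

lemma dctx_keep: "dctx n N P T s \<Longrightarrow> keep s s' \<Longrightarrow> dctx n N P T s'"
  by (auto simp: dctx_def keep_def pts_def)

lemma row_index_eq:
  fixes a b i j w :: nat
  assumes "b < w" "j < w"
  shows "a * w + b = i * w + j \<longleftrightarrow> a = i \<and> b = j"
proof
  assume e: "a * w + b = i * w + j"
  have "(a * w + b) div w = a" "(i * w + j) div w = i" using assms by simp_all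
  then show "a = i \<and> b = j" using e by auto
qed simp

lemma tab_store:
  assumes "dctx n N P T s" "a \<le> 2 * n" "b \<le> 2 * n" "i \<le> 2 * n" "j \<le> 2 * n" "q < 16" "q' < 16" "q \<noteq> 2"
    "x = i * (2 * n + 1) + j"
  shows "tab (sra q x v s) q' a b = (if q' = q \<and> a = i \<and> b = j then v else tab s q' a b)"
    "ntab (sna q x y s) q' a b = (if q' = q \<and> a = i \<and> b = j then y else ntab s q' a b)"
    "tab (sna q x y s) q' a b = tab s q' a b"
    "ntab (sra q x v s) q' a b = ntab s q' a b"
  using assms row_index_eq[of b "2 * n + 1" j a i]
  by (auto simp: tab_def ntab_def dctx_def simp del: ra_tab na_ntab)

definition eqcell :: "ram_state \<Rightarrow> ram_state \<Rightarrow> nat \<Rightarrow> nat \<Rightarrow> bool" where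
  "eqcell s s' a b \<longleftrightarrow> (\<forall>q<16. tab s' q a b = tab s q a b \<and> ntab s' q a b = ntab s q a b)"

text \<open>Real table 3 is \<open>A\<close> and real table 4 is \<open>B\<close>. The solution
  behind an entry of \<open>B\<close> is its hub in real tables 5 and 6 and its four cuts in natural
  tables 3 to 6; natural table 7 holds the split behind an entry of \<open>A\<close>.\<close>

definition okB where
  "okB P T \<epsilon> s i f \<longleftrightarrow>
     sound_cut P T (tab s 3) i f (ntab s 3 i f) (ntab s 4 i f) (ntab s 5 i f) (ntab s 6 i f)
       (tab s 5 i f, tab s 6 i f) (tab s 4 i f) \<and>
     (\<forall>b c d e. valid_cut i b c d e f \<longrightarrow> good_cut P T (tab s 3) \<epsilon> i f b c d e (tab s 4 i f))"

definition okA where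
  "okA s i j \<longleftrightarrow> i < ntab s 7 i j \<and> ntab s 7 i j \<le> j \<and>
     tab s 3 i j = tab s 4 i (ntab s 7 i j) + tab s 3 (ntab s 7 i j) j \<and>
     (\<forall>g. i < g \<longrightarrow> g \<le> j \<longrightarrow> tab s 3 i j \<le> tab s 4 i g + tab s 3 g j)"

text \<open>Since \<open>b > i\<close>, both gaps of a cut lie in later rows. So the entry depends
  on those rows and on its own cell only, which is why rows are filled by decreasing
  \<open>i\<close>.\<close>

lemma okB_eqcell:
  assumes "okB P T \<epsilon> s i f" "i < f" "f \<le> m" "\<And>a b. a \<le> m \<Longrightarrow> b \<le> m \<Longrightarrow> i < a \<or> a = i \<and> b = f \<Longrightarrow> eqcell s s' a b"
  shows "okB P T \<epsilon> s' i f"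
proof -
  have e: "eqcell s s' i f" using assms by simp
  then have if': "tab s' q i f = tab s q i f" "ntab s' q i f = ntab s q i f" if "q < 16" for q
    using that by (auto simp: eqcell_def)
  have t: "tab s' 3 b c = tab s 3 b c" if "i < b" "b \<le> f" "c \<le> f" for b c
    using assms(3,4) that by (simp add: eqcell_def)
  let ?b = "ntab s 3 i f" and ?c = "ntab s 4 i f" and ?d = "ntab s 5 i f" and ?e = "ntab s 6 i f"
  have v: "valid_cut i ?b ?c ?d ?e f" using assms(1) by (simp add: okB_def sound_cut_def)
  have "good_cut P T (tab s' 3) \<epsilon> i f b c d e (tab s 4 i f)" if "valid_cut i b c d e f" for b c d e
    using assms(1) that t[of b c] t[of d e] by (auto simp: okB_def good_cut_def valid_cut_def)
  moreover have "sound_cut P T (tab s' 3) i f ?b ?c ?d ?e (tab s 5 i f, tab s 6 i f) (tab s 4 i f)"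
    using assms(1) v t[of ?b ?c] t[of ?d ?e] by (auto simp: okB_def sound_cut_def valid_cut_def)
  ultimately show ?thesis unfolding okB_def by (simp add: if')
qed

text \<open>Besides later rows, an entry of \<open>A\<close> refers to its own row up to column
  \<open>j\<close>, which determines the order within a row.\<close>

lemma okA_eqcell:
  assumes "okA s i j" "i < j" "j \<le> m" "\<And>a b. a \<le> m \<Longrightarrow> b \<le> m \<Longrightarrow> i < a \<or> a = i \<and> b \<le> j \<Longrightarrow> eqcell s s' a b"
  shows "okA s' i j"
proof -
  have ij: "tab s' 3 i j = tab s 3 i j" "ntab s' 7 i j = ntab s 7 i j" using assms by (simp_all add: eqcell_def)
  have g: "tab s' 4 i g = tab s 4 i g" "tab s' 3 g j = tab s 3 g j" if "i < g" "g \<le> j" for g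
    using assms(2,3,4) that by (simp_all add: eqcell_def)
  show ?thesis using assms(1) g g[of "ntab s 7 i j"] unfolding okA_def ij by auto
qed

text \<open>The last assignment starts the search for the split of \<open>A\<close> with
  \<open>g = f\<close>. Register 13 already holds the value of that split, because it is
  \<open>B i f\<close> plus a zero on the diagonal.\<close>

definition store_B :: com where
  "store_B = seqs [SRA 4 (AT (NV 11) (NV 12)) (RV 13), SRA 5 (AT (NV 11) (NV 12)) (RV 14),
     SRA 6 (AT (NV 11) (NV 12)) (RV 15), SNA 3 (AT (NV 11) (NV 12)) (NV 13), SNA 4 (AT (NV 11) (NV 12)) (NV 14),
     SNA 5 (AT (NV 11) (NV 12)) (NV 15), SNA 6 (AT (NV 11) (NV 12)) (NV 16), SNV 13 (NV 12)]"

definition val_g :: rexp where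
  "val_g = RAdd (RA 4 (AT (NV 11) (NV 17))) (RA 3 (AT (NV 17) (NV 12)))"

definition upd_g :: com where
  "upd_g = Cond (RLess val_g (RV 13)) (seqs [SRV 13 val_g, SNV 13 (NV 17)]) Skip"

definition search_g :: com where
  "search_g = For 17 (NAdd (NV 11) (NConst 1)) (NV 12) upd_g"

definition store_A :: com where
  "store_A = seqs [SRA 3 (AT (NV 11) (NV 12)) (RV 13), SNA 7 (AT (NV 11) (NV 12)) (NV 13)]"

definition body_f :: com where
  "body_f = Seq search (Seq store_B (Seq search_g store_A))"

definition body_time :: "nat \<Rightarrow> nat \<Rightarrow> nat" where
  "body_time n N = search_time n N + ctime store_B + ctime store_A + (2 * n + 2) * (ctime upd_g + 22) + 3"

lemma body_f_correct:
  assumes ctx: "dctx n N P T s" and i: "i < j" "j \<le> 2 * n" "nv s 11 = i" "nv s 12 = j"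
    and \<epsilon>: "0 < \<epsilon>" "\<epsilon> \<le> 1" and N: "(7/9) ^ N < (\<epsilon>/4)\<^sup>2"
    and diag: "tab s 3 j j = 0"
  shows "tot body_f s (body_time n N) (\<lambda>s'. keep s s' \<and> (\<forall>k<13. nv s' k = nv s k) \<and>
    (\<forall>a b. a \<le> 2 * n \<longrightarrow> b \<le> 2 * n \<longrightarrow> (a, b) \<noteq> (i, j) \<longrightarrow> eqcell s s' a b) \<and> okB P T \<epsilon> s' i j \<and> okA s' i j)"
proof -
  have pts: "pts P T (2 * n) s" and nN: "nv s 2 = N" using ctx by (auto simp: dctx_def)
  have i2: "i \<le> 2 * n" using i by simp
  define x where "x = i * (2 * n + 1) + j"
  let ?eq = "\<lambda>s'. \<forall>a b. a \<le> 2 * n \<longrightarrow> b \<le> 2 * n \<longrightarrow> (a, b) \<noteq> (i, j) \<longrightarrow> eqcell s s' a b"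
  let ?Q = "\<lambda>s'. keep s s' \<and> (\<forall>k<13. nv s' k = nv s k) \<and> ?eq s' \<and> okB P T \<epsilon> s' i j \<and> okA s' i j"
  define M where "M s' \<longleftrightarrow> keep s s' \<and> (\<forall>k<13. nv s' k = nv s k) \<and> ?eq s' \<and> okB P T \<epsilon> s' i j" for s'
  define S where "S s' \<longleftrightarrow> i < nv s' 13 \<and> nv s' 13 \<le> j \<and> rv s' 13 = tab s' 4 i (nv s' 13) + tab s' 3 (nv s' 13) j" for s'
  show ?thesis unfolding body_f_def
  proof (rule tot_Seq[OF search_correct[OF pts i \<epsilon> nN N refl]])
    fix s1
    assume s1: "frame 13 13 s s1 \<and>
      sound_cut P T (tab s 3) i j (nv s1 13) (nv s1 14) (nv s1 15) (nv s1 16) (rv s1 14, rv s1 15) (rv s1 13) \<and>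
      (\<forall>b c d e. valid_cut i b c d e j \<longrightarrow> good_cut P T (tab s 3) \<epsilon> i j b c d e (rv s1 13))"
    have fr: "frame 13 13 s s1" using s1 by blast
    have k1: "keep s s1" using keep_frame[OF fr] by simp
    have ctx1: "dctx n N P T s1" using dctx_keep[OF ctx k1] .
    have v1: "nv s1 11 = i" "nv s1 12 = j" using frame_get[OF fr] i by auto
    have ad: "na s1 2 i = i * (2 * n + 1)" using ctx1 i2 by (simp add: dctx_def)
    let ?s2 = "run store_B s1"
    define s2 where "s2 = run store_B s1"
    have s2': "s2 = snv 13 j (sna 6 x (nv s1 16) (sna 5 x (nv s1 15) (sna 4 x (nv s1 14) (sna 3 x (nv s1 13)
        (sra 6 x (rv s1 15) (sra 5 x (rv s1 14) (sra 4 x (rv s1 13) s1)))))))"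
      unfolding s2_def store_B_def by (simp add: v1 ad x_def)
    have c: "dctx n N P T (sra 4 x (rv s1 13) s1)"
      "dctx n N P T (sra 5 x (rv s1 14) (sra 4 x (rv s1 13) s1))"
      "dctx n N P T (sra 6 x (rv s1 15) (sra 5 x (rv s1 14) (sra 4 x (rv s1 13) s1)))"
      "dctx n N P T (sna 3 x (nv s1 13) (sra 6 x (rv s1 15) (sra 5 x (rv s1 14) (sra 4 x (rv s1 13) s1))))"
      "dctx n N P T (sna 4 x (nv s1 14) (sna 3 x (nv s1 13) (sra 6 x (rv s1 15) (sra 5 x (rv s1 14) (sra 4 x (rv s1 13) s1)))))"
      "dctx n N P T (sna 5 x (nv s1 15) (sna 4 x (nv s1 14) (sna 3 x (nv s1 13) (sra 6 x (rv s1 15) (sra 5 x (rv s1 14) (sra 4 x (rv s1 13) s1))))))"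
      by (rule dctx_keep[OF ctx1]; simp)+
    note ts = tab_store[OF ctx1 _ _ i2 i(2) _ _ _ x_def] tab_store[OF c(1) _ _ i2 i(2) _ _ _ x_def]
      tab_store[OF c(2) _ _ i2 i(2) _ _ _ x_def] tab_store[OF c(3) _ _ i2 i(2) _ _ _ x_def]
      tab_store[OF c(4) _ _ i2 i(2) _ _ _ x_def] tab_store[OF c(5) _ _ i2 i(2) _ _ _ x_def]
      tab_store[OF c(6) _ _ i2 i(2) _ _ _ x_def]
    have tab2: "tab s2 q a b = (if q = 4 \<and> a = i \<and> b = j then rv s1 13 else if q = 5 \<and> a = i \<and> b = j then rv s1 14
        else if q = 6 \<and> a = i \<and> b = j then rv s1 15 else tab s q a b)" if "a \<le> 2 * n" "b \<le> 2 * n" "q < 16" for q a b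
      unfolding s2' using that by (simp add: ts frame_tab[OF fr])
    have ntab2: "ntab s2 q a b = (if q = 3 \<and> a = i \<and> b = j then nv s1 13 else if q = 4 \<and> a = i \<and> b = j then nv s1 14
        else if q = 5 \<and> a = i \<and> b = j then nv s1 15 else if q = 6 \<and> a = i \<and> b = j then nv s1 16 else ntab s q a b)"
      if "a \<le> 2 * n" "b \<le> 2 * n" "q < 16" for q a b
      unfolding s2' using that by (simp add: ts frame_tab[OF fr])
    have k2: "keep s s2" unfolding s2' using k1 by simp
    have n2: "nv s2 k = nv s k" if "k < 13" for k unfolding s2' using that frame_get(1)[OF fr] by simp
    have eq2: "?eq s2" unfolding eqcell_def using tab2 ntab2 by auto
    have ij: "tab s2 4 i j = rv s1 13" "tab s2 5 i j = rv s1 14" "tab s2 6 i j = rv s1 15"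
      "ntab s2 3 i j = nv s1 13" "ntab s2 4 i j = nv s1 14" "ntab s2 5 i j = nv s1 15" "ntab s2 6 i j = nv s1 16"
      using tab2[of i j] ntab2[of i j] i i2 by simp_all
    have A2: "tab s2 3 b c = tab s 3 b c" if "b \<le> 2 * n" "c \<le> 2 * n" for b c using tab2 that by simp
    have ok2: "okB P T \<epsilon> s2 i j"
      using s1 i A2 unfolding okB_def ij by (auto simp: sound_cut_def good_cut_def valid_cut_def)
    have M2: "M s2" using k2 n2 eq2 ok2 by (simp add: M_def)
    have S2: "S s2"
    proof -
      have "nv s2 13 = j" "rv s2 13 = rv s1 13" unfolding s2' by simp_all
      then show ?thesis using i A2 diag ij by (simp add: S_def)
    qed
    have r13: "rv s2 13 = tab s2 4 i j + tab s2 3 j j"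
      using S2 unfolding s2' S_def by simp
    define J where "J s' \<longleftrightarrow> frame 13 13 s2 s' \<and> S s'" for s'
    have J0: "J s2" using S2 by (simp add: J_def)
    have eqs: "tab s' q a b = tab s2 q a b" if "J s'" "q < 16" for s' q a b
      using that frame_tab(1)[of 13 13 s2 s' q a b] by (simp add: J_def)
    have Jv: "nv s' 11 = i" "nv s' 12 = j" if "J s'" for s'
      using that n2 i by (auto simp: J_def frame_get)
    have lo: "nval (NAdd (NV 11) (NConst 1)) s2 = i + 1" using n2[of 11] i by simp
    have "tot search_g s2 ((2 * n + 2) * (ctime upd_g + 22)) (\<lambda>s'. J s' \<and> rv s' 13 \<le> rv s2 13 \<and>
      (\<forall>g. i + 1 \<le> g \<longrightarrow> g < j \<longrightarrow> rv s' 13 \<le> tab s2 4 i g + tab s2 3 g j))"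
      unfolding search_g_def
    proof (rule tot_For_search[where l = "i + 1" and h = j and t = "ctime upd_g"])
      show "nval (NV 12) s' = j" if "J s'" for s' using Jv that by simp
      show "J (snv 17 x s')" if "J s'" for x s' using that by (simp add: J_def S_def)
      fix g s' assume g: "i + 1 \<le> g" "g < j" and j': "J s'" "nv s' 17 = g"
      have val: "rval val_g s' = tab s' 4 i g + tab s' 3 g j" using Jv[OF j'(1)] j'(2) by (simp add: val_g_def)
      show "tot upd_g s' (ctime upd_g) (\<lambda>s''. J s'' \<and> nv s'' 17 = g \<and> rv s'' 13 \<le> rv s' 13 \<and>
        rv s'' 13 \<le> tab s2 4 i g + tab s2 3 g j)"
      proof (rule tot_run)
        show "loopfree upd_g" by (simp add: upd_g_def)
        have e: "tab s' 4 i g = tab s2 4 i g" "tab s' 3 g j = tab s2 3 g j" using eqs[OF j'(1)] by simp_all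
        have Js: "frame 13 13 s2 s'" "S s'" using j' by (auto simp: J_def)
        show "J (run upd_g s') \<and> nv (run upd_g s') 17 = g \<and> rv (run upd_g s') 13 \<le> rv s' 13 \<and>
          rv (run upd_g s') 13 \<le> tab s2 4 i g + tab s2 3 g j"
        proof (cases "rval val_g s' < rv s' 13")
          case True
          have "run upd_g s' = snv 13 g (srv 13 (tab s' 4 i g + tab s' 3 g j) s')"
          proof -
            have "rval val_g (srv 13 z s') = rval val_g s'" for z by (simp add: val_g_def)
            then show ?thesis using True j'(2) by (simp add: upd_g_def val)
          qed
          then show ?thesis using True j'(2) g Js e by (simp add: J_def S_def val)
        next
          case False
          then have "run upd_g s' = s'" by (simp add: upd_g_def)
          then show ?thesis using False j' e by (simp add: val)
        qed
      qed simp
    next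
      show "(j - (i + 1) + 1) * (ctime upd_g + ntime (NAdd (NV 11) (NConst 1)) + ntime (NV 12) + 14) \<le> (2 * n + 2) * (ctime upd_g + 22)"
        by (rule mult_le_mono) (use i in \<open>simp_all add: NV_def\<close>)
    qed (use J0 lo i in auto)
    then have sg: "tot (Seq search_g store_A) s2 ((2 * n + 2) * (ctime upd_g + 22) + ctime store_A + 1) ?Q"
    proof (rule tot_Seq)
      fix s3 assume s3: "J s3 \<and> rv s3 13 \<le> rv s2 13 \<and> (\<forall>g. i + 1 \<le> g \<longrightarrow> g < j \<longrightarrow> rv s3 13 \<le> tab s2 4 i g + tab s2 3 g j)"
      have f3: "frame 13 13 s2 s3" and S3: "S s3" using s3 by (auto simp: J_def)
      have k3: "keep s s3" using keep_trans[OF k2 keep_frame[OF f3]] by simp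
      have ctx3: "dctx n N P T s3" using dctx_keep[OF ctx k3] .
      have v3: "nv s3 11 = i" "nv s3 12 = j" using Jv s3 by auto
      have ad3: "na s3 2 i = i * (2 * n + 1)" using ctx3 i2 by (simp add: dctx_def)
      define s4 where "s4 = run store_A s3"
      have s4': "s4 = sna 7 x (nv s3 13) (sra 3 x (rv s3 13) s3)"
        unfolding s4_def store_A_def by (simp add: v3 ad3 x_def)
      have c4: "dctx n N P T (sra 3 x (rv s3 13) s3)" by (rule dctx_keep[OF ctx3]) simp
      note ts4 = tab_store[OF ctx3 _ _ i2 i(2) _ _ _ x_def] tab_store[OF c4 _ _ i2 i(2) _ _ _ x_def]
      have tab4: "tab s4 q a b = (if q = 3 \<and> a = i \<and> b = j then rv s3 13 else tab s2 q a b)"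
        "ntab s4 q a b = (if q = 7 \<and> a = i \<and> b = j then nv s3 13 else ntab s2 q a b)"
        if "a \<le> 2 * n" "b \<le> 2 * n" "q < 16" for q a b
        unfolding s4' using that by (simp_all add: ts4 frame_tab[OF f3])
      have eq4: "eqcell s2 s4 a b" if "a \<le> 2 * n" "b \<le> 2 * n" "(a, b) \<noteq> (i, j)" for a b
        unfolding eqcell_def using tab4 that by auto
      have eq: "?eq s4" using eq2 eq4 by (simp add: eqcell_def)
      have "okB P T \<epsilon> s4 i j"
      proof -
        have A4: "tab s4 3 b c = tab s2 3 b c" if "i < b" "b \<le> 2 * n" "c \<le> 2 * n" for b c using tab4 that by simp
        have e4: "tab s4 4 i j = tab s2 4 i j" "tab s4 5 i j = tab s2 5 i j" "tab s4 6 i j = tab s2 6 i j"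
          "ntab s4 3 i j = ntab s2 3 i j" "ntab s4 4 i j = ntab s2 4 i j" "ntab s4 5 i j = ntab s2 5 i j" "ntab s4 6 i j = ntab s2 6 i j"
          using tab4[of i j] i i2 by simp_all
        show ?thesis using ok2 A4 i unfolding okB_def e4 by (auto simp: sound_cut_def good_cut_def valid_cut_def)
      qed
      moreover have "okA s4 i j"
      proof -
        have ij4: "tab s4 3 i j = rv s3 13" "ntab s4 7 i j = nv s3 13" using tab4[of i j] i i2 by simp_all
        have g4: "tab s4 4 i g = tab s2 4 i g" "tab s4 3 g j = tab s2 3 g j" if "i < g" "g \<le> j" for g
          using tab4 that i by simp_all
        have "rv s3 13 \<le> tab s2 4 i g + tab s2 3 g j" if "i < g" "g \<le> j" for g
        proof (cases "g = j")
          case True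
          then show ?thesis using s3 r13 by simp
        qed (use s3 that in simp)
        moreover have "i < nv s3 13" "nv s3 13 \<le> j" "rv s3 13 = tab s2 4 i (nv s3 13) + tab s2 3 (nv s3 13) j"
          using S3 eqs[OF conjunct1[OF s3]] by (simp_all add: S_def)
        ultimately show ?thesis unfolding okA_def ij4 using g4 by simp
      qed
      moreover have "keep s s4" unfolding s4' using k3 by simp
      moreover have "\<forall>k<13. nv s4 k = nv s k" unfolding s4' using n2 frame_get(1)[OF f3] by simp
      ultimately have "?Q s4" using eq by blast
      moreover have "loopfree store_A" by (simp add: store_A_def)
      ultimately show "tot store_A s3 (ctime store_A) ?Q" unfolding s4_def by (intro tot_run) simp_all
    qed simp
    show "tot (Seq store_B (Seq search_g store_A)) s1
      (ctime store_B + ((2 * n + 2) * (ctime upd_g + 22) + ctime store_A + 1) + 1) ?Q"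
      by (rule tot_run_Seq[OF _ sg[unfolded s2_def]]) (simp_all add: store_B_def)
  next
    show "search_time n N + (ctime store_B + ((2 * n + 2) * (ctime upd_g + 22) + ctime store_A + 1) + 1) + 1 \<le> body_time n N"
      by (simp add: body_time_def)
  qed
qed


definition NN :: nexp where "NN = NAdd (NV 0) (NV 0)"

text \<open>\<open>For\<close> counts upwards, so row \<open>2 n - x\<close> is computed in round
  \<open>x\<close>. Variable 9 is the exclusive column bound: arcs have at most \<open>n\<close>
  positions and end no later than \<open>2 n\<close>.\<close>

definition set_i :: com where
  "set_i = seqs [SNV 11 (NSub NN (NV 10)),
     Cond (NLess (NV 11) (NV 0)) (SNV 9 (NAdd (NAdd (NV 11) (NV 0)) (NConst 1))) (SNV 9 (NAdd NN (NConst 1))),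
     SRA 3 (AT (NV 11) (NV 11)) (RN 0)]"

definition fill_row :: com where
  "fill_row = Seq set_i (For 12 (NAdd (NV 11) (NConst 1)) (NV 9) body_f)"

definition fill :: com where
  "fill = For 10 (NConst 0) (NAdd NN (NConst 1)) fill_row"

definition row_time :: "nat \<Rightarrow> nat \<Rightarrow> nat" where
  "row_time n N = ctime set_i + (2 * n + 2) * (body_time n N + 20) + 1"

definition fill_time :: "nat \<Rightarrow> nat \<Rightarrow> nat" where
  "fill_time n N = (2 * n + 2) * (row_time n N + 22)"

definition row_ok where
  "row_ok P T \<epsilon> n hi s i \<longleftrightarrow> tab s 3 i i = 0 \<and>
     (\<forall>j. i < j \<longrightarrow> j < hi \<longrightarrow> j \<le> i + n \<longrightarrow> j \<le> 2 * n \<longrightarrow> okB P T \<epsilon> s i j \<and> okA s i j)"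

lemma tab_snv [simp]:
  "k < 100 \<Longrightarrow> k \<noteq> 5 \<Longrightarrow> tab (snv k x s) = tab s" "k < 100 \<Longrightarrow> k \<noteq> 5 \<Longrightarrow> ntab (snv k x s) = ntab s"
  by (auto intro!: ext)

lemma row_ok_snv [simp]: "k < 100 \<Longrightarrow> k \<noteq> 5 \<Longrightarrow> row_ok P T \<epsilon> n hi (snv k x s) i = row_ok P T \<epsilon> n hi s i"
  by (simp add: row_ok_def okB_def okA_def)

lemma row_ok_eqcell:
  assumes ok: "row_ok P T \<epsilon> n hi s i" and i: "i \<le> 2 * n"
    and eq: "\<And>a b. a \<le> 2 * n \<Longrightarrow> b \<le> 2 * n \<Longrightarrow> i < a \<or> a = i \<and> b < hi \<Longrightarrow> eqcell s s' a b" and hi: "i < hi"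
  shows "row_ok P T \<epsilon> n hi s' i"
  unfolding row_ok_def
proof (intro conjI allI impI)
  have "eqcell s s' i i" using eq i hi by simp
  then show "tab s' 3 i i = 0" using ok by (simp add: row_ok_def eqcell_def)
  fix j assume j: "i < j" "j < hi" "j \<le> i + n" "j \<le> 2 * n"
  show "okB P T \<epsilon> s' i j"
    by (rule okB_eqcell[of P T \<epsilon> s i j "2 * n"]) (use ok j eq in \<open>auto simp: row_ok_def\<close>)
  show "okA s' i j"
    by (rule okA_eqcell[of s i j "2 * n"]) (use ok j eq in \<open>auto simp: row_ok_def\<close>)
qed

lemma fill_row_correct:
  assumes ctx: "dctx n N P T s" and x: "nv s 10 = x" "x \<le> 2 * n"
    and \<epsilon>: "0 < \<epsilon>" "\<epsilon> \<le> 1" and N: "(7/9) ^ N < (\<epsilon>/4)\<^sup>2"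
    and rdone: "\<And>i. 2 * n < i + x \<Longrightarrow> i \<le> 2 * n \<Longrightarrow> row_ok P T \<epsilon> n (2 * n + 1) s i"
  shows "tot fill_row s (row_time n N) (\<lambda>s'. keep s s' \<and> nv s' 10 = x \<and>
    (\<forall>i. 2 * n < i + Suc x \<longrightarrow> i \<le> 2 * n \<longrightarrow> row_ok P T \<epsilon> n (2 * n + 1) s' i))"
  unfolding fill_row_def
proof (rule tot_run_Seq)
  define i where "i = 2 * n - x"
  have i2: "i \<le> 2 * n" "i + x = 2 * n" using x by (simp_all add: i_def)
  define hi where "hi = (if i < n then i + n + 1 else 2 * n + 1)"
  define s1 where "s1 = run set_i s"
  have n: "nv s 0 = n" and rows: "\<And>a. a \<le> 2 * n \<Longrightarrow> na s 2 a = a * (2 * n + 1)" using ctx by (auto simp: dctx_def)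
  define y where "y = i * (2 * n + 1) + i"
  have ii: "n + n - x = i" by (simp add: i_def)
  have s1': "s1 = sra 3 y 0 (snv 9 hi (snv 11 i s))"
    unfolding s1_def set_i_def NN_def using n x rows[OF i2(1)] by (simp add: ii hi_def y_def mult_2)
  have k1: "keep s s1" unfolding s1' by simp
  have v1: "nv s1 10 = x" "nv s1 11 = i" "nv s1 9 = hi" unfolding s1' using x by simp_all
  have ctx1: "dctx n N P T s1" using dctx_keep[OF ctx k1] .
  have c: "dctx n N P T (snv 9 hi (snv 11 i s))" by (rule dctx_keep[OF ctx]) simp
  have tab1: "tab s1 q a b = (if q = 3 \<and> a = i \<and> b = i then 0 else tab s q a b)" "ntab s1 q a b = ntab s q a b"
    if "a \<le> 2 * n" "b \<le> 2 * n" "q < 16" for q a b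
    unfolding s1' using that by (simp_all add: tab_store[OF c _ _ i2(1) i2(1) _ _ _ y_def])
  have done1: "row_ok P T \<epsilon> n (2 * n + 1) s1 a" if "i < a" "a \<le> 2 * n" for a
  proof (rule row_ok_eqcell[of P T \<epsilon> n "2 * n + 1" s])
    show "row_ok P T \<epsilon> n (2 * n + 1) s a" using rdone that i2 by simp
    show "eqcell s s1 a' b" if "a' \<le> 2 * n" "b \<le> 2 * n" "a < a' \<or> a' = a \<and> b < 2 * n + 1" for a' b
      unfolding eqcell_def using tab1 that \<open>i < a\<close> by auto
  qed (use that in auto)
  have diag1: "tab s1 3 i i = 0" using tab1 i2 by simp
  have hi2: "i < hi" "hi \<le> 2 * n + 1" using i2 by (auto simp: hi_def)
  define I where "I j s' \<longleftrightarrow> keep s s' \<and> nv s' 10 = x \<and> nv s' 11 = i \<and> nv s' 9 = hi \<and> nv s' 12 = j \<and>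
    (\<forall>a. i < a \<longrightarrow> a \<le> 2 * n \<longrightarrow> row_ok P T \<epsilon> n (2 * n + 1) s' a) \<and> row_ok P T \<epsilon> n j s' i" for j s'
  \<comment> \<open>Columns from \<open>hi\<close> on violate one of the bounds on \<open>j\<close>
    inside \<open>row_ok\<close>.\<close>
  have fin: "row_ok P T \<epsilon> n (2 * n + 1) s' i" if "row_ok P T \<epsilon> n hi s' i" for s'
    using that i2 unfolding row_ok_def hi_def by auto
  show "tot (For 12 (NAdd (NV 11) (NConst 1)) (NV 9) body_f) (run set_i s) ((2 * n + 2) * (body_time n N + 20))
    (\<lambda>s'. keep s s' \<and> nv s' 10 = x \<and> (\<forall>i. 2 * n < i + Suc x \<longrightarrow> i \<le> 2 * n \<longrightarrow> row_ok P T \<epsilon> n (2 * n + 1) s' i))"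
    unfolding s1_def[symmetric]
  proof (rule tot_For[where I = I and l = "i + 1" and h = hi and t = "body_time n N"])
    show "nval (NAdd (NV 11) (NConst 1)) s1 = i + 1" using v1 by simp
    show "I (i + 1) (snv 12 (i + 1) s1)" 
    proof -
      have "row_ok P T \<epsilon> n (i + 1) s1 i" using diag1 by (simp add: row_ok_def)
      then show ?thesis using k1 v1 done1 by (simp add: I_def)
    qed
    show "nv s' 12 = j \<and> nval (NV 9) s' = hi" if "I j s'" for j s' using that by (simp add: I_def)
    show "keep s s' \<and> nv s' 10 = x \<and> (\<forall>i. 2 * n < i + Suc x \<longrightarrow> i \<le> 2 * n \<longrightarrow> row_ok P T \<epsilon> n (2 * n + 1) s' i)"
      if "I hi s'" for s'
    proof -
      have "row_ok P T \<epsilon> n (2 * n + 1) s' a" if "2 * n < a + Suc x" "a \<le> 2 * n" for a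
      proof (cases "a = i")
        case True
        then show ?thesis using fin \<open>I hi s'\<close> by (simp add: I_def)
      next
        case False
        then have "i < a" using that i2 by linarith
        then show ?thesis using \<open>I hi s'\<close> that by (simp add: I_def)
      qed
      then show ?thesis using that by (simp add: I_def)
    qed
    show "(hi - (i + 1) + 1) * (body_time n N + ntime (NAdd (NV 11) (NConst 1)) + ntime (NV 9) + 14) \<le> (2 * n + 2) * (body_time n N + 20)"
      by (rule mult_le_mono) (use hi2 in \<open>simp_all add: NV_def\<close>)
    fix j s' assume j: "i + 1 \<le> j" "j < hi" and ij: "I j s'"
    have k': "keep s s'" using ij by (simp add: I_def)
    have ctx': "dctx n N P T s'" using dctx_keep[OF ctx k'] .
    have j2: "i < j" "j \<le> 2 * n" using j hi2 by auto
    have v: "nv s' 11 = i" "nv s' 12 = j" using ij by (simp_all add: I_def)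
    \<comment> \<open>The diagonal entry of column \<open>j\<close> belongs to row
      \<open>j > i\<close>, which is complete.\<close>
    have "row_ok P T \<epsilon> n (2 * n + 1) s' j" using ij j2 by (simp add: I_def)
    then have dj: "tab s' 3 j j = 0" by (simp add: row_ok_def)
    show "tot body_f s' (body_time n N) (\<lambda>s''. nv s'' 12 = j \<and> I (Suc j) (snv 12 (Suc j) s''))"
    proof (rule tot_mono[OF body_f_correct[OF ctx' j2 v \<epsilon> N dj]])
      fix s'' assume s'': "keep s' s'' \<and> (\<forall>k<13. nv s'' k = nv s' k) \<and>
        (\<forall>a b. a \<le> 2 * n \<longrightarrow> b \<le> 2 * n \<longrightarrow> (a, b) \<noteq> (i, j) \<longrightarrow> eqcell s' s'' a b) \<and> okB P T \<epsilon> s'' i j \<and> okA s'' i j"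
      then have eq: "eqcell s' s'' a b" if "a \<le> 2 * n" "b \<le> 2 * n" "(a, b) \<noteq> (i, j)" for a b using that by blast
      have k'': "keep s s''" using keep_trans[OF k'] s'' by blast
      have vv: "nv s'' 10 = x" "nv s'' 11 = i" "nv s'' 9 = hi" "nv s'' 12 = j" using s'' ij by (simp_all add: I_def)
      have r1: "row_ok P T \<epsilon> n (2 * n + 1) s'' a" if "i < a" "a \<le> 2 * n" for a
        by (rule row_ok_eqcell[of P T \<epsilon> n "2 * n + 1" s']) (use ij that eq in \<open>auto simp: I_def\<close>)
      have r2: "row_ok P T \<epsilon> n j s'' i"
        by (rule row_ok_eqcell[of P T \<epsilon> n j s']) (use ij j2 i2 eq in \<open>auto simp: I_def\<close>)
      have "row_ok P T \<epsilon> n (Suc j) s'' i"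
        using r2 s'' unfolding row_ok_def by (auto simp: less_Suc_eq)
      then show "nv s'' 12 = j \<and> I (Suc j) (snv 12 (Suc j) s'')"
        using k'' vv r1 by (simp add: I_def)
    qed simp
  qed (use hi2 in simp)
  show "loopfree set_i" by (simp add: set_i_def)
  show "ctime set_i + (2 * n + 2) * (body_time n N + 20) + 1 \<le> row_time n N" by (simp add: row_time_def)
qed

lemma fill_correct:
  assumes ctx: "dctx n N P T s" and \<epsilon>: "0 < \<epsilon>" "\<epsilon> \<le> 1" and N: "(7/9) ^ N < (\<epsilon>/4)\<^sup>2"
  shows "tot fill s (fill_time n N) (\<lambda>s'. keep s s' \<and> (\<forall>i \<le> 2 * n. row_ok P T \<epsilon> n (2 * n + 1) s' i))"
  unfolding fill_def
proof (rule tot_For[where l = 0 and h = "2 * n + 1" and t = "row_time n N" and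
      I = "\<lambda>x s'. keep s s' \<and> nv s' 10 = x \<and> (\<forall>i. 2 * n < i + x \<longrightarrow> i \<le> 2 * n \<longrightarrow> row_ok P T \<epsilon> n (2 * n + 1) s' i)"])
  have n: "nv s 0 = n" using ctx by (auto simp: dctx_def)
  show "nv s' 10 = x \<and> nval (NAdd NN (NConst 1)) s' = 2 * n + 1"
    if "keep s s' \<and> nv s' 10 = x \<and> (\<forall>i. 2 * n < i + x \<longrightarrow> i \<le> 2 * n \<longrightarrow> row_ok P T \<epsilon> n (2 * n + 1) s' i)" for x s'
    using that n by (simp add: NN_def keep_def)
  fix x s' assume x: "x < 2 * n + 1"
    and i: "keep s s' \<and> nv s' 10 = x \<and> (\<forall>i. 2 * n < i + x \<longrightarrow> i \<le> 2 * n \<longrightarrow> row_ok P T \<epsilon> n (2 * n + 1) s' i)"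
  have k: "keep s s'" using i by blast
  show "tot fill_row s' (row_time n N) (\<lambda>s''. nv s'' 10 = x \<and> keep s (snv 10 (Suc x) s'') \<and> nv (snv 10 (Suc x) s'') 10 = Suc x \<and>
    (\<forall>i. 2 * n < i + Suc x \<longrightarrow> i \<le> 2 * n \<longrightarrow> row_ok P T \<epsilon> n (2 * n + 1) (snv 10 (Suc x) s'') i))"
    by (rule tot_mono[OF fill_row_correct[OF dctx_keep[OF ctx k] _ _ \<epsilon> N]])
       (use i x keep_trans[OF k] in auto)
qed (auto simp: fill_time_def NN_def NV_def)

text \<open>Rows and columns contribute one factor each to the fifth power of the search.\<close>

lemma fill_time_bound: "\<exists>C. \<forall>n N. fill_time n N \<le> C * ((2 * n + 2) ^ 7 * (N + 1))"
proof (intro exI allI)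
  fix n N :: nat
  define X where "X = 2 * n + 2"
  define u where "u = X ^ 5 * (N + 1)"
  define cs where "cs = 2 * med_time + ctime set_f + ctime take_best + ctime cand_upd + 92"
  define cb where "cb = cs + ctime store_B + ctime store_A + (ctime upd_g + 22) + 3"
  have X1: "1 \<le> X" by (simp add: X_def)
  have Xu: "X \<le> u" "1 \<le> u"
  proof -
    have "X ^ 1 \<le> X ^ 5" using X1 by (rule power_increasing[rotated]) simp
    also have "\<dots> \<le> u" by (simp add: u_def)
    finally show "X \<le> u" by simp
    then show "1 \<le> u" using X1 by simp
  qed
  have s: "search_time n N = cs * u" by (simp add: search_time_def cs_def u_def X_def)
  have b: "body_time n N \<le> cb * u"
  proof -
    have "X * (ctime upd_g + 22) \<le> u * (ctime upd_g + 22)" using Xu by (intro mult_le_mono1)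
    moreover have "ctime store_B + ctime store_A + 3 \<le> (ctime store_B + ctime store_A + 3) * u" using Xu by simp
    ultimately have "body_time n N \<le> cs * u + (ctime store_B + ctime store_A + 3) * u + u * (ctime upd_g + 22)"
      unfolding body_time_def s X_def[symmetric] by linarith
    also have "\<dots> = cb * u" by (simp add: cb_def algebra_simps)
    finally show ?thesis .
  qed
  have r: "row_time n N \<le> (cb + 20 + ctime set_i + 1) * (X * u)"
  proof -
    have "1 \<le> X * u" using X1 Xu by simp
    then have "(ctime set_i + 1) * 1 \<le> (ctime set_i + 1) * (X * u)" by (rule mult_le_mono2)
    then have c: "ctime set_i + 1 \<le> (ctime set_i + 1) * (X * u)" by (simp only: mult_1_right)
    have "body_time n N + 20 \<le> (cb + 20) * u" using b Xu by (simp add: algebra_simps)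
    then have "X * (body_time n N + 20) \<le> X * ((cb + 20) * u)" by (rule mult_le_mono2)
    also have "\<dots> = (cb + 20) * (X * u)" by (simp only: mult.left_commute)
    finally have "row_time n N \<le> (cb + 20) * (X * u) + (ctime set_i + 1) * (X * u)"
      using c unfolding row_time_def X_def[symmetric] by linarith
    then show ?thesis by (simp add: algebra_simps)
  qed
  have "1 \<le> X * u" using X1 Xu by simp
  then have "row_time n N + 22 \<le> (cb + 20 + ctime set_i + 1) * (X * u) + 22 * (X * u)" using r by linarith
  also have "\<dots> = (cb + 20 + ctime set_i + 23) * (X * u)" by (simp add: algebra_simps)
  finally have "X * (row_time n N + 22) \<le> X * ((cb + 20 + ctime set_i + 23) * (X * u))" by (rule mult_le_mono2)
  also have "\<dots> = (cb + 20 + ctime set_i + 23) * (X ^ 7 * (N + 1))"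
  proof -
    have e: "X ^ 7 = X * (X * X ^ 5)" by (simp add: power_Suc[symmetric] del: power_Suc)
    show ?thesis unfolding e u_def by (simp only: mult_ac)
  qed
  finally show "fill_time n N \<le> (2 * med_time + ctime set_f + ctime take_best + ctime cand_upd + 92 + ctime store_B + ctime store_A + (ctime upd_g + 22) + 3 + 20 + ctime set_i + 23) * ((2 * n + 2) ^ 7 * (N + 1))"
    unfolding fill_time_def X_def[symmetric] cb_def cs_def by simp
qed

section \<open>Partial solutions during the readout\<close>

text \<open>The state of the top-down reconstruction. \<open>L k\<close> is zero if position
  \<open>k\<close> is not yet served and otherwise the number of its hub plus one. The unserved
  positions form disjoint intervals with starts \<open>St\<close> and ends \<open>En\<close>, none
  of them starting before \<open>x\<close>; the cost already realised and the table values of these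
  intervals add up to the total. Scanning positions from left to right and remembering intervals by
  their starts takes the place of a recursion stack.\<close>

definition partial_sol ::
  "(nat \<Rightarrow> nat \<Rightarrow> real) \<Rightarrow> (nat \<Rightarrow> point) \<Rightarrow> point \<Rightarrow> nat \<Rightarrow> nat \<Rightarrow> nat \<Rightarrow> real \<Rightarrow> nat \<Rightarrow> nat \<Rightarrow>
    (nat \<Rightarrow> nat) \<Rightarrow> (nat \<Rightarrow> point) \<Rightarrow> (nat \<Rightarrow> nat) \<Rightarrow> nat set \<Rightarrow> bool" where
  "partial_sol A P T n lo hi total_cost x m L pos En St \<longleftrightarrow>
     finite St \<and> St \<subseteq> {x..<hi} \<and> (\<forall>l\<in>St. l < En l \<and> En l \<le> hi) \<and>
     (\<forall>l\<in>St. \<forall>l'\<in>St. l \<noteq> l' \<longrightarrow> {l..<En l} \<inter> {l'..<En l'} = {}) \<and>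
     {k \<in> {lo..<hi}. L k = 0} = (\<Union>l\<in>St. {l..<En l}) \<and>
     (\<forall>k\<in>{lo..<hi}. L k \<noteq> 0 \<longrightarrow> n + 1 < L k \<and> L k \<le> m) \<and>
     (\<forall>v\<in>{n + 1..<m}. \<exists>k\<in>{lo..<hi}. L k = Suc v) \<and> n + 1 \<le> m \<and>
     (\<Sum>k\<in>{k \<in> {lo..<hi}. L k \<noteq> 0}. dist (pos (L k - 1)) (P k)) + (\<Sum>v\<in>{n + 1..<m}. dist (pos v) T) +
       (\<Sum>l\<in>St. A l (En l)) = total_cost"

lemma partial_solD:
  assumes "partial_sol A P T n lo hi total_cost x m L pos En St"
  shows "finite St" "St \<subseteq> {x..<hi}" "\<forall>l\<in>St. l < En l \<and> En l \<le> hi"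
    "\<forall>l\<in>St. \<forall>l'\<in>St. l \<noteq> l' \<longrightarrow> {l..<En l} \<inter> {l'..<En l'} = {}"
    "{k \<in> {lo..<hi}. L k = 0} = (\<Union>l\<in>St. {l..<En l})"
    "\<forall>k\<in>{lo..<hi}. L k \<noteq> 0 \<longrightarrow> n + 1 < L k \<and> L k \<le> m"
    "\<forall>v\<in>{n + 1..<m}. \<exists>k\<in>{lo..<hi}. L k = Suc v" "n + 1 \<le> m"
    "(\<Sum>k\<in>{k \<in> {lo..<hi}. L k \<noteq> 0}. dist (pos (L k - 1)) (P k)) + (\<Sum>v\<in>{n + 1..<m}. dist (pos v) T) +
       (\<Sum>l\<in>St. A l (En l)) = total_cost"
  using assms unfolding partial_sol_def by - (elim conjE, assumption)+

lemma partial_sol_init: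
  fixes lo hi :: nat
  assumes "lo < hi" "\<And>k. k \<in> {lo..<hi} \<Longrightarrow> L k = 0" "En lo = hi"
  shows "partial_sol A P T n lo hi (A lo hi) lo (n + 1) L pos En {lo}"
proof -
  have e: "{k \<in> {lo..<hi}. L k \<noteq> 0} = {}" "{k \<in> {lo..<hi}. L k = 0} = {lo..<hi}" using assms(2) by auto
  show ?thesis unfolding partial_sol_def e using assms by auto
qed

lemma partial_sol_skip:
  assumes "partial_sol A P T n lo hi total_cost x m L pos En St" "lo \<le> x" "x < hi" "L x \<noteq> 0"
  shows "partial_sol A P T n lo hi total_cost (Suc x) m L pos En St"
proof -
  have "x \<notin> St"
  proof
    assume x: "x \<in> St"
    then have "x < En x" using partial_solD(3)[OF assms(1)] by blast
    then have "x \<in> (\<Union>l\<in>St. {l..<En l})" using x by force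
    then have "L x = 0" using partial_solD(5)[OF assms(1)] by blast
    then show False using assms(4) by simp
  qed
  moreover have "St \<subseteq> {x..<hi}" using partial_solD(2)[OF assms(1)] .
  moreover have "{x..<hi} - {x} = {Suc x..<hi}" by auto
  ultimately have "St \<subseteq> {Suc x..<hi}" by blast
  then show ?thesis using assms(1) unfolding partial_sol_def by blast
qed

lemma partial_sol_done:
  assumes "partial_sol A P T n lo hi total_cost hi m L pos En St"
  shows "\<And>k. k \<in> {lo..<hi} \<Longrightarrow> n + 1 < L k \<and> L k \<le> m" "\<And>v. v \<in> {n + 1..<m} \<Longrightarrow> \<exists>k\<in>{lo..<hi}. L k = Suc v"
    "(\<Sum>k\<in>{lo..<hi}. dist (pos (L k - 1)) (P k)) + (\<Sum>v\<in>{n + 1..<m}. dist (pos v) T) = total_cost" "n + 1 \<le> m"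
proof -
  have St: "St = {}" using partial_solD(2)[OF assms] by simp
  then have e: "{k \<in> {lo..<hi}. L k = 0} = {}" using partial_solD(5)[OF assms] by simp
  then show "\<And>k. k \<in> {lo..<hi} \<Longrightarrow> n + 1 < L k \<and> L k \<le> m" using partial_solD(6)[OF assms] by blast
  have "L k \<noteq> 0" if "k \<in> {lo..<hi}" for k using e that by fastforce
  then have "{k \<in> {lo..<hi}. L k \<noteq> 0} = {lo..<hi}" by (intro set_eqI iffI) auto
  then show "(\<Sum>k\<in>{lo..<hi}. dist (pos (L k - 1)) (P k)) + (\<Sum>v\<in>{n + 1..<m}. dist (pos v) T) = total_cost"
    using partial_solD(9)[OF assms] St by simp
  show "\<And>v. v \<in> {n + 1..<m} \<Longrightarrow> \<exists>k\<in>{lo..<hi}. L k = Suc v" "n + 1 \<le> m"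
    using partial_solD(7,8)[OF assms] by blast+
qed

text \<open>The interval that contains the unserved position \<open>x\<close> cannot start before
  \<open>x\<close>, so it starts there.\<close>

lemma partial_sol_start:
  assumes "partial_sol A P T n lo hi total_cost x m L pos En St" "lo \<le> x" "x < hi" "L x = 0"
  shows "x \<in> St" "x < En x" "En x \<le> hi"
proof -
  have "x \<in> (\<Union>l\<in>St. {l..<En l})" using partial_solD(5)[OF assms(1), symmetric] assms(2-4) by simp
  then obtain l where l: "l \<in> St" "l \<le> x" "x < En l" by auto
  have "x \<le> l" using partial_solD(2)[OF assms(1)] l(1) by auto
  then have "l = x" using l by simp
  then show x: "x \<in> St" using l by simp
  then show "x < En x" "En x \<le> hi" using partial_solD(3)[OF assms(1)] by blast+
qed

text \<open>Empty intervals are not recorded: one may begin where another pending interval begins,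
  whose end must not be overwritten.\<close>

definition upd_if :: "nat \<Rightarrow> nat \<Rightarrow> (nat \<Rightarrow> nat) \<Rightarrow> nat \<Rightarrow> nat" where
  "upd_if a b E = (if a < b then E(a := b) else E)"

text \<open>The interval starting at \<open>x\<close> is replaced by a cluster, served by the new
  hub \<open>m\<close> at \<open>p\<close>, and up to three shorter intervals: the two gaps and the
  tail. The identity for \<open>A\<close> distributes the table value over these parts, so the total
  is unchanged.\<close>

lemma partial_sol_step:
  assumes ps: "partial_sol A P T n lo hi total_cost x m L pos En St" and x: "lo \<le> x" "x < hi" "L x = 0"
    and v: "valid_cut x b c d e f" and f: "f \<le> En x"
    and A: "A x (En x) = star P T (grp x b c d e f) p + A b c + A d e + A f (En x)"
    and A0: "\<And>k. k \<le> hi \<Longrightarrow> A k k = 0"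
  defines "G \<equiv> grp x b c d e f"
  shows "\<exists>St'. partial_sol A P T n lo hi total_cost (Suc x) (Suc m) (\<lambda>k. if k \<in> G then Suc m else L k)
    (pos(m := p)) (upd_if f (En x) (upd_if d e (upd_if b c En))) St'"
proof -
  define j where "j = En x"
  note start = partial_sol_start[OF ps x]
  have jh: "x < j" "j \<le> hi" using start by (simp_all add: j_def)
  have o: "x < b" "b \<le> c" "c \<le> d" "d \<le> e" "e \<le> f" "f \<le> j" using v f by (auto simp: valid_cut_def j_def)
  have fin: "finite St" and sub: "St \<subseteq> {x..<hi}" and En: "\<And>l. l \<in> St \<Longrightarrow> l < En l \<and> En l \<le> hi"
    and dj: "\<And>l l'. l \<in> St \<Longrightarrow> l' \<in> St \<Longrightarrow> l \<noteq> l' \<Longrightarrow> {l..<En l} \<inter> {l'..<En l'} = {}"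
    and pend: "{k \<in> {lo..<hi}. L k = 0} = (\<Union>l\<in>St. {l..<En l})"
    and Lr: "\<And>k. k \<in> {lo..<hi} \<Longrightarrow> L k \<noteq> 0 \<Longrightarrow> n + 1 < L k \<and> L k \<le> m"
    and hub: "\<And>v. v \<in> {n + 1..<m} \<Longrightarrow> \<exists>k\<in>{lo..<hi}. L k = Suc v" and m: "n + 1 \<le> m"
    and tot: "(\<Sum>k\<in>{k \<in> {lo..<hi}. L k \<noteq> 0}. dist (pos (L k - 1)) (P k)) + (\<Sum>v\<in>{n + 1..<m}. dist (pos v) T) +
       (\<Sum>l\<in>St. A l (En l)) = total_cost"
    using partial_solD[OF ps] by blast+
  let ?En = "upd_if f j (upd_if d e (upd_if b c En))"
  let ?L = "\<lambda>k. if k \<in> G then Suc m else L k"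
  define Nb where "Nb = (if b < c then {b} else {})"
  define Nd where "Nd = (if d < e then {d} else {})"
  define Nf where "Nf = (if f < j then {f} else {})"
  define R where "R = St - {x}"
  define N where "N = Nb \<union> Nd \<union> Nf"
  have Ge: "G = {x..<b} \<union> {c..<d} \<union> {e..<f}"
    unfolding G_def grp_def using o(1-5) by (intro set_eqI iffI; simp; linarith)
  have all: "{x..<j} = G \<union> ({b..<c} \<union> {d..<e} \<union> {f..<j})"
  proof -
    have "{x..<j} = {x..<b} \<union> {b..<c} \<union> {c..<d} \<union> {d..<e} \<union> {e..<f} \<union> {f..<j}"
      using o by (simp add: ivl_disj_un_two(3))
    then show ?thesis unfolding Ge by blast
  qed
  have Gdj: "G \<inter> ({b..<c} \<union> {d..<e} \<union> {f..<j}) = {}"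
    unfolding Ge using o by (simp add: Int_Un_distrib Int_Un_distrib2)
  have NE: "?En b = c" if "b < c" using that o by (simp add: upd_if_def)
  have NE2: "?En d = e" if "d < e" using that o by (simp add: upd_if_def)
  have NE3: "?En f = j" if "f < j" using that o by (simp add: upd_if_def)
  \<comment> \<open>The other pending intervals are disjoint from the one being resolved, and all
    recorded new starts lie inside the latter; so their ends are not touched.\<close>
  have RE: "?En l = En l \<and> l \<notin> {x..<j}" if "l \<in> R" for l
  proof -
    have l: "l \<in> St" "l \<noteq> x" using that by (auto simp: R_def)
    have "l \<in> {l..<En l}" using En[OF l(1)] by simp
    then have "l \<notin> {x..<j}" using dj[OF l(1) start(1) l(2)] unfolding j_def by blast
    moreover have "b \<noteq> l" if "b < c" using calculation that o by auto
    moreover have "d \<noteq> l" if "d < e" using calculation(1) that o by auto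
    moreover have "f \<noteq> l" if "f < j" using calculation(1) that o by auto
    ultimately show ?thesis by (auto simp: upd_if_def)
  qed
  have Nint: "(\<Union>l\<in>N. {l..<?En l}) = {b..<c} \<union> {d..<e} \<union> {f..<j}"
  proof -
    have "(\<Union>l\<in>Nb. {l..<?En l}) = {b..<c}" using NE by (simp add: Nb_def)
    moreover have "(\<Union>l\<in>Nd. {l..<?En l}) = {d..<e}" using NE2 by (simp add: Nd_def)
    moreover have "(\<Union>l\<in>Nf. {l..<?En l}) = {f..<j}" using NE3 by (simp add: Nf_def)
    ultimately show ?thesis unfolding N_def UN_Un by simp
  qed
  have Nsub: "N \<subseteq> {Suc x..<j}" unfolding N_def Nb_def Nd_def Nf_def using o by auto
  have NEn: "l < ?En l \<and> ?En l \<le> j \<and> x < l" if "l \<in> N" for l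
  proof -
    have "l = b \<and> b < c \<or> l = d \<and> d < e \<or> l = f \<and> f < j"
      using that unfolding N_def Nb_def Nd_def Nf_def by (auto split: if_splits)
    then show ?thesis
    proof (elim disjE conjE)
      assume "l = b" "b < c" then show ?thesis using NE o by simp
    next
      assume "l = d" "d < e" then show ?thesis using NE2 o by simp
    next
      assume "l = f" "f < j" then show ?thesis using NE3 o by simp
    qed
  qed
  have Ndj: "{l..<?En l} \<inter> {l'..<?En l'} = {}" if "l \<in> N" "l' \<in> N" "l \<noteq> l'" for l l'
  proof -
    have cs: "k = b \<and> ?En k = c \<or> k = d \<and> ?En k = e \<or> k = f \<and> ?En k = j" if "k \<in> N" for k
      using that NE NE2 NE3 unfolding N_def Nb_def Nd_def Nf_def by (auto split: if_splits)
    have dis: "{b..<c} \<inter> {d..<e} = {}" "{b..<c} \<inter> {f..<j} = {}" "{d..<e} \<inter> {f..<j} = {}" using o by auto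
    from cs[OF that(1)] cs[OF that(2)] show ?thesis
      by (elim disjE conjE; use that(3) dis in \<open>simp add: Int_commute\<close>)
  qed
  have RN: "R \<inter> N = {}" using RE Nsub by fastforce
  have "partial_sol A P T n lo hi total_cost (Suc x) (Suc m) ?L (pos(m := p)) ?En (R \<union> N)"
    unfolding partial_sol_def
  proof (intro conjI ballI impI)
    show "finite (R \<union> N)" using fin by (simp add: R_def N_def Nb_def Nd_def Nf_def)
    show "R \<union> N \<subseteq> {Suc x..<hi}"
    proof
      fix l assume "l \<in> R \<union> N"
      then show "l \<in> {Suc x..<hi}"
      proof
        assume "l \<in> R"
        then have "l \<in> {x..<hi}" "l \<noteq> x" using sub by (auto simp: R_def)
        then show ?thesis by auto
      next
        assume "l \<in> N"
        then show ?thesis using Nsub jh by auto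
      qed
    qed
    fix l assume l: "l \<in> R \<union> N"
    have "l < ?En l \<and> ?En l \<le> hi"
    proof (cases "l \<in> R")
      case True
      then have "l \<in> St" by (simp add: R_def)
      then show ?thesis using RE[OF True] En by simp
    next
      case False
      then have "l \<in> N" using l by blast
      then show ?thesis using NEn[of l] jh by linarith
    qed
    then show "l < ?En l" "?En l \<le> hi" by blast+
    fix l' assume l': "l' \<in> R \<union> N" "l \<noteq> l'"
    have RNd: "{r..<?En r} \<inter> {k..<?En k} = {}" if "r \<in> R" "k \<in> N" for r k
    proof -
      have r: "r \<in> St" "r \<noteq> x" using that by (auto simp: R_def)
      have "{r..<En r} \<inter> {x..<j} = {}" using dj[OF r(1) start(1) r(2)] by (simp add: j_def)
      moreover have "{k..<?En k} \<subseteq> {x..<j}" using NEn[OF that(2)] by auto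
      ultimately show ?thesis using RE[OF that(1)] by auto
    qed
    show "{l..<?En l} \<inter> {l'..<?En l'} = {}"
    proof (cases "l \<in> R")
      case lR: True
      show ?thesis
      proof (cases "l' \<in> R")
        case True
        have "l \<in> St" "l' \<in> St" using lR True by (simp_all add: R_def)
        then have "{l..<En l} \<inter> {l'..<En l'} = {}" by (rule dj) (use l' in simp)
        then show ?thesis using RE[OF lR] RE[OF True] by simp
      next
        case False
        then show ?thesis using RNd[OF lR] l' by blast
      qed
    next
      case False
      then have lN: "l \<in> N" using l by blast
      show ?thesis
      proof (cases "l' \<in> R")
        case True
        then show ?thesis using RNd[OF True lN] by blast
      next
        case False
        then show ?thesis using Ndj[OF lN] l' by blast
      qed
    qed
  next
    have St: "St = insert x R" using start(1) by (auto simp: R_def)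
    have U: "(\<Union>l\<in>St. {l..<En l}) = {x..<j} \<union> (\<Union>l\<in>R. {l..<En l})" unfolding St by (simp add: j_def)
    have UR: "(\<Union>l\<in>R. {l..<?En l}) = (\<Union>l\<in>R. {l..<En l})" using RE by simp
    have GR: "G \<inter> (\<Union>l\<in>R. {l..<En l}) = {}"
    proof -
      have "{l..<En l} \<inter> {x..<j} = {}" if "l \<in> R" for l using dj[of l x] start(1) that by (simp add: R_def j_def)
      then show ?thesis using all by blast
    qed
    have "{k \<in> {lo..<hi}. ?L k = 0} = {k \<in> {lo..<hi}. L k = 0} - G" by auto
    also have "\<dots> = ({b..<c} \<union> {d..<e} \<union> {f..<j}) \<union> (\<Union>l\<in>R. {l..<En l})"
      unfolding pend U all using Gdj GR by blast
    also have "\<dots> = (\<Union>l\<in>R \<union> N. {l..<?En l})" using UR Nint by auto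
    finally show "{k \<in> {lo..<hi}. ?L k = 0} = (\<Union>l\<in>R \<union> N. {l..<?En l})" .
    have Gsub: "G \<subseteq> {k \<in> {lo..<hi}. L k = 0}" unfolding pend U all by blast
    show "n + 1 < ?L k" "?L k \<le> Suc m" if "k \<in> {lo..<hi}" "?L k \<noteq> 0" for k
      using that Lr[of k] m by (auto split: if_splits)
    show "\<exists>k\<in>{lo..<hi}. ?L k = Suc v" if vv: "v \<in> {n + 1..<Suc m}" for v
    proof (cases "v = m")
      case True
      have "x \<in> G" unfolding Ge using o by simp
      then show ?thesis using True x by auto
    next
      case False
      then obtain k where k: "k \<in> {lo..<hi}" "L k = Suc v" using hub[of v] vv by auto
      then have "k \<notin> G" using Gsub by auto
      then show ?thesis using k by auto
    qed
    show "n + 1 \<le> Suc m" using m by simp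
    have s1: "{k \<in> {lo..<hi}. ?L k \<noteq> 0} = {k \<in> {lo..<hi}. L k \<noteq> 0} \<union> G" using Gsub by auto
    have finG: "finite G" by (simp add: G_def)
    have "(\<Sum>k\<in>{k \<in> {lo..<hi}. ?L k \<noteq> 0}. dist ((pos(m := p)) (?L k - 1)) (P k)) =
      (\<Sum>k\<in>{k \<in> {lo..<hi}. L k \<noteq> 0}. dist ((pos(m := p)) (?L k - 1)) (P k)) + (\<Sum>k\<in>G. dist ((pos(m := p)) (?L k - 1)) (P k))"
      unfolding s1 by (rule sum.union_disjoint) (use Gsub finG in auto)
    also have "(\<Sum>k\<in>{k \<in> {lo..<hi}. L k \<noteq> 0}. dist ((pos(m := p)) (?L k - 1)) (P k)) =
      (\<Sum>k\<in>{k \<in> {lo..<hi}. L k \<noteq> 0}. dist (pos (L k - 1)) (P k))"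
    proof (rule sum.cong[OF refl])
      fix k assume k: "k \<in> {k \<in> {lo..<hi}. L k \<noteq> 0}"
      then have "k \<notin> G" "L k \<le> m" "L k \<noteq> 0" using Gsub Lr[of k] by auto
      then show "dist ((pos(m := p)) (?L k - 1)) (P k) = dist (pos (L k - 1)) (P k)" by auto
    qed
    also have "(\<Sum>k\<in>G. dist ((pos(m := p)) (?L k - 1)) (P k)) = (\<Sum>k\<in>G. dist p (P k))"
      by (rule sum.cong) auto
    finally have c1: "(\<Sum>k\<in>{k \<in> {lo..<hi}. ?L k \<noteq> 0}. dist ((pos(m := p)) (?L k - 1)) (P k)) =
      (\<Sum>k\<in>{k \<in> {lo..<hi}. L k \<noteq> 0}. dist (pos (L k - 1)) (P k)) + (\<Sum>k\<in>G. dist p (P k))" .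
    have "{n + 1..<Suc m} = insert m {n + 1..<m}" using m by auto
    then have c2: "(\<Sum>v\<in>{n + 1..<Suc m}. dist ((pos(m := p)) v) T) = (\<Sum>v\<in>{n + 1..<m}. dist (pos v) T) + dist p T"
      by simp
    have "(\<Sum>l\<in>N. A l (?En l)) = (\<Sum>l\<in>Nb. A l (?En l)) + (\<Sum>l\<in>Nd. A l (?En l)) + (\<Sum>l\<in>Nf. A l (?En l))"
    proof -
      have "Nb \<inter> Nd = {}" "(Nb \<union> Nd) \<inter> Nf = {}" "finite Nb" "finite Nd" "finite Nf"
        using o unfolding Nb_def Nd_def Nf_def by auto
      then show ?thesis unfolding N_def by (simp add: sum.union_disjoint)
    qed
    \<comment> \<open>An empty gap leaves no pending interval, which agrees with its table value
      zero.\<close>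
    also have "(\<Sum>l\<in>Nb. A l (?En l)) = A b c"
      using NE A0[of b] o jh by (cases "b < c") (auto simp: Nb_def)
    also have "(\<Sum>l\<in>Nd. A l (?En l)) = A d e"
      using NE2 A0[of d] o jh by (cases "d < e") (auto simp: Nd_def)
    also have "(\<Sum>l\<in>Nf. A l (?En l)) = A f j"
      using NE3 A0[of f] o jh by (cases "f < j") (auto simp: Nf_def)
    finally have cN: "(\<Sum>l\<in>N. A l (?En l)) = A b c + A d e + A f j" .
    have "(\<Sum>l\<in>R \<union> N. A l (?En l)) = (\<Sum>l\<in>R. A l (?En l)) + (\<Sum>l\<in>N. A l (?En l))"
      by (rule sum.union_disjoint) (use RN fin in \<open>auto simp: R_def N_def Nb_def Nd_def Nf_def\<close>)
    also have "(\<Sum>l\<in>R. A l (?En l)) = (\<Sum>l\<in>R. A l (En l))" using RE by (intro sum.cong) auto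
    finally have c3: "(\<Sum>l\<in>R \<union> N. A l (?En l)) = (\<Sum>l\<in>R. A l (En l)) + (A b c + A d e + A f j)" unfolding cN .
    have "(\<Sum>l\<in>St. A l (En l)) = A x j + (\<Sum>l\<in>R. A l (En l))"
      using sum.remove[OF fin start(1), of "\<lambda>l. A l (En l)"] by (simp add: R_def j_def)
    then show "(\<Sum>k\<in>{k \<in> {lo..<hi}. ?L k \<noteq> 0}. dist ((pos(m := p)) (?L k - 1)) (P k)) +
      (\<Sum>v\<in>{n + 1..<Suc m}. dist ((pos(m := p)) v) T) + (\<Sum>l\<in>R \<union> N. A l (?En l)) = total_cost"
      unfolding c1 c2 c3 using tot A unfolding star_def G_def[symmetric] j_def[symmetric] by linarith
  qed
  then show ?thesis unfolding j_def by blast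
qed

text \<open>Sorting by counting: for a strict total order the number of smaller elements is
  injective, and an injection of a finite set into itself is onto.\<close>

lemma rank_bij:
  fixes lt :: "nat \<Rightarrow> nat \<Rightarrow> bool" and n :: nat
  assumes irr: "\<And>v. \<not> lt v v" and tr: "\<And>u v w. lt u v \<Longrightarrow> lt v w \<Longrightarrow> lt u w"
    and total: "\<And>u v. u \<noteq> v \<Longrightarrow> lt u v \<or> lt v u"
  defines "rk \<equiv> \<lambda>v. card {w \<in> {..<n}. lt w v}"
  shows "bij_betw rk {..<n} {..<n}" "\<And>u v. u < n \<Longrightarrow> v < n \<Longrightarrow> rk u < rk v \<Longrightarrow> lt u v"
proof -
  have mono: "rk u < rk v" if "lt u v" "u < n" for u v
  proof -
    have "{w \<in> {..<n}. lt w u} \<subseteq> {w \<in> {..<n}. lt w v}" using that tr by blast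
    moreover have "u \<in> {w \<in> {..<n}. lt w v}" "u \<notin> {w \<in> {..<n}. lt w u}" using that irr by auto
    ultimately have "{w \<in> {..<n}. lt w u} \<subset> {w \<in> {..<n}. lt w v}" by blast
    then show ?thesis unfolding rk_def by (intro psubset_card_mono) auto
  qed
  have inj: "inj_on rk {..<n}"
  proof (rule inj_onI, rule ccontr)
    fix u v assume "u \<in> {..<n}" "v \<in> {..<n}" "rk u = rk v" "u \<noteq> v"
    then show False using total[of u v] mono[of u v] mono[of v u] by auto
  qed
  have lt: "rk v < n" if "v < n" for v
  proof -
    have "{w \<in> {..<n}. lt w v} \<subset> {..<n}" using that irr by auto
    then have "card {w \<in> {..<n}. lt w v} < card {..<n}" by (intro psubset_card_mono) auto
    then show ?thesis by (simp add: rk_def)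
  qed
  have "rk ` {..<n} = {..<n}"
    by (rule card_subset_eq) (use lt card_image[OF inj] in auto)
  then show "bij_betw rk {..<n} {..<n}" using inj by (simp add: bij_betw_def)
  show "lt u v" if "u < n" "v < n" "rk u < rk v" for u v
  proof (rule ccontr)
    assume "\<not> lt u v"
    then have "u = v \<or> lt v u" using total by blast
    then show False using that mono[of v u] by auto
  qed
qed

subsection \<open>Extracting the layout\<close>

lemma get_tab_sinp [simp]:
  "a < nv s 5 \<Longrightarrow> tab (sinp a z s) q i j = tab s q i j" "ntab (sinp a z s) q i j = ntab s q i j"
  by (simp_all add: tab_def ntab_def del: ra_tab na_ntab)

definition total_val :: rexp where "total_val = RA 3 (AT (NV 10) (NAdd (NV 10) (NV 0)))"

definition pick_upd :: com where
  "pick_upd = Cond (RLess total_val (RV 13)) (seqs [SRV 13 total_val, SNV 11 (NV 10)]) Skip"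

definition pick_init :: com where
  "pick_init = seqs [SNV 10 (NConst 0), SNV 11 (NConst 0), SRV 13 total_val]"

definition pick :: com where
  "pick = Seq pick_init (For 10 (NConst 0) (NV 0) pick_upd)"

definition "pick_time = ctime pick_init + ctime pick_upd + 25"

lemma pick_correct:
  assumes n: "nv s 0 = n" "n \<ge> 1"
  shows "tot pick s (pick_time * (n + 1)) (\<lambda>s'. frame 10 13 s s' \<and> nv s' 11 < n \<and>
    (\<forall>c<n. tab s 3 (nv s' 11) (nv s' 11 + n) \<le> tab s 3 c (c + n)))"
  unfolding pick_def
proof (rule tot_run_Seq)
  show "loopfree pick_init" by (simp add: pick_init_def)
  define J where "J s' \<longleftrightarrow> frame 10 13 s s' \<and> nv s' 11 < n \<and> rv s' 13 = tab s 3 (nv s' 11) (nv s' 11 + n)" for s'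
  let ?s1 = "run pick_init s"
  have "tot (For 10 (NConst 0) (NV 0) pick_upd) ?s1 ((n - 0 + 1) * (ctime pick_upd + 20)) (\<lambda>s'. J s' \<and> rv s' 13 \<le> rv ?s1 13 \<and>
    (\<forall>c. 0 \<le> c \<longrightarrow> c < n \<longrightarrow> rv s' 13 \<le> tab s 3 c (c + n)))"
  proof (rule tot_For_search[where l = 0 and h = n and t = "ctime pick_upd"])
    show "J ?s1" using n by (simp add: J_def pick_init_def total_val_def)
    show "nval (NV 0) s' = n" if "J s'" for s' using that n frame_get(1)[of 10 13 s s' 0] by (simp add: J_def)
    show "J (snv 10 x s')" if "J s'" for x s' using that by (simp add: J_def)
    show "(n - 0 + 1) * (ctime pick_upd + ntime (NConst 0) + ntime (NV 0) + 14) \<le> (n - 0 + 1) * (ctime pick_upd + 20)"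
      by (rule mult_le_mono) (simp_all add: NV_def)
    fix c s' assume c: "c < n" and j: "J s'" "nv s' 10 = c"
    have fr: "frame 10 13 s s'" using j by (simp add: J_def)
    have v: "rval total_val s' = tab s 3 c (c + n)"
      using frame_tab(1)[OF fr] frame_get(1)[OF fr, of 0] j n by (simp add: total_val_def)
    show "tot pick_upd s' (ctime pick_upd) (\<lambda>s''. J s'' \<and> nv s'' 10 = c \<and> rv s'' 13 \<le> rv s' 13 \<and>
      rv s'' 13 \<le> tab s 3 c (c + n))"
    proof (rule tot_run)
      show "loopfree pick_upd" by (simp add: pick_upd_def)
      show "J (run pick_upd s') \<and> nv (run pick_upd s') 10 = c \<and> rv (run pick_upd s') 13 \<le> rv s' 13 \<and>
        rv (run pick_upd s') 13 \<le> tab s 3 c (c + n)"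
      proof (cases "rval total_val s' < rv s' 13")
        case True
        then have "run pick_upd s' = snv 11 c (srv 13 (tab s 3 c (c + n)) s')"
          using j v by (simp add: pick_upd_def)
        then show ?thesis using True j c v fr by (simp add: J_def)
      next
        case False
        then have "run pick_upd s' = s'" by (simp add: pick_upd_def)
        then show ?thesis using False j v by simp
      qed
    qed simp
  qed (use n in auto)
  then show "tot (For 10 (NConst 0) (NV 0) pick_upd) ?s1 ((n + 1) * (ctime pick_upd + 20)) (\<lambda>s'. frame 10 13 s s' \<and> nv s' 11 < n \<and>
    (\<forall>c<n. tab s 3 (nv s' 11) (nv s' 11 + n) \<le> tab s 3 c (c + n)))"
    by (rule tot_mono) (auto simp: J_def)
  have "ctime pick_init + 1 \<le> (n + 1) * (ctime pick_init + 5)" by simp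
  moreover have "pick_time * (n + 1) = (n + 1) * (ctime pick_init + 5) + (n + 1) * (ctime pick_upd + 20)"
    by (simp add: pick_time_def algebra_simps)
  ultimately show "ctime pick_init + (n + 1) * (ctime pick_upd + 20) + 1 \<le> pick_time * (n + 1)" by linarith
qed

text \<open>The readout fills natural array 0, the parent buffer, and array 8, the ends of
  intervals. It also writes hub coordinates into real cells beyond the input, so only the cells up
  to \<open>2 n + 2\<close> are kept.\<close>

definition xkeep :: "nat \<Rightarrow> ram_state \<Rightarrow> ram_state \<Rightarrow> bool" where
  "xkeep n s s' \<longleftrightarrow> nv s' 0 = nv s 0 \<and> nv s' 5 = nv s 5 \<and> (\<forall>q<16. q \<notin> {0, 8} \<longrightarrow> (\<forall>i. na s' q i = na s q i)) \<and>
     (\<forall>q<16. \<forall>i. ra s' q i = ra s q i) \<and> (\<forall>a\<le>2 * n + 2. inp s' a = inp s a)"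

lemma xkeep_tab: "xkeep n s s' \<Longrightarrow> q < 16 \<Longrightarrow> tab s' q i j = tab s q i j"
  "xkeep n s s' \<Longrightarrow> q < 16 \<Longrightarrow> q \<notin> {0, 8} \<Longrightarrow> ntab s' q i j = ntab s q i j"
  by (simp_all add: tab_def ntab_def xkeep_def del: ra_tab na_ntab)

text \<open>Hub coordinates go to their final place at once, whereas parents are buffered with an
  offset of one, so that zero means unassigned. The last store makes the sink \<open>n\<close> the
  parent of the new hub.\<close>

definition ext_a :: com where
  "ext_a = seqs [SNV 13 (NA 8 (NV 10)), SNV 14 (NA 7 (AT (NV 10) (NV 13))),
     SNV 17 (NA 3 (AT (NV 10) (NV 14))), SNV 18 (NA 4 (AT (NV 10) (NV 14))),
     SNV 19 (NA 5 (AT (NV 10) (NV 14))), SNV 20 (NA 6 (AT (NV 10) (NV 14))),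
     SRI (NAdd (NAdd (NV 12) (NV 12)) (NConst 1)) (RA 5 (AT (NV 10) (NV 14))),
     SRI (NAdd (NAdd (NV 12) (NV 12)) (NConst 2)) (RA 6 (AT (NV 10) (NV 14))),
     SNA 0 (NV 12) (NAdd (NV 0) (NConst 1))]"

definition ext_mark :: com where
  "ext_mark = Cond (in_grp (NV 21)) (SNA 0 (NA 9 (NV 21)) (NAdd (NV 12) (NConst 1))) Skip"

definition ext_b :: com where
  "ext_b = seqs [Cond (NLess (NV 17) (NV 18)) (SNA 8 (NV 17) (NV 18)) Skip,
     Cond (NLess (NV 19) (NV 20)) (SNA 8 (NV 19) (NV 20)) Skip,
     Cond (NLess (NV 14) (NV 13)) (SNA 8 (NV 14) (NV 13)) Skip,
     SNV 12 (NAdd (NV 12) (NConst 1))]"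

definition ext_proc :: com where
  "ext_proc = Seq ext_a (Seq (For 21 (NV 10) (NV 14) ext_mark) ext_b)"

definition ext_body :: com where
  "ext_body = Cond (NLess (NA 0 (NA 9 (NV 10))) (NConst 1)) ext_proc Skip"

text \<open>The sink has no parent, but gets a nonzero buffer entry: otherwise the copy loop would
  stop at it.\<close>

definition ext_init :: com where
  "ext_init = seqs [SNV 12 (NAdd (NV 0) (NConst 1)), SNA 0 (NV 0) (NConst 1), SNA 8 (NV 11) (NAdd (NV 11) (NV 0))]"

definition readout :: com where
  "readout = Seq ext_init (For 10 (NV 11) (NAdd (NV 11) (NV 0)) ext_body)"

lemma partial_sol_cong:
  assumes "partial_sol A P T n lo hi total_cost x m L pos En St" "\<And>k. k \<in> {lo..<hi} \<Longrightarrow> L' k = L k"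
  shows "partial_sol A P T n lo hi total_cost x m L' pos En St"
proof -
  have e: "{k \<in> {lo..<hi}. L' k = 0} = {k \<in> {lo..<hi}. L k = 0}" "{k \<in> {lo..<hi}. L' k \<noteq> 0} = {k \<in> {lo..<hi}. L k \<noteq> 0}"
    using assms(2) by auto
  have s: "(\<Sum>k\<in>{k \<in> {lo..<hi}. L k \<noteq> 0}. dist (pos (L' k - 1)) (P k)) = (\<Sum>k\<in>{k \<in> {lo..<hi}. L k \<noteq> 0}. dist (pos (L k - 1)) (P k))"
    by (rule sum.cong) (use assms(2) in auto)
  note D = partial_solD[OF assms(1)]
  have 6: "\<forall>k\<in>{lo..<hi}. L' k \<noteq> 0 \<longrightarrow> n + 1 < L' k \<and> L' k \<le> m" using D(6) assms(2) by simp
  have 7: "\<forall>v\<in>{n + 1..<m}. \<exists>k\<in>{lo..<hi}. L' k = Suc v" using D(7) assms(2) by metis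
  show ?thesis unfolding partial_sol_def e s
    by (intro conjI; fact D(1) D(2) D(3) D(4) D(5) 6 7 D(8) D(9))
qed

lemma mark_correct:
  assumes v: "nv s 10 = x" "nv s 14 = f" "nv s 17 = b" "nv s 18 = c" "nv s 19 = d" "nv s 20 = e" "nv s 12 = m"
    and xf: "x \<le> f"
  defines "G \<equiv> grp x b c d e f"
  shows "tot (For 21 (NV 10) (NV 14) ext_mark) s ((f - x + 1) * (ctime ext_mark + 18)) (\<lambda>s'.
    (\<forall>k<21. nv s' k = nv s k) \<and> (\<forall>q<16. q \<noteq> 0 \<longrightarrow> (\<forall>i. na s' q i = na s q i)) \<and> (\<forall>q<16. \<forall>i. ra s' q i = ra s q i) \<and>
    (\<forall>a. inp s' a = inp s a) \<and> (\<forall>w. na s' 0 w = (if w \<in> na s 9 ` G then Suc m else na s 0 w)))"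
proof -
  define I where "I k s' \<longleftrightarrow> nv s' 21 = k \<and> (\<forall>k<21. nv s' k = nv s k) \<and> (\<forall>q<16. q \<noteq> 0 \<longrightarrow> (\<forall>i. na s' q i = na s q i)) \<and>
    (\<forall>q<16. \<forall>i. ra s' q i = ra s q i) \<and> (\<forall>a. inp s' a = inp s a) \<and>
    (\<forall>w. na s' 0 w = (if w \<in> na s 9 ` (G \<inter> {..<k}) then Suc m else na s 0 w))" for k s'
  have G0: "G \<inter> {..<x} = {}" "G \<inter> {..<f} = G" by (auto simp: G_def grp_def)
  show ?thesis
  proof (rule tot_For[where I = I and l = x and h = f and t = "ctime ext_mark"])
    show "I x (snv 21 x s)" by (simp add: I_def G0)
    show "nv s' 21 = k \<and> nval (NV 14) s' = f" if "I k s'" for k s' using that v by (simp add: I_def)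
    show "(f - x + 1) * (ctime ext_mark + ntime (NV 10) + ntime (NV 14) + 14) \<le> (f - x + 1) * (ctime ext_mark + 18)"
      by (simp add: NV_def)
    fix k s' assume k: "x \<le> k" "k < f" and i: "I k s'"
    have vv: "nv s' 17 = b" "nv s' 18 = c" "nv s' 19 = d" "nv s' 20 = e" "nv s' 21 = k" "nv s' 12 = m"
      using i v by (simp_all add: I_def)
    have inG: "bval (in_grp (NV 21)) s' \<longleftrightarrow> k \<in> G"
      using k by (auto simp: in_grp_def G_def grp_def vv)
    have p: "na s' 9 k = na s 9 k" using i by (simp add: I_def)
    have GS: "G \<inter> {..<Suc k} = (if k \<in> G then insert k (G \<inter> {..<k}) else G \<inter> {..<k})"
      by (auto simp: less_Suc_eq)
    show "tot ext_mark s' (ctime ext_mark) (\<lambda>s''. nv s'' 21 = k \<and> I (Suc k) (snv 21 (Suc k) s''))"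
    proof (rule tot_run)
      show "loopfree ext_mark" by (simp add: ext_mark_def)
      show "nv (run ext_mark s') 21 = k \<and> I (Suc k) (snv 21 (Suc k) (run ext_mark s'))"
      proof (cases "k \<in> G")
        case True
        then have "run ext_mark s' = sna 0 (na s 9 k) (Suc m) s'" using inG by (simp add: ext_mark_def vv p)
        then show ?thesis using i vv True by (simp add: I_def GS)
      next
        case False
        then have "run ext_mark s' = s'" using inG by (simp add: ext_mark_def)
        then show ?thesis using i vv False by (simp add: I_def GS)
      qed
    qed simp
  qed (use v xf in \<open>auto simp: I_def G0\<close>)
qed

text \<open>The inequality for variable 12 says that at most one hub is opened per scanned position.
  It keeps the hub coordinates in front of the working memory, which begins at
  \<open>4 n + 8\<close>.\<close>

definition ext_inv where
  "ext_inv P T n c0 s0 x s' \<longleftrightarrow> xkeep n s0 s' \<and> nv s' 11 = c0 \<and> nv s' 10 = x \<and> nv s' 12 + c0 \<le> n + 1 + x \<and>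
     na s' 0 n = 1 \<and> (\<forall>v\<in>{n + 1..<nv s' 12}. na s' 0 v = n + 1) \<and> (\<forall>v\<ge>nv s' 12. na s' 0 v = 0) \<and>
     (\<exists>St. partial_sol (tab s0 3) P T n c0 (c0 + n) (tab s0 3 c0 (c0 + n)) x (nv s' 12) (\<lambda>k. na s' 0 (na s0 9 k))
       (\<lambda>v. (inp s' (2 * v + 1), inp s' (2 * v + 2))) (na s' 8) St)"

definition "ext_time = ctime ext_a + ctime ext_b + ctime ext_mark + btime (NLess (NA 0 (NA 9 (NV 10))) (NConst 1)) + 25"

lemma ext_body_correct:
  assumes n: "nv s0 0 = n" "nv s0 5 = 4 * n + 8" "c0 < n"
    and ok: "\<And>i. i \<le> 2 * n \<Longrightarrow> row_ok P T \<epsilon> n (2 * n + 1) s0 i"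
    and perm: "\<And>k. k < 2 * n \<Longrightarrow> na s0 9 k < n" "inj_on (na s0 9) {c0..<c0 + n}"
    and inv: "ext_inv P T n c0 s0 x s" and x: "c0 \<le> x" "x < c0 + n"
  shows "tot ext_body s (ext_time * (2 * n + 1)) (\<lambda>s'. nv s' 10 = x \<and> ext_inv P T n c0 s0 (Suc x) (snv 10 (Suc x) s'))"
proof -
  let ?A = "tab s0 3" and ?hi = "c0 + n"
  let ?L = "\<lambda>k. na s 0 (na s0 9 k)" and ?pos = "\<lambda>v. (inp s (2 * v + 1), inp s (2 * v + 2))"
  define m where "m = nv s 12"
  have xk: "xkeep n s0 s" and v: "nv s 11 = c0" "nv s 10 = x" and m1: "m + c0 \<le> n + 1 + x"
    and pn: "na s 0 n = 1" "\<And>v. v \<in> {n + 1..<m} \<Longrightarrow> na s 0 v = n + 1" "\<And>v. v \<ge> m \<Longrightarrow> na s 0 v = 0"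
    using inv by (auto simp: ext_inv_def m_def)
  obtain St where ps: "partial_sol ?A P T n c0 ?hi (?A c0 ?hi) x m ?L ?pos (na s 8) St"
    using inv by (auto simp: ext_inv_def m_def)
  have nm: "n + 1 \<le> m" using partial_solD(8)[OF ps] .
  have m2: "m \<le> 2 * n" using m1 x by linarith
  have s9: "na s 9 k = na s0 9 k" for k using xk by (simp add: xkeep_def)
  have s5: "nv s 5 = 4 * n + 8" "nv s 0 = n" using xk n by (simp_all add: xkeep_def)
  have bt: "bval (NLess (NA 0 (NA 9 (NV 10))) (NConst 1)) s \<longleftrightarrow> ?L x = 0" using v by (simp add: s9)
  show ?thesis unfolding ext_body_def
  proof (rule tot_Cond)
    assume "\<not> bval (NLess (NA 0 (NA 9 (NV 10))) (NConst 1)) s"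
    then have "?L x \<noteq> 0" using bt by simp
    moreover have "na (snv 10 (Suc x) s) 8 = na s 8" by (intro ext) simp
    ultimately have "ext_inv P T n c0 s0 (Suc x) (snv 10 (Suc x) s)"
      using inv partial_sol_skip[OF ps x] unfolding ext_inv_def by (auto simp: m_def xkeep_def)
    then show "tot Skip s ((ctime ext_a + ctime ext_b + ctime ext_mark + 23) * (2 * n + 1)) (\<lambda>s'. nv s' 10 = x \<and> ext_inv P T n c0 s0 (Suc x) (snv 10 (Suc x) s'))"
      by (intro tot_run) (use v in simp_all)
  next
    assume "bval (NLess (NA 0 (NA 9 (NV 10))) (NConst 1)) s"
    then have L0: "?L x = 0" using bt by simp
    note start = partial_sol_start[OF ps x L0]
    define j where "j = na s 8 x"
    have j: "x < j" "j \<le> c0 + n" using start by (simp_all add: j_def)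
    have x2: "x \<le> 2 * n" "j \<le> 2 * n" "j \<le> x + n" using j x n by linarith+
    have okA: "okA s0 x j" using ok[OF x2(1)] j x2 by (simp add: row_ok_def)
    define f where "f = ntab s0 7 x j"
    have f: "x < f" "f \<le> j" "?A x j = tab s0 4 x f + ?A f j" using okA by (simp_all add: okA_def f_def)
    have okB: "okB P T \<epsilon> s0 x f" using ok[OF x2(1)] f x2 by (simp add: row_ok_def)
    define b c d e where "b = ntab s0 3 x f" and "c = ntab s0 4 x f" and "d = ntab s0 5 x f" and "e = ntab s0 6 x f"
    define p where "p = (tab s0 5 x f, tab s0 6 x f)"
    have vc: "valid_cut x b c d e f" and B: "tab s0 4 x f = star P T (grp x b c d e f) p + ?A b c + ?A d e"
      using okB by (simp_all add: okB_def sound_cut_def b_def c_def d_def e_def p_def)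
    define G where "G = grp x b c d e f"
    have Gw: "G \<subseteq> {c0..<?hi}" using f j x by (auto simp: G_def grp_def)
    define s1 where "s1 = run ext_a s"
    have s1': "s1 = sna 0 m (n + 1) (sinp (2 * m + 2) (snd p) (sinp (2 * m + 1) (fst p)
       (snv 20 e (snv 19 d (snv 18 c (snv 17 b (snv 14 f (snv 13 j s))))))))"
      unfolding s1_def ext_a_def
      using v s5 m2 by (simp add: xkeep_tab[OF xk] j_def[symmetric] f_def[symmetric] b_def[symmetric] c_def[symmetric]
          d_def[symmetric] e_def[symmetric] m_def[symmetric] p_def mult_2)
    have g1: "nv s1 10 = x" "nv s1 14 = f" "nv s1 17 = b" "nv s1 18 = c" "nv s1 19 = d" "nv s1 20 = e" "nv s1 12 = m"
      "nv s1 13 = j" "nv s1 11 = c0" "nv s1 0 = n" "nv s1 5 = 4 * n + 8"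
      unfolding s1' using v s5 by (simp_all add: m_def)
    have na1: "na s1 q i = (if q = 0 \<and> i = m then n + 1 else na s q i)" if "q < 16" for q i
      unfolding s1' using that by simp
    have ra1: "ra s1 q i = ra s q i" if "q < 16" for q i unfolding s1' using that s5 m2 by simp
    have inp1: "inp s1 a = (if a = 2 * m + 2 then snd p else if a = 2 * m + 1 then fst p else inp s a)" for a
      unfolding s1' by simp
    let ?Q = "\<lambda>s'. nv s' 10 = x \<and> ext_inv P T n c0 s0 (Suc x) (snv 10 (Suc x) s')"
    have xf: "x \<le> f" using f by simp
    have proc: "tot (Seq (For 21 (NV 10) (NV 14) ext_mark) ext_b) s1 ((f - x + 1) * (ctime ext_mark + 18) + ctime ext_b + 1) ?Q"
    proof (rule tot_Seq[OF mark_correct[OF g1(1-7) xf, folded G_def]])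
      fix s2 assume s2: "(\<forall>k<21. nv s2 k = nv s1 k) \<and> (\<forall>q<16. q \<noteq> 0 \<longrightarrow> (\<forall>i. na s2 q i = na s1 q i)) \<and>
        (\<forall>q<16. \<forall>i. ra s2 q i = ra s1 q i) \<and> (\<forall>a. inp s2 a = inp s1 a) \<and>
        (\<forall>w. na s2 0 w = (if w \<in> na s1 9 ` G then Suc m else na s1 0 w))"
      define s3 where "s3 = run ext_b s2"
      have g2: "nv s2 k = nv s1 k" if "k < 21" for k using s2 that by blast
      have s3': "s3 = snv 12 (m + 1) (if f < j then sna 8 f j (if d < e then sna 8 d e (if b < c then sna 8 b c s2 else s2)
          else (if b < c then sna 8 b c s2 else s2))
        else (if d < e then sna 8 d e (if b < c then sna 8 b c s2 else s2) else (if b < c then sna 8 b c s2 else s2)))"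
        unfolding s3_def ext_b_def using g1 by (simp add: g2)
      have nv3: "nv s3 k = (if k = 12 then m + 1 else nv s1 k)" if "k < 21" for k
        unfolding s3' using g2 that by simp
      have na3: "na s3 q i = na s2 q i" if "q < 16" "q \<noteq> 8" for q i
        unfolding s3' using that by simp
      have ra3: "ra s3 q i = ra s q i" if "q < 16" for q i
        unfolding s3' using s2 ra1 that by simp
      have inp3: "inp s3 a = inp s1 a" for a unfolding s3' using s2 by simp
      have En3: "na s3 8 = upd_if f j (upd_if d e (upd_if b c (na s 8)))"
      proof
        fix i
        have "na s2 8 i = na s 8 i" for i using s2 na1 by simp
        then show "na s3 8 i = upd_if f j (upd_if d e (upd_if b c (na s 8))) i"
          unfolding s3' upd_if_def by simp
      qed
      have p9: "na s1 9 k = na s0 9 k" for k using na1 s9 by simp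
      have par: "na s3 0 w = (if w \<in> na s0 9 ` G then Suc m else if w = m then n + 1 else na s 0 w)" for w
        using s2 na3[of 0 w] na1[of 0 w] by (simp add: p9)
      have Gn: "w < n" if wG: "w \<in> na s0 9 ` G" for w
      proof -
        obtain k where "k \<in> G" "w = na s0 9 k" using wG by blast
        then show ?thesis using perm(1)[of k] Gw n by fastforce
      qed
      \<comment> \<open>Sources have numbers below \<open>n\<close>, hubs above \<open>n\<close>,
        and the permutation is injective on the window, so marking the cluster and entering the new
        hub do not interfere.\<close>
      have Lw: "na s3 0 (na s0 9 k) = (if k \<in> G then Suc m else ?L k)" if k: "k \<in> {c0..<?hi}" for k
      proof -
        have "na s0 9 k < n" using perm(1)[of k] k n by simp
        then have "na s0 9 k \<noteq> m" using nm by simp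
        moreover have "na s0 9 k \<in> na s0 9 ` G \<longleftrightarrow> k \<in> G" using perm(2) Gw k by (meson inj_on_image_mem_iff)
        ultimately show ?thesis using par by simp
      qed
      have A0: "?A k k = 0" if "k \<le> ?hi" for k using ok[of k] that n by (simp add: row_ok_def)
      have AA: "?A x (na s 8 x) = star P T (grp x b c d e f) p + ?A b c + ?A d e + ?A f (na s 8 x)"
        using f(3) B by (simp add: j_def)
      from partial_sol_step[OF ps x L0 vc _ AA A0] f(2) obtain St' where
        ps': "partial_sol ?A P T n c0 ?hi (?A c0 ?hi) (Suc x) (Suc m) (\<lambda>k. if k \<in> G then Suc m else ?L k)
          (?pos(m := p)) (upd_if f j (upd_if d e (upd_if b c (na s 8)))) St'"
        unfolding G_def j_def by blast
      have pos3: "(\<lambda>v. (inp s3 (2 * v + 1), inp s3 (2 * v + 2))) = ?pos(m := p)"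
      proof
        fix v show "(inp s3 (2 * v + 1), inp s3 (2 * v + 2)) = (?pos(m := p)) v"
        proof (cases "v = m")
          case True
          then show ?thesis by (simp add: inp3 inp1)
        next
          case False
          then have "2 * v + 1 \<noteq> 2 * m + 1" "2 * v + 2 \<noteq> 2 * m + 2" "2 * v + 1 \<noteq> 2 * m + 2" "2 * v + 2 \<noteq> 2 * m + 1"
            by presburger+
          then show ?thesis using False unfolding inp3 inp1 by simp
        qed
      qed
      have ps3: "partial_sol ?A P T n c0 ?hi (?A c0 ?hi) (Suc x) (Suc m) (\<lambda>k. na s3 0 (na s0 9 k))
          (\<lambda>v. (inp s3 (2 * v + 1), inp s3 (2 * v + 2))) (na s3 8) St'"
        unfolding pos3 En3 by (rule partial_sol_cong[OF ps']) (rule Lw)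
      have xk3: "xkeep n s0 s3"
      proof -
        have "nv s3 0 = nv s0 0" "nv s3 5 = nv s0 5" using nv3 g1 n by simp_all
        moreover have "na s3 q i = na s0 q i" if "q < 16" "q \<notin> {0, 8}" for q i
        proof -
          have "na s3 q i = na s q i" using na3 s2 na1 that by simp
          then show ?thesis using xk that by (simp add: xkeep_def)
        qed
        moreover have "inp s3 a = inp s0 a" if "a \<le> 2 * n + 2" for a
        proof -
          have "inp s3 a = inp s a" unfolding inp3 inp1 using that nm by simp
          then show ?thesis using xk that by (simp add: xkeep_def)
        qed
        moreover have "ra s3 q i = ra s0 q i" if "q < 16" for q i using ra3 xk that by (simp add: xkeep_def)
        ultimately show ?thesis unfolding xkeep_def by blast
      qed
      have nG: "w \<notin> na s0 9 ` G" if "n \<le> w" for w using Gn[of w] that by auto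
      have "ext_inv P T n c0 s0 (Suc x) (snv 10 (Suc x) s3)"
        unfolding ext_inv_def
      proof (intro conjI ballI allI impI)
        show "xkeep n s0 (snv 10 (Suc x) s3)" using xk3 by (simp add: xkeep_def)
        show "nv (snv 10 (Suc x) s3) 11 = c0" "nv (snv 10 (Suc x) s3) 10 = Suc x" using nv3 g1 by simp_all
        have m3: "nv (snv 10 (Suc x) s3) 12 = Suc m" using nv3 by simp
        show "nv (snv 10 (Suc x) s3) 12 + c0 \<le> n + 1 + Suc x" unfolding m3 using m1 by simp
        show "na (snv 10 (Suc x) s3) 0 n = 1" using par[of n] nG[of n] nm pn by simp
        show "na (snv 10 (Suc x) s3) 0 v = n + 1" if "v \<in> {n + 1..<nv (snv 10 (Suc x) s3) 12}" for v
          using that par[of v] nG[of v] pn(2)[of v] unfolding m3 by auto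
        show "na (snv 10 (Suc x) s3) 0 v = 0" if "nv (snv 10 (Suc x) s3) 12 \<le> v" for v
          using that par[of v] nG[of v] pn(3)[of v] nm unfolding m3 by auto
        have r: "(\<lambda>k. na (snv 10 (Suc x) s3) 0 (na s0 9 k)) = (\<lambda>k. na s3 0 (na s0 9 k))"
          "(\<lambda>v. (inp (snv 10 (Suc x) s3) (2 * v + 1), inp (snv 10 (Suc x) s3) (2 * v + 2))) = (\<lambda>v. (inp s3 (2 * v + 1), inp s3 (2 * v + 2)))"
          "na (snv 10 (Suc x) s3) 8 = na s3 8" by (auto intro!: ext)
        show "\<exists>St. partial_sol ?A P T n c0 ?hi (?A c0 ?hi) (Suc x) (nv (snv 10 (Suc x) s3) 12)
          (\<lambda>k. na (snv 10 (Suc x) s3) 0 (na s0 9 k))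
          (\<lambda>v. (inp (snv 10 (Suc x) s3) (2 * v + 1), inp (snv 10 (Suc x) s3) (2 * v + 2))) (na (snv 10 (Suc x) s3) 8) St"
          unfolding r m3 using ps3 by blast
      qed
      moreover have "nv s3 10 = x" using nv3 g1 by simp
      ultimately have "?Q s3" by blast
      moreover have "loopfree ext_b" by (simp add: ext_b_def)
      ultimately show "tot ext_b s2 (ctime ext_b) ?Q" unfolding s3_def by (intro tot_run) simp_all
    qed simp
    show "tot ext_proc s ((ctime ext_a + ctime ext_b + ctime ext_mark + 23) * (2 * n + 1)) ?Q"
      unfolding ext_proc_def
    proof (rule tot_run_Seq[OF _ proc[unfolded s1_def]])
      show "loopfree ext_a" by (simp add: ext_a_def)
      have "(f - x + 1) * (ctime ext_mark + 18) \<le> (2 * n + 1) * (ctime ext_mark + 18)"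
        by (rule mult_le_mono1) (use f x2 n j x in linarith)
      moreover have "ctime ext_a + ctime ext_b + 2 \<le> (2 * n + 1) * (ctime ext_a + ctime ext_b + 5)" by simp
      moreover have "(ctime ext_a + ctime ext_b + ctime ext_mark + 23) * (2 * n + 1) =
        (2 * n + 1) * (ctime ext_mark + 18) + (2 * n + 1) * (ctime ext_a + ctime ext_b + 5)" by (simp add: algebra_simps)
      ultimately show "ctime ext_a + ((f - x + 1) * (ctime ext_mark + 18) + ctime ext_b + 1) + 1 \<le> (ctime ext_a + ctime ext_b + ctime ext_mark + 23) * (2 * n + 1)"
        by linarith
    qed
  next
    let ?bb = "btime (NLess (NA 0 (NA 9 (NV 10))) (NConst 1))" and ?k = "ctime ext_a + ctime ext_b + ctime ext_mark + 23"
    have "?bb + 1 \<le> (?bb + 2) * (2 * n + 1)" by simp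
    moreover have "ext_time * (2 * n + 1) = ?k * (2 * n + 1) + (?bb + 2) * (2 * n + 1)"
      unfolding ext_time_def by (simp only: add_mult_distrib[symmetric]) (simp add: ac_simps)
    ultimately show "?bb + ?k * (2 * n + 1) + 1 \<le> ext_time * (2 * n + 1)" by linarith
  qed
qed

lemma readout_correct:
  assumes n: "nv s 0 = n" "nv s 5 = 4 * n + 8" "nv s 11 = c0" "c0 < n"
    and ok: "\<And>i. i \<le> 2 * n \<Longrightarrow> row_ok P T \<epsilon> n (2 * n + 1) s i"
    and perm: "\<And>k. k < 2 * n \<Longrightarrow> na s 9 k < n" "inj_on (na s 9) {c0..<c0 + n}"
    and zero: "\<And>v. na s 0 v = 0"
  shows "tot readout s (ctime ext_init + 1 + (n + 1) * (ext_time * (2 * n + 1) + 30)) (ext_inv P T n c0 s (c0 + n))"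
  unfolding readout_def
proof (rule tot_run_Seq)
  show "loopfree ext_init" by (simp add: ext_init_def)
  define s1 where "s1 = run ext_init s"
  have s1': "s1 = sna 8 c0 (c0 + n) (sna 0 n 1 (snv 12 (n + 1) s))"
    unfolding s1_def ext_init_def using n by simp
  have i0: "ext_inv P T n c0 s c0 (snv 10 c0 s1)"
    unfolding ext_inv_def
  proof (intro conjI ballI allI impI)
    show "xkeep n s (snv 10 c0 s1)" unfolding s1' by (simp add: xkeep_def)
    have m: "nv (snv 10 c0 s1) 12 = n + 1" unfolding s1' by simp
    show "nv (snv 10 c0 s1) 11 = c0" "nv (snv 10 c0 s1) 10 = c0" unfolding s1' using n by simp_all
    show "nv (snv 10 c0 s1) 12 + c0 \<le> n + 1 + c0" unfolding m by simp
    have na1: "na (snv 10 c0 s1) 0 v = (if v = n then 1 else 0)" for v unfolding s1' using zero by simp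
    show "na (snv 10 c0 s1) 0 n = 1" using na1 by simp
    show "na (snv 10 c0 s1) 0 v = n + 1" if "v \<in> {n + 1..<nv (snv 10 c0 s1) 12}" for v using that m by simp
    show "na (snv 10 c0 s1) 0 v = 0" if "nv (snv 10 c0 s1) 12 \<le> v" for v using that m na1 by simp
    have "na (snv 10 c0 s1) 0 (na s 9 k) = 0" if "k \<in> {c0..<c0 + n}" for k
      using na1 perm(1)[of k] that n by simp
    moreover have "na (snv 10 c0 s1) 8 c0 = c0 + n" unfolding s1' by simp
    ultimately show "\<exists>St. partial_sol (tab s 3) P T n c0 (c0 + n) (tab s 3 c0 (c0 + n)) c0 (nv (snv 10 c0 s1) 12)
      (\<lambda>k. na (snv 10 c0 s1) 0 (na s 9 k)) (\<lambda>v. (inp (snv 10 c0 s1) (2 * v + 1), inp (snv 10 c0 s1) (2 * v + 2)))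
      (na (snv 10 c0 s1) 8) St"
      unfolding m using n(4) by (intro exI[of _ "{c0}"] partial_sol_init) auto
  qed
  show "tot (For 10 (NV 11) (NAdd (NV 11) (NV 0)) ext_body) (run ext_init s) ((n + 1) * (ext_time * (2 * n + 1) + 30)) (ext_inv P T n c0 s (c0 + n))"
    unfolding s1_def[symmetric]
  proof (rule tot_For[where I = "ext_inv P T n c0 s" and l = c0 and h = "c0 + n" and t = "ext_time * (2 * n + 1)"])
    show "nval (NV 11) s1 = c0" unfolding s1' using n by simp
    show "nv s' 10 = x \<and> nval (NAdd (NV 11) (NV 0)) s' = c0 + n" if "ext_inv P T n c0 s x s'" for x s'
      using that n by (simp add: ext_inv_def xkeep_def)
    show "(c0 + n - c0 + 1) * (ext_time * (2 * n + 1) + ntime (NV 11) + ntime (NAdd (NV 11) (NV 0)) + 14)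
      \<le> (n + 1) * (ext_time * (2 * n + 1) + 30)" by (rule mult_le_mono) (simp_all add: NV_def)
    show "tot ext_body s' (ext_time * (2 * n + 1)) (\<lambda>s''. nv s'' 10 = x \<and> ext_inv P T n c0 s (Suc x) (snv 10 (Suc x) s''))"
      if "c0 \<le> x" "x < c0 + n" "ext_inv P T n c0 s x s'" for x s'
      using ext_body_correct[OF n(1,2,4) ok perm that(3,1,2)] by simp
  qed (use i0 in auto)
qed simp

definition copy_body :: com where
  "copy_body = Seq (NStore (NAdd (NV 0) (NConst 1)) (NSub (NA 0 (NV 0)) (NConst 1))) (SNV 0 (NAdd (NV 0) (NConst 1)))"

definition copy_out :: com where
  "copy_out = Seq (SNV 0 (NConst 0)) (While (NLess (NConst 0) (NA 0 (NV 0))) copy_body)"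

text \<open>
  The output overwrites the variables, so cell \<open>0\<close> is the only counter; parents are buffered with an
  offset of one, and the first empty entry of the buffer marks its end.
\<close>

lemma copy_out_correct:
  assumes pos: "\<And>v. v < m \<Longrightarrow> na s 0 v > 0" and zero: "na s 0 m = 0"
  shows "tot copy_out s (ctime (SNV 0 (NConst 0)) + 1 + (m + 1) * (ctime copy_body + btime (NLess (NConst 0) (NA 0 (NV 0))) + 1))
    (\<lambda>s'. fst s' 0 = m \<and> (\<forall>v<m. fst s' (v + 1) = na s 0 v - 1) \<and> snd s' = snd s)"
  unfolding copy_out_def
proof (rule tot_run_Seq)
  let ?b = "NLess (NConst 0) (NA 0 (NV 0))"
  define I where "I x s' \<longleftrightarrow> fst s' 0 = x \<and> (\<forall>v<x. fst s' (v + 1) = na s 0 v - 1) \<and> (\<forall>a>x. fst s' a = fst s a) \<and> snd s' = snd s" for x s'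
  have na': "na s' 0 x = na s 0 x" "nv s' 0 = x" if "I x s'" for x s'
  proof -
    \<comment> \<open>Entry \<open>x\<close> of the buffer is in cell \<open>100 + 16 * x\<close>,
      behind all cells overwritten so far, which are those up to \<open>x\<close>.\<close>
    have "nad 0 x > x" by (simp add: nad_def)
    then show "na s' 0 x = na s 0 x" using that by (simp add: na_def I_def)
    show "nv s' 0 = x" using that by (simp add: nv_def I_def)
  qed
  show "tot (While ?b copy_body) (run (SNV 0 (NConst 0)) s) ((m + 1) * (ctime copy_body + btime ?b + 1))
    (\<lambda>s'. fst s' 0 = m \<and> (\<forall>v<m. fst s' (v + 1) = na s 0 v - 1) \<and> snd s' = snd s)"
  proof (rule tot_While[where I = I and m = m and t = "ctime copy_body"])
    show "I 0 (run (SNV 0 (NConst 0)) s)" by (simp add: I_def snv_def)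
    fix x s' assume x: "x < m" and i: "I x s'"
    have "tot copy_body s' (ctime copy_body) (I (Suc x))"
    proof (rule tot_run)
      show "loopfree copy_body" by (simp add: copy_body_def)
      have "run copy_body s' = ((fst s')(Suc x := na s 0 x - 1, 0 := Suc x), snd s')"
        unfolding copy_body_def using na'[OF i] by (simp add: snv_def nv_def)
      then show "I (Suc x) (run copy_body s')" using i by (auto simp: I_def less_Suc_eq)
    qed simp
    then show "bval ?b s' \<and> tot copy_body s' (ctime copy_body) (I (Suc x))" using na'[OF i] pos[OF x] by simp
  next
    fix s' assume i: "I m s'"
    show "\<not> bval ?b s' \<and> fst s' 0 = m \<and> (\<forall>v<m. fst s' (v + 1) = na s 0 v - 1) \<and> snd s' = snd s"
      using i na'[OF i] zero by (simp add: I_def)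
  qed simp
qed simp_all

subsection \<open>Sorting\<close>

definition RX :: "nexp \<Rightarrow> rexp" where "RX v = RI (NAdd (NAdd v v) (NConst 1))"
definition RY :: "nexp \<Rightarrow> rexp" where "RY v = RI (NAdd (NAdd v v) (NConst 2))"

definition pre :: "nat \<Rightarrow> (nat \<Rightarrow> point) \<Rightarrow> real \<Rightarrow> ram_state \<Rightarrow> bool" where
  "pre n p \<epsilon> s \<longleftrightarrow> nv s 0 = n \<and> nv s 5 = 4 * n + 8 \<and> p n = (rv s 2, rv s 3) \<and> rv s 4 = \<epsilon> \<and>
     (\<forall>v\<le>n. inp s (2 * v + 1) = fst (p v) \<and> inp s (2 * v + 2) = snd (p v)) \<and> (\<forall>v. na s 0 v = 0)"

lemma pre_set [simp]:
  "pre n p \<epsilon> s \<Longrightarrow> k \<noteq> 0 \<Longrightarrow> k \<noteq> 5 \<Longrightarrow> k < 100 \<Longrightarrow> pre n p \<epsilon> (snv k x s)"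
  "pre n p \<epsilon> s \<Longrightarrow> 5 \<le> k \<Longrightarrow> k < 100 \<Longrightarrow> pre n p \<epsilon> (srv k z s)"
  "pre n p \<epsilon> s \<Longrightarrow> q \<noteq> 0 \<Longrightarrow> q < 16 \<Longrightarrow> pre n p \<epsilon> (sna q i x s)"
  "pre n p \<epsilon> s \<Longrightarrow> pre n p \<epsilon> (sra q i z s)"
  by (auto simp: pre_def)

lemma rval_RX [simp]: "pre n p \<epsilon> s \<Longrightarrow> nval v s \<le> n \<Longrightarrow> rval (RX v) s = fst (p (nval v s))"
  "pre n p \<epsilon> s \<Longrightarrow> nval v s \<le> n \<Longrightarrow> rval (RY v) s = snd (p (nval v s))"
  by (simp_all add: RX_def RY_def pre_def flip: mult_2)

text \<open>The precision is capped at 1/2, as the ellipsoid method assumes a bound on it; register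
  5 receives the threshold \<open>(\<epsilon>/4)\<^sup>2\<close> of \<open>med_inv_final\<close>.
  The offset \<open>4 n + 8\<close> leaves room for the coordinates of \<open>2 n + 1\<close>
  vertices: sources, sink and at most \<open>n\<close> hubs.\<close>

definition prologue :: com where
  "prologue = Seq (SNV 5 (NAdd (NAdd NN NN) (NConst 8))) (seqs [
     SRV 2 (RI (NAdd NN (NConst 1))), SRV 3 (RI (NAdd NN (NConst 2))),
     Cond (RLess (RI (NConst 0)) (RDiv (RN 1) (RN 2))) (SRV 4 (RI (NConst 0))) (SRV 4 (RDiv (RN 1) (RN 2))),
     SNV 2 (NConst 0), SRV 5 (RDiv (RMul (RV 4) (RV 4)) (RN 16)), SRV 6 (RN 1)])"

lemma prologue_correct:
  assumes "s = run prologue (input_state n I \<epsilon>)"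
  shows "pre n (loc I) (min \<epsilon> (1/2)) s" "nv s 2 = 0" "rv s 5 = (min \<epsilon> (1/2) / 4)\<^sup>2" "rv s 6 = 1"
proof -
  define s0 where "s0 = input_state n I \<epsilon>"
  define s1 where "s1 = snv 5 (4 * n + 8) s0"
  have n0: "nv s0 k = (if k = 0 then n else 0)" for k by (simp add: s0_def input_state_def nv_def)
  have n1: "nv s1 k = (if k = 5 then 4 * n + 8 else if k = 0 then n else 0)" for k by (simp add: s1_def n0)
  have a1: "na s1 q i = 0" for q i by (simp add: s1_def s0_def na_def snv_def input_state_def nad_def)
  have i1: "inp s1 a = snd (input_state n I \<epsilon>) a" for a by (simp add: s1_def inp_def snv_def s0_def)
  have x: "inp s1 (2 * v + 1) = fst (loc I v)" "inp s1 (2 * v + 2) = snd (loc I v)" if "v \<le> n" for v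
    using that by (simp_all add: i1 input_state_def)
  have e: "inp s1 0 = \<epsilon>" by (simp add: i1 input_state_def)
  have s: "s = srv 6 1 (srv 5 (min \<epsilon> (1/2) * min \<epsilon> (1/2) / 16) (snv 2 0 (srv 4 (min \<epsilon> (1/2))
      (srv 3 (snd (loc I n)) (srv 2 (fst (loc I n)) s1)))))"
  proof -
    have "run (SNV 5 (NAdd (NAdd NN NN) (NConst 8))) s0 = s1" by (simp add: NN_def n0 s1_def)
    then have "s = run (seqs [SRV 2 (RI (NAdd NN (NConst 1))), SRV 3 (RI (NAdd NN (NConst 2))),
        Cond (RLess (RI (NConst 0)) (RDiv (RN 1) (RN 2))) (SRV 4 (RI (NConst 0))) (SRV 4 (RDiv (RN 1) (RN 2))),
        SNV 2 (NConst 0), SRV 5 (RDiv (RMul (RV 4) (RV 4)) (RN 16)), SRV 6 (RN 1)]) s1"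
      unfolding assms prologue_def run.simps(4) s0_def[symmetric] by (simp only:)
    moreover have "min \<epsilon> (1/2) = (if \<epsilon> < 1/2 then \<epsilon> else 1/2)" by auto
    ultimately show ?thesis
      using x[of n] by (cases "\<epsilon> < 1/2") (simp_all add: NN_def n1 e flip: mult_2)
  qed
  show "pre n (loc I) (min \<epsilon> (1/2)) s" unfolding s pre_def using x by (simp add: n1 a1)
  show "nv s 2 = 0" "rv s 6 = 1" unfolding s by simp_all
  show "rv s 5 = (min \<epsilon> (1/2) / 4)\<^sup>2" unfolding s by (simp add: power2_eq_square)
qed

text \<open>The number of ellipsoid steps is found by multiplying by 7/9 until the threshold is
  passed; this replaces a logarithm and a conversion of reals to naturals.\<close>

definition count_body :: com where
  "count_body = seqs [SRV 6 (RMul (RV 6) (RDiv (RN 7) (RN 9))), SNV 2 (NAdd (NV 2) (NConst 1))]"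

definition count :: com where
  "count = While (BNot (RLess (RV 6) (RV 5))) count_body"

lemma count_correct:
  assumes p: "pre n p \<epsilon> s" and s: "nv s 2 = 0" "rv s 5 = r" "rv s 6 = 1"
    and N: "(7/9) ^ N < r" "\<And>k. k < N \<Longrightarrow> \<not> (7/9) ^ k < r"
  shows "tot count s ((N + 1) * (ctime count_body + btime (BNot (RLess (RV 6) (RV 5))) + 1)) (\<lambda>s'. pre n p \<epsilon> s' \<and> nv s' 2 = N)"
  unfolding count_def
proof (rule tot_While[where m = N and t = "ctime count_body" and
      I = "\<lambda>x s'. pre n p \<epsilon> s' \<and> nv s' 2 = x \<and> rv s' 5 = r \<and> rv s' 6 = (7/9) ^ x"])
  fix x s' assume x: "x < N" and i: "pre n p \<epsilon> s' \<and> nv s' 2 = x \<and> rv s' 5 = r \<and> rv s' 6 = (7/9) ^ x"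
  have "tot count_body s' (ctime count_body) (\<lambda>s'. pre n p \<epsilon> s' \<and> nv s' 2 = Suc x \<and> rv s' 5 = r \<and> rv s' 6 = (7/9) ^ Suc x)"
    by (rule tot_run) (use i in \<open>simp_all add: count_body_def\<close>)
  then show "bval (BNot (RLess (RV 6) (RV 5))) s' \<and>
    tot count_body s' (ctime count_body) (\<lambda>s'. pre n p \<epsilon> s' \<and> nv s' 2 = Suc x \<and> rv s' 5 = r \<and> rv s' 6 = (7/9) ^ Suc x)"
    using i N(2)[OF x] by simp
qed (use p s N in auto)

definition cen_init :: com where "cen_init = seqs [SRV 7 (RN 0), SRV 8 (RN 0)]"
definition cen_body :: com where
  "cen_body = seqs [SRV 7 (RAdd (RV 7) (RX (NV 10))), SRV 8 (RAdd (RV 8) (RY (NV 10)))]"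
definition cen_fin :: com where
  "cen_fin = seqs [SRV 7 (RDiv (RV 7) (ROfNat (NAdd (NV 0) (NConst 1)))), SRV 8 (RDiv (RV 8) (ROfNat (NAdd (NV 0) (NConst 1))))]"
definition cen :: com where
  "cen = Seq cen_init (Seq (For 10 (NConst 0) (NAdd (NV 0) (NConst 1)) cen_body) cen_fin)"

definition "cen_time = ctime cen_init + ctime cen_body + ctime cen_fin + 24"

lemma cen_correct:
  assumes p: "pre n p \<epsilon> s" "nv s 2 = N"
  shows "tot cen s (cen_time * (n + 2)) (\<lambda>s'. pre n p \<epsilon> s' \<and> nv s' 2 = N \<and>
    (rv s' 7, rv s' 8) = (1 / real (n + 1)) *\<^sub>R (\<Sum>v\<le>n. p v))"
  unfolding cen_def
proof (rule tot_run_Seq)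
  let ?Q = "\<lambda>s'. pre n p \<epsilon> s' \<and> nv s' 2 = N \<and> (rv s' 7, rv s' 8) = (1 / real (n + 1)) *\<^sub>R (\<Sum>v\<le>n. p v)"
  let ?t = "(n + 2) * (ctime cen_body + 20)"
  have n: "nv s' 0 = n" if "pre n p \<epsilon> s'" for s' using that by (simp add: pre_def)
  have "tot (For 10 (NConst 0) (NAdd (NV 0) (NConst 1)) cen_body) (run cen_init s) ?t
    (\<lambda>s'. pre n p \<epsilon> s' \<and> nv s' 2 = N \<and> (rv s' 7, rv s' 8) = (\<Sum>v\<le>n. p v))"
  proof (rule tot_For[where l = 0 and h = "n + 1" and t = "ctime cen_body" and
        I = "\<lambda>x s'. pre n p \<epsilon> s' \<and> nv s' 2 = N \<and> nv s' 10 = x \<and> (rv s' 7, rv s' 8) = (\<Sum>v<x. p v)"])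
    show "pre n p \<epsilon> (snv 10 0 (run cen_init s)) \<and> nv (snv 10 0 (run cen_init s)) 2 = N \<and> nv (snv 10 0 (run cen_init s)) 10 = 0 \<and>
      (rv (snv 10 0 (run cen_init s)) 7, rv (snv 10 0 (run cen_init s)) 8) = (\<Sum>v<0. p v)"
      using p by (simp add: cen_init_def zero_prod_def)
    show "(n + 1 - 0 + 1) * (ctime cen_body + ntime (NConst 0) + ntime (NAdd (NV 0) (NConst 1)) + 14) \<le> ?t"
      by (rule mult_le_mono) (simp_all add: NV_def)
    fix x s' assume x: "x < n + 1" and i: "pre n p \<epsilon> s' \<and> nv s' 2 = N \<and> nv s' 10 = x \<and> (rv s' 7, rv s' 8) = (\<Sum>v<x. p v)"
    have g: "fst (\<Sum>v<x. p v) = rv s' 7" "snd (\<Sum>v<x. p v) = rv s' 8" using i by (metis fst_conv snd_conv)+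
    have pp: "pre n p \<epsilon> s'" "nv s' 10 = x" "x \<le> n" "nv s' 2 = N" using i x by auto
    have "rval (RY (NV 10)) (srv 7 z s') = snd (p x)" for z
      using rval_RX(2)[of n p \<epsilon> "srv 7 z s'" "NV 10"] pp by simp
    then have r: "run cen_body s' = srv 8 (rv s' 8 + snd (p x)) (srv 7 (rv s' 7 + fst (p x)) s')"
      using pp rval_RX(1)[of n p \<epsilon> s' "NV 10"] by (simp add: cen_body_def)
    show "tot cen_body s' (ctime cen_body) (\<lambda>s''. nv s'' 10 = x \<and> pre n p \<epsilon> (snv 10 (Suc x) s'') \<and>
      nv (snv 10 (Suc x) s'') 2 = N \<and> nv (snv 10 (Suc x) s'') 10 = Suc x \<and>
      (rv (snv 10 (Suc x) s'') 7, rv (snv 10 (Suc x) s'') 8) = (\<Sum>v<Suc x. p v))"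
    proof (rule tot_run)
      show "loopfree cen_body" by (simp add: cen_body_def)
    qed (use pp g in \<open>simp_all add: r prod_eq_iff\<close>)
  next
    fix s' assume "pre n p \<epsilon> s' \<and> nv s' 2 = N \<and> nv s' 10 = n + 1 \<and> (rv s' 7, rv s' 8) = (\<Sum>v<n + 1. p v)"
    then show "pre n p \<epsilon> s' \<and> nv s' 2 = N \<and> (rv s' 7, rv s' 8) = (\<Sum>v\<le>n. p v)" by (simp add: lessThan_Suc_atMost)
  qed (use n in auto)
  then show "tot (Seq (For 10 (NConst 0) (NAdd (NV 0) (NConst 1)) cen_body) cen_fin) (run cen_init s) (?t + ctime cen_fin + 1) ?Q"
  proof (rule tot_Seq)
    fix s1 assume s1: "pre n p \<epsilon> s1 \<and> nv s1 2 = N \<and> (rv s1 7, rv s1 8) = (\<Sum>v\<le>n. p v)"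
    have g: "fst (\<Sum>v\<le>n. p v) = rv s1 7" "snd (\<Sum>v\<le>n. p v) = rv s1 8" using s1 by (metis fst_conv snd_conv)+
    have pp: "pre n p \<epsilon> s1" "nv s1 2 = N" "nv s1 0 = n" using s1 n by auto
    have r: "run cen_fin s1 = srv 8 (rv s1 8 / real (n + 1)) (srv 7 (rv s1 7 / real (n + 1)) s1)"
      using pp by (simp add: cen_fin_def)
    show "tot cen_fin s1 (ctime cen_fin) ?Q"
    proof (rule tot_run)
      show "loopfree cen_fin" by (simp add: cen_fin_def)
      show "?Q (run cen_fin s1)" using pp by (simp add: r prod_eq_iff g)
    qed simp
  qed simp
  show "loopfree cen_init" by (simp add: cen_init_def)
  have "ctime cen_init + ctime cen_fin + 2 \<le> (n + 2) * (ctime cen_init + ctime cen_fin + 4)" by simp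
  moreover have "cen_time * (n + 2) = (n + 2) * (ctime cen_body + 20) + (n + 2) * (ctime cen_init + ctime cen_fin + 4)"
    unfolding cen_time_def by (simp only: add_mult_distrib2[symmetric]) (simp add: ac_simps)
  ultimately show "ctime cen_init + (?t + ctime cen_fin + 1) + 1 \<le> cen_time * (n + 2)" by linarith
qed

definition key_body :: com where
  "key_body = seqs [SRV 9 (RSub (RX (NV 10)) (RV 7)), SRV 10 (RSub (RY (NV 10)) (RV 8)),
     SRV 11 (RDist (RV 9) (RV 10) (RN 0) (RN 0)),
     Cond (RLess (RN 0) (RV 11))
       (Cond (BOr (RLess (RN 0) (RV 10)) (BAnd (BNot (RLess (RV 10) (RN 0))) (RLess (RN 0) (RV 9))))
         (SRA 2 (NV 10) (RSub (RN 1) (RDiv (RV 9) (RV 11)))) (SRA 2 (NV 10) (RAdd (RN 3) (RDiv (RV 9) (RV 11)))))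
       (SRA 2 (NV 10) (RSub (RN 0) (RN 1)))]"

definition keys :: com where "keys = For 10 (NConst 0) (NV 0) key_body"

lemma keys_correct:
  assumes p: "pre n p \<epsilon> s" "nv s 2 = N" "(rv s 7, rv s 8) = o'"
  shows "tot keys s ((n + 1) * (ctime key_body + 18)) (\<lambda>s'. pre n p \<epsilon> s' \<and> nv s' 2 = N \<and> (\<forall>v<n. ra s' 2 v = ang_key (p v - o')))"
  unfolding keys_def
proof (rule tot_For[where l = 0 and h = n and t = "ctime key_body" and
      I = "\<lambda>x s'. pre n p \<epsilon> s' \<and> nv s' 2 = N \<and> (rv s' 7, rv s' 8) = o' \<and> nv s' 10 = x \<and> (\<forall>v<x. ra s' 2 v = ang_key (p v - o'))"])
  fix x s' assume x: "x < n" and i: "pre n p \<epsilon> s' \<and> nv s' 2 = N \<and> (rv s' 7, rv s' 8) = o' \<and> nv s' 10 = x \<and> (\<forall>v<x. ra s' 2 v = ang_key (p v - o'))"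
  have pp: "pre n p \<epsilon> s'" "nv s' 10 = x" "x \<le> n" and oo: "rv s' 7 = fst o'" "rv s' 8 = snd o'" using i x by auto
  define d where "d = p x - o'"
  define s1 where "s1 = srv 11 (norm d) (srv 10 (snd d) (srv 9 (fst d) s'))"
  have y: "rval (RY (NV 10)) (srv 9 z s') = snd (p x)" for z
    using rval_RX(2)[of n p \<epsilon> "srv 9 z s'" "NV 10"] pp by simp
  have dn: "dist (fst d, snd d) (0, 0) = norm d" by (simp add: dist_norm zero_prod_def[symmetric])
  have r: "run key_body s' = sra 2 x (ang_key d) s1"
  proof -
    have "run key_body s' = run (seqs [Cond (RLess (RN 0) (RV 11))
       (Cond (BOr (RLess (RN 0) (RV 10)) (BAnd (BNot (RLess (RV 10) (RN 0))) (RLess (RN 0) (RV 9))))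
         (SRA 2 (NV 10) (RSub (RN 1) (RDiv (RV 9) (RV 11)))) (SRA 2 (NV 10) (RAdd (RN 3) (RDiv (RV 9) (RV 11)))))
       (SRA 2 (NV 10) (RSub (RN 0) (RN 1)))]) s1"
      unfolding key_body_def s1_def using pp y rval_RX(1)[of n p \<epsilon> s' "NV 10"] dn
      by (simp add: oo d_def)
    also have "\<dots> = sra 2 x (ang_key d) s1"
    proof -
      have "nv s1 10 = x" "rv s1 9 = fst d" "rv s1 10 = snd d" "rv s1 11 = norm d" using pp by (simp_all add: s1_def)
      then show ?thesis by (auto simp: ang_key_def)
    qed
    finally show ?thesis .
  qed
  show "tot key_body s' (ctime key_body) (\<lambda>s''. nv s'' 10 = x \<and> pre n p \<epsilon> (snv 10 (Suc x) s'') \<and> nv (snv 10 (Suc x) s'') 2 = N \<and>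
    (rv (snv 10 (Suc x) s'') 7, rv (snv 10 (Suc x) s'') 8) = o' \<and> nv (snv 10 (Suc x) s'') 10 = Suc x \<and>
    (\<forall>v<Suc x. ra (snv 10 (Suc x) s'') 2 v = ang_key (p v - o')))"
  proof (rule tot_run)
    show "loopfree key_body" by (simp add: key_body_def)
  qed (use i in \<open>auto simp: r s1_def d_def less_Suc_eq\<close>)
next
  show "nv s' 10 = x \<and> nval (NV 0) s' = n" if "pre n p \<epsilon> s' \<and> nv s' 2 = N \<and> (rv s' 7, rv s' 8) = o' \<and> nv s' 10 = x \<and>
    (\<forall>v<x. ra s' 2 v = ang_key (p v - o'))" for x s'
    using that by (simp add: pre_def)
  show "(n - 0 + 1) * (ctime key_body + ntime (NConst 0) + ntime (NV 0) + 14) \<le> (n + 1) * (ctime key_body + 18)"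
    by (rule mult_le_mono) (simp_all add: NV_def)
qed (use p in auto)

text \<open>The index as the last criterion makes the order total on sources in the same position.
  Ties are expressed by failing comparisons in the opposite direction, because the machine only
  tests strict inequality.\<close>

definition lt :: "(nat \<Rightarrow> point) \<Rightarrow> point \<Rightarrow> nat \<Rightarrow> nat \<Rightarrow> bool" where
  "lt p o' w v \<longleftrightarrow> ang_key (p w - o') < ang_key (p v - o') \<or> \<not> ang_key (p v - o') < ang_key (p w - o') \<and>
     (snd (p w) < snd (p v) \<or> \<not> snd (p v) < snd (p w) \<and> (fst (p w) < fst (p v) \<or> \<not> fst (p v) < fst (p w) \<and> w < v))"

definition rk :: "(nat \<Rightarrow> point) \<Rightarrow> point \<Rightarrow> nat \<Rightarrow> nat \<Rightarrow> nat" where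
  "rk p o' n v = card {w \<in> {..<n}. lt p o' w v}"

lemma rk_props:
  "bij_betw (rk p o' n) {..<n} {..<n}"
  "u < n \<Longrightarrow> v < n \<Longrightarrow> rk p o' n u < rk p o' n v \<Longrightarrow> before o' (p u) (p v)"
proof -
  have 1: "\<not> lt p o' v v" for v by (simp add: lt_def)
  have 2: "lt p o' u v \<Longrightarrow> lt p o' v w \<Longrightarrow> lt p o' u w" for u v w by (auto simp: lt_def)
  have 3: "u \<noteq> v \<Longrightarrow> lt p o' u v \<or> lt p o' v u" for u v by (auto simp: lt_def)
  note rb = rank_bij[of "lt p o'", OF 1 2 3, where n = n, folded rk_def]
  show "bij_betw (rk p o' n) {..<n} {..<n}" using rb(1) by (simp add: rk_def[abs_def])
  assume uv: "u < n" "v < n" "rk p o' n u < rk p o' n v"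
  have "lt p o' u v" by (rule rb(2)) (use uv in \<open>auto simp: rk_def\<close>)
  then show "before o' (p u) (p v)" by (auto simp: lt_def before_def)
qed

definition less_wv :: bexp where
  "less_wv = BOr (RLess (RA 2 (NV 12)) (RA 2 (NV 10))) (BAnd (BNot (RLess (RA 2 (NV 10)) (RA 2 (NV 12))))
     (BOr (RLess (RY (NV 12)) (RY (NV 10))) (BAnd (BNot (RLess (RY (NV 10)) (RY (NV 12))))
     (BOr (RLess (RX (NV 12)) (RX (NV 10))) (BAnd (BNot (RLess (RX (NV 10)) (RX (NV 12)))) (NLess (NV 12) (NV 10)))))))"

definition rank_body :: com where
  "rank_body = Cond less_wv (SNV 11 (NAdd (NV 11) (NConst 1))) Skip"

text \<open>Each source is stored at its rank \<open>r\<close> and at \<open>r + n\<close>. In this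
  doubled sequence every cyclic rotation is a window.\<close>

definition rank_put :: com where
  "rank_put = seqs [SNA 9 (NV 11) (NV 10), SNA 9 (NAdd (NV 11) (NV 0)) (NV 10),
     SRA 0 (NV 11) (RX (NV 10)), SRA 0 (NAdd (NV 11) (NV 0)) (RX (NV 10)),
     SRA 8 (NV 11) (RY (NV 10)), SRA 8 (NAdd (NV 11) (NV 0)) (RY (NV 10))]"

definition rank_one :: com where
  "rank_one = Seq (SNV 11 (NConst 0)) (Seq (For 12 (NConst 0) (NV 0) rank_body) rank_put)"

definition ranks :: com where "ranks = For 10 (NConst 0) (NV 0) rank_one"

definition srt where
  "srt n p o' x s \<longleftrightarrow> (\<forall>v<x. na s 9 (rk p o' n v) = v \<and> na s 9 (rk p o' n v + n) = v \<and>
     (ra s 0 (rk p o' n v), ra s 8 (rk p o' n v)) = p v \<and> (ra s 0 (rk p o' n v + n), ra s 8 (rk p o' n v + n)) = p v)"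

definition rank_time :: nat where
  "rank_time = ctime (SNV 11 (NConst 0)) + ctime rank_body + ctime rank_put + 30"

lemma rank_one_correct:
  assumes p: "pre n p \<epsilon> s" "nv s 2 = N" and keys: "\<And>v. v < n \<Longrightarrow> ra s 2 v = ang_key (p v - o')"
    and x: "nv s 10 = x" "x < n" and srt: "srt n p o' x s"
  shows "tot rank_one s (rank_time * (n + 1)) (\<lambda>s'. pre n p \<epsilon> s' \<and> nv s' 2 = N \<and> (\<forall>v<n. ra s' 2 v = ang_key (p v - o')) \<and>
    nv s' 10 = x \<and> srt n p o' (Suc x) s')"
  unfolding rank_one_def
proof (rule tot_run_Seq)
  let ?Q = "\<lambda>s'. pre n p \<epsilon> s' \<and> nv s' 2 = N \<and> (\<forall>v<n. ra s' 2 v = ang_key (p v - o')) \<and> nv s' 10 = x \<and> srt n p o' (Suc x) s'"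
  define K where "K s' \<longleftrightarrow> pre n p \<epsilon> s' \<and> nv s' 2 = N \<and> (\<forall>v<n. ra s' 2 v = ang_key (p v - o')) \<and> nv s' 10 = x \<and> srt n p o' x s'" for s'
  have K_snv: "K (snv k y s')" if "K s'" "11 \<le> k" "k < 100" for k y s' using that by (simp add: K_def srt_def)
  let ?t = "(n + 1) * (ctime rank_body + 18)"
  have "tot (For 12 (NConst 0) (NV 0) rank_body) (run (SNV 11 (NConst 0)) s) ?t (\<lambda>s'. K s' \<and> nv s' 11 = rk p o' n x)"
  proof (rule tot_For[where l = 0 and h = n and t = "ctime rank_body" and
        I = "\<lambda>y s'. K s' \<and> nv s' 12 = y \<and> nv s' 11 = card {w \<in> {..<y}. lt p o' w x}"])
    show "K (snv 12 0 (run (SNV 11 (NConst 0)) s)) \<and> nv (snv 12 0 (run (SNV 11 (NConst 0)) s)) 12 = 0 \<and>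
      nv (snv 12 0 (run (SNV 11 (NConst 0)) s)) 11 = card {w \<in> {..<0}. lt p o' w x}"
      using p keys x srt by (simp add: K_def srt_def)
    show "nv s' 12 = y \<and> nval (NV 0) s' = n" if "K s' \<and> nv s' 12 = y \<and> nv s' 11 = card {w \<in> {..<y}. lt p o' w x}" for y s'
      using that by (simp add: K_def pre_def)
    show "(n - 0 + 1) * (ctime rank_body + ntime (NConst 0) + ntime (NV 0) + 14) \<le> ?t"
      by (rule mult_le_mono) (simp_all add: NV_def)
    show "K s' \<and> nv s' 11 = rk p o' n x" if "K s' \<and> nv s' 12 = n \<and> nv s' 11 = card {w \<in> {..<n}. lt p o' w x}" for s'
      using that by (simp add: rk_def)
    fix y s' assume y: "y < n" and i: "K s' \<and> nv s' 12 = y \<and> nv s' 11 = card {w \<in> {..<y}. lt p o' w x}"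
    have pr: "pre n p \<epsilon> s'" "nv s' 10 = x" "nv s' 12 = y" using i by (auto simp: K_def)
    have b: "bval less_wv s' \<longleftrightarrow> lt p o' y x"
    proof -
      have "rval (RX (NV 12)) s' = fst (p y)" "rval (RX (NV 10)) s' = fst (p x)" "rval (RY (NV 12)) s' = snd (p y)" "rval (RY (NV 10)) s' = snd (p x)"
        using rval_RX[of n p \<epsilon> s'] pr x y by simp_all
      moreover have "ra s' 2 y = ang_key (p y - o')" "ra s' 2 x = ang_key (p x - o')" using i x y by (auto simp: K_def)
      ultimately show ?thesis using pr by (simp add: less_wv_def lt_def)
    qed
    have c: "{w \<in> {..<Suc y}. lt p o' w x} = (if lt p o' y x then insert y {w \<in> {..<y}. lt p o' w x} else {w \<in> {..<y}. lt p o' w x})"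
      by (auto simp: less_Suc_eq)
    have r: "run rank_body s' = (if lt p o' y x then snv 11 (nv s' 11 + 1) s' else s')" using b by (simp add: rank_body_def)
    show "tot rank_body s' (ctime rank_body) (\<lambda>s''. nv s'' 12 = y \<and> K (snv 12 (Suc y) s'') \<and> nv (snv 12 (Suc y) s'') 12 = Suc y \<and>
      nv (snv 12 (Suc y) s'') 11 = card {w \<in> {..<Suc y}. lt p o' w x})"
    proof (rule tot_run)
      show "loopfree rank_body" by (simp add: rank_body_def)
      have cc: "card {w \<in> {..<Suc y}. lt p o' w x} =
        (if lt p o' y x then Suc (card {w \<in> {..<y}. lt p o' w x}) else card {w \<in> {..<y}. lt p o' w x})"
        unfolding c by simp
      show "nv (run rank_body s') 12 = y \<and> K (snv 12 (Suc y) (run rank_body s')) \<and> nv (snv 12 (Suc y) (run rank_body s')) 12 = Suc y \<and>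
        nv (snv 12 (Suc y) (run rank_body s')) 11 = card {w \<in> {..<Suc y}. lt p o' w x}"
        unfolding cc r using i K_snv by simp
    qed simp
  qed simp_all
  then show "tot (Seq (For 12 (NConst 0) (NV 0) rank_body) rank_put) (run (SNV 11 (NConst 0)) s) (?t + ctime rank_put + 1) ?Q"
  proof (rule tot_Seq)
    fix s1 assume s1: "K s1 \<and> nv s1 11 = rk p o' n x"
    define r where "r = rk p o' n x"
    have pr: "pre n p \<epsilon> s1" "nv s1 10 = x" "nv s1 11 = r" "nv s1 0 = n" using s1 by (auto simp: K_def r_def pre_def)
    let ?s2 = "sna 9 (r + n) x (sna 9 r x s1)"
    have e: "rval (RX (NV 10)) ?s2 = fst (p x)" "rval (RX (NV 10)) (sra 0 r z ?s2) = fst (p x)"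
      "rval (RY (NV 10)) (sra 0 (r + n) z' (sra 0 r z ?s2)) = snd (p x)"
      "rval (RY (NV 10)) (sra 8 r z'' (sra 0 (r + n) z' (sra 0 r z ?s2))) = snd (p x)" for z z' z''
    proof -
      have "rval (RX (NV 10)) s' = fst (p x) \<and> rval (RY (NV 10)) s' = snd (p x)" if "pre n p \<epsilon> s'" "nv s' 10 = x" for s'
        using rval_RX[OF that(1), of "NV 10"] that(2) x by simp
      then show "rval (RX (NV 10)) ?s2 = fst (p x)" "rval (RX (NV 10)) (sra 0 r z ?s2) = fst (p x)"
        "rval (RY (NV 10)) (sra 0 (r + n) z' (sra 0 r z ?s2)) = snd (p x)"
        "rval (RY (NV 10)) (sra 8 r z'' (sra 0 (r + n) z' (sra 0 r z ?s2))) = snd (p x)"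
        using pr by simp_all
    qed
    have run: "run rank_put s1 = sra 8 (r + n) (snd (p x)) (sra 8 r (snd (p x)) (sra 0 (r + n) (fst (p x)) (sra 0 r (fst (p x)) ?s2)))"
      using pr by (simp add: rank_put_def e)
    have bij: "bij_betw (rk p o' n) {..<n} {..<n}" by (rule rk_props)
    have rn: "rk p o' n v < n" if "v < n" for v using bij that by (auto simp: bij_betw_def)
    have inj: "rk p o' n v \<noteq> r" if "v < x" for v
      using bij that x unfolding r_def by (auto simp: bij_betw_def inj_on_def)
    have "srt n p o' (Suc x) (run rank_put s1)"
      unfolding srt_def
    proof (intro allI impI)
      fix v assume v: "v < Suc x"
      show "na (run rank_put s1) 9 (rk p o' n v) = v \<and> na (run rank_put s1) 9 (rk p o' n v + n) = v \<and>
        (ra (run rank_put s1) 0 (rk p o' n v), ra (run rank_put s1) 8 (rk p o' n v)) = p v \<and>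
        (ra (run rank_put s1) 0 (rk p o' n v + n), ra (run rank_put s1) 8 (rk p o' n v + n)) = p v"
      proof (cases "v = x")
        case True
        then show ?thesis unfolding run by (simp add: r_def[symmetric])
      next
        case False
        then have vx: "v < x" using v by simp
        have "rk p o' n v \<noteq> r" "rk p o' n v < n" "r < n" using inj[OF vx] rn x vx by (simp_all add: r_def)
        then show ?thesis unfolding run using s1 vx by (auto simp: K_def srt_def)
      qed
    qed
    then show "tot rank_put s1 (ctime rank_put) ?Q"
      by (intro tot_run) (use s1 in \<open>simp_all add: K_def run\<close>, simp add: rank_put_def)
  qed simp
  have "ctime (SNV 11 (NConst 0)) + ctime rank_put + 2 \<le> (n + 1) * (ctime (SNV 11 (NConst 0)) + ctime rank_put + 12)" by simp
  moreover have "rank_time * (n + 1) = (n + 1) * (ctime rank_body + 18) + (n + 1) * (ctime (SNV 11 (NConst 0)) + ctime rank_put + 12)"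
    unfolding rank_time_def by (simp only: add_mult_distrib2[symmetric]) (simp add: ac_simps)
  ultimately show "ctime (SNV 11 (NConst 0)) + (?t + ctime rank_put + 1) + 1 \<le> rank_time * (n + 1)" by linarith
qed simp

lemma ranks_correct:
  assumes p: "pre n p \<epsilon> s" "nv s 2 = N" and keys: "\<forall>v<n. ra s 2 v = ang_key (p v - o')"
  shows "tot ranks s ((n + 1) * (rank_time * (n + 1) + 18)) (\<lambda>s'. pre n p \<epsilon> s' \<and> nv s' 2 = N \<and> srt n p o' n s')"
  unfolding ranks_def
proof (rule tot_For[where l = 0 and h = n and t = "rank_time * (n + 1)" and
      I = "\<lambda>x s'. pre n p \<epsilon> s' \<and> nv s' 2 = N \<and> (\<forall>v<n. ra s' 2 v = ang_key (p v - o')) \<and> nv s' 10 = x \<and> srt n p o' x s'"])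
  fix x s' assume x: "x < n" and i: "pre n p \<epsilon> s' \<and> nv s' 2 = N \<and> (\<forall>v<n. ra s' 2 v = ang_key (p v - o')) \<and> nv s' 10 = x \<and> srt n p o' x s'"
  have "tot rank_one s' (rank_time * (n + 1)) (\<lambda>s'. pre n p \<epsilon> s' \<and> nv s' 2 = N \<and> (\<forall>v<n. ra s' 2 v = ang_key (p v - o')) \<and>
    nv s' 10 = x \<and> srt n p o' (Suc x) s')"
    by (rule rank_one_correct) (use i x in auto)
  then show "tot rank_one s' (rank_time * (n + 1)) (\<lambda>s''. nv s'' 10 = x \<and> pre n p \<epsilon> (snv 10 (Suc x) s'') \<and> nv (snv 10 (Suc x) s'') 2 = N \<and>
    (\<forall>v<n. ra (snv 10 (Suc x) s'') 2 v = ang_key (p v - o')) \<and> nv (snv 10 (Suc x) s'') 10 = Suc x \<and> srt n p o' (Suc x) (snv 10 (Suc x) s''))"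
    by (rule tot_mono) (simp_all add: srt_def)
next
  show "nv s' 10 = x \<and> nval (NV 0) s' = n" if "pre n p \<epsilon> s' \<and> nv s' 2 = N \<and> (\<forall>v<n. ra s' 2 v = ang_key (p v - o')) \<and> nv s' 10 = x \<and> srt n p o' x s'" for x s'
    using that by (simp add: pre_def)
  show "(n - 0 + 1) * (rank_time * (n + 1) + ntime (NConst 0) + ntime (NV 0) + 14) \<le> (n + 1) * (rank_time * (n + 1) + 18)"
    by (rule mult_le_mono) (simp_all add: NV_def)
qed (use p keys in \<open>auto simp: srt_def\<close>)

text \<open>The multiples of the row length \<open>2 n + 1\<close> are produced by repeated
  addition.\<close>

definition row_body :: com where
  "row_body = seqs [SNA 2 (NV 10) (NV 11), SNV 11 (NAdd (NV 11) (NAdd NN (NConst 1)))]"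

definition rows :: com where
  "rows = Seq (SNV 11 (NConst 0)) (For 10 (NConst 0) (NAdd NN (NConst 1)) row_body)"

definition "row_tab_time = ctime (SNV 11 (NConst 0)) + ctime row_body + 30"

lemma rows_correct:
  assumes p: "pre n p \<epsilon> s" "nv s 2 = N" and srt: "srt n p o' n s"
  shows "tot rows s (row_tab_time * (2 * n + 2)) (\<lambda>s'. pre n p \<epsilon> s' \<and> nv s' 2 = N \<and> srt n p o' n s' \<and>
    (\<forall>i\<le>2 * n. na s' 2 i = i * (2 * n + 1)))"
  unfolding rows_def
proof (rule tot_run_Seq)
  let ?t = "(2 * n + 2) * (ctime row_body + 23)"
  show "tot (For 10 (NConst 0) (NAdd NN (NConst 1)) row_body) (run (SNV 11 (NConst 0)) s) ?t (\<lambda>s'. pre n p \<epsilon> s' \<and> nv s' 2 = N \<and> srt n p o' n s' \<and>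
    (\<forall>i\<le>2 * n. na s' 2 i = i * (2 * n + 1)))"
  proof (rule tot_For[where l = 0 and h = "2 * n + 1" and t = "ctime row_body" and
        I = "\<lambda>x s'. pre n p \<epsilon> s' \<and> nv s' 2 = N \<and> srt n p o' n s' \<and> nv s' 10 = x \<and> nv s' 11 = x * (2 * n + 1) \<and> (\<forall>i<x. na s' 2 i = i * (2 * n + 1))"])
    show "nv s' 10 = x \<and> nval (NAdd NN (NConst 1)) s' = 2 * n + 1"
      if "pre n p \<epsilon> s' \<and> nv s' 2 = N \<and> srt n p o' n s' \<and> nv s' 10 = x \<and> nv s' 11 = x * (2 * n + 1) \<and> (\<forall>i<x. na s' 2 i = i * (2 * n + 1))" for x s'
      using that by (simp add: pre_def NN_def)
    show "(2 * n + 1 - 0 + 1) * (ctime row_body + ntime (NConst 0) + ntime (NAdd NN (NConst 1)) + 14) \<le> ?t"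
      by (rule mult_le_mono) (simp_all add: NV_def NN_def)
    fix x s' assume i: "pre n p \<epsilon> s' \<and> nv s' 2 = N \<and> srt n p o' n s' \<and> nv s' 10 = x \<and> nv s' 11 = x * (2 * n + 1) \<and> (\<forall>i<x. na s' 2 i = i * (2 * n + 1))"
    have r: "run row_body s' = snv 11 (x * (2 * n + 1) + (2 * n + 1)) (sna 2 x (x * (2 * n + 1)) s')"
      using i by (simp add: row_body_def NN_def pre_def mult_2)
    show "tot row_body s' (ctime row_body) (\<lambda>s''. nv s'' 10 = x \<and> pre n p \<epsilon> (snv 10 (Suc x) s'') \<and> nv (snv 10 (Suc x) s'') 2 = N \<and>
      srt n p o' n (snv 10 (Suc x) s'') \<and> nv (snv 10 (Suc x) s'') 10 = Suc x \<and> nv (snv 10 (Suc x) s'') 11 = Suc x * (2 * n + 1) \<and>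
      (\<forall>i<Suc x. na (snv 10 (Suc x) s'') 2 i = i * (2 * n + 1)))"
    proof (rule tot_run)
      show "loopfree row_body" by (simp add: row_body_def)
    qed (use i in \<open>auto simp: r srt_def less_Suc_eq\<close>)
  next
    fix s' assume "pre n p \<epsilon> s' \<and> nv s' 2 = N \<and> srt n p o' n s' \<and> nv s' 10 = 2 * n + 1 \<and> nv s' 11 = (2 * n + 1) * (2 * n + 1) \<and>
      (\<forall>i<2 * n + 1. na s' 2 i = i * (2 * n + 1))"
    then show "pre n p \<epsilon> s' \<and> nv s' 2 = N \<and> srt n p o' n s' \<and> (\<forall>i\<le>2 * n. na s' 2 i = i * (2 * n + 1))" by simp
  qed (use p srt in \<open>simp_all add: srt_def\<close>)
  have "ctime (SNV 11 (NConst 0)) + 1 \<le> (2 * n + 2) * (ctime (SNV 11 (NConst 0)) + 7)" by simp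
  moreover have "row_tab_time * (2 * n + 2) = (2 * n + 2) * (ctime row_body + 23) + (2 * n + 2) * (ctime (SNV 11 (NConst 0)) + 7)"
    unfolding row_tab_time_def by (simp only: add_mult_distrib2[symmetric]) (simp add: ac_simps)
  ultimately show "ctime (SNV 11 (NConst 0)) + ?t + 1 \<le> row_tab_time * (2 * n + 2)" by linarith
qed simp

text \<open>Array 9 is the inverse of the rank function on the first \<open>n\<close> cells and
  repeats with period \<open>n\<close>, so it lists the sources in sorted order twice.\<close>

lemma sorted_points:
  assumes p: "pre n p \<epsilon> s" "nv s 2 = N" and srt: "srt n p o' n s" and n: "n \<ge> 1"
    and rw: "\<forall>i\<le>2 * n. na s 2 i = i * (2 * n + 1)"
  defines "\<pi> \<equiv> na s 9"
  shows "bij_betw \<pi> {..<n} {..<n}" "\<And>i j. i < j \<Longrightarrow> j < n \<Longrightarrow> before o' (p (\<pi> i)) (p (\<pi> j))"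
    "\<And>k. k < 2 * n \<Longrightarrow> na s 9 k = \<pi> (k mod n)" "dctx n N (\<lambda>k. p (\<pi> (k mod n))) (p n) s"
proof -
  let ?r = "rk p o' n"
  have bij: "bij_betw ?r {..<n} {..<n}" by (rule rk_props)
  have inv: "\<pi> (?r v) = v" "na s 9 (?r v + n) = v" "p v = (ra s 0 (?r v), ra s 8 (?r v))"
    "p v = (ra s 0 (?r v + n), ra s 8 (?r v + n))" if "v < n" for v
    using srt that by (simp_all add: srt_def \<pi>_def)
  have ex: "\<exists>v<n. k = ?r v" if "k < n" for k using bij that unfolding bij_betw_def by blast
  have rn: "?r v < n" if "v < n" for v using bij that by (auto simp: bij_betw_def)
  show "bij_betw \<pi> {..<n} {..<n}"
  proof (rule bij_betw_byWitness[where f' = ?r])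
    have pr: "?r (\<pi> a) = a \<and> \<pi> a < n" if "a < n" for a using ex[OF that] inv(1) by metis
    show "\<forall>a\<in>{..<n}. ?r (\<pi> a) = a" "\<pi> ` {..<n} \<subseteq> {..<n}" using pr by auto
    show "\<forall>a\<in>{..<n}. \<pi> (?r a) = a" "?r ` {..<n} \<subseteq> {..<n}" using inv(1) rn by auto
  qed
  show "before o' (p (\<pi> i)) (p (\<pi> j))" if ij: "i < j" "j < n" for i j
  proof -
    obtain u v where uv: "u < n" "i = ?r u" "v < n" "j = ?r v" using ex[of i] ex[of j] ij by auto
    show ?thesis using rk_props(2)[of u n v p o'] uv ij inv by simp
  qed
  have kk: "na s 9 k = \<pi> (k mod n) \<and> p (\<pi> (k mod n)) = (ra s 0 k, ra s 8 k)" if k: "k < 2 * n" for k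
  proof (cases "k < n")
    case True
    obtain v where "v < n" "k = ?r v" using ex[OF True] by blast
    then show ?thesis using inv[of v] rn[of v] by (simp add: \<pi>_def)
  next
    case False
    then have kn: "k - n < n" "k mod n = k - n" using k by (simp_all add: mod_if)
    obtain v where v: "v < n" "k - n = ?r v" using ex[OF kn(1)] by blast
    then have "k = ?r v + n" using False by simp
    then show ?thesis using inv[OF v(1)] v kn by simp
  qed
  then show "na s 9 k = \<pi> (k mod n)" if "k < 2 * n" for k using that by blast
  show "dctx n N (\<lambda>k. p (\<pi> (k mod n))) (p n) s"
    using p rw kk by (simp add: dctx_def pts_def pre_def)
qed

subsection \<open>The whole algorithm\<close>

definition prog :: com where
  "prog = Seq prologue (Seq count (Seq cen (Seq keys (Seq ranks (Seq rows (Seq fill (Seq pick (Seq readout copy_out))))))))"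

lemma row_ok_frame:
  assumes "row_ok P T \<epsilon> n (2 * n + 1) s i" "i \<le> 2 * n" "frame kn kr s s'"
  shows "row_ok P T \<epsilon> n (2 * n + 1) s' i"
  by (rule row_ok_eqcell[OF assms(1,2)]) (use assms frame_tab[OF assms(3)] in \<open>auto simp: eqcell_def\<close>)

text \<open>After the scan no interval is pending, so the realised cost equals the table entry and
  every hub has a source. The permutation turns the sum over the window into the sum over the
  sources.\<close>

lemma readout_layout:
  assumes n: "n \<ge> 1" "c0 < n" and I: "sources I = {..<n}" "sinks I = {n}" "layers I = 1" "alpha I = 0"
    and \<pi>: "bij_betw \<pi> {..<n} {..<n}" and perm: "\<And>k. k < 2 * n \<Longrightarrow> na s0 9 k = \<pi> (k mod n)"
    and inv: "ext_inv (\<lambda>k. loc I (\<pi> (k mod n))) (loc I n) n c0 s0 (c0 + n) s"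
    and inp: "\<And>v. v \<le> n \<Longrightarrow> inp s0 (2 * v + 1) = fst (loc I v) \<and> inp s0 (2 * v + 2) = snd (loc I v)"
  shows "tot copy_out s (ctime (SNV 0 (NConst 0)) + 1 + (2 * n + 2) * (ctime copy_body + btime (NLess (NConst 0) (NA 0 (NV 0))) + 1))
    (\<lambda>s'. is_layout I (output_layout n s') \<and> cost I (output_layout n s') = tab s0 3 c0 (c0 + n))"
proof -
  let ?P = "\<lambda>k. loc I (\<pi> (k mod n))" and ?hi = "c0 + n"
  define m where "m = nv s 12"
  define pos where "pos v = (inp s (2 * v + 1), inp s (2 * v + 2))" for v
  have xk: "xkeep n s0 s" and m2: "m \<le> 2 * n + 1" and pn: "na s 0 n = 1"
    and pv: "\<And>v. v \<in> {n + 1..<m} \<Longrightarrow> na s 0 v = n + 1" and pz: "\<And>v. v \<ge> m \<Longrightarrow> na s 0 v = 0"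
    using inv by (auto simp: ext_inv_def m_def)
  obtain St where ps: "partial_sol (tab s0 3) ?P (loc I n) n c0 ?hi (tab s0 3 c0 ?hi) ?hi m (\<lambda>k. na s 0 (na s0 9 k)) pos (na s 8) St"
    using inv unfolding ext_inv_def m_def pos_def by blast
  note D = partial_sol_done[OF ps]
  have bij: "bij_betw (\<lambda>k. \<pi> (k mod n)) {c0..<?hi} {..<n}"
    using bij_betw_trans[OF bij_betw_mod_window \<pi>] by (simp add: comp_def)
  have p9: "na s0 9 k = \<pi> (k mod n)" if "k \<in> {c0..<?hi}" for k using perm[of k] that n by simp
  have Lr: "n + 1 < na s 0 (\<pi> (k mod n)) \<and> na s 0 (\<pi> (k mod n)) \<le> m" if "k \<in> {c0..<?hi}" for k
    using D(1)[OF that] p9[OF that] by simp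
  have src: "n + 1 < na s 0 u \<and> na s 0 u \<le> m" if "u < n" for u
  proof -
    have "u \<in> (\<lambda>k. \<pi> (k mod n)) ` {c0..<?hi}" using bij that by (simp add: bij_betw_def)
    then obtain k where "k \<in> {c0..<?hi}" "u = \<pi> (k mod n)" by blast
    then show ?thesis using Lr by simp
  qed
  have hub: "\<exists>u<n. na s 0 u = Suc v" if "v \<in> {n + 1..<m}" for v
  proof -
    obtain k where k: "k \<in> {c0..<?hi}" "na s 0 (na s0 9 k) = Suc v" using D(2)[OF \<open>v \<in> {n + 1..<m}\<close>] by blast
    have "\<pi> (k mod n) < n" using bij k(1) unfolding bij_betw_def by blast
    then show ?thesis using k p9 by auto
  qed
  have nm: "n + 1 \<le> m" using D(4) .
  have posv: "na s 0 v > 0" if vm: "v < m" for v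
  proof (cases "v < n")
    case True
    then show ?thesis using src[of v] by linarith
  next
    case False
    then show ?thesis using pn pv[of v] vm by (cases "v = n") auto
  qed
  have posn: "pos v = loc I v" if "v \<le> n" for v
    using xk inp[OF that] that by (simp add: pos_def xkeep_def prod_eq_iff)
  have "tot copy_out s (ctime (SNV 0 (NConst 0)) + 1 + (m + 1) * (ctime copy_body + btime (NLess (NConst 0) (NA 0 (NV 0))) + 1))
    (\<lambda>s'. fst s' 0 = m \<and> (\<forall>v<m. fst s' (v + 1) = na s 0 v - 1) \<and> snd s' = snd s)"
    by (rule copy_out_correct) (use posv pz in auto)
  then show ?thesis
  proof (rule tot_mono)
    show "ctime (SNV 0 (NConst 0)) + 1 + (m + 1) * (ctime copy_body + btime (NLess (NConst 0) (NA 0 (NV 0))) + 1)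
      \<le> ctime (SNV 0 (NConst 0)) + 1 + (2 * n + 2) * (ctime copy_body + btime (NLess (NConst 0) (NA 0 (NV 0))) + 1)"
      by (intro add_left_mono mult_le_mono1) (use m2 in simp)
    fix s' assume s': "fst s' 0 = m \<and> (\<forall>v<m. fst s' (v + 1) = na s 0 v - 1) \<and> snd s' = snd s"
    define par where "par v = fst s' (v + 1)" for v
    have par: "par v = na s 0 v - 1" if "v < m" for v using s' that by (simp add: par_def)
    have out: "output_layout n s' = \<lparr>verts = {..<m}, parent = (\<lambda>v. if v = n then None else Some (par v)), emb = pos\<rparr>"
      using s' unfolding output_layout_def par_def pos_def[abs_def] inp_def by simp
    have s1: "n < par u \<and> par u < m" if "u < n" for u using src[OF that] par[of u] that nm by linarith
    have h1: "par v = n \<and> (\<exists>u<n. par u = v)" if v: "n < v" "v < m" for v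
    proof -
      have vv: "v \<in> {n + 1..<m}" using v by simp
      obtain u where u: "u < n" "na s 0 u = Suc v" using hub[OF vv] by blast
      then have "par u = v" using par[of u] nm by simp
      then show ?thesis using par[of v] pv[OF vv] v u by auto
    qed
    have L: "is_layout I (output_layout n s')"
      "cost I (output_layout n s') = (\<Sum>u<n. dist (pos (par u)) (loc I u)) + (\<Sum>v\<in>{n<..<m}. dist (pos v) (loc I n))"
      unfolding out by (rule two_level_layout[OF n(1) I]; (rule s1 h1 posn; assumption))+
    have "(\<Sum>u<n. dist (pos (par u)) (loc I u)) = (\<Sum>k\<in>{c0..<?hi}. dist (pos (par (\<pi> (k mod n)))) (?P k))"
      using sum.reindex_bij_betw[OF bij, of "\<lambda>u. dist (pos (par u)) (loc I u)"] by simp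
    also have "\<dots> = (\<Sum>k\<in>{c0..<?hi}. dist (pos (na s 0 (na s0 9 k) - 1)) (?P k))"
    proof (rule sum.cong[OF refl])
      fix k assume k: "k \<in> {c0..<?hi}"
      have "\<pi> (k mod n) < n" using bij k unfolding bij_betw_def by blast
      then show "dist (pos (par (\<pi> (k mod n)))) (?P k) = dist (pos (na s 0 (na s0 9 k) - 1)) (?P k)"
        using par[of "\<pi> (k mod n)"] nm p9[OF k] by simp
    qed
    finally have e1: "(\<Sum>u<n. dist (pos (par u)) (loc I u)) = (\<Sum>k\<in>{c0..<?hi}. dist (pos (na s 0 (na s0 9 k) - 1)) (?P k))" .
    have e2: "{n<..<m} = {n + 1..<m}" by auto
    have "cost I (output_layout n s') = tab s0 3 c0 ?hi" unfolding L(2) e1 e2 using D(3) by simp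
    with L(1) show "is_layout I (output_layout n s') \<and> cost I (output_layout n s') = tab s0 3 c0 ?hi" by blast
  qed
qed

definition prog_time :: "nat \<Rightarrow> nat \<Rightarrow> nat" where
  "prog_time n N = ctime prologue + (N + 1) * (ctime count_body + btime (BNot (RLess (RV 6) (RV 5))) + 1) + cen_time * (n + 2) +
     (n + 1) * (ctime key_body + 18) + (n + 1) * (rank_time * (n + 1) + 18) + row_tab_time * (2 * n + 2) + fill_time n N +
     pick_time * (n + 1) + (ctime ext_init + 1 + (n + 1) * (ext_time * (2 * n + 1) + 30)) +
     (ctime (SNV 0 (NConst 0)) + 1 + (2 * n + 2) * (ctime copy_body + btime (NLess (NConst 0) (NA 0 (NV 0))) + 1)) + 9"

text \<open>A lower bound for the costs of all layouts passes to the infimum, which is taken over a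
  nonempty set because of \<open>L0\<close>.\<close>

lemma min_cost_ge:
  assumes "is_layout I L0" "\<rho> > 0" "\<And>L. is_layout I L \<Longrightarrow> x \<le> \<rho> * cost I L"
  shows "x \<le> \<rho> * min_cost I"
proof -
  have "x / \<rho> \<le> min_cost I" unfolding min_cost_def
    by (rule cINF_greatest) (use assms in \<open>auto simp: field_simps\<close>)
  then show ?thesis using assms(2) by (simp add: field_simps)
qed

lemma prog_correct:
  assumes n: "n \<ge> 1" and I: "sources I = {..<n}" "sinks I = {n}" "layers I = 1" "alpha I = 0"
    and conv: "convex_instance I" and \<epsilon>: "\<epsilon> > 0"
  defines "\<delta> \<equiv> min \<epsilon> (1/2)"
  assumes N: "(7/9) ^ N < (\<delta>/4)\<^sup>2" "\<And>k. k < N \<Longrightarrow> \<not> (7/9) ^ k < (\<delta>/4)\<^sup>2"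
  shows "tot prog (input_state n I \<epsilon>) (prog_time n N) (\<lambda>s. is_layout I (output_layout n s) \<and>
    cost I (output_layout n s) \<le> (1 + \<delta>) * min_cost I)"
proof -
  let ?Q = "\<lambda>s. is_layout I (output_layout n s) \<and> cost I (output_layout n s) \<le> (1 + \<delta>) * min_cost I"
  have \<delta>: "0 < \<delta>" "\<delta> \<le> 1" using \<epsilon> by (auto simp: \<delta>_def)
  define o' where "o' = (1 / real (n + 1)) *\<^sub>R (\<Sum>v\<le>n. loc I v)"
  let ?t9 = "ctime (SNV 0 (NConst 0)) + 1 + (2 * n + 2) * (ctime copy_body + btime (NLess (NConst 0) (NA 0 (NV 0))) + 1)"
  let ?t8 = "ctime ext_init + 1 + (n + 1) * (ext_time * (2 * n + 1) + 30)"
  have after_rows: "tot (Seq fill (Seq pick (Seq readout copy_out))) s5 (fill_time n N + (pick_time * (n + 1) + (?t8 + ?t9 + 1) + 1) + 1) ?Q"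
    if s5: "pre n (loc I) \<delta> s5" "nv s5 2 = N" "srt n (loc I) o' n s5" "\<forall>i\<le>2 * n. na s5 2 i = i * (2 * n + 1)" for s5
  proof -
    define \<pi> where "\<pi> = na s5 9"
    let ?P = "\<lambda>k. loc I (\<pi> (k mod n))"
    note so = sorted_points[OF s5(1,2,3) n s5(4), folded \<pi>_def]
    show ?thesis
    proof (rule tot_Seq[OF fill_correct[OF so(4) \<delta> N(1)]])
      fix s6 assume s6: "keep s5 s6 \<and> (\<forall>i\<le>2 * n. row_ok ?P (loc I n) \<delta> n (2 * n + 1) s6 i)"
      have k6: "keep s5 s6" and ok6: "\<And>i. i \<le> 2 * n \<Longrightarrow> row_ok ?P (loc I n) \<delta> n (2 * n + 1) s6 i" using s6 by auto
      have v6: "nv s6 0 = n" "nv s6 5 = 4 * n + 8" using k6 s5(1) by (simp_all add: keep_def pre_def)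
      \<comment> \<open>Each layout is matched by a starting position of its own; the minimum over
        all starts, taken by \<open>pick\<close>, beats all layouts simultaneously.\<close>
      have opt: "\<exists>c<n. tab s6 3 c (c + n) \<le> (1 + \<delta>) * cost I L" if L: "is_layout I L" for L
      proof -
        have A0: "tab s6 3 i i = 0" if "i \<le> 2 * n" for i using ok6[OF that] by (simp add: row_ok_def)
        have AB: "tab s6 3 i j \<le> tab s6 4 i f + tab s6 3 f j" if "i < f" "f \<le> j" "j \<le> i + n" "j \<le> 2 * n" for i f j
        proof -
          have "okA s6 i j" using ok6[of i] that by (simp add: row_ok_def)
          then show ?thesis using that unfolding okA_def by blast
        qed
        have Bo: "tab s6 4 i f \<le> (1 + \<delta>) * star ?P (loc I n) (grp i b c d e f) q + tab s6 3 b c + tab s6 3 d e"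
          if "i < b" "b \<le> c" "c \<le> d" "d \<le> e" "e \<le> f" "f \<le> i + n" "f \<le> 2 * n" for i b c d e f q
        proof -
          have "okB ?P (loc I n) \<delta> s6 i f" using ok6[of i] that by (simp add: row_ok_def)
          moreover have "valid_cut i b c d e f" using that by (simp add: valid_cut_def)
          ultimately have "good_cut ?P (loc I n) (tab s6 3) \<delta> i f b c d e (tab s6 4 i f)" by (simp add: okB_def)
          then show ?thesis unfolding good_cut_def by blast
        qed
        have \<rho>: "0 \<le> 1 + \<delta>" using \<delta> by simp
        show ?thesis
          using dp_le_cost[OF n I conv L so(1) so(2)[unfolded o'_def] refl refl A0 AB Bo \<rho>] by blast
      qed
      show "tot (Seq pick (Seq readout copy_out)) s6 (pick_time * (n + 1) + (?t8 + ?t9 + 1) + 1) ?Q"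
      proof (rule tot_Seq[OF pick_correct[OF v6(1) n]])
        fix s7 assume s7: "frame 10 13 s6 s7 \<and> nv s7 11 < n \<and> (\<forall>c<n. tab s6 3 (nv s7 11) (nv s7 11 + n) \<le> tab s6 3 c (c + n))"
        define c0 where "c0 = nv s7 11"
        have f7: "frame 10 13 s6 s7" and c0: "c0 < n" and best: "\<And>c. c < n \<Longrightarrow> tab s6 3 c0 (c0 + n) \<le> tab s6 3 c (c + n)"
          using s7 by (auto simp: c0_def)
        have v7: "nv s7 0 = n" "nv s7 5 = 4 * n + 8" "nv s7 11 = c0" using frame_get[OF f7] v6 by (auto simp: c0_def)
        have ok7: "row_ok ?P (loc I n) \<delta> n (2 * n + 1) s7 i" if "i \<le> 2 * n" for i
          by (rule row_ok_frame[OF ok6[OF that] that f7])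
        have p9: "na s7 9 k = \<pi> (k mod n)" if "k < 2 * n" for k
          using frame_get(2)[OF f7, of 9 k] k6 so(3)[OF that] by (simp add: keep_def \<pi>_def)
        have p9n: "na s7 9 k < n" if "k < 2 * n" for k
          using p9[OF that] so(1) n by (auto simp: bij_betw_def)
        have inj: "inj_on (na s7 9) {c0..<c0 + n}"
        proof -
          have "inj_on (\<lambda>k. \<pi> (k mod n)) {c0..<c0 + n}"
            using bij_betw_trans[OF bij_betw_mod_window so(1)] by (simp add: comp_def bij_betw_def)
          moreover have "na s7 9 k = \<pi> (k mod n)" if "k \<in> {c0..<c0 + n}" for k using p9[of k] that c0 by simp
          ultimately show ?thesis using inj_on_cong[of "{c0..<c0 + n}" "na s7 9" "\<lambda>k. \<pi> (k mod n)"] by blast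
        qed
        have z7: "na s7 0 v = 0" for v using frame_get(2)[OF f7, of 0 v] k6 s5(1) by (simp add: keep_def pre_def)
        have inp7: "inp s7 (2 * v + 1) = fst (loc I v) \<and> inp s7 (2 * v + 2) = snd (loc I v)" if "v \<le> n" for v
        proof -
          have "inp s7 a = inp s5 a" if "a \<le> 2 * n + 2" for a
            using frame_get(5)[OF f7, of a] k6 v6 that s5(1) by (simp add: keep_def pre_def)
          then show ?thesis using s5(1) that by (simp add: pre_def)
        qed
        show "tot (Seq readout copy_out) s7 (?t8 + ?t9 + 1) ?Q"
        proof (rule tot_Seq[OF readout_correct[OF v7 c0 ok7 p9n inj z7]])
          fix s8 assume s8: "ext_inv ?P (loc I n) n c0 s7 (c0 + n) s8"
          show "tot copy_out s8 ?t9 ?Q"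
          proof (rule tot_mono[OF readout_layout[OF n c0 I so(1) p9 s8 inp7]])
            fix s9 assume s9: "is_layout I (output_layout n s9) \<and> cost I (output_layout n s9) = tab s7 3 c0 (c0 + n)"
            have "cost I (output_layout n s9) \<le> (1 + \<delta>) * cost I L" if L: "is_layout I L" for L
            proof -
              obtain c where "c < n" "tab s6 3 c (c + n) \<le> (1 + \<delta>) * cost I L" using opt[OF L] by blast
              then show ?thesis using s9 best[of c] frame_tab(1)[OF f7, of 3 c0 "c0 + n"] by simp
            qed
            then have "cost I (output_layout n s9) \<le> (1 + \<delta>) * min_cost I"
              using min_cost_ge[of I "output_layout n s9" "1 + \<delta>"] s9 \<delta> by simp
            then show "?Q s9" using s9 by blast
          qed (assumption | rule order_refl)+
        qed (assumption | rule order_refl)+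
      qed simp_all
    qed simp_all
  qed
  define s1 where "s1 = run prologue (input_state n I \<epsilon>)"
  note s1 = prologue_correct[OF s1_def, folded \<delta>_def]
  show ?thesis unfolding prog_def
  proof (rule tot_run_Seq)
    show "loopfree prologue" by (simp add: prologue_def)
    let ?t7 = "fill_time n N + (pick_time * (n + 1) + (?t8 + ?t9 + 1) + 1) + 1"
    let ?t6 = "row_tab_time * (2 * n + 2) + ?t7 + 1"
    let ?t5 = "(n + 1) * (rank_time * (n + 1) + 18) + ?t6 + 1"
    let ?t4 = "(n + 1) * (ctime key_body + 18) + ?t5 + 1"
    let ?t3 = "cen_time * (n + 2) + ?t4 + 1"
    let ?t2 = "(N + 1) * (ctime count_body + btime (BNot (RLess (RV 6) (RV 5))) + 1) + ?t3 + 1"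
    show "tot (Seq count (Seq cen (Seq keys (Seq ranks (Seq rows (Seq fill (Seq pick (Seq readout copy_out))))))))
      (run prologue (input_state n I \<epsilon>)) ?t2 ?Q"
      unfolding s1_def[symmetric]
    proof (rule tot_Seq[OF count_correct[OF s1 N]])
      fix s2 assume s2: "pre n (loc I) \<delta> s2 \<and> nv s2 2 = N"
      show "tot (Seq cen (Seq keys (Seq ranks (Seq rows (Seq fill (Seq pick (Seq readout copy_out))))))) s2 ?t3 ?Q"
      proof (rule tot_Seq[OF cen_correct[OF conjunct1[OF s2] conjunct2[OF s2]]])
        fix s3 assume s3: "pre n (loc I) \<delta> s3 \<and> nv s3 2 = N \<and> (rv s3 7, rv s3 8) = (1 / real (n + 1)) *\<^sub>R (\<Sum>v\<le>n. loc I v)"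
        then have s3': "pre n (loc I) \<delta> s3" "nv s3 2 = N" "(rv s3 7, rv s3 8) = o'" unfolding o'_def by blast+
        show "tot (Seq keys (Seq ranks (Seq rows (Seq fill (Seq pick (Seq readout copy_out)))))) s3 ?t4 ?Q"
        proof (rule tot_Seq[OF keys_correct[OF s3']])
          fix s4 assume s4: "pre n (loc I) \<delta> s4 \<and> nv s4 2 = N \<and> (\<forall>v<n. ra s4 2 v = ang_key (loc I v - o'))"
          then have s4': "pre n (loc I) \<delta> s4" "nv s4 2 = N" "\<forall>v<n. ra s4 2 v = ang_key (loc I v - o')" by blast+
          show "tot (Seq ranks (Seq rows (Seq fill (Seq pick (Seq readout copy_out))))) s4 ?t5 ?Q"
          proof (rule tot_Seq[OF ranks_correct[OF s4']])
            fix s5 assume s5: "pre n (loc I) \<delta> s5 \<and> nv s5 2 = N \<and> srt n (loc I) o' n s5"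
            then have s5': "pre n (loc I) \<delta> s5" "nv s5 2 = N" "srt n (loc I) o' n s5" by blast+
            show "tot (Seq rows (Seq fill (Seq pick (Seq readout copy_out)))) s5 ?t6 ?Q"
            proof (rule tot_Seq[OF rows_correct[OF s5']])
              fix s6 assume "pre n (loc I) \<delta> s6 \<and> nv s6 2 = N \<and> srt n (loc I) o' n s6 \<and> (\<forall>i\<le>2 * n. na s6 2 i = i * (2 * n + 1))"
              then show "tot (Seq fill (Seq pick (Seq readout copy_out))) s6 ?t7 ?Q" using after_rows by blast
            qed simp
          qed simp
        qed simp
      qed simp
    qed (assumption | rule order_refl | simp)+
    show "ctime prologue + ?t2 + 1 \<le> prog_time n N" by (simp add: prog_time_def)
  qed
qed

text \<open>Filling the tables dominates: the other phases are at most quadratic in \<open>n\<close>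
  or linear in \<open>N\<close>.\<close>

lemma prog_time_bound: "\<exists>C. \<forall>n N. prog_time n N \<le> C * ((2 * n + 2) ^ 7 * (N + 1))"
proof -
  obtain C0 where C0: "\<And>n N. fill_time n N \<le> C0 * ((2 * n + 2) ^ 7 * (N + 1))" using fill_time_bound by blast
  let ?c2 = "ctime count_body + btime (BNot (RLess (RV 6) (RV 5))) + 1"
  let ?c9 = "ctime copy_body + btime (NLess (NConst 0) (NA 0 (NV 0))) + 1"
  let ?a = "ctime prologue + ctime ext_init + ctime (SNV 0 (NConst 0)) + 11"
  define C where "C = C0 + ?a + ?c2 + cen_time + (ctime key_body + 18) + (rank_time + 18) + row_tab_time + pick_time + (ext_time + 30) + ?c9"
  have "prog_time n N \<le> C * ((2 * n + 2) ^ 7 * (N + 1))" for n N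
  proof -
    define X where "X = 2 * n + 2"
    define u where "u = X ^ 7 * (N + 1)"
    have X1: "1 \<le> X" by (simp add: X_def)
    have p: "X ^ k \<le> u" if "k \<le> 7" for k
    proof -
      have "X ^ k \<le> X ^ 7" using power_increasing[OF that X1] .
      also have "\<dots> \<le> u" by (simp add: u_def)
      finally show ?thesis .
    qed
    have Xu: "X \<le> u" "1 \<le> u" "X * X \<le> u" using p[of 1] p[of 0] p[of 2] by (simp_all add: power2_eq_square)
    have "1 * (N + 1) \<le> X ^ 7 * (N + 1)" using X1 by (intro mult_le_mono1) simp
    then have Nu: "N + 1 \<le> u" unfolding u_def by simp
    have lin: "a * b \<le> a * u" if "b \<le> X" for a b :: nat using that Xu(1) by (intro mult_le_mono2) simp
    have quad: "b * (a * c + d) \<le> (a + d) * u" if "b \<le> X" "c \<le> X" for a b c d :: nat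
    proof -
      have "a * c + d \<le> a * X + d * X" using that X1 by (intro add_mono mult_le_mono2) simp_all
      then have "b * (a * c + d) \<le> X * (a * X + d * X)" using that by (intro mult_le_mono)
      also have "\<dots> = (a + d) * (X * X)" by (simp add: algebra_simps)
      also have "\<dots> \<le> (a + d) * u" using Xu(3) by (rule mult_le_mono2)
      finally show ?thesis .
    qed
    have "?a \<le> ?a * u" using Xu by simp
    moreover have "(N + 1) * ?c2 \<le> ?c2 * u" using Nu by (metis mult.commute mult_le_mono2)
    moreover have "cen_time * (n + 2) \<le> cen_time * u" "pick_time * (n + 1) \<le> pick_time * u" "row_tab_time * (2 * n + 2) \<le> row_tab_time * u"
      by (rule lin; simp add: X_def)+
    moreover have "(n + 1) * (ctime key_body + 18) \<le> (ctime key_body + 18) * u" "(2 * n + 2) * ?c9 \<le> ?c9 * u"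
      by (subst mult.commute, rule lin, simp add: X_def)+
    moreover have "(n + 1) * (rank_time * (n + 1) + 18) \<le> (rank_time + 18) * u" "(n + 1) * (ext_time * (2 * n + 1) + 30) \<le> (ext_time + 30) * u"
      by (rule quad; simp add: X_def)+
    moreover have "fill_time n N \<le> C0 * u" using C0[of n N] by (simp add: u_def X_def)
    moreover have "C * u = C0 * u + ?a * u + ?c2 * u + cen_time * u + (ctime key_body + 18) * u + (rank_time + 18) * u + row_tab_time * u
      + pick_time * u + (ext_time + 30) * u + ?c9 * u" unfolding C_def by (simp only: add_mult_distrib)
    moreover have "prog_time n N = ?a + (N + 1) * ?c2 + cen_time * (n + 2) + (n + 1) * (ctime key_body + 18) + (n + 1) * (rank_time * (n + 1) + 18)
      + row_tab_time * (2 * n + 2) + fill_time n N + pick_time * (n + 1) + (n + 1) * (ext_time * (2 * n + 1) + 30) + (2 * n + 2) * ?c9"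
      unfolding prog_time_def by linarith
    ultimately have "prog_time n N \<le> C * u" by linarith
    then show ?thesis by (simp add: u_def X_def)
  qed
  then show ?thesis by blast
qed

text \<open>The exponent \<open>N - 1\<close> has not passed the threshold, which bounds it by a
  multiple of the logarithm plus a constant. Constants are absorbed because
  \<open>ln (1 / \<epsilon>)\<close> is at least \<open>ln 2\<close>.\<close>

lemma iterations_bound:
  fixes \<epsilon> :: real
  assumes \<epsilon>: "0 < \<epsilon>" "\<epsilon> \<le> 1/2" and N: "\<And>k. k < N \<Longrightarrow> \<not> (7/9) ^ k < (\<epsilon>/4)\<^sup>2"
  shows "real (N + 1) \<le> (2 / ln 2 + 6 / ln (9/7)) * ln (1 / \<epsilon>)"
proof -
  define l where "l = ln (1 / \<epsilon>)"
  have l2: "ln 2 \<le> l" unfolding l_def using \<epsilon> by (subst ln_le_cancel_iff) (auto simp: field_simps)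
  have p: "ln (2::real) > 0" "ln (9/7 :: real) > 0" by simp_all
  have l0: "0 < l" using l2 p by linarith
  have one: "1 \<le> l / ln 2" using l2 p by simp
  show ?thesis
  proof (cases N)
    case 0
    have "(2 / ln 2 + 6 / ln (9/7)) * l = l / ln 2 + (l / ln 2 + 6 / ln (9/7) * l)" by (simp add: algebra_simps)
    moreover have "0 \<le> l / ln 2 + 6 / ln (9/7) * l" using p l0 by simp
    ultimately have "1 \<le> (2 / ln 2 + 6 / ln (9/7)) * l" using one by linarith
    then show ?thesis using 0 unfolding l_def[symmetric] by simp
  next
    case (Suc k)
    have "(\<epsilon>/4)\<^sup>2 \<le> (7/9) ^ k" using N[of k] Suc by simp
    moreover have "(\<epsilon>/4)\<^sup>2 > 0" using \<epsilon> by simp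
    ultimately have "ln ((\<epsilon>/4)\<^sup>2) \<le> ln ((7/9) ^ k)" by (subst ln_le_cancel_iff) auto
    then have "2 * ln (\<epsilon>/4) \<le> real k * ln (7/9)" using \<epsilon> by (simp add: ln_realpow)
    moreover have "ln (7/9 :: real) = - ln (9/7)" using ln_inverse[of "9/7 :: real"] by simp
    moreover have "ln (\<epsilon>/4) = - l - 2 * ln 2"
    proof -
      have "ln (\<epsilon>/4) = ln \<epsilon> - ln 4" using \<epsilon> by (simp add: ln_div)
      moreover have "ln (4 :: real) = 2 * ln 2" using ln_realpow[of 2 2] by simp
      moreover have "l = - ln \<epsilon>" unfolding l_def using \<epsilon> by (simp add: ln_div)
      ultimately show ?thesis by simp
    qed
    ultimately have "real k * ln (9/7) \<le> 2 * l + 4 * ln 2" by simp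
    then have "real k * ln (9/7) \<le> 6 * l" using l2 by linarith
    then have "real k \<le> 6 / ln (9/7) * l" using p by (simp add: pos_le_divide_eq)
    \<comment> \<open>In \<open>N + 1 = k + 2\<close> the summand 2 is paid for by
      \<open>2 / ln 2\<close> times the logarithm.\<close>
    moreover have "2 / ln 2 * l = 2 * (l / ln 2)" by simp
    then have "2 \<le> 2 / ln 2 * l" using one by linarith
    ultimately show ?thesis unfolding l_def[symmetric] Suc by (simp add: algebra_simps)
  qed
qed

text \<open>The running time is linear in \<open>ln (1 / \<epsilon>)\<close>. As this logarithm is
  at least \<open>ln 2\<close>, it is at most its own cube divided by \<open>(ln 2)\<^sup>2\<close>,
  which enters \<open>K\<close>. For \<open>\<epsilon>\<close> above 1/2 the program works with
  precision 1/2, and its guarantee is then even stronger.\<close>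

theorem corollary33:
  "\<exists>(P :: com) (K :: real). \<forall>(n :: nat) (I :: flamecast) (\<epsilon> :: real).
     n \<ge> 1 \<and> sources I = {..<n} \<and> sinks I = {n} \<and> layers I = 1 \<and> alpha I = 0 \<and>
     convex_instance I \<and> \<epsilon> > 0 \<longrightarrow>
     (\<exists>k s. exec P (input_state n I \<epsilon>) k s \<and>
        is_layout I (output_layout n s) \<and>
        cost I (output_layout n s) \<le> (1 + \<epsilon>) * min_cost I \<and>
        (\<epsilon> \<le> 1 / 2 \<longrightarrow> real k \<le> K * real n ^ 7 * ln (1 / \<epsilon>) ^ 3))"
proof -
  obtain C where C: "\<And>n N. prog_time n N \<le> C * ((2 * n + 2) ^ 7 * (N + 1))" using prog_time_bound by blast
  define c where "c = 2 / ln 2 + 6 / ln (9/7 :: real)"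
  define K where "K = real C * 4 ^ 7 * c / (ln 2)\<^sup>2"
  show ?thesis
  proof (intro exI[of _ prog] exI[of _ K] allI impI)
    fix n I and \<epsilon> :: real
    assume "n \<ge> 1 \<and> sources I = {..<n} \<and> sinks I = {n} \<and> layers I = 1 \<and> alpha I = 0 \<and> convex_instance I \<and> \<epsilon> > 0"
    then have n: "n \<ge> 1" and I: "sources I = {..<n}" "sinks I = {n}" "layers I = 1" "alpha I = 0"
      and conv: "convex_instance I" and \<epsilon>: "\<epsilon> > 0" by blast+
    define \<delta> where "\<delta> = min \<epsilon> (1/2)"
    have \<delta>: "0 < \<delta>" "\<delta> \<le> \<epsilon>" using \<epsilon> by (auto simp: \<delta>_def)
    \<comment> \<open>The least exponent is the one that the counting loop finds; its minimality
      bounds the running time.\<close>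
    define N where "N = (LEAST k. (7/9 :: real) ^ k < (\<delta>/4)\<^sup>2)"
    have "\<exists>k. (7/9 :: real) ^ k < (\<delta>/4)\<^sup>2" using \<delta> by (intro real_arch_pow_inv) auto
    then have N: "(7/9 :: real) ^ N < (\<delta>/4)\<^sup>2" unfolding N_def by (rule LeastI_ex)
    have N': "\<not> (7/9 :: real) ^ k < (\<delta>/4)\<^sup>2" if "k < N" for k using that not_less_Least unfolding N_def by blast
    obtain k s where run: "exec prog (input_state n I \<epsilon>) k s" "k \<le> prog_time n N"
      and lay: "is_layout I (output_layout n s)" and cst: "cost I (output_layout n s) \<le> (1 + \<delta>) * min_cost I"
      using prog_correct[OF n I conv \<epsilon>, folded \<delta>_def, OF N N'] unfolding tot_def by blast
    have "0 \<le> min_cost I" unfolding min_cost_def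
      by (rule cINF_greatest) (use lay in \<open>auto simp: cost_def intro!: sum_nonneg\<close>)
    then have "(1 + \<delta>) * min_cost I \<le> (1 + \<epsilon>) * min_cost I" using \<delta> by (intro mult_right_mono) auto
    then have cst': "cost I (output_layout n s) \<le> (1 + \<epsilon>) * min_cost I" using cst by simp
    have "real k \<le> K * real n ^ 7 * ln (1 / \<epsilon>) ^ 3" if le: "\<epsilon> \<le> 1/2"
    proof -
      have de: "\<delta> = \<epsilon>" using le by (simp add: \<delta>_def)
      define l where "l = ln (1 / \<epsilon>)"
      have l2: "ln 2 \<le> l" unfolding l_def using \<epsilon> le by (subst ln_le_cancel_iff) (auto simp: field_simps)
      have p2: "ln (2::real) > 0" by simp
      have l0: "0 < l" using l2 p2 by linarith
      have c0: "0 \<le> c" unfolding c_def by simp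
      have Nb: "real (N + 1) \<le> c * l" unfolding c_def l_def
        by (rule iterations_bound[OF \<epsilon> le]) (use N' de in auto)
      have l3: "l \<le> l ^ 3 / (ln 2)\<^sup>2"
      proof -
        have "(ln 2)\<^sup>2 \<le> l\<^sup>2" using l2 p2 by (intro power_mono) auto
        then have "l * (ln 2)\<^sup>2 \<le> l * l\<^sup>2" using l0 by (intro mult_left_mono) auto
        then show ?thesis using p2 by (simp add: pos_le_divide_eq power3_eq_cube power2_eq_square)
      qed
      \<comment> \<open>\<open>2 n + 2\<close> is at most \<open>4 n\<close> because there is at
        least one source.\<close>
      have "real (2 * n + 2) ^ 7 \<le> (4 * real n) ^ 7" using n by (intro power_mono) auto
      then have X: "real (2 * n + 2) ^ 7 \<le> 4 ^ 7 * real n ^ 7" by (simp only: power_mult_distrib)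
      have "real k \<le> real (C * ((2 * n + 2) ^ 7 * (N + 1)))" using run(2) C[of n N] by (meson le_trans of_nat_le_iff)
      also have "\<dots> = real C * (real (2 * n + 2) ^ 7 * real (N + 1))" by (simp only: of_nat_mult of_nat_power)
      also have "\<dots> \<le> real C * ((4 ^ 7 * real n ^ 7) * (c * l))"
        by (intro mult_left_mono mult_mono X Nb) auto
      also have "\<dots> \<le> real C * ((4 ^ 7 * real n ^ 7) * (c * (l ^ 3 / (ln 2)\<^sup>2)))"
        using l3 c0 by (intro mult_left_mono) auto
      also have "\<dots> = K * real n ^ 7 * l ^ 3" by (simp add: K_def)
      finally show ?thesis unfolding l_def .
    qed
    then show "\<exists>k s. exec prog (input_state n I \<epsilon>) k s \<and> is_layout I (output_layout n s) \<and>
        cost I (output_layout n s) \<le> (1 + \<epsilon>) * min_cost I \<and>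
        (\<epsilon> \<le> 1 / 2 \<longrightarrow> real k \<le> K * real n ^ 7 * ln (1 / \<epsilon>) ^ 3)"
      using run(1) lay cst' by blast
  qed
qed

end
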